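(* Let $Q=Q_+\sqcup Q_-$ with involution $\tau$ be of diagonal type, and let $\underline\lambda=(\lambda^{(1)},\dots,\lambda^{(\ell)})$ be a sequence of dominant weights associated with $Q_+$ (i.e. each $\lambda^{(r)}$ is an $\mathbb N$-linear combination of the $\varpi_i$ with $i$ a vertex of $Q_+$). Then the oKLRW algebra $\mathcal O_{\mathbf 0}^{\underline\lambda}$ associated with $(Q,\tau)$ and framing weight $\mathbf 0$ is Morita equivalent to the KLRW algebra $\mathcal K^{\underline\lambda}$ associated with $Q_+$.
   Context: $k$ is an algebraically closed field. Quivers are loop-free with at most one arrow (both directions counted) between two distinct vertices. $i\to j$ means there is an arrow from $i$ to $j$. **Diagonal type:** $Q$ is the disjoint union of $Q_+$ and $Q_-$, where $Q_-$ has the same vertices as $Q_+$ and opposite arrows, and $\tau$ interchanges corresponding vertices (and corresponding arrows). A dominant weight is $\theta=\sum_i\theta_i\varpi_i$, $\theta_i\in\mathbb N$ ($\varpi_i$ fundamental weights). $X_{ij}(u,v)=u-v$ if $j\to i$, and $1$ otherwise; $f_{ij}(u,v)=X_{ij}(u,v)X_{ji}(v,u)$. **KLRW category $\mathcal K$ of a quiver:** the strict $k$-linear monoidal category with generating objects the vertices $i$ (black strands) and dominant weights $\theta$ (red strands), generating morphisms $x_i:i\to i$ (dot), $\sigma_{ij}:i\otimes j\to j\otimes i$, $\sigma_{i\theta}:i\otimes\theta\to\theta\otimes i$, $\sigma_{\theta i}:\theta\otimes i\to i\otimes\theta$, and relations ($y_r$ = dot on the $r$-th black strand): $(x_j\otimes1)\sigma_{ij}=\sigma_{ij}(1\otimes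 x_j)+\delta_{ij}$, $\sigma_{ij}(x_i\otimes1)=(1\otimes x_i)\sigma_{ij}+\delta_{ij}$; $\sigma_{ii}^2=0$, $\sigma_{ji}\sigma_{ij}=f_{ij}(y_1,y_2)$ for $i\ne j$; $(\sigma_{jk}\otimes1)(1\otimes\sigma_{ik})(\sigma_{ij}\otimes1)-(1\otimes\sigma_{ij})(\sigma_{ik}\otimes1)(1\otimes\sigma_{jk})=\delta_{i=k\neq j}\frac{f_{ij}(y_3,y_2)-f_{ij}(y_1,y_2)}{y_3-y_1}$; $(\sigma_{\theta j}\otimes1)(1\otimes\sigma_{ij})(\sigma_{i\theta}\otimes1)-(1\otimes\sigma_{i\theta})(\sigma_{ij}\otimes1)(1\otimes\sigma_{\theta j})=\delta_{ij}\sum_{a+b+1=\theta_i}x_i^a\otimes1\otimes x_j^b$; $(\sigma_{j\theta}\otimes1)(1\otimes\sigma_{i\theta})(\sigma_{ij}\otimes1)=(1\otimes\sigma_{ij})(\sigma_{i\theta}\otimes1)(1\otimes\sigma_{j\theta})$, $(\sigma_{ji}\otimes1)(1\otimes\sigma_{\theta i})(\sigma_{\theta j}\otimes1)=(1\otimes\sigma_{\theta j})(\sigma_{\theta i}\otimes1)(1\otimes\sigma_{ji})$; $(x_i\otimes1)\sigma_{\theta i}=\sigma_{\theta i}(1\otimes x_i)$, $\sigma_{i\theta}(x_i\otimes1)=(1\otimes x_i)\sigma_{i\theta}$; $\sigma_{i\theta}\sigma_{\theta i}=1\otimes x_i^{\theta_i}$, $\sigma_{\theta i}\sigma_{i\theta}=x_i^{\theta_i}\otimes1$.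 **oKLRW category $\mathcal O_{\mathbf 0}$ of $(Q,\tau)$ with framing weight $\mathbf 0$:** it has the same objects as the KLRW category $\mathcal K$ of $Q$; morphisms are linear combinations of composites of morphisms of $\mathcal K$ and morphisms $\rho_i\otimes\mathrm{id}_Z$, $\rho_i:i\to\tau i$, modulo the consequences (closed under composition and $-\otimes\mathrm{id}_Z$) of the relations of $\mathcal K$ and $\rho_{\tau i}\rho_i=\mathrm{id}$, $\rho_ix_i=-x_{\tau i}\rho_i$, $\sigma_{\tau j,\tau i}(\rho_j\otimes1)\sigma_{\tau i,j}(\rho_i\otimes1)=(\rho_i\otimes1)\sigma_{\tau j,i}(\rho_j\otimes1)\sigma_{ij}$. **Algebras:** for a sequence $\underline\lambda$ of dominant weights, $\mathcal K^{\underline\lambda}$ (resp. $\mathcal O^{\underline\lambda}_{\mathbf 0}$) is the direct sum of all $\operatorname{Hom}_{\mathcal K}(X,Y)$ (resp. $\operatorname{Hom}_{\mathcal O_{\mathbf 0}}(X,Y)$) over pairs of objects (words) $X,Y$ whose red letters, read from left to right, are $\underline\lambda$. These are locally unital algebras (with idempotents $\mathrm{id}_X$); modules $M$ are required to satisfy $M=\bigoplus_X\mathrm{id}_XM$, and Morita equivalence means equivalence of module categories. In $\mathcal K^{\underline\lambda}$ for $Q_+$ the black letters are vertices of $Q_+$ only. *)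

theory Defs
  imports
    "HOL-Computational_Algebra.Polynomial"
    "HOL-Library.Poly_Mapping"
    "Graph_Theory.Pair_Digraph"
    "HOL-Algebra.Module"
begin

section \<open>Linear categories and their equivalences\<close>

definition scalars :: "'k::field ring"
  where "scalars = \<lparr>carrier = UNIV, mult = (*), one = 1, zero = 0, add = (+)\<rparr>"

text \<open>Morphism spaces are vector spaces, stored as \<open>module\<close> records of HOL-Algebra whose
  ring fields \<open>mult\<close> and \<open>one\<close> carry no meaning. \<open>comp C X Y Z g f\<close> is the composite
  \<open>X \<rightarrow> Y \<rightarrow> Z\<close> of \<open>f\<close> followed by \<open>g\<close>.\<close>

record ('o, 'a, 'k) lincat =
  obj :: "'o set"
  Hom :: "'o \<Rightarrow> 'o \<Rightarrow> ('k, 'a) module"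
  ident :: "'o \<Rightarrow> 'a"
  comp :: "'o \<Rightarrow> 'o \<Rightarrow> 'o \<Rightarrow> 'a \<Rightarrow> 'a \<Rightarrow> 'a"

locale linear_category =
  fixes C :: "('o, 'a, 'k::field) lincat"
  assumes Hom_module: "\<lbrakk>X \<in> obj C; Y \<in> obj C\<rbrakk> \<Longrightarrow> Module.module scalars (Hom C X Y)"
    and ident_closed: "X \<in> obj C \<Longrightarrow> ident C X \<in> carrier (Hom C X X)"
    and comp_closed: "\<lbrakk>X \<in> obj C; Y \<in> obj C; Z \<in> obj C;
        f \<in> carrier (Hom C X Y); g \<in> carrier (Hom C Y Z)\<rbrakk>
      \<Longrightarrow> comp C X Y Z g f \<in> carrier (Hom C X Z)"
    and comp_ident_right: "\<lbrakk>X \<in> obj C; Y \<in> obj C; f \<in> carrier (Hom C X Y)\<rbrakk>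
      \<Longrightarrow> comp C X X Y f (ident C X) = f"
    and comp_ident_left: "\<lbrakk>X \<in> obj C; Y \<in> obj C; f \<in> carrier (Hom C X Y)\<rbrakk>
      \<Longrightarrow> comp C X Y Y (ident C Y) f = f"
    and comp_assoc: "\<lbrakk>W \<in> obj C; X \<in> obj C; Y \<in> obj C; Z \<in> obj C;
        f \<in> carrier (Hom C W X); g \<in> carrier (Hom C X Y); h \<in> carrier (Hom C Y Z)\<rbrakk>
      \<Longrightarrow> comp C W Y Z h (comp C W X Y g f) = comp C W X Z (comp C X Y Z h g) f"
    and comp_add_left: "\<lbrakk>X \<in> obj C; Y \<in> obj C; Z \<in> obj C;
        f \<in> carrier (Hom C X Y); g \<in> carrier (Hom C Y Z); g' \<in> carrier (Hom C Y Z)\<rbrakk>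
      \<Longrightarrow> comp C X Y Z (g \<oplus>\<^bsub>Hom C Y Z\<^esub> g') f =
          comp C X Y Z g f \<oplus>\<^bsub>Hom C X Z\<^esub> comp C X Y Z g' f"
    and comp_add_right: "\<lbrakk>X \<in> obj C; Y \<in> obj C; Z \<in> obj C;
        f \<in> carrier (Hom C X Y); f' \<in> carrier (Hom C X Y); g \<in> carrier (Hom C Y Z)\<rbrakk>
      \<Longrightarrow> comp C X Y Z g (f \<oplus>\<^bsub>Hom C X Y\<^esub> f') =
          comp C X Y Z g f \<oplus>\<^bsub>Hom C X Z\<^esub> comp C X Y Z g f'"
    and comp_smult_left: "\<lbrakk>X \<in> obj C; Y \<in> obj C; Z \<in> obj C;
        f \<in> carrier (Hom C X Y); g \<in> carrier (Hom C Y Z)\<rbrakk>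
      \<Longrightarrow> comp C X Y Z (c \<odot>\<^bsub>Hom C Y Z\<^esub> g) f = c \<odot>\<^bsub>Hom C X Z\<^esub> comp C X Y Z g f"
    and comp_smult_right: "\<lbrakk>X \<in> obj C; Y \<in> obj C; Z \<in> obj C;
        f \<in> carrier (Hom C X Y); g \<in> carrier (Hom C Y Z)\<rbrakk>
      \<Longrightarrow> comp C X Y Z g (c \<odot>\<^bsub>Hom C X Y\<^esub> f) = c \<odot>\<^bsub>Hom C X Z\<^esub> comp C X Y Z g f"

text \<open>A functor is given by its object map \<open>F\<^sub>0\<close> and its maps \<open>F\<^sub>1 X Y\<close> on morphism spaces.\<close>

definition linear_functor ::
    "('o, 'a, 'k::field) lincat \<Rightarrow> ('p, 'b, 'k) lincat \<Rightarrow>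
     ('o \<Rightarrow> 'p) \<Rightarrow> ('o \<Rightarrow> 'o \<Rightarrow> 'a \<Rightarrow> 'b) \<Rightarrow> bool"
  where "linear_functor C D F\<^sub>0 F\<^sub>1 \<longleftrightarrow>
    (\<forall>X\<in>obj C. F\<^sub>0 X \<in> obj D) \<and>
    (\<forall>X\<in>obj C. \<forall>Y\<in>obj C. \<forall>f\<in>carrier (Hom C X Y).
       F\<^sub>1 X Y f \<in> carrier (Hom D (F\<^sub>0 X) (F\<^sub>0 Y)) \<and>
       (\<forall>g\<in>carrier (Hom C X Y).
          F\<^sub>1 X Y (f \<oplus>\<^bsub>Hom C X Y\<^esub> g) = F\<^sub>1 X Y f \<oplus>\<^bsub>Hom D (F\<^sub>0 X) (F\<^sub>0 Y)\<^esub> F\<^sub>1 X Y g) \<and>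
       (\<forall>c. F\<^sub>1 X Y (c \<odot>\<^bsub>Hom C X Y\<^esub> f) = c \<odot>\<^bsub>Hom D (F\<^sub>0 X) (F\<^sub>0 Y)\<^esub> F\<^sub>1 X Y f)) \<and>
    (\<forall>X\<in>obj C. F\<^sub>1 X X (ident C X) = ident D (F\<^sub>0 X)) \<and>
    (\<forall>X\<in>obj C. \<forall>Y\<in>obj C. \<forall>Z\<in>obj C.
       \<forall>f\<in>carrier (Hom C X Y). \<forall>g\<in>carrier (Hom C Y Z).
         F\<^sub>1 X Z (comp C X Y Z g f) = comp D (F\<^sub>0 X) (F\<^sub>0 Y) (F\<^sub>0 Z) (F\<^sub>1 Y Z g) (F\<^sub>1 X Y f))"

definition isomorphism :: "('o, 'a, 'k) lincat \<Rightarrow> 'o \<Rightarrow> 'o \<Rightarrow> 'a \<Rightarrow> bool"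
  where "isomorphism C X Y f \<longleftrightarrow> f \<in> carrier (Hom C X Y) \<and>
    (\<exists>g\<in>carrier (Hom C Y X). comp C X Y X g f = ident C X \<and> comp C Y X Y f g = ident C Y)"

definition natural_isomorphism ::
    "('o, 'a, 'k) lincat \<Rightarrow> ('p, 'b, 'k) lincat \<Rightarrow>
     ('o \<Rightarrow> 'p) \<Rightarrow> ('o \<Rightarrow> 'o \<Rightarrow> 'a \<Rightarrow> 'b) \<Rightarrow>
     ('o \<Rightarrow> 'p) \<Rightarrow> ('o \<Rightarrow> 'o \<Rightarrow> 'a \<Rightarrow> 'b) \<Rightarrow> ('o \<Rightarrow> 'b) \<Rightarrow> bool"
  where "natural_isomorphism C D F\<^sub>0 F\<^sub>1 G\<^sub>0 G\<^sub>1 \<eta> \<longleftrightarrow>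
    (\<forall>X\<in>obj C. isomorphism D (F\<^sub>0 X) (G\<^sub>0 X) (\<eta> X)) \<and>
    (\<forall>X\<in>obj C. \<forall>Y\<in>obj C. \<forall>f\<in>carrier (Hom C X Y).
       comp D (F\<^sub>0 X) (F\<^sub>0 Y) (G\<^sub>0 Y) (\<eta> Y) (F\<^sub>1 X Y f) =
       comp D (F\<^sub>0 X) (G\<^sub>0 X) (G\<^sub>0 Y) (G\<^sub>1 X Y f) (\<eta> X))"

definition equivalent_categories ::
    "('o, 'a, 'k::field) lincat \<Rightarrow> ('p, 'b, 'k) lincat \<Rightarrow> bool"
  where "equivalent_categories C D \<longleftrightarrow>
    (\<exists>F\<^sub>0 F\<^sub>1 G\<^sub>0 G\<^sub>1 \<eta> \<epsilon>.
       linear_functor C D F\<^sub>0 F\<^sub>1 \<and> linear_functor D C G\<^sub>0 G\<^sub>1 \<and>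
       natural_isomorphism C C (\<lambda>X. X) (\<lambda>X Y f. f)
         (\<lambda>X. G\<^sub>0 (F\<^sub>0 X)) (\<lambda>X Y f. G\<^sub>1 (F\<^sub>0 X) (F\<^sub>0 Y) (F\<^sub>1 X Y f)) \<eta> \<and>
       natural_isomorphism D D (\<lambda>X. F\<^sub>0 (G\<^sub>0 X)) (\<lambda>X Y f. F\<^sub>1 (G\<^sub>0 X) (G\<^sub>0 Y) (G\<^sub>1 X Y f))
         (\<lambda>X. X) (\<lambda>X Y f. f) \<epsilon>)"


section \<open>Locally unital algebras, modules, Morita equivalence\<close>

record ('k, 'a, 'i) lu_algebra = "('k, 'a) module" +
  index :: "'i set"
  idem :: "'i \<Rightarrow> 'a"

text \<open>The direct sum of all \<open>Hom C X Y\<close> with \<open>X, Y \<in> S\<close>: finitely supported families.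
  In the product, only the finitely many \<open>Y\<close> in the support of \<open>b\<close> contribute; the
  restriction of the summation set is needed because \<open>finsum\<close> over an infinite set is a
  junk value. There is in general no unit element, so \<open>one\<close> is meaningless.\<close>

definition hom_algebra ::
    "('o, 'a, 'k::field) lincat \<Rightarrow> 'o set \<Rightarrow> ('k, 'o \<times> 'o \<Rightarrow> 'a, 'o) lu_algebra"
  where "hom_algebra C S =
    \<lparr>carrier = {a \<in> \<Pi>\<^sub>E (X, Y)\<in>S \<times> S. carrier (Hom C X Y).
         finite {(X, Y) \<in> S \<times> S. a (X, Y) \<noteq> \<zero>\<^bsub>Hom C X Y\<^esub>}},
     mult = (\<lambda>a b. \<lambda>(X, Z)\<in>S \<times> S.
         \<Oplus>\<^bsub>Hom C X Z\<^esub>Y\<in>{Y \<in> S. b (X, Y) \<noteq> \<zero>\<^bsub>Hom C X Y\<^esub>}. comp C X Y Z (a (Y, Z)) (b (X, Y))),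
     one = undefined,
     zero = (\<lambda>(X, Y)\<in>S \<times> S. \<zero>\<^bsub>Hom C X Y\<^esub>),
     add = (\<lambda>a b. \<lambda>(X, Y)\<in>S \<times> S. a (X, Y) \<oplus>\<^bsub>Hom C X Y\<^esub> b (X, Y)),
     smult = (\<lambda>c a. \<lambda>(X, Y)\<in>S \<times> S. c \<odot>\<^bsub>Hom C X Y\<^esub> a (X, Y)),
     index = S,
     idem = (\<lambda>Z. \<lambda>(X, Y)\<in>S \<times> S. if X = Z \<and> Y = Z then ident C Z else \<zero>\<^bsub>Hom C X Y\<^esub>)\<rparr>"

record ('k, 'a, 'm) lu_module = "('k, 'm) module" +
  act :: "'a \<Rightarrow> 'm \<Rightarrow> 'm"

text \<open>Left modules \<open>M\<close> with \<open>M = \<Oplus>\<^sub>X id\<^sub>X M\<close>; the last conjunct states this direct sum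
  decomposition.\<close>

definition lu_module_over ::
    "('k::field, 'a, 'i) lu_algebra \<Rightarrow> ('k, 'a, 'm) lu_module \<Rightarrow> bool"
  where "lu_module_over A M \<longleftrightarrow>
    Module.module scalars M \<and>
    (\<forall>a\<in>carrier A. \<forall>x\<in>carrier M. act M a x \<in> carrier M) \<and>
    (\<forall>a\<in>carrier A. \<forall>b\<in>carrier A. \<forall>x\<in>carrier M.
       act M (a \<oplus>\<^bsub>A\<^esub> b) x = act M a x \<oplus>\<^bsub>M\<^esub> act M b x) \<and>
    (\<forall>a\<in>carrier A. \<forall>x\<in>carrier M. \<forall>y\<in>carrier M.
       act M a (x \<oplus>\<^bsub>M\<^esub> y) = act M a x \<oplus>\<^bsub>M\<^esub> act M a y) \<and>
    (\<forall>c. \<forall>a\<in>carrier A. \<forall>x\<in>carrier M.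
       act M (c \<odot>\<^bsub>A\<^esub> a) x = c \<odot>\<^bsub>M\<^esub> act M a x \<and>
       act M a (c \<odot>\<^bsub>M\<^esub> x) = c \<odot>\<^bsub>M\<^esub> act M a x) \<and>
    (\<forall>a\<in>carrier A. \<forall>b\<in>carrier A. \<forall>x\<in>carrier M.
       act M (a \<otimes>\<^bsub>A\<^esub> b) x = act M a (act M b x)) \<and>
    (\<forall>x\<in>carrier M. \<exists>!u.
       u \<in> (\<Pi>\<^sub>E i\<in>index A. act M (idem A i) ` carrier M) \<and>
       finite {i \<in> index A. u i \<noteq> \<zero>\<^bsub>M\<^esub>} \<and>
       x = (\<Oplus>\<^bsub>M\<^esub>i\<in>{i \<in> index A. u i \<noteq> \<zero>\<^bsub>M\<^esub>}. u i))"

definition lu_module_homs ::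
    "('k, 'a, 'i) lu_algebra \<Rightarrow> ('k, 'a, 'm) lu_module \<Rightarrow> ('k, 'a, 'm) lu_module \<Rightarrow> ('m \<Rightarrow> 'm) set"
  where "lu_module_homs A M N =
    {f \<in> carrier M \<rightarrow>\<^sub>E carrier N.
       (\<forall>x\<in>carrier M. \<forall>y\<in>carrier M. f (x \<oplus>\<^bsub>M\<^esub> y) = f x \<oplus>\<^bsub>N\<^esub> f y) \<and>
       (\<forall>c. \<forall>x\<in>carrier M. f (c \<odot>\<^bsub>M\<^esub> x) = c \<odot>\<^bsub>N\<^esub> f x) \<and>
       (\<forall>a\<in>carrier A. \<forall>x\<in>carrier M. f (act M a x) = act N a (f x))}"

text \<open>The category of modules with underlying set in the type \<open>'m\<close>, which plays the role
  of the universe.\<close>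

definition module_category ::
    "('k::field, 'a, 'i) lu_algebra \<Rightarrow> (('k, 'a, 'm) lu_module, 'm \<Rightarrow> 'm, 'k) lincat"
  where "module_category A =
    \<lparr>obj = {M. lu_module_over A M},
     Hom = (\<lambda>M N.
       \<lparr>carrier = lu_module_homs A M N, mult = undefined, one = undefined,
        zero = (\<lambda>x\<in>carrier M. \<zero>\<^bsub>N\<^esub>),
        add = (\<lambda>f g. \<lambda>x\<in>carrier M. f x \<oplus>\<^bsub>N\<^esub> g x),
        smult = (\<lambda>c f. \<lambda>x\<in>carrier M. c \<odot>\<^bsub>N\<^esub> f x)\<rparr>),
     ident = (\<lambda>M. \<lambda>x\<in>carrier M. x),
     comp = (\<lambda>L M N g f. compose (carrier L) g f)\<rparr>"

text \<open>The type argument is the universe; a statement with a free type variable in this place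
  asserts the equivalence for module categories in every universe.\<close>

definition morita_equivalent ::
    "'m itself \<Rightarrow> ('k::field, 'a, 'i) lu_algebra \<Rightarrow> ('k, 'b, 'j) lu_algebra \<Rightarrow> bool"
  where "morita_equivalent _ A B \<longleftrightarrow>
    equivalent_categories
      (module_category A :: (('k, 'a, 'm) lu_module, 'm \<Rightarrow> 'm, 'k) lincat)
      (module_category B :: (('k, 'b, 'm) lu_module, 'm \<Rightarrow> 'm, 'k) lincat)"


section \<open>Linear monoidal categories by generators and relations\<close>

datatype ('x, 'g, 'k) expr =
    Gen 'g
  | Ident "'x list"
  | Zero "'x list" "'x list"
  | Add "('x, 'g, 'k) expr" "('x, 'g, 'k) expr"
  | Scale 'k "('x, 'g, 'k) expr"
  | Comp "('x, 'g, 'k) expr" "('x, 'g, 'k) expr"  (infixl \<open>\<circ>\<^sub>e\<close> 66)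
  | Tensor "('x, 'g, 'k) expr" "('x, 'g, 'k) expr"  (infixl \<open>\<otimes>\<^sub>e\<close> 72)

text \<open>A presentation lists the generating objects, the generating morphisms with their source
  and target words, and the relations, as pairs of expressions to be identified.\<close>

record ('x, 'g, 'k) presentation =
  gen_obj :: "'x set"
  gens :: "('g \<times> 'x list \<times> 'x list) set"
  rels :: "(('x, 'g, 'k) expr \<times> ('x, 'g, 'k) expr) set"

text \<open>\<open>mor P H e X Y\<close> says that \<open>e\<close> is a well-formed morphism \<open>X \<rightarrow> Y\<close>. For \<open>H = {}\<close> these are
  the morphisms of the strict monoidal category presented by \<open>P\<close>. For general \<open>H\<close> they are those
  of the strict right module category over it that has the same objects (it is generated by
  the object \<open>[]\<close>) and the additional generating morphisms \<open>H\<close>. Accordingly, the right factor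
  of a tensor product is always a morphism of the monoidal category.\<close>

inductive mor ::
    "('x, 'g, 'k) presentation \<Rightarrow> ('g \<times> 'x list \<times> 'x list) set \<Rightarrow>
     ('x, 'g, 'k) expr \<Rightarrow> 'x list \<Rightarrow> 'x list \<Rightarrow> bool"
  for P
  where
    mor_gen: "\<lbrakk>(g, X, Y) \<in> gens P \<union> H; X \<in> lists (gen_obj P); Y \<in> lists (gen_obj P)\<rbrakk>
      \<Longrightarrow> mor P H (Gen g) X Y"
  | mor_id: "X \<in> lists (gen_obj P) \<Longrightarrow> mor P H (Ident X) X X"
  | mor_zero: "\<lbrakk>X \<in> lists (gen_obj P); Y \<in> lists (gen_obj P)\<rbrakk> \<Longrightarrow> mor P H (Zero X Y) X Y"
  | mor_add: "\<lbrakk>mor P H e X Y; mor P H f X Y\<rbrakk> \<Longrightarrow> mor P H (Add e f) X Y"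
  | mor_scale: "mor P H e X Y \<Longrightarrow> mor P H (Scale c e) X Y"
  | mor_comp: "\<lbrakk>mor P H f X Y; mor P H g Y Z\<rbrakk> \<Longrightarrow> mor P H (g \<circ>\<^sub>e f) X Z"
  | mor_tensor: "\<lbrakk>mor P H e X Y; mor P {} f Z W\<rbrakk> \<Longrightarrow> mor P H (e \<otimes>\<^sub>e f) (X @ Z) (Y @ W)"

text \<open>Equality of morphisms \<open>X \<rightarrow> Y\<close>: the smallest congruence that contains the given relations
  and makes the expressions a strict linear monoidal category (for \<open>H = R = {}\<close>), respectively
  a strict linear right module category over the latter, in which the additional relations
  \<open>R\<close> hold.\<close>

inductive eqv ::
    "('x, 'g, 'k::field) presentation \<Rightarrow> ('g \<times> 'x list \<times> 'x list) set \<Rightarrow>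
     (('x, 'g, 'k) expr \<times> ('x, 'g, 'k) expr) set \<Rightarrow> 'x list \<Rightarrow> 'x list \<Rightarrow>
     ('x, 'g, 'k) expr \<Rightarrow> ('x, 'g, 'k) expr \<Rightarrow> bool"
  for P
  where
    rel: "\<lbrakk>(e, f) \<in> rels P \<union> R; mor P H e X Y; mor P H f X Y\<rbrakk> \<Longrightarrow> eqv P H R X Y e f"

  | refl: "mor P H e X Y \<Longrightarrow> eqv P H R X Y e e"
  | sym: "eqv P H R X Y e f \<Longrightarrow> eqv P H R X Y f e"
  | trans: "\<lbrakk>eqv P H R X Y e f; eqv P H R X Y f g\<rbrakk> \<Longrightarrow> eqv P H R X Y e g"

  | add: "\<lbrakk>eqv P H R X Y e e'; eqv P H R X Y f f'\<rbrakk> \<Longrightarrow> eqv P H R X Y (Add e f) (Add e' f')"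
  | scale: "eqv P H R X Y e e' \<Longrightarrow> eqv P H R X Y (Scale c e) (Scale c e')"
  | comp: "\<lbrakk>eqv P H R X Y f f'; eqv P H R Y Z g g'\<rbrakk> \<Longrightarrow> eqv P H R X Z (g \<circ>\<^sub>e f) (g' \<circ>\<^sub>e f')"
  | tensor: "\<lbrakk>eqv P H R X Y e e'; eqv P {} {} Z W f f'\<rbrakk>
      \<Longrightarrow> eqv P H R (X @ Z) (Y @ W) (e \<otimes>\<^sub>e f) (e' \<otimes>\<^sub>e f')"

  | add_assoc: "\<lbrakk>mor P H e X Y; mor P H f X Y; mor P H g X Y\<rbrakk>
      \<Longrightarrow> eqv P H R X Y (Add (Add e f) g) (Add e (Add f g))"
  | add_commute: "\<lbrakk>mor P H e X Y; mor P H f X Y\<rbrakk> \<Longrightarrow> eqv P H R X Y (Add e f) (Add f e)"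
  | add_zero: "mor P H e X Y \<Longrightarrow> eqv P H R X Y (Add (Zero X Y) e) e"
  | scale_zero: "mor P H e X Y \<Longrightarrow> eqv P H R X Y (Scale 0 e) (Zero X Y)"
  | scale_one: "mor P H e X Y \<Longrightarrow> eqv P H R X Y (Scale 1 e) e"
  | scale_scale: "mor P H e X Y \<Longrightarrow> eqv P H R X Y (Scale a (Scale b e)) (Scale (a * b) e)"
  | scale_add_left: "mor P H e X Y
      \<Longrightarrow> eqv P H R X Y (Scale (a + b) e) (Add (Scale a e) (Scale b e))"
  | scale_add_right: "\<lbrakk>mor P H e X Y; mor P H f X Y\<rbrakk>
      \<Longrightarrow> eqv P H R X Y (Scale a (Add e f)) (Add (Scale a e) (Scale a f))"

  | comp_id_right: "mor P H e X Y \<Longrightarrow> eqv P H R X Y (e \<circ>\<^sub>e Ident X) e"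
  | comp_id_left: "mor P H e X Y \<Longrightarrow> eqv P H R X Y (Ident Y \<circ>\<^sub>e e) e"
  | comp_assoc: "\<lbrakk>mor P H f W X; mor P H g X Y; mor P H h Y Z\<rbrakk>
      \<Longrightarrow> eqv P H R W Z (h \<circ>\<^sub>e g \<circ>\<^sub>e f) (h \<circ>\<^sub>e (g \<circ>\<^sub>e f))"
  | comp_add_right: "\<lbrakk>mor P H f X Y; mor P H g X Y; mor P H h Y Z\<rbrakk>
      \<Longrightarrow> eqv P H R X Z (h \<circ>\<^sub>e Add f g) (Add (h \<circ>\<^sub>e f) (h \<circ>\<^sub>e g))"
  | comp_add_left: "\<lbrakk>mor P H f X Y; mor P H g Y Z; mor P H h Y Z\<rbrakk>
      \<Longrightarrow> eqv P H R X Z (Add g h \<circ>\<^sub>e f) (Add (g \<circ>\<^sub>e f) (h \<circ>\<^sub>e f))"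
  | comp_scale_right: "\<lbrakk>mor P H f X Y; mor P H g Y Z\<rbrakk>
      \<Longrightarrow> eqv P H R X Z (g \<circ>\<^sub>e Scale c f) (Scale c (g \<circ>\<^sub>e f))"
  | comp_scale_left: "\<lbrakk>mor P H f X Y; mor P H g Y Z\<rbrakk>
      \<Longrightarrow> eqv P H R X Z (Scale c g \<circ>\<^sub>e f) (Scale c (g \<circ>\<^sub>e f))"

  | tensor_id: "\<lbrakk>X \<in> lists (gen_obj P); Y \<in> lists (gen_obj P)\<rbrakk>
      \<Longrightarrow> eqv P H R (X @ Y) (X @ Y) (Ident X \<otimes>\<^sub>e Ident Y) (Ident (X @ Y))"
  | interchange: "\<lbrakk>mor P H f X Y; mor P H g Y Z; mor P {} f' X' Y'; mor P {} g' Y' Z'\<rbrakk>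
      \<Longrightarrow> eqv P H R (X @ X') (Z @ Z') ((g \<circ>\<^sub>e f) \<otimes>\<^sub>e (g' \<circ>\<^sub>e f')) (g \<otimes>\<^sub>e g' \<circ>\<^sub>e f \<otimes>\<^sub>e f')"
  | tensor_add_left: "\<lbrakk>mor P H e X Y; mor P H f X Y; mor P {} g Z W\<rbrakk>
      \<Longrightarrow> eqv P H R (X @ Z) (Y @ W) (Add e f \<otimes>\<^sub>e g) (Add (e \<otimes>\<^sub>e g) (f \<otimes>\<^sub>e g))"
  | tensor_add_right: "\<lbrakk>mor P H e X Y; mor P {} f Z W; mor P {} g Z W\<rbrakk>
      \<Longrightarrow> eqv P H R (X @ Z) (Y @ W) (e \<otimes>\<^sub>e Add f g) (Add (e \<otimes>\<^sub>e f) (e \<otimes>\<^sub>e g))"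
  | tensor_scale_left: "\<lbrakk>mor P H e X Y; mor P {} f Z W\<rbrakk>
      \<Longrightarrow> eqv P H R (X @ Z) (Y @ W) (Scale c e \<otimes>\<^sub>e f) (Scale c (e \<otimes>\<^sub>e f))"
  | tensor_scale_right: "\<lbrakk>mor P H e X Y; mor P {} f Z W\<rbrakk>
      \<Longrightarrow> eqv P H R (X @ Z) (Y @ W) (e \<otimes>\<^sub>e Scale c f) (Scale c (e \<otimes>\<^sub>e f))"
  | tensor_assoc: "\<lbrakk>mor P H e X Y; mor P {} f X' Y'; mor P {} g X'' Y''\<rbrakk>
      \<Longrightarrow> eqv P H R (X @ X' @ X'') (Y @ Y' @ Y'') (e \<otimes>\<^sub>e f \<otimes>\<^sub>e g) (e \<otimes>\<^sub>e (f \<otimes>\<^sub>e g))"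
  | tensor_unit_right: "mor P H e X Y \<Longrightarrow> eqv P H R X Y (e \<otimes>\<^sub>e Ident []) e"
  | tensor_unit_left: "mor P {} e X Y \<Longrightarrow> eqv P H R X Y (Ident [] \<otimes>\<^sub>e e) e"

definition eqv_rel ::
    "('x, 'g, 'k::field) presentation \<Rightarrow> ('g \<times> 'x list \<times> 'x list) set \<Rightarrow>
     (('x, 'g, 'k) expr \<times> ('x, 'g, 'k) expr) set \<Rightarrow> 'x list \<Rightarrow> 'x list \<Rightarrow>
     (('x, 'g, 'k) expr \<times> ('x, 'g, 'k) expr) set"
  where "eqv_rel P H R X Y = {(e, f). eqv P H R X Y e f}"

definition presented_module_category ::
    "('x, 'g, 'k::field) presentation \<Rightarrow> ('g \<times> 'x list \<times> 'x list) set \<Rightarrow>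
     (('x, 'g, 'k) expr \<times> ('x, 'g, 'k) expr) set \<Rightarrow> ('x list, ('x, 'g, 'k) expr set, 'k) lincat"
  where "presented_module_category P H R =
    \<lparr>obj = lists (gen_obj P),
     Hom = (\<lambda>X Y.
       \<lparr>carrier = {e. mor P H e X Y} // eqv_rel P H R X Y, mult = undefined, one = undefined,
        zero = eqv_rel P H R X Y `` {Zero X Y},
        add = (\<lambda>A B. \<Union>a\<in>A. \<Union>b\<in>B. eqv_rel P H R X Y `` {Add a b}),
        smult = (\<lambda>c A. \<Union>a\<in>A. eqv_rel P H R X Y `` {Scale c a})\<rparr>),
     ident = (\<lambda>X. eqv_rel P H R X X `` {Ident X}),
     comp = (\<lambda>X Y Z B A. \<Union>b\<in>B. \<Union>a\<in>A. eqv_rel P H R X Z `` {b \<circ>\<^sub>e a})\<rparr>"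

definition presented_monoidal_category ::
    "('x, 'g, 'k::field) presentation \<Rightarrow> ('x list, ('x, 'g, 'k) expr set, 'k) lincat"
  where "presented_monoidal_category P = presented_module_category P {} {}"

lemma cring_scalars: "cring (scalars :: 'k::field ring)"
  by (rule cringI, rule abelian_groupI, rule_tac [7] comm_monoidI)
     (auto simp: scalars_def algebra_simps intro: exI[of _ "- _"])

lemma mor_mono: "mor P H e X Y \<Longrightarrow> H \<subseteq> H' \<Longrightarrow> mor P H' e X Y"
  by (induction rule: mor.induct) (auto intro: mor.intros)

lemma mor_lists: "mor P H e X Y \<Longrightarrow> X \<in> lists (gen_obj P) \<and> Y \<in> lists (gen_obj P)"
  by (induction rule: mor.induct) auto

lemma eqv_mor: "eqv P H R X Y e f \<Longrightarrow> mor P H e X Y \<and> mor P H f X Y"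
proof (induction rule: eqv.induct)
  case (tensor_assoc H e X Y f X' Y' g X'' Y'' R)
  then show ?case
    using mor_tensor[OF mor_tensor] by (metis append_assoc mor_tensor)
next
  case (tensor_id X Y H R)
  then show ?case by (metis append_in_lists_conv mor_id mor_tensor)
next
  case (tensor_unit_right H e X Y R)
  have "mor P {} (Ident []) [] []" by (rule mor_id) simp
  from mor_tensor[OF tensor_unit_right this] show ?case using tensor_unit_right by simp
next
  case (tensor_unit_left e X Y H R)
  have "mor P H (Ident []) [] []" by (rule mor_id) simp
  from mor_tensor[OF this tensor_unit_left] mor_mono[OF tensor_unit_left, of H]
  show ?case by simp
next
  case (add_zero H e X Y R)
  then show ?case using mor_lists[OF add_zero] by (intro conjI mor_add mor_zero) simp_all
next
  case (comp_id_right H e X Y R)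
  then show ?case using mor_lists[OF comp_id_right] by (intro conjI mor_comp[OF mor_id]) simp_all
next
  case (comp_id_left H e X Y R)
  then show ?case using mor_lists[OF comp_id_left] by (intro conjI mor_comp[OF _ mor_id]) simp_all
next
  case (scale_zero H e X Y R)
  then show ?case using mor_lists[OF scale_zero] by (intro conjI mor_scale mor_zero) simp_all
next
  case (interchange H f X Y g Z f' X' Y' g' Z' R)
  then show ?case by (meson mor_comp mor_tensor)
qed (assumption | erule conjE | rule conjI mor_add mor_scale mor_comp mor_tensor)+

lemma equiv_eqv_rel: "equiv {e. mor P H e X Y} (eqv_rel P H R X Y)"
  unfolding eqv_rel_def
  by (auto intro!: equivI refl_onI symI transI eqv.refl
      intro: eqv.sym eqv.trans dest: eqv_mor)

abbreviation eqv_class where "eqv_class P H R X Y e \<equiv> eqv_rel P H R X Y `` {e}"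

lemma eqv_class_eq: "eqv P H R X Y e f \<Longrightarrow> eqv_class P H R X Y e = eqv_class P H R X Y f"
  by (rule equiv_class_eq[OF equiv_eqv_rel]) (simp add: eqv_rel_def)

lemma presented_carrier:
  "carrier (Hom (presented_module_category P H R) X Y) =
    {eqv_class P H R X Y e | e. mor P H e X Y}"
  by (auto simp: presented_module_category_def quotient_def)

lemma presented_zero:
  "\<zero>\<^bsub>Hom (presented_module_category P H R) X Y\<^esub> = eqv_class P H R X Y (Zero X Y)"
  by (simp add: presented_module_category_def)

lemma UN_eqv_class:
  assumes "mor P H e X Y" "\<And>a. eqv P H R X Y a e \<Longrightarrow> F a = K"
  shows "(\<Union>a\<in>eqv_class P H R X Y e. F a) = K"
proof -
  have "e \<in> eqv_class P H R X Y e"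
    using assms(1) by (simp add: eqv_rel_def eqv.refl)
  moreover have "F a = K" if "a \<in> eqv_class P H R X Y e" for a
    using that by (intro assms(2)) (simp add: eqv_rel_def eqv.sym)
  ultimately show ?thesis by blast
qed

lemma presented_add:
  assumes "mor P H e X Y" "mor P H f X Y"
  shows "eqv_class P H R X Y e \<oplus>\<^bsub>Hom (presented_module_category P H R) X Y\<^esub> eqv_class P H R X Y f
    = eqv_class P H R X Y (Add e f)"
  unfolding presented_module_category_def lincat.simps module.simps ring.simps
  by (intro UN_eqv_class assms eqv_class_eq eqv.add)

lemma presented_smult:
  assumes "mor P H e X Y"
  shows "c \<odot>\<^bsub>Hom (presented_module_category P H R) X Y\<^esub> eqv_class P H R X Y e
    = eqv_class P H R X Y (Scale c e)"
  unfolding presented_module_category_def lincat.simps module.simps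
  by (intro UN_eqv_class assms eqv_class_eq eqv.scale)

lemma presented_comp:
  assumes "mor P H f X Y" "mor P H g Y Z"
  shows "comp (presented_module_category P H R) X Y Z (eqv_class P H R Y Z g) (eqv_class P H R X Y f)
    = eqv_class P H R X Z (g \<circ>\<^sub>e f)"
  unfolding presented_module_category_def lincat.simps
  by (intro UN_eqv_class assms eqv_class_eq eqv.comp)

lemma presented_module:
  assumes XY: "X \<in> lists (gen_obj P)" "Y \<in> lists (gen_obj P)"
  shows "Module.module scalars (Hom (presented_module_category P H R) X Y)" (is "Module.module _ ?M")
proof -
  let ?cl = "eqv_class P H R X Y"
  have elim: thesis if "A \<in> carrier ?M" "\<And>e. mor P H e X Y \<Longrightarrow> A = ?cl e \<Longrightarrow> thesis" for A thesis
    using that by (auto simp: presented_carrier)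
  have intro: "?cl e \<in> carrier ?M" if "mor P H e X Y" for e
    using that by (auto simp: presented_carrier)
  note simps = presented_add presented_smult presented_zero intro mor_add mor_scale mor_zero
  have "abelian_group ?M"
  proof (rule abelian_groupI)
    show "A \<oplus>\<^bsub>?M\<^esub> B \<in> carrier ?M" if "A \<in> carrier ?M" "B \<in> carrier ?M" for A B
      using that by (elim elim) (simp add: simps)
    show "\<zero>\<^bsub>?M\<^esub> \<in> carrier ?M"
      using XY by (simp add: simps)
    show "A \<oplus>\<^bsub>?M\<^esub> B \<oplus>\<^bsub>?M\<^esub> C = A \<oplus>\<^bsub>?M\<^esub> (B \<oplus>\<^bsub>?M\<^esub> C)"
      if "A \<in> carrier ?M" "B \<in> carrier ?M" "C \<in> carrier ?M" for A B C
      using that by (elim elim) (simp add: simps eqv_class_eq[OF eqv.add_assoc])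
    show "A \<oplus>\<^bsub>?M\<^esub> B = B \<oplus>\<^bsub>?M\<^esub> A" if "A \<in> carrier ?M" "B \<in> carrier ?M" for A B
      using that by (elim elim) (simp add: simps eqv_class_eq[OF eqv.add_commute])
    show "\<zero>\<^bsub>?M\<^esub> \<oplus>\<^bsub>?M\<^esub> A = A" if "A \<in> carrier ?M" for A
      using that XY by (elim elim) (simp add: simps eqv_class_eq[OF eqv.add_zero])
    fix A assume "A \<in> carrier ?M"
    then obtain e where e: "mor P H e X Y" "A = ?cl e" by (rule elim)
    have "eqv P H R X Y (Add (Scale (- 1) e) e) (Add (Scale (- 1) e) (Scale 1 e))"
      using e by (intro eqv.add eqv.refl eqv.sym[OF eqv.scale_one] mor_scale)
    moreover have "eqv P H R X Y (Add (Scale (- 1) e) (Scale 1 e)) (Scale (- 1 + 1) e)"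
      using e(1) by (rule eqv.sym[OF eqv.scale_add_left])
    moreover have "eqv P H R X Y (Scale (- 1 + 1) e) (Zero X Y)"
      using eqv.scale_zero[OF e(1)] by simp
    ultimately have "?cl (Add (Scale (- 1) e) e) = ?cl (Zero X Y)"
      by (intro eqv_class_eq) (rule eqv.trans[OF eqv.trans])
    then show "\<exists>B\<in>carrier ?M. B \<oplus>\<^bsub>?M\<^esub> A = \<zero>\<^bsub>?M\<^esub>"
      using e XY by (intro bexI[of _ "?cl (Scale (- 1) e)"]) (simp_all add: simps)
  qed
  then show ?thesis
  proof (rule Module.moduleI[OF cring_scalars])
    show "a \<odot>\<^bsub>?M\<^esub> A \<in> carrier ?M" if "A \<in> carrier ?M" for a A
      using that by (elim elim) (simp add: simps)
    show "(a \<oplus>\<^bsub>scalars\<^esub> b) \<odot>\<^bsub>?M\<^esub> A = a \<odot>\<^bsub>?M\<^esub> A \<oplus>\<^bsub>?M\<^esub> b \<odot>\<^bsub>?M\<^esub> A"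
      if "A \<in> carrier ?M" for a b A
      using that by (elim elim)
        (simp add: simps eqv_class_eq[OF eqv.scale_add_left] scalars_def)
    show "a \<odot>\<^bsub>?M\<^esub> (A \<oplus>\<^bsub>?M\<^esub> B) = a \<odot>\<^bsub>?M\<^esub> A \<oplus>\<^bsub>?M\<^esub> a \<odot>\<^bsub>?M\<^esub> B"
      if "A \<in> carrier ?M" "B \<in> carrier ?M" for a A B
      using that by (elim elim) (simp add: simps eqv_class_eq[OF eqv.scale_add_right])
    show "(a \<otimes>\<^bsub>scalars\<^esub> b) \<odot>\<^bsub>?M\<^esub> A = a \<odot>\<^bsub>?M\<^esub> (b \<odot>\<^bsub>?M\<^esub> A)" if "A \<in> carrier ?M" for a b A
      using that by (elim elim)
        (simp add: simps eqv_class_eq[OF eqv.scale_scale] scalars_def)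
    show "\<one>\<^bsub>scalars\<^esub> \<odot>\<^bsub>?M\<^esub> A = A" if "A \<in> carrier ?M" for A
      using that by (elim elim)
        (simp add: simps eqv_class_eq[OF eqv.scale_one] scalars_def)
  qed
qed

lemma linear_category_presented: "linear_category (presented_module_category P H R)"
  (is "linear_category ?C")
proof (rule linear_category.intro)
  let ?cl = "eqv_class P H R"
  have obj: "obj ?C = lists (gen_obj P)"
    and ident: "ident ?C X = ?cl X X (Ident X)" for X
    by (simp_all add: presented_module_category_def)
  have elim: thesis
    if "A \<in> carrier (Hom ?C X Y)" "\<And>e. mor P H e X Y \<Longrightarrow> A = ?cl X Y e \<Longrightarrow> thesis"
    for A X Y thesis
    using that by (auto simp: presented_carrier)
  have intro: "?cl X Y e \<in> carrier (Hom ?C X Y)" if "mor P H e X Y" for e X Y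
    using that by (auto simp: presented_carrier)
  note simps = presented_add presented_smult presented_comp
  show "Module.module scalars (Hom ?C X Y)" if "X \<in> obj ?C" "Y \<in> obj ?C" for X Y
    using that by (simp add: presented_module obj)
  show "ident ?C X \<in> carrier (Hom ?C X X)" if "X \<in> obj ?C" for X
    using that by (simp add: ident obj intro mor_id)
  fix X Y assume X: "X \<in> obj ?C" and Y: "Y \<in> obj ?C"
  {
    fix A assume "A \<in> carrier (Hom ?C X Y)"
    then obtain f where f: "mor P H f X Y" "A = ?cl X Y f" by (rule elim)
    have "mor P H (Ident X) X X" "mor P H (Ident Y) Y Y"
      using X Y by (simp_all add: obj mor_id)
    then show "comp ?C X X Y A (ident ?C X) = A" "comp ?C X Y Y (ident ?C Y) A = A"
      using f
      by (simp_all add: ident simps eqv_class_eq[OF eqv.comp_id_right]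
          eqv_class_eq[OF eqv.comp_id_left])
  }
  fix Z
  {
    fix A B assume "A \<in> carrier (Hom ?C X Y)" "B \<in> carrier (Hom ?C Y Z)"
    then obtain f g where f: "mor P H f X Y" "A = ?cl X Y f"
      and g: "mor P H g Y Z" "B = ?cl Y Z g"
      by (elim elim)
    have gf: "mor P H (g \<circ>\<^sub>e f) X Z" using f(1) g(1) by (rule mor_comp)
    then show "comp ?C X Y Z B A \<in> carrier (Hom ?C X Z)"
      using f g by (simp add: simps intro)
    fix c
    have "mor P H (Scale c f) X Y" "mor P H (Scale c g) Y Z"
      using f g by (simp_all add: mor_scale)
    then show "comp ?C X Y Z (c \<odot>\<^bsub>Hom ?C Y Z\<^esub> B) A = c \<odot>\<^bsub>Hom ?C X Z\<^esub> comp ?C X Y Z B A"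
      "comp ?C X Y Z B (c \<odot>\<^bsub>Hom ?C X Y\<^esub> A) = c \<odot>\<^bsub>Hom ?C X Z\<^esub> comp ?C X Y Z B A"
      using f g gf
      by (simp_all add: simps eqv_class_eq[OF eqv.comp_scale_left]
          eqv_class_eq[OF eqv.comp_scale_right])
  }
  {
    fix A B B'
    assume "A \<in> carrier (Hom ?C X Y)" "B \<in> carrier (Hom ?C Y Z)" "B' \<in> carrier (Hom ?C Y Z)"
    then obtain f g g' where f: "mor P H f X Y" "A = ?cl X Y f"
      and g: "mor P H g Y Z" "B = ?cl Y Z g" "mor P H g' Y Z" "B' = ?cl Y Z g'"
      by (elim elim)
    moreover have "mor P H (g \<circ>\<^sub>e f) X Z" "mor P H (g' \<circ>\<^sub>e f) X Z" "mor P H (Add g g') Y Z"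
      using f(1) g(1,3) by (auto intro: mor_comp mor_add)
    ultimately show "comp ?C X Y Z (B \<oplus>\<^bsub>Hom ?C Y Z\<^esub> B') A =
        comp ?C X Y Z B A \<oplus>\<^bsub>Hom ?C X Z\<^esub> comp ?C X Y Z B' A"
      by (simp add: simps eqv_class_eq[OF eqv.comp_add_left])
  }
  {
    fix A A' B
    assume "A \<in> carrier (Hom ?C X Y)" "A' \<in> carrier (Hom ?C X Y)" "B \<in> carrier (Hom ?C Y Z)"
    then obtain f f' g where f: "mor P H f X Y" "A = ?cl X Y f" "mor P H f' X Y" "A' = ?cl X Y f'"
      and g: "mor P H g Y Z" "B = ?cl Y Z g"
      by (elim elim)
    moreover have "mor P H (g \<circ>\<^sub>e f) X Z" "mor P H (g \<circ>\<^sub>e f') X Z" "mor P H (Add f f') X Y"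
      using f(1,3) g(1) by (auto intro: mor_comp mor_add)
    ultimately show "comp ?C X Y Z B (A \<oplus>\<^bsub>Hom ?C X Y\<^esub> A') =
        comp ?C X Y Z B A \<oplus>\<^bsub>Hom ?C X Z\<^esub> comp ?C X Y Z B A'"
      by (simp add: simps eqv_class_eq[OF eqv.comp_add_right])
  }
  {
    fix W A B D
    assume "A \<in> carrier (Hom ?C W X)" "B \<in> carrier (Hom ?C X Y)" "D \<in> carrier (Hom ?C Y Z)"
    then obtain f g h where f: "mor P H f W X" "A = ?cl W X f" and g: "mor P H g X Y" "B = ?cl X Y g"
      and h: "mor P H h Y Z" "D = ?cl Y Z h"
      by (elim elim)
    moreover have "mor P H (g \<circ>\<^sub>e f) W Y" "mor P H (h \<circ>\<^sub>e g) X Z"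
      using f(1) g(1) h(1) by (auto intro: mor_comp)
    ultimately show "comp ?C W Y Z D (comp ?C W X Y B A) = comp ?C W X Z (comp ?C X Y Z D B) A"
      by (simp add: simps eqv_class_eq[OF eqv.comp_assoc])
  }
qed

definition Diff :: "('x, 'g, 'k::field) expr \<Rightarrow> ('x, 'g, 'k) expr \<Rightarrow> ('x, 'g, 'k) expr"
  where "Diff e f = Add e (Scale (- 1) f)"

definition delta ::
    "bool \<Rightarrow> 'x list \<Rightarrow> 'x list \<Rightarrow> ('x, 'g, 'k) expr \<Rightarrow> ('x, 'g, 'k) expr"
  where "delta b X Y e = (if b then e else Zero X Y)"

fun Sum_expr :: "'x list \<Rightarrow> 'x list \<Rightarrow> ('x, 'g, 'k) expr list \<Rightarrow> ('x, 'g, 'k) expr"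
  where
    "Sum_expr X Y [] = Zero X Y"
  | "Sum_expr X Y (e # es) = Add e (Sum_expr X Y es)"

fun Pow_expr :: "'x list \<Rightarrow> ('x, 'g, 'k) expr \<Rightarrow> nat \<Rightarrow> ('x, 'g, 'k) expr"
  where
    "Pow_expr X y 0 = Ident X"
  | "Pow_expr X y (Suc n) = y \<circ>\<^sub>e Pow_expr X y n"

text \<open>Substitution of endomorphisms of \<open>X\<close> into a polynomial, where \<open>h\<close> translates the
  coefficients. Iterating it evaluates polynomials in several variables, encoded as iterated
  \<open>poly\<close> types whose innermost variable is the first one.\<close>

definition poly_subst ::
    "'x list \<Rightarrow> ('c::zero \<Rightarrow> ('x, 'g, 'k) expr) \<Rightarrow> ('x, 'g, 'k) expr \<Rightarrow> 'c poly \<Rightarrow> ('x, 'g, 'k) expr"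
  where "poly_subst X h y p =
    Sum_expr X X (map (\<lambda>n. h (coeff p n) \<circ>\<^sub>e Pow_expr X y n) [0..<Suc (degree p)])"

definition poly_subst2 ::
    "'x list \<Rightarrow> ('x, 'g, 'k) expr \<Rightarrow> ('x, 'g, 'k) expr \<Rightarrow> 'k::field poly poly \<Rightarrow> ('x, 'g, 'k) expr"
  where "poly_subst2 X y\<^sub>1 y\<^sub>2 = poly_subst X (poly_subst X (\<lambda>c. Scale c (Ident X)) y\<^sub>1) y\<^sub>2"

definition poly_subst3 ::
    "'x list \<Rightarrow> ('x, 'g, 'k) expr \<Rightarrow> ('x, 'g, 'k) expr \<Rightarrow> ('x, 'g, 'k) expr \<Rightarrow>
     'k::field poly poly poly \<Rightarrow> ('x, 'g, 'k) expr"
  where "poly_subst3 X y\<^sub>1 y\<^sub>2 y\<^sub>3 = poly_subst X (poly_subst2 X y\<^sub>1 y\<^sub>2) y\<^sub>3"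


lemma mor_tensor_eq:
  "\<lbrakk>mor P H e X Y; mor P {} f Z W; V = X @ Z; U = Y @ W\<rbrakk> \<Longrightarrow> mor P H (e \<otimes>\<^sub>e f) V U"
  using mor_tensor by blast

lemma mor_Diff: "\<lbrakk>mor P H e X Y; mor P H f X Y\<rbrakk> \<Longrightarrow> mor P H (Diff e f) X Y"
  unfolding Diff_def by (intro mor_add mor_scale)

lemma mor_delta:
  "\<lbrakk>b \<Longrightarrow> mor P H e X Y; X \<in> lists (gen_obj P); Y \<in> lists (gen_obj P)\<rbrakk>
    \<Longrightarrow> mor P H (delta b X Y e) X Y"
  by (simp add: delta_def mor_zero)

lemma mor_Sum_expr:
  "\<lbrakk>\<And>e. e \<in> set es \<Longrightarrow> mor P H e X Y; X \<in> lists (gen_obj P); Y \<in> lists (gen_obj P)\<rbrakk>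
    \<Longrightarrow> mor P H (Sum_expr X Y es) X Y"
  by (induction es) (auto simp del: in_listsI intro: mor_add mor_zero)

lemma mor_Pow_expr:
  "\<lbrakk>mor P H y X X; X \<in> lists (gen_obj P)\<rbrakk> \<Longrightarrow> mor P H (Pow_expr X y n) X X"
  by (induction n) (auto intro: mor_comp mor_id)

lemma mor_poly_subst:
  assumes "mor P H y X X" "X \<in> lists (gen_obj P)" "\<And>c. mor P H (h c) X X"
  shows "mor P H (poly_subst X h y p) X X"
  unfolding poly_subst_def
  by (intro mor_Sum_expr assms) (auto intro!: mor_comp[OF mor_Pow_expr] assms)

lemma mor_poly_subst2:
  assumes "mor P H y\<^sub>1 X X" "mor P H y\<^sub>2 X X" "X \<in> lists (gen_obj P)"
  shows "mor P H (poly_subst2 X y\<^sub>1 y\<^sub>2 p) X X"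
  unfolding poly_subst2_def by (intro mor_poly_subst mor_scale mor_id assms)

lemma mor_poly_subst3:
  assumes "mor P H y\<^sub>1 X X" "mor P H y\<^sub>2 X X" "mor P H y\<^sub>3 X X" "X \<in> lists (gen_obj P)"
  shows "mor P H (poly_subst3 X y\<^sub>1 y\<^sub>2 y\<^sub>3 p) X X"
  unfolding poly_subst3_def by (intro mor_poly_subst mor_poly_subst2 assms)


section \<open>KLRW categories\<close>

definition quiver :: "'v pair_pre_digraph \<Rightarrow> bool"
  where "quiver Q \<longleftrightarrow> pair_loopfree_digraph Q \<and>
    (\<forall>i j. (i, j) \<in> parcs Q \<longrightarrow> (j, i) \<notin> parcs Q)"

text \<open>The weight \<open>\<Sum>\<^sub>i \<theta>\<^sub>i \<varpi>\<^sub>i\<close> is the finitely supported function \<open>i \<mapsto> \<theta>\<^sub>i\<close>.\<close>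

type_synonym 'v weight = "'v \<Rightarrow>\<^sub>0 nat"

definition dominant_weights :: "'v pair_pre_digraph \<Rightarrow> 'v weight set"
  where "dominant_weights Q = {\<theta>. Poly_Mapping.keys \<theta> \<subseteq> pverts Q}"

datatype 'v letter = Black 'v | Red "'v weight"

text \<open>\<open>Cross a b\<close> is \<open>\<sigma>\<^sub>a\<^sub>b\<close>, for two letters that are not both red. \<open>Rho i\<close> is not a morphism of
  the KLRW category; it is used for the oKLRW category only.\<close>

datatype 'v generator = Dot 'v | Cross "'v letter" "'v letter" | Rho 'v

type_synonym ('v, 'k) diagram = "('v letter, 'v generator, 'k) expr"

definition letters :: "'v pair_pre_digraph \<Rightarrow> 'v letter set"
  where "letters Q = Black ` pverts Q \<union> Red ` dominant_weights Q"

inductive_set KLRW_gens ::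
    "'v pair_pre_digraph \<Rightarrow> ('v generator \<times> 'v letter list \<times> 'v letter list) set"
  for Q
  where
    "i \<in> pverts Q \<Longrightarrow> (Dot i, [Black i], [Black i]) \<in> KLRW_gens Q"
  | "\<lbrakk>i \<in> pverts Q; j \<in> pverts Q\<rbrakk>
      \<Longrightarrow> (Cross (Black i) (Black j), [Black i, Black j], [Black j, Black i]) \<in> KLRW_gens Q"
  | "\<lbrakk>i \<in> pverts Q; \<theta> \<in> dominant_weights Q\<rbrakk>
      \<Longrightarrow> (Cross (Black i) (Red \<theta>), [Black i, Red \<theta>], [Red \<theta>, Black i]) \<in> KLRW_gens Q"
  | "\<lbrakk>i \<in> pverts Q; \<theta> \<in> dominant_weights Q\<rbrakk>
      \<Longrightarrow> (Cross (Red \<theta>) (Black i), [Red \<theta>, Black i], [Black i, Red \<theta>]) \<in> KLRW_gens Q"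

definition X_poly :: "'v pair_pre_digraph \<Rightarrow> 'v \<Rightarrow> 'v \<Rightarrow> 'a::comm_ring_1 \<Rightarrow> 'a \<Rightarrow> 'a"
  where "X_poly Q i j u v = (if (j, i) \<in> parcs Q then u - v else 1)"

definition f_poly :: "'v pair_pre_digraph \<Rightarrow> 'v \<Rightarrow> 'v \<Rightarrow> 'a::comm_ring_1 \<Rightarrow> 'a \<Rightarrow> 'a"
  where "f_poly Q i j u v = X_poly Q i j u v * X_poly Q j i v u"

definition f2 :: "'v pair_pre_digraph \<Rightarrow> 'v \<Rightarrow> 'v \<Rightarrow> 'k::field poly poly"
  where "f2 Q i j = (let Y\<^sub>1 = [:[:0, 1:]:]; Y\<^sub>2 = [:0, 1:] in f_poly Q i j Y\<^sub>1 Y\<^sub>2)"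

text \<open>The division is the exact one of the polynomial ring in three variables, see
  \<open>braid_quotient\<close> below.\<close>

definition f3_quotient :: "'v pair_pre_digraph \<Rightarrow> 'v \<Rightarrow> 'v \<Rightarrow> 'k::field poly poly poly"
  where "f3_quotient Q i j =
    (let Y\<^sub>1 = [:[:[:0, 1:]:]:]; Y\<^sub>2 = [:[:0, 1:]:]; Y\<^sub>3 = [:0, 1:]
     in (f_poly Q i j Y\<^sub>3 Y\<^sub>2 - f_poly Q i j Y\<^sub>1 Y\<^sub>2) div (Y\<^sub>3 - Y\<^sub>1))"

lemma braid_quotient:
  assumes "quiver Q"
  defines "Y\<^sub>1 \<equiv> [:[:[:0, 1:]:]:]" and "Y\<^sub>2 \<equiv> [:[:0, 1:]:]" and "Y\<^sub>3 \<equiv> [:0, 1:]"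
  shows "f3_quotient Q i j * (Y\<^sub>3 - Y\<^sub>1) =
    f_poly Q i j Y\<^sub>3 Y\<^sub>2 - (f_poly Q i j Y\<^sub>1 Y\<^sub>2 :: 'k::field poly poly poly)"
proof -
  have 1: "\<not> ((i, j) \<in> parcs Q \<and> (j, i) \<in> parcs Q)"
    using assms(1) unfolding quiver_def by blast
  have "(Y\<^sub>3 - Y\<^sub>1) dvd f_poly Q i j Y\<^sub>3 Y\<^sub>2 - (f_poly Q i j Y\<^sub>1 Y\<^sub>2 :: 'k poly poly poly)"
    using 1 by (auto simp: f_poly_def X_poly_def dvd_def intro: exI[of _ 1] exI[of _ "-1"])
  then show ?thesis
    unfolding f3_quotient_def Let_def Y\<^sub>1_def Y\<^sub>2_def Y\<^sub>3_def by (rule dvd_div_mult_self)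
qed

abbreviation dot :: "'v \<Rightarrow> ('v, 'k) diagram"
  where "dot i \<equiv> Gen (Dot i)"

abbreviation sigma :: "'v letter \<Rightarrow> 'v letter \<Rightarrow> ('v, 'k) diagram"
  where "sigma a b \<equiv> Gen (Cross a b)"

abbreviation strand :: "'v letter \<Rightarrow> ('v, 'k) diagram"
  where "strand a \<equiv> Ident [a]"

inductive_set KLRW_rels ::
    "'v pair_pre_digraph \<Rightarrow> (('v, 'k::field) diagram \<times> ('v, 'k) diagram) set"
  for Q
  where
    dot_cross_left: "\<lbrakk>i \<in> pverts Q; j \<in> pverts Q; a = Black i; b = Black j\<rbrakk> \<Longrightarrow>
      (dot j \<otimes>\<^sub>e strand a \<circ>\<^sub>e sigma a b,
       Add (sigma a b \<circ>\<^sub>e strand a \<otimes>\<^sub>e dot j) (delta (i = j) [a, b] [b, a] (Ident [a, b])))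
      \<in> KLRW_rels Q"
  | dot_cross_right: "\<lbrakk>i \<in> pverts Q; j \<in> pverts Q; a = Black i; b = Black j\<rbrakk> \<Longrightarrow>
      (sigma a b \<circ>\<^sub>e dot i \<otimes>\<^sub>e strand b,
       Add (strand b \<otimes>\<^sub>e dot i \<circ>\<^sub>e sigma a b) (delta (i = j) [a, b] [b, a] (Ident [a, b])))
      \<in> KLRW_rels Q"
  | cross_square: "\<lbrakk>i \<in> pverts Q; a = Black i\<rbrakk> \<Longrightarrow>
      (sigma a a \<circ>\<^sub>e sigma a a, Zero [a, a] [a, a]) \<in> KLRW_rels Q"
  | cross_cross: "\<lbrakk>i \<in> pverts Q; j \<in> pverts Q; i \<noteq> j; a = Black i; b = Black j\<rbrakk> \<Longrightarrow>
      (sigma b a \<circ>\<^sub>e sigma a b,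
       poly_subst2 [a, b] (dot i \<otimes>\<^sub>e strand b) (strand a \<otimes>\<^sub>e dot j) (f2 Q i j))
      \<in> KLRW_rels Q"
  | braid: "\<lbrakk>i \<in> pverts Q; j \<in> pverts Q; k \<in> pverts Q; a = Black i; b = Black j; c = Black k\<rbrakk> \<Longrightarrow>
      (Diff
         (sigma b c \<otimes>\<^sub>e strand a \<circ>\<^sub>e strand b \<otimes>\<^sub>e sigma a c \<circ>\<^sub>e sigma a b \<otimes>\<^sub>e strand c)
         (strand c \<otimes>\<^sub>e sigma a b \<circ>\<^sub>e sigma a c \<otimes>\<^sub>e strand b \<circ>\<^sub>e strand a \<otimes>\<^sub>e sigma b c),
       delta (i = k \<and> k \<noteq> j) [a, b, c] [c, b, a]
         (poly_subst3 [a, b, c]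
            (dot i \<otimes>\<^sub>e Ident [b, c]) (strand a \<otimes>\<^sub>e dot j \<otimes>\<^sub>e strand c) (Ident [a, b] \<otimes>\<^sub>e dot k)
            (f3_quotient Q i j)))
      \<in> KLRW_rels Q"
  | braid_red_middle: "\<lbrakk>i \<in> pverts Q; j \<in> pverts Q; \<theta> \<in> dominant_weights Q;
        a = Black i; b = Black j; t = Red \<theta>\<rbrakk> \<Longrightarrow>
      (Diff
         (sigma t b \<otimes>\<^sub>e strand a \<circ>\<^sub>e strand t \<otimes>\<^sub>e sigma a b \<circ>\<^sub>e sigma a t \<otimes>\<^sub>e strand b)
         (strand b \<otimes>\<^sub>e sigma a t \<circ>\<^sub>e sigma a b \<otimes>\<^sub>e strand t \<circ>\<^sub>e strand a \<otimes>\<^sub>e sigma t b),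
       delta (i = j) [a, t, b] [b, t, a]
         (Sum_expr [a, t, b] [b, t, a]
            [Pow_expr [a] (dot i) m \<otimes>\<^sub>e strand t \<otimes>\<^sub>e Pow_expr [b] (dot j) n.
               m \<leftarrow> [0..<Poly_Mapping.lookup \<theta> i], n \<leftarrow> [0..<Poly_Mapping.lookup \<theta> i], m + n + 1 = Poly_Mapping.lookup \<theta> i]))
      \<in> KLRW_rels Q"
  | braid_red_right: "\<lbrakk>i \<in> pverts Q; j \<in> pverts Q; \<theta> \<in> dominant_weights Q;
        a = Black i; b = Black j; t = Red \<theta>\<rbrakk> \<Longrightarrow>
      (sigma b t \<otimes>\<^sub>e strand a \<circ>\<^sub>e strand b \<otimes>\<^sub>e sigma a t \<circ>\<^sub>e sigma a b \<otimes>\<^sub>e strand t,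
       strand t \<otimes>\<^sub>e sigma a b \<circ>\<^sub>e sigma a t \<otimes>\<^sub>e strand b \<circ>\<^sub>e strand a \<otimes>\<^sub>e sigma b t)
      \<in> KLRW_rels Q"
  | braid_red_left: "\<lbrakk>i \<in> pverts Q; j \<in> pverts Q; \<theta> \<in> dominant_weights Q;
        a = Black i; b = Black j; t = Red \<theta>\<rbrakk> \<Longrightarrow>
      (sigma b a \<otimes>\<^sub>e strand t \<circ>\<^sub>e strand b \<otimes>\<^sub>e sigma t a \<circ>\<^sub>e sigma t b \<otimes>\<^sub>e strand a,
       strand a \<otimes>\<^sub>e sigma t b \<circ>\<^sub>e sigma t a \<otimes>\<^sub>e strand b \<circ>\<^sub>e strand t \<otimes>\<^sub>e sigma b a)
      \<in> KLRW_rels Q"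
  | dot_red_left: "\<lbrakk>i \<in> pverts Q; \<theta> \<in> dominant_weights Q; a = Black i; t = Red \<theta>\<rbrakk> \<Longrightarrow>
      (dot i \<otimes>\<^sub>e strand t \<circ>\<^sub>e sigma t a, sigma t a \<circ>\<^sub>e strand t \<otimes>\<^sub>e dot i) \<in> KLRW_rels Q"
  | dot_red_right: "\<lbrakk>i \<in> pverts Q; \<theta> \<in> dominant_weights Q; a = Black i; t = Red \<theta>\<rbrakk> \<Longrightarrow>
      (sigma a t \<circ>\<^sub>e dot i \<otimes>\<^sub>e strand t, strand t \<otimes>\<^sub>e dot i \<circ>\<^sub>e sigma a t) \<in> KLRW_rels Q"
  | red_cross_left: "\<lbrakk>i \<in> pverts Q; \<theta> \<in> dominant_weights Q; a = Black i; t = Red \<theta>\<rbrakk> \<Longrightarrow>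
      (sigma a t \<circ>\<^sub>e sigma t a, strand t \<otimes>\<^sub>e Pow_expr [a] (dot i) (Poly_Mapping.lookup \<theta> i)) \<in> KLRW_rels Q"
  | red_cross_right: "\<lbrakk>i \<in> pverts Q; \<theta> \<in> dominant_weights Q; a = Black i; t = Red \<theta>\<rbrakk> \<Longrightarrow>
      (sigma t a \<circ>\<^sub>e sigma a t, Pow_expr [a] (dot i) (Poly_Mapping.lookup \<theta> i) \<otimes>\<^sub>e strand t) \<in> KLRW_rels Q"

definition KLRW :: "'v pair_pre_digraph \<Rightarrow> ('v letter, 'v generator, 'k::field) presentation"
  where "KLRW Q = \<lparr>gen_obj = letters Q, gens = KLRW_gens Q, rels = KLRW_rels Q\<rparr>"

lemma letters_lists:
  "[] \<in> lists (gen_obj (KLRW Q))"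
  "\<lbrakk>i \<in> pverts Q; w \<in> lists (gen_obj (KLRW Q))\<rbrakk> \<Longrightarrow> Black i # w \<in> lists (gen_obj (KLRW Q))"
  "\<lbrakk>\<theta> \<in> dominant_weights Q; w \<in> lists (gen_obj (KLRW Q))\<rbrakk> \<Longrightarrow> Red \<theta> # w \<in> lists (gen_obj (KLRW Q))"
  by (auto simp: KLRW_def letters_def)

lemma mor_KLRW_gens:
  "i \<in> pverts Q \<Longrightarrow> mor (KLRW Q) H (dot i) [Black i] [Black i]"
  "\<lbrakk>i \<in> pverts Q; j \<in> pverts Q\<rbrakk>
    \<Longrightarrow> mor (KLRW Q) H (sigma (Black i) (Black j)) [Black i, Black j] [Black j, Black i]"
  "\<lbrakk>i \<in> pverts Q; \<theta> \<in> dominant_weights Q\<rbrakk>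
    \<Longrightarrow> mor (KLRW Q) H (sigma (Black i) (Red \<theta>)) [Black i, Red \<theta>] [Red \<theta>, Black i]"
  "\<lbrakk>i \<in> pverts Q; \<theta> \<in> dominant_weights Q\<rbrakk>
    \<Longrightarrow> mor (KLRW Q) H (sigma (Red \<theta>) (Black i)) [Red \<theta>, Black i] [Black i, Red \<theta>]"
  by (auto intro!: mor_gen letters_lists KLRW_gens.intros simp: KLRW_def letters_def)

lemmas mor_rules = mor_id mor_zero mor_add mor_scale mor_comp mor_tensor_eq mor_Diff mor_delta
  mor_Sum_expr mor_Pow_expr mor_poly_subst2 mor_poly_subst3 mor_KLRW_gens letters_lists

lemma KLRW_rels_typed:
  assumes "(e, f) \<in> KLRW_rels Q"
  shows "\<exists>X Y. mor (KLRW Q) H e X Y \<and> mor (KLRW Q) H f X Y"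
  using assms
proof cases
  case (braid_red_middle i j \<theta> a b t)
  have "mor (KLRW Q) H e [a, t, b] [b, t, a]"
    unfolding braid_red_middle by (rule mor_rules braid_red_middle | simp)+
  moreover have "mor (KLRW Q) H (Pow_expr [Black i] (dot i) m \<otimes>\<^sub>e strand (Red \<theta>) \<otimes>\<^sub>e
      Pow_expr [Black j] (dot j) n) [Black i, Red \<theta>, Black j] [Black i, Red \<theta>, Black j]" for m n
    by (rule mor_rules braid_red_middle | simp)+
  then have "mor (KLRW Q) H f [a, t, b] [b, t, a]"
    using braid_red_middle(3-5) unfolding braid_red_middle
    by (intro mor_delta mor_Sum_expr letters_lists) auto
  ultimately show ?thesis by blast
next
  case (braid i j k a b c)
  have "mor (KLRW Q) H e [a, b, c] [c, b, a]"
    unfolding braid by (rule mor_rules braid | simp)+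
  moreover have "mor (KLRW Q) H f [a, b, c] [c, b, a]"
  proof (cases "i = k")
    case True
    have "mor (KLRW Q) H f [a, b, c] [a, b, c]"
      unfolding braid True by (rule mor_rules braid | simp)+
    then show ?thesis using True braid by simp
  next
    case False
    then show ?thesis
      unfolding braid delta_def by simp (intro mor_zero letters_lists braid)
  qed
  ultimately show ?thesis by blast
next
  case (dot_cross_left i j a b)
  then show ?thesis
    apply (intro exI conjI)
    by (hypsubst, (assumption | rule mor_rules | simp add: delta_def split: if_splits)+; fail)+
next
  case (dot_cross_right i j a b)
  then show ?thesis
    apply (intro exI conjI)
    by (hypsubst, (assumption | rule mor_rules | simp add: delta_def split: if_splits)+; fail)+
qed (intro exI conjI, (hypsubst, (assumption | rule mor_rules | simp)+)+; fail)+


definition KLRW_category ::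
    "'v pair_pre_digraph \<Rightarrow> ('v letter list, ('v, 'k::field) diagram set, 'k) lincat"
  where "KLRW_category Q = presented_monoidal_category (KLRW Q)"


section \<open>oKLRW categories with framing weight zero\<close>

definition oKLRW_gens ::
    "'v pair_pre_digraph \<Rightarrow> ('v \<Rightarrow> 'v) \<Rightarrow> ('v generator \<times> 'v letter list \<times> 'v letter list) set"
  where "oKLRW_gens Q \<tau> = {(Rho i, [Black i], [Black (\<tau> i)]) | i. i \<in> pverts Q}"

inductive_set oKLRW_rels ::
    "'v pair_pre_digraph \<Rightarrow> ('v \<Rightarrow> 'v) \<Rightarrow> (('v, 'k::field) diagram \<times> ('v, 'k) diagram) set"
  for Q \<tau>
  where
    rho_square: "i \<in> pverts Q \<Longrightarrow>
      (Gen (Rho (\<tau> i)) \<circ>\<^sub>e Gen (Rho i), strand (Black i)) \<in> oKLRW_rels Q \<tau>"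
  | rho_dot: "i \<in> pverts Q \<Longrightarrow>
      (Gen (Rho i) \<circ>\<^sub>e dot i, Scale (- 1) (dot (\<tau> i) \<circ>\<^sub>e Gen (Rho i))) \<in> oKLRW_rels Q \<tau>"
  | rho_cross: "\<lbrakk>i \<in> pverts Q; j \<in> pverts Q;
        a = Black i; b = Black j; a' = Black (\<tau> i); b' = Black (\<tau> j)\<rbrakk> \<Longrightarrow>
      (sigma b' a' \<circ>\<^sub>e Gen (Rho j) \<otimes>\<^sub>e strand a' \<circ>\<^sub>e sigma a' b \<circ>\<^sub>e Gen (Rho i) \<otimes>\<^sub>e strand b,
       Gen (Rho i) \<otimes>\<^sub>e strand b' \<circ>\<^sub>e sigma b' a \<circ>\<^sub>e Gen (Rho j) \<otimes>\<^sub>e strand a \<circ>\<^sub>e sigma a b)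
      \<in> oKLRW_rels Q \<tau>"

lemma mor_Rho:
  "\<lbrakk>i \<in> pverts Q; \<tau> i \<in> pverts Q\<rbrakk>
    \<Longrightarrow> mor (KLRW Q) (oKLRW_gens Q \<tau>) (Gen (Rho i)) [Black i] [Black (\<tau> i)]"
  by (auto intro!: mor_gen letters_lists simp: oKLRW_gens_def KLRW_def letters_def)

lemma oKLRW_rels_typed:
  assumes "(e, f) \<in> oKLRW_rels Q \<tau>" and \<tau>: "\<And>i. i \<in> pverts Q \<Longrightarrow> \<tau> i \<in> pverts Q \<and> \<tau> (\<tau> i) = i"
  shows "\<exists>X Y. mor (KLRW Q) (oKLRW_gens Q \<tau>) e X Y \<and> mor (KLRW Q) (oKLRW_gens Q \<tau>) f X Y"
  using assms(1)
proof cases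
  case (rho_square i)
  have "mor (KLRW Q) (oKLRW_gens Q \<tau>) (Gen (Rho (\<tau> i))) [Black (\<tau> i)] [Black i]"
    using mor_Rho[of "\<tau> i" Q \<tau>] \<tau> rho_square(3) by simp
  then show ?thesis
    unfolding rho_square using mor_Rho[of i Q \<tau>] \<tau> rho_square(3)
    by (intro exI[of _ "[Black i]"] conjI mor_comp[where Y = "[Black (\<tau> i)]"] mor_id letters_lists)
      simp_all
next
  case (rho_dot i)
  have "mor (KLRW Q) (oKLRW_gens Q \<tau>) e [Black i] [Black (\<tau> i)]"
    "mor (KLRW Q) (oKLRW_gens Q \<tau>) f [Black i] [Black (\<tau> i)]"
    unfolding rho_dot by (rule mor_Rho mor_rules rho_dot | simp add: \<tau> rho_dot)+
  then show ?thesis by blast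
next
  case (rho_cross i j a b a' b')
  have "mor (KLRW Q) (oKLRW_gens Q \<tau>) e [a, b] [a', b']"
    "mor (KLRW Q) (oKLRW_gens Q \<tau>) f [a, b] [a', b']"
    unfolding rho_cross by (rule mor_Rho mor_rules rho_cross | simp add: \<tau> rho_cross)+
  then show ?thesis by blast
qed

text \<open>The notation \<open>f \<otimes> id\<^sub>Z\<close> for morphisms \<open>f\<close> of the oKLRW category refers to its structure of
  a right module category over the KLRW category, hence it is presented as such: tensoring
  with \<open>id\<^sub>Z\<close> is a functor, and diagrams on disjoint sets of strands commute, that is,
  \<open>(\<rho>\<^sub>i \<otimes> id)(id \<otimes> g) = (id \<otimes> g)(\<rho>\<^sub>i \<otimes> id)\<close>. There is no tensor product with \<open>\<rho>\<^sub>i\<close> on the right.\<close>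

definition oKLRW_category ::
    "'v pair_pre_digraph \<Rightarrow> ('v \<Rightarrow> 'v) \<Rightarrow>
     ('v letter list, ('v, 'k::field) diagram set, 'k) lincat"
  where "oKLRW_category Q \<tau> =
    presented_module_category (KLRW Q) (oKLRW_gens Q \<tau>) (oKLRW_rels Q \<tau>)"


section \<open>The algebras\<close>

definition words_over :: "'v pair_pre_digraph \<Rightarrow> 'v weight list \<Rightarrow> 'v letter list set"
  where "words_over Q lam = {w \<in> lists (letters Q). [\<theta>. Red \<theta> \<leftarrow> w] = lam}"

definition KLRW_algebra ::
    "'v pair_pre_digraph \<Rightarrow> 'v weight list \<Rightarrow>
     ('k::field, 'v letter list \<times> 'v letter list \<Rightarrow> ('v, 'k) diagram set, 'v letter list) lu_algebra"
  where "KLRW_algebra Q lam = hom_algebra (KLRW_category Q) (words_over Q lam)"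

definition oKLRW_algebra ::
    "'v pair_pre_digraph \<Rightarrow> ('v \<Rightarrow> 'v) \<Rightarrow> 'v weight list \<Rightarrow>
     ('k::field, 'v letter list \<times> 'v letter list \<Rightarrow> ('v, 'k) diagram set, 'v letter list) lu_algebra"
  where "oKLRW_algebra Q \<tau> lam = hom_algebra (oKLRW_category Q \<tau>) (words_over Q lam)"

text \<open>Within \<open>Q\<close>, the copy of \<open>Q\<^sub>+\<close> with opposite arrows is the image of \<open>Q\<^sub>+\<close> under \<open>\<tau>\<close>.\<close>

definition diagonal_type ::
    "'v pair_pre_digraph \<Rightarrow> ('v \<Rightarrow> 'v) \<Rightarrow> 'v pair_pre_digraph \<Rightarrow> bool"
  where "diagonal_type Q \<tau> Qp \<longleftrightarrow>
    quiver Qp \<and>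
    (\<forall>i\<in>pverts Q. \<tau> (\<tau> i) = i) \<and>
    pverts Q = pverts Qp \<union> \<tau> ` pverts Qp \<and>
    pverts Qp \<inter> \<tau> ` pverts Qp = {} \<and>
    parcs Q = parcs Qp \<union> {(\<tau> j, \<tau> i) | i j. (i, j) \<in> parcs Qp}"

lemma diagonal_type_quiver:
  assumes "diagonal_type Q \<tau> Qp"
  shows "quiver Q"
proof -
  have Qp: "quiver Qp" and \<tau>: "\<And>i. i \<in> pverts Qp \<Longrightarrow> \<tau> (\<tau> i) = i"
    and disj: "\<And>i. i \<in> pverts Qp \<Longrightarrow> \<tau> i \<notin> pverts Qp"
    and verts: "pverts Q = pverts Qp \<union> \<tau> ` pverts Qp"
    and arcs: "parcs Q = parcs Qp \<union> {(\<tau> j, \<tau> i) | i j. (i, j) \<in> parcs Qp}"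
    using assms by (auto simp: diagonal_type_def)
  interpret pair_loopfree_digraph Qp
    using Qp by (simp add: quiver_def)
  have anti: "(j, i) \<notin> parcs Qp" if "(i, j) \<in> parcs Qp" for i j
    using Qp that by (simp add: quiver_def)
  have wf: "i \<in> pverts Qp" "j \<in> pverts Qp" "i \<noteq> j" if "(i, j) \<in> parcs Qp" for i j
    using in_arcsD1[OF that] in_arcsD2[OF that] pair_no_loops[OF that] by auto
  have inj: "\<tau> i = \<tau> j \<Longrightarrow> i = j" if "i \<in> pverts Qp" "j \<in> pverts Qp" for i j
    using \<tau> that by metis
  have inj': "\<tau> i \<noteq> \<tau> j" "\<tau> j \<noteq> \<tau> i" if "(i, j) \<in> parcs Qp" for i j
    using inj wf[OF that] by auto
  show ?thesis
    unfolding quiver_def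
  proof (intro conjI allI impI)
    show "pair_loopfree_digraph Q"
      by unfold_locales (auto simp: arcs verts dest: wf inj')
  next
    fix i j assume ij: "(i, j) \<in> parcs Q"
    show "(j, i) \<notin> parcs Q"
    proof
      assume ji: "(j, i) \<in> parcs Q"
      from ij[unfolded arcs] show False
      proof
        assume a: "(i, j) \<in> parcs Qp"
        have "(j, i) \<noteq> (\<tau> l, \<tau> k)" if "(k, l) \<in> parcs Qp" for k l
          using wf[OF a] wf[OF that] disj by auto
        with ji anti[OF a] show False unfolding arcs by blast
      next
        assume "(i, j) \<in> {(\<tau> j, \<tau> i) | i j. (i, j) \<in> parcs Qp}"
        then obtain k l where kl: "i = \<tau> l" "j = \<tau> k" "(k, l) \<in> parcs Qp" by blast
        then have "i \<notin> pverts Qp" using disj wf by simp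
        with ji wf obtain k' l' where "j = \<tau> l'" "i = \<tau> k'" "(k', l') \<in> parcs Qp"
          unfolding arcs by blast
        with kl have "k' = l" "l' = k" using inj wf[OF kl(3)] wf[of k' l'] by auto
        with \<open>(k', l') \<in> parcs Qp\<close> kl(3) show False using anti by blast
      qed
    qed
  qed
qed

end

theory Submission
  imports Defs "HOL-Algebra.Free_Abelian_Groups"
begin

text \<open>A strand labelled by a vertex of \<open>Q\<^sub>-\<close> has no interaction with the strands of \<open>Q\<^sub>+\<close> and with the
  red strands, since these are labelled by weights of \<open>Q\<^sub>+\<close>. It can therefore be moved to the far
  left, where \<open>\<rho>\<close> turns it into a strand of \<open>Q\<^sub>+\<close>. This gives for every word \<open>X\<close> an isomorphism
  \<open>straighten X []\<close> from \<open>X\<close> to a word \<open>mv [] X\<close> over \<open>Q\<^sub>+\<close>, and for every diagram \<open>f\<close> a diagram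
  \<open>alpha f []\<close> over \<open>Q\<^sub>+\<close>, to which \<open>f\<close> corresponds under these isomorphisms. Since \<open>alpha\<close> respects all
  relations, it is a functor from the oKLRW category of \<open>Q\<close> to the KLRW category of \<open>Q\<^sub>+\<close>. By the
  isomorphisms it is fully faithful, and it is the identity on diagrams over \<open>Q\<^sub>+\<close>, hence surjective
  on objects. Modules over the KLRW algebra are pulled back along it; the inverse of this
  equivalence cuts down a module to the words over \<open>Q\<^sub>+\<close>.\<close>

section \<open>Calculus of classes of diagrams\<close>

text \<open>\<open>\<rho>\<close> acts on the leftmost strand only and nothing can be tensored to
  the left of it, so the factors of a diagram cannot be straightened in isolation. Hence
  \<open>alpha\<close> and \<open>straighten\<close> carry an accumulator \<open>M\<close>, the word
  already straightened; for a right tensor factor it is the straightened target of the left factor,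
  and the interchange law becomes naturality in \<open>M\<close>. The signs fit because
  straightening reflects the negative strands in a vertical line and negates their dots: exchange
  and negation of the variables cancel in \<open>u - v\<close>, and the exchange of the labels is
  matched by the opposite arrows of \<open>Q_-\<close>. Two further obstacles are of a formal kind.
  Words of \<open>Q\<close> may carry red labels that involve vertices of \<open>Q_-\<close>, with
  which a negative strand can interact. No generator connects them with the words of interest, but a
  composite may run through them and has to be sent to zero. Moreover, modules live in a fixed type,
  while the pullback of a module consists of families; to embed it into the original module, its
  cardinality is bounded by means of finite fibres and an infinite field.\<close>

definition cls ::
    "('x, 'g, 'k::field) presentation \<Rightarrow> ('g \<times> 'x list \<times> 'x list) set \<Rightarrow>
     (('x, 'g, 'k) expr \<times> ('x, 'g, 'k) expr) set \<Rightarrow> ('x, 'g, 'k) expr \<Rightarrow> ('x, 'g, 'k) expr set"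
  where "cls P H R e = {f. \<exists>X Y. eqv P H R X Y e f}"

lemma cls_ill_typed: "(\<And>X Y. \<not> mor P H e X Y) \<Longrightarrow> cls P H R e = {}"
  by (auto simp: cls_def dest: eqv_mor)

lemma in_cls_imp_mor: "f \<in> cls P H R e \<Longrightarrow> \<exists>X Y. mor P H e X Y \<and> mor P H f X Y \<and> eqv P H R X Y e f"
  by (auto simp: cls_def dest: eqv_mor)

inductive_cases mor_CompE: "mor P H (g \<circ>\<^sub>e f) X Z"
inductive_cases mor_TensorE: "mor P H (e \<otimes>\<^sub>e f) X Z"
inductive_cases mor_AddE: "mor P H (Add e f) X Z"
inductive_cases mor_ScaleE: "mor P H (Scale c e) X Z"
inductive_cases mor_IdentE: "mor P H (Ident W) X Z"

text \<open>Ill-typed expressions have the empty class, and the operations below preserve emptiness;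
  this makes associativity and the homomorphism properties of \<open>cls\<close> unconditional.\<close>

locale presented =
  fixes P :: "('x, 'g, 'k::field) presentation"
    and H :: "('g \<times> 'x list \<times> 'x list) set"
    and R :: "(('x, 'g, 'k) expr \<times> ('x, 'g, 'k) expr) set"
  assumes unique_type: "\<lbrakk>mor P H e X Y; mor P H e X' Y'\<rbrakk> \<Longrightarrow> X = X' \<and> Y = Y'"
begin

abbreviation cl where "cl \<equiv> cls P H R"
abbreviation ob where "ob X \<equiv> X \<in> lists (gen_obj P)"

definition idt where "idt X = cl (Ident X)"
definition zer where "zer X Y = cl (Zero X Y)"
definition cmp (infixl \<open>\<cdot>\<close> 66) where "B \<cdot> A = (\<Union>b\<in>B. \<Union>a\<in>A. cl (b \<circ>\<^sub>e a))"
definition pls (infixl \<open>\<boxplus>\<close> 65) where "A \<boxplus> B = (\<Union>a\<in>A. \<Union>b\<in>B. cl (Add a b))"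
definition scl where "scl c A = (\<Union>a\<in>A. cl (Scale c a))"
definition rw where "rw A Z = (\<Union>a\<in>A. cl (a \<otimes>\<^sub>e Ident Z))"

definition arr where "arr A \<longleftrightarrow> (\<exists>e X Y. mor P H e X Y \<and> A = cl e)"
definition dom where "dom A = (THE X. \<exists>e Y. mor P H e X Y \<and> e \<in> A)"
definition cod where "cod A = (THE Y. \<exists>e X. mor P H e X Y \<and> e \<in> A)"

lemma cl_eqI: "eqv P H R X Y e f \<Longrightarrow> cl e = cl f"
  unfolding cls_def
  by (metis (mono_tags, lifting) eqv.sym eqv.trans eqv_mor unique_type)

lemma cl_self: "mor P H e X Y \<Longrightarrow> e \<in> cl e"
  by (auto simp: cls_def intro: eqv.refl)

lemma cl_eqv_class: "mor P H e X Y \<Longrightarrow> cl e = eqv_class P H R X Y e"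
  unfolding cls_def eqv_rel_def using eqv_mor unique_type by blast

lemma cl_eqD:
  assumes "cl e = cl f" "mor P H e X Y" shows "eqv P H R X Y e f"
proof -
  have "e \<in> cl f" using cl_self[OF assms(2)] assms(1) by simp
  then obtain X' Y' where "eqv P H R X' Y' f e" by (auto simp: cls_def)
  then show ?thesis using assms(2) by (metis eqv.sym eqv_mor unique_type)
qed

text \<open>All operations on classes are unions over representatives. Such a union collapses to its
  value at \<open>e\<close> because the family is constant on a non-empty class; for ill-typed
  \<open>e\<close> the class is empty, and \<open>F e\<close> has to be empty as well.\<close>

lemma UN_cl:
  assumes "\<And>x. x \<in> cl e \<Longrightarrow> F x = F e" and "(\<And>X Y. \<not> mor P H e X Y) \<Longrightarrow> F e = {}"
  shows "(\<Union>x\<in>cl e. F x) = F e"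
proof (cases "\<exists>X Y. mor P H e X Y")
  case True
  then have "e \<in> cl e" using cl_self by blast
  then show ?thesis using assms(1) by blast
next
  case False
  then show ?thesis using assms(2) cls_ill_typed[of P H e R] by simp
qed

text \<open>For composable classes this is the congruence rule of \<open>eqv\<close>. Otherwise both
  composites are ill-typed, and both sides are the empty class.\<close>

lemma cl_comp_cong:
  assumes "x \<in> cl e" "y \<in> cl f" shows "cl (x \<circ>\<^sub>e y) = cl (e \<circ>\<^sub>e f)"
proof -
  obtain X Y where e: "mor P H e X Y" "mor P H x X Y" "eqv P H R X Y e x"
    using in_cls_imp_mor[OF assms(1)] by blast
  obtain X' Y' where f: "mor P H f X' Y'" "mor P H y X' Y'" "eqv P H R X' Y' f y"
    using in_cls_imp_mor[OF assms(2)] by blast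
  show ?thesis
  proof (cases "Y' = X")
    case True
    then show ?thesis by (intro cl_eqI[OF eqv.sym] eqv.comp) (use e f in auto)
  next
    case False
    then have "\<not> mor P H (x \<circ>\<^sub>e y) Z W" "\<not> mor P H (e \<circ>\<^sub>e f) Z W" for Z W
      using e f unique_type by (blast elim: mor_CompE)+
    then show ?thesis by (simp add: cls_ill_typed)
  qed
qed

lemma cl_add_cong:
  assumes "x \<in> cl e" "y \<in> cl f" shows "cl (Add x y) = cl (Add e f)"
proof -
  obtain X Y where e: "mor P H e X Y" "mor P H x X Y" "eqv P H R X Y e x"
    using in_cls_imp_mor[OF assms(1)] by blast
  obtain X' Y' where f: "mor P H f X' Y'" "mor P H y X' Y'" "eqv P H R X' Y' f y"
    using in_cls_imp_mor[OF assms(2)] by blast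
  show ?thesis
  proof (cases "X' = X \<and> Y' = Y")
    case True
    then show ?thesis by (intro cl_eqI[OF eqv.sym] eqv.add) (use e f in auto)
  next
    case False
    then have "\<not> mor P H (Add x y) Z W" "\<not> mor P H (Add e f) Z W" for Z W
      using e f unique_type by (blast elim: mor_AddE)+
    then show ?thesis by (simp add: cls_ill_typed)
  qed
qed

lemma cl_scale_cong: "x \<in> cl e \<Longrightarrow> cl (Scale c x) = cl (Scale c e)"
  by (metis cl_eqI eqv.scale in_cls_imp_mor)

lemma cl_rw_cong: "x \<in> cl e \<Longrightarrow> cl (x \<otimes>\<^sub>e Ident Z) = cl (e \<otimes>\<^sub>e Ident Z)"
proof (cases "ob Z")
  case True
  assume "x \<in> cl e"
  then obtain X Y where "eqv P H R X Y e x"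
    using in_cls_imp_mor by blast
  then show ?thesis
    using True cl_eqI[OF eqv.tensor[OF _ eqv.refl[OF mor_id]], of X Y e x Z] by simp
next
  case False
  then have "\<not> mor P H (a \<otimes>\<^sub>e Ident Z) X Y" for a X Y
    by (auto elim!: mor_TensorE mor_IdentE)
  then show ?thesis by (simp add: cls_ill_typed)
qed

lemma cl_comp_in: "x \<in> cl b \<Longrightarrow> y \<in> cl a \<Longrightarrow> cl (x \<circ>\<^sub>e y) = cl (b \<circ>\<^sub>e y)"
  using cl_comp_cong[of x b y y] in_cls_imp_mor[of y P H R a] cl_self by blast

lemma cl_add_in: "x \<in> cl b \<Longrightarrow> y \<in> cl a \<Longrightarrow> cl (Add x y) = cl (Add b y)"
  using cl_add_cong[of x b y y] in_cls_imp_mor[of y P H R a] cl_self by blast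

text \<open>The two unions in \<open>cmp\<close> are collapsed one after the other. Together with
  its companions for sums, multiples and whiskering (\<open>cl_ops\<close>), this turns laws for
  expressions into laws for classes.\<close>

lemma cl_comp: "cl (b \<circ>\<^sub>e a) = cl b \<cdot> cl a"
  unfolding cmp_def
proof (subst UN_cl)
  show "(\<Union>y\<in>cl a. cl (x \<circ>\<^sub>e y)) = (\<Union>y\<in>cl a. cl (b \<circ>\<^sub>e y))" if "x \<in> cl b" for x
    using that by (intro SUP_cong HOL.refl) (auto simp: cl_comp_in)
  show "(\<Union>y\<in>cl a. cl (b \<circ>\<^sub>e y)) = {}" if "\<And>X Y. \<not> mor P H b X Y"
  proof -
    have "\<not> mor P H (b \<circ>\<^sub>e y) X Y" for X Y y using that by (auto elim: mor_CompE)
    then show ?thesis by (simp add: cls_ill_typed)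
  qed
  show "cl (b \<circ>\<^sub>e a) = (\<Union>y\<in>cl a. cl (b \<circ>\<^sub>e y))"
  proof (rule UN_cl[symmetric])
    show "cl (b \<circ>\<^sub>e x) = cl (b \<circ>\<^sub>e a)" if "x \<in> cl a" for x
    proof (cases "\<exists>X Y. mor P H b X Y")
      case True
      then show ?thesis using cl_comp_cong[OF cl_self that] by blast
    next
      case False
      then have "cl (b \<circ>\<^sub>e y) = {}" for y by (intro cls_ill_typed) (auto elim: mor_CompE)
      then show ?thesis by simp
    qed
    show "cl (b \<circ>\<^sub>e a) = {}" if "\<And>X Y. \<not> mor P H a X Y"
      using that by (auto intro!: cls_ill_typed elim: mor_CompE)
  qed
qed

lemma cl_add: "cl (Add b a) = cl b \<boxplus> cl a"
  unfolding pls_def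
proof (subst UN_cl)
  show "(\<Union>y\<in>cl a. cl (Add x y)) = (\<Union>y\<in>cl a. cl (Add b y))" if "x \<in> cl b" for x
    using that by (intro SUP_cong HOL.refl) (auto simp: cl_add_in)
  show "(\<Union>y\<in>cl a. cl (Add b y)) = {}" if "\<And>X Y. \<not> mor P H b X Y"
  proof -
    have "\<not> mor P H (Add b y) X Y" for X Y y using that by (auto elim: mor_AddE)
    then show ?thesis by (simp add: cls_ill_typed)
  qed
  show "cl (Add b a) = (\<Union>y\<in>cl a. cl (Add b y))"
  proof (rule UN_cl[symmetric])
    show "cl (Add b x) = cl (Add b a)" if "x \<in> cl a" for x
    proof (cases "\<exists>X Y. mor P H b X Y")
      case True
      then show ?thesis using cl_add_cong[OF cl_self that] by blast
    next
      case False
      then have "cl (Add b y) = {}" for y by (intro cls_ill_typed) (auto elim: mor_AddE)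
      then show ?thesis by simp
    qed
    show "cl (Add b a) = {}" if "\<And>X Y. \<not> mor P H a X Y"
      using that by (auto intro!: cls_ill_typed elim: mor_AddE)
  qed
qed

lemma cl_scale: "cl (Scale c a) = scl c (cl a)"
  unfolding scl_def
  by (rule UN_cl[symmetric]) (auto intro!: cl_scale_cong cls_ill_typed elim: mor_ScaleE)

lemma cl_rw: "cl (a \<otimes>\<^sub>e Ident Z) = rw (cl a) Z"
  unfolding rw_def
  by (rule UN_cl[symmetric]) (auto intro!: cl_rw_cong cls_ill_typed elim: mor_TensorE)

lemmas cl_ops = idt_def[symmetric] zer_def[symmetric] cl_comp cl_add cl_scale cl_rw

lemma dom_cl: "mor P H e X Y \<Longrightarrow> dom (cl e) = X"
  and cod_cl: "mor P H e X Y \<Longrightarrow> cod (cl e) = Y"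
  unfolding dom_def cod_def
  by (rule the_equality; metis cl_self in_cls_imp_mor unique_type)+

lemma arr_cl: "mor P H e X Y \<Longrightarrow> arr (cl e)"
  by (auto simp: arr_def)

lemma arrE:
  assumes "arr A"
  obtains e where "mor P H e (dom A) (cod A)" "A = cl e"
proof -
  obtain e X Y where e: "mor P H e X Y" "A = cl e" using assms unfolding arr_def by blast
  then show thesis using that[of e] dom_cl[OF e(1)] cod_cl[OF e(1)] by simp
qed

text \<open>The axioms of \<open>eqv\<close> speak about expressions. Choosing a member of each
  arrow allows an axiom to be instantiated at representatives and read back as a law for
  arrows.\<close>

definition rep where "rep A = (SOME e. e \<in> A)"

lemma in_arr: "arr A \<Longrightarrow> e \<in> A \<Longrightarrow> mor P H e (dom A) (cod A) \<and> A = cl e"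
  by (erule arrE) (use in_cls_imp_mor unique_type cl_eqI in blast)

lemma mor_rep [simp]: "\<lbrakk>arr A; X = dom A; Y = cod A\<rbrakk> \<Longrightarrow> mor P H (rep A) X Y"
  and cl_rep [simp]: "arr A \<Longrightarrow> cl (rep A) = A"
  using in_arr[of A "rep A"] cl_self unfolding rep_def by (metis arrE someI)+

lemma arr_idt [simp]: "ob X \<Longrightarrow> arr (idt X)" "ob X \<Longrightarrow> dom (idt X) = X" "ob X \<Longrightarrow> cod (idt X) = X"
  using mor_id[of X P H] by (auto simp: idt_def intro: arr_cl dom_cl cod_cl)

lemma arr_zer [simp]:
  "\<lbrakk>ob X; ob Y\<rbrakk> \<Longrightarrow> arr (zer X Y)"
  "\<lbrakk>ob X; ob Y\<rbrakk> \<Longrightarrow> dom (zer X Y) = X"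
  "\<lbrakk>ob X; ob Y\<rbrakk> \<Longrightarrow> cod (zer X Y) = Y"
  using mor_zero[of X P Y H] by (auto simp: zer_def intro: arr_cl dom_cl cod_cl)

lemma arr_cmp [simp]:
  assumes "arr B" "arr A" "dom B = cod A"
  shows "arr (B \<cdot> A)" "dom (B \<cdot> A) = dom A" "cod (B \<cdot> A) = cod B"
proof -
  obtain e f where "mor P H e (dom A) (cod A)" "A = cl e" "mor P H f (dom B) (cod B)" "B = cl f"
    using assms by (meson arrE)
  then have "mor P H (f \<circ>\<^sub>e e) (dom A) (cod B)" "B \<cdot> A = cl (f \<circ>\<^sub>e e)"
    using assms mor_comp by (force, simp add: cl_comp)
  then show "arr (B \<cdot> A)" "dom (B \<cdot> A) = dom A" "cod (B \<cdot> A) = cod B"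
    by (metis arr_cl, metis dom_cl, metis cod_cl)
qed

lemma arr_pls [simp]:
  assumes "arr B" "arr A" "dom B = dom A" "cod B = cod A"
  shows "arr (B \<boxplus> A)" "dom (B \<boxplus> A) = dom A" "cod (B \<boxplus> A) = cod A"
proof -
  obtain e f where "mor P H e (dom A) (cod A)" "A = cl e" "mor P H f (dom B) (cod B)" "B = cl f"
    using assms by (meson arrE)
  then have "mor P H (Add f e) (dom A) (cod A)" "B \<boxplus> A = cl (Add f e)"
    using assms mor_add by (force, simp add: cl_add)
  then show "arr (B \<boxplus> A)" "dom (B \<boxplus> A) = dom A" "cod (B \<boxplus> A) = cod A"
    by (metis arr_cl, metis dom_cl, metis cod_cl)
qed

lemma arr_scl [simp]:
  assumes "arr A"
  shows "arr (scl c A)" "dom (scl c A) = dom A" "cod (scl c A) = cod A"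
proof -
  obtain e where "mor P H e (dom A) (cod A)" "A = cl e"
    using assms by (meson arrE)
  then have "mor P H (Scale c e) (dom A) (cod A)" "scl c A = cl (Scale c e)"
    using assms mor_scale by (force, simp add: cl_scale)
  then show "arr (scl c A)" "dom (scl c A) = dom A" "cod (scl c A) = cod A"
    by (metis arr_cl, metis dom_cl, metis cod_cl)
qed

lemma arr_rw [simp]:
  assumes "arr A" "ob Z"
  shows "arr (rw A Z)" "dom (rw A Z) = dom A @ Z" "cod (rw A Z) = cod A @ Z"
proof -
  obtain e where "mor P H e (dom A) (cod A)" "A = cl e"
    using assms by (meson arrE)
  then have "mor P H (e \<otimes>\<^sub>e Ident Z) (dom A @ Z) (cod A @ Z)" "rw A Z = cl (e \<otimes>\<^sub>e Ident Z)"
    using assms by (auto intro: mor_tensor mor_id simp: cl_rw)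
  then show "arr (rw A Z)" "dom (rw A Z) = dom A @ Z" "cod (rw A Z) = cod A @ Z"
    by (metis arr_cl, metis dom_cl, metis cod_cl)
qed

lemma ob_dom [simp]: "arr A \<Longrightarrow> ob (dom A)" and ob_cod [simp]: "arr A \<Longrightarrow> ob (cod A)"
  by (meson arrE mor_lists)+

text \<open>Inside \<open>cmp\<close> a union over a class collapses (facts \<open>1\<close> and
  \<open>2\<close>), even next to arbitrary sets of expressions; after that only expressions are
  reassociated. Long composites can thus be rewritten without bookkeeping of types.\<close>

lemma cmp_assoc: "C \<cdot> B \<cdot> A = C \<cdot> (B \<cdot> A)"
proof -
  have *: "cl (c \<circ>\<^sub>e b \<circ>\<^sub>e a) = cl (c \<circ>\<^sub>e (b \<circ>\<^sub>e a))" for a b c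
  proof (cases "\<exists>X Y. mor P H (c \<circ>\<^sub>e b \<circ>\<^sub>e a) X Y")
    case True
    then obtain W X Y Z where "mor P H a W X" "mor P H b X Y" "mor P H c Y Z"
      by (meson mor_CompE)
    then show ?thesis using cl_eqI[OF eqv.comp_assoc] by blast
  next
    case False
    then have "\<not> mor P H (c \<circ>\<^sub>e (b \<circ>\<^sub>e a)) X Y" for X Y
      by (meson mor_CompE mor_comp)
    then show ?thesis using False by (simp add: cls_ill_typed)
  qed
  have cl_in: "cl x = cl e" if "x \<in> cl e" for x e
    using in_cls_imp_mor[OF that] cl_eqI by metis
  have 1: "(\<Union>x\<in>cl e. \<Union>a\<in>A. cl (x \<circ>\<^sub>e a)) = (\<Union>a\<in>A. cl (e \<circ>\<^sub>e a))" for e A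
  proof (rule UN_cl)
    show "(\<Union>a\<in>A. cl (x \<circ>\<^sub>e a)) = (\<Union>a\<in>A. cl (e \<circ>\<^sub>e a))" if "x \<in> cl e" for x
      by (simp add: cl_comp cl_in[OF that])
    show "(\<Union>a\<in>A. cl (e \<circ>\<^sub>e a)) = {}" if "\<And>X Y. \<not> mor P H e X Y"
      using cls_ill_typed[OF that] by (simp add: cl_comp) (simp add: cmp_def)
  qed
  have 2: "(\<Union>x\<in>cl e. cl (a \<circ>\<^sub>e x)) = cl (a \<circ>\<^sub>e e)" for e a
  proof (rule UN_cl)
    show "cl (a \<circ>\<^sub>e x) = cl (a \<circ>\<^sub>e e)" if "x \<in> cl e" for x
      by (simp add: cl_comp cl_in[OF that])
    show "cl (a \<circ>\<^sub>e e) = {}" if "\<And>X Y. \<not> mor P H e X Y"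
      using cls_ill_typed[OF that] by (simp add: cl_comp) (simp add: cmp_def)
  qed
  have "C \<cdot> B \<cdot> A = (\<Union>c\<in>C. \<Union>b\<in>B. \<Union>x\<in>cl (c \<circ>\<^sub>e b). \<Union>a\<in>A. cl (x \<circ>\<^sub>e a))"
    by (simp add: cmp_def)
  also have "\<dots> = (\<Union>c\<in>C. \<Union>b\<in>B. \<Union>a\<in>A. cl (c \<circ>\<^sub>e b \<circ>\<^sub>e a))"
    unfolding 1 ..
  also have "\<dots> = C \<cdot> (B \<cdot> A)"
    unfolding cmp_def by (simp add: 2 *)
  finally show ?thesis .
qed

lemma cmp_idt_right [simp]:
  assumes "arr A" "dom A = X" shows "A \<cdot> idt X = A"
  using assms cl_eqI[OF eqv.comp_id_right[of P H "rep A" "dom A" "cod A"]]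
  by (simp add: cl_ops)

lemma cmp_idt_left [simp]:
  assumes "arr A" "cod A = X" shows "idt X \<cdot> A = A"
  using assms cl_eqI[OF eqv.comp_id_left[of P H "rep A" "dom A" "cod A"]]
  by (simp add: cl_ops)

lemma cmp_pls_right:
  assumes "arr C" "arr A" "arr B" "dom B = dom A" "cod B = cod A" "dom C = cod A"
  shows "C \<cdot> (A \<boxplus> B) = C \<cdot> A \<boxplus> C \<cdot> B"
  using assms cl_eqI[OF eqv.comp_add_right[of P H "rep A" "dom A" "cod A" "rep B" "rep C" "cod C"]]
  by (simp add: cl_ops)

lemma cmp_pls_left:
  assumes "arr C" "arr A" "arr B" "dom B = dom A" "cod B = cod A" "cod C = dom A"
  shows "(A \<boxplus> B) \<cdot> C = A \<cdot> C \<boxplus> B \<cdot> C"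
  using assms cl_eqI[OF eqv.comp_add_left[of P H "rep C" "dom C" "cod C" "rep A" "cod A" "rep B"]]
  by (simp add: cl_ops)

lemma cmp_scl_right:
  assumes "arr C" "arr A" "dom C = cod A"
  shows "C \<cdot> scl c A = scl c (C \<cdot> A)"
  using assms cl_eqI[OF eqv.comp_scale_right[of P H "rep A" "dom A" "cod A" "rep C" "cod C"]]
  by (simp add: cl_ops)

lemma cmp_scl_left:
  assumes "arr C" "arr A" "dom C = cod A"
  shows "scl c C \<cdot> A = scl c (C \<cdot> A)"
  using assms cl_eqI[OF eqv.comp_scale_left[of P H "rep A" "dom A" "cod A" "rep C" "cod C"]]
  by (simp add: cl_ops)

lemma pls_assoc:
  assumes "arr A" "arr B" "arr C" "dom B = dom A" "cod B = cod A" "dom C = dom A" "cod C = cod A"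
  shows "A \<boxplus> B \<boxplus> C = A \<boxplus> (B \<boxplus> C)"
  using assms cl_eqI[OF eqv.add_assoc[of P H "rep A" "dom A" "cod A" "rep B" "rep C"]]
  by (simp add: cl_ops)

lemma pls_commute:
  assumes "arr A" "arr B" "dom B = dom A" "cod B = cod A"
  shows "A \<boxplus> B = B \<boxplus> A"
  using assms cl_eqI[OF eqv.add_commute[of P H "rep A" "dom A" "cod A" "rep B"]]
  by (simp add: cl_ops)

lemma pls_zer_left [simp]:
  assumes "arr A" "dom A = X" "cod A = Y" shows "zer X Y \<boxplus> A = A"
  using assms cl_eqI[OF eqv.add_zero[of P H "rep A" "dom A" "cod A"]]
  by (simp add: cl_ops)

lemma pls_zer_right [simp]:
  assumes "arr A" "dom A = X" "cod A = Y" shows "A \<boxplus> zer X Y = A"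
  using pls_commute[of A "zer X Y"] assms by auto

lemma scl_0 [simp]:
  assumes "arr A" shows "scl 0 A = zer (dom A) (cod A)"
  using assms cl_eqI[OF eqv.scale_zero[of P H "rep A" "dom A" "cod A"]]
  by (simp add: cl_ops)

lemma scl_1 [simp]:
  assumes "arr A" shows "scl 1 A = A"
  using assms cl_eqI[OF eqv.scale_one[of P H "rep A" "dom A" "cod A"]]
  by (simp add: cl_ops)

lemma scl_scl [simp]:
  assumes "arr A" shows "scl a (scl b A) = scl (a * b) A"
  using assms cl_eqI[OF eqv.scale_scale[of P H "rep A" "dom A" "cod A"]]
  by (simp add: cl_ops)

lemma scl_add:
  assumes "arr A" shows "scl (a + b) A = scl a A \<boxplus> scl b A"
  using assms cl_eqI[OF eqv.scale_add_left[of P H "rep A" "dom A" "cod A"]]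
  by (simp add: cl_ops)

lemma scl_pls:
  assumes "arr A" "arr B" "dom B = dom A" "cod B = cod A"
  shows "scl c (A \<boxplus> B) = scl c A \<boxplus> scl c B"
  using assms cl_eqI[OF eqv.scale_add_right[of P H "rep A" "dom A" "cod A" "rep B"]]
  by (simp add: cl_ops)

lemma scl_zer [simp]: "ob X \<Longrightarrow> ob Y \<Longrightarrow> scl c (zer X Y) = zer X Y"
  using scl_0[of "zer X Y"] scl_scl[of "zer X Y" c 0] by simp

text \<open>A zero arrow is its own multiple by \<open>0\<close>, so composition with it is computed
  by linearity.\<close>

lemma cmp_zer_right [simp]:
  assumes "arr B" "dom B = Y" "ob X" shows "B \<cdot> zer X Y = zer X (cod B)"
  using assms cmp_scl_right[of B "zer X Y" 0] ob_cod[of B] ob_dom[of B] by (simp del: ob_cod ob_dom)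

lemma cmp_zer_left [simp]:
  assumes "arr B" "cod B = Y" "ob Z" shows "zer Y Z \<cdot> B = zer (dom B) Z"
  using assms cmp_scl_left[of "zer Y Z" B 0] ob_cod[of B] ob_dom[of B] by (simp del: ob_cod ob_dom)

lemma rw_cmp:
  assumes "arr A" "arr B" "dom B = cod A" "ob Z"
  shows "rw (B \<cdot> A) Z = rw B Z \<cdot> rw A Z"
proof -
  obtain e f where e: "mor P H e (dom A) (cod A)" "A = cl e" and f: "mor P H f (cod A) (cod B)" "B = cl f"
    using assms by (metis arrE)
  have Z: "mor P {} (Ident Z) Z Z" using assms(4) by (rule mor_id)
  have "cl (f \<otimes>\<^sub>e Ident Z \<circ>\<^sub>e e \<otimes>\<^sub>e Ident Z) = cl ((f \<circ>\<^sub>e e) \<otimes>\<^sub>e (Ident Z \<circ>\<^sub>e Ident Z))"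
    by (rule cl_eqI[OF eqv.sym[OF eqv.interchange]]) (fact e f Z)+
  also have "\<dots> = cl ((f \<circ>\<^sub>e e) \<otimes>\<^sub>e Ident Z)"
    by (rule cl_eqI[OF eqv.tensor[OF eqv.refl]]) (use e f Z in \<open>blast intro: mor_comp eqv.comp_id_right\<close>)+
  finally show ?thesis by (simp add: e(2) f(2) cl_ops)
qed

lemma rw_idt [simp]: "\<lbrakk>ob X; ob Z\<rbrakk> \<Longrightarrow> rw (idt X) Z = idt (X @ Z)"
  using cl_eqI[OF eqv.tensor_id[of X P Z H R]] by (simp add: cl_ops)

lemma rw_rw [simp]:
  assumes "arr A" "ob Z" "ob W"
  shows "rw (rw A Z) W = rw A (Z @ W)"
proof -
  obtain e where e: "mor P H e (dom A) (cod A)" "A = cl e"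
    using assms by (metis arrE)
  have *: "mor P {} (Ident Z) Z Z" "mor P {} (Ident W) W W" using assms by (auto intro: mor_id)
  have "cl (e \<otimes>\<^sub>e Ident Z \<otimes>\<^sub>e Ident W) = cl (e \<otimes>\<^sub>e (Ident Z \<otimes>\<^sub>e Ident W))"
    by (rule cl_eqI[OF eqv.tensor_assoc]) (fact e *)+
  also have "\<dots> = cl (e \<otimes>\<^sub>e Ident (Z @ W))"
    by (rule cl_eqI[OF eqv.tensor[OF eqv.refl]]) (use e assms in \<open>blast intro: eqv.tensor_id\<close>)+
  finally show ?thesis by (simp add: e(2) cl_ops)
qed

lemma rw_Nil [simp]: "arr A \<Longrightarrow> rw A [] = A"
  using cl_eqI[OF eqv.tensor_unit_right[of P H "rep A" "dom A" "cod A"]] by (simp add: cl_ops)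

lemma rw_scl:
  assumes "arr A" "ob Z"
  shows "rw (scl c A) Z = scl c (rw A Z)"
proof -
  obtain e where e: "mor P H e (dom A) (cod A)" "A = cl e"
    using assms by (metis arrE)
  have Z: "mor P {} (Ident Z) Z Z" using assms by (blast intro: mor_id)
  show ?thesis using cl_eqI[OF eqv.tensor_scale_left[OF e(1) Z]] e by (simp add: cl_ops)
qed

lemma rw_zer [simp]:
  assumes "ob X" "ob Y" "ob Z"
  shows "rw (zer X Y) Z = zer (X @ Z) (Y @ Z)"
  using assms rw_scl[of "zer X Y" Z 0] by simp

end

section \<open>Whiskering and the interchange law in a monoidal category\<close>

locale monoidal = presented P "{}" "{}" for P :: "('x, 'g, 'k::field) presentation"
begin

notation cmp (infixl \<open>\<cdot>\<close> 66)
notation pls (infixl \<open>\<boxplus>\<close> 65)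

text \<open>Tensor products of two arrows are never formed on the level of classes: each of them
  factors into two whiskerings, which are linear and functorial in a single argument.\<close>

definition wh where "wh L A Z = (\<Union>a\<in>A. cl (Ident L \<otimes>\<^sub>e a \<otimes>\<^sub>e Ident Z))"

lemma wh_cl:
  assumes e: "mor P {} e X Y" and ob: "ob L" "ob Z"
  shows "wh L (cl e) Z = cl (Ident L \<otimes>\<^sub>e e \<otimes>\<^sub>e Ident Z)"
  unfolding wh_def
proof (rule UN_cl)
  show "cl (Ident L \<otimes>\<^sub>e x \<otimes>\<^sub>e Ident Z) = cl (Ident L \<otimes>\<^sub>e e \<otimes>\<^sub>e Ident Z)" if "x \<in> cl e" for x
  proof -
    obtain X' Y' where "eqv P {} {} X' Y' e x"
      using in_cls_imp_mor \<open>x \<in> cl e\<close> by metis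
    from eqv.tensor[OF eqv.tensor[OF eqv.refl[OF mor_id] this] eqv.refl[OF mor_id]] show ?thesis
      using ob by (intro cl_eqI[OF eqv.sym]) blast
  qed
qed (use e in blast)

lemma wh_rep:
  assumes "arr A" "ob L" "ob Z"
  shows "wh L A Z = cl (Ident L \<otimes>\<^sub>e rep A \<otimes>\<^sub>e Ident Z)"
  using wh_cl[of "rep A" "dom A" "cod A" L Z] assms by simp

lemma arr_wh [simp]:
  assumes "arr A" "ob L" "ob Z"
  shows "arr (wh L A Z)" "dom (wh L A Z) = L @ dom A @ Z" "cod (wh L A Z) = L @ cod A @ Z"
proof -
  have "mor P {} (Ident L \<otimes>\<^sub>e rep A \<otimes>\<^sub>e Ident Z) (L @ dom A @ Z) (L @ cod A @ Z)"
    using mor_tensor[OF mor_tensor[OF mor_id mor_rep] mor_id, of L A _ _ Z] assms by simp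
  then show "arr (wh L A Z)" "dom (wh L A Z) = L @ dom A @ Z" "cod (wh L A Z) = L @ cod A @ Z"
    using assms by (metis wh_rep arr_cl, metis wh_rep dom_cl, metis wh_rep cod_cl)
qed

lemma cl_tensor_cong:
  "eqv P {} {} X Y e e' \<Longrightarrow> eqv P {} {} Z W f f' \<Longrightarrow> cl (e \<otimes>\<^sub>e f) = cl (e' \<otimes>\<^sub>e f')"
  by (rule cl_eqI[OF eqv.tensor])

lemma wh_cmp:
  assumes "arr A" "arr B" "dom B = cod A" "ob L" "ob Z"
  shows "wh L (B \<cdot> A) Z = wh L B Z \<cdot> wh L A Z"
proof -
  have m: "mor P {} (rep A) (dom A) (cod A)" "mor P {} (rep B) (cod A) (cod B)"
    "mor P {} (Ident L) L L" "mor P {} (Ident Z) Z Z"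
    using assms by (simp_all add: mor_id)
  have "wh L (B \<cdot> A) Z = cl (Ident L \<otimes>\<^sub>e (rep B \<circ>\<^sub>e rep A) \<otimes>\<^sub>e Ident Z)"
    using wh_cl[OF mor_comp[OF m(1,2)] assms(4,5)] assms by (simp add: cl_comp)
  \<comment> \<open>The identities are doubled so that the interchange law can split both tensor
    products.\<close>
  also have "\<dots> = cl ((Ident L \<circ>\<^sub>e Ident L) \<otimes>\<^sub>e (rep B \<circ>\<^sub>e rep A) \<otimes>\<^sub>e (Ident Z \<circ>\<^sub>e Ident Z))"
    by (rule cl_tensor_cong[OF eqv.tensor[OF _ eqv.refl]])
      (use m in \<open>blast intro: mor_comp eqv.sym[OF eqv.comp_id_right]\<close>)+
  also have "\<dots> = cl ((Ident L \<otimes>\<^sub>e rep B \<circ>\<^sub>e Ident L \<otimes>\<^sub>e rep A) \<otimes>\<^sub>e (Ident Z \<circ>\<^sub>e Ident Z))"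
    by (rule cl_tensor_cong[OF eqv.interchange eqv.refl]) (use m in \<open>blast intro: mor_comp\<close>)+
  also have "\<dots> = cl (Ident L \<otimes>\<^sub>e rep B \<otimes>\<^sub>e Ident Z \<circ>\<^sub>e Ident L \<otimes>\<^sub>e rep A \<otimes>\<^sub>e Ident Z)"
    by (rule cl_eqI[OF eqv.interchange]) (use m in \<open>blast intro: mor_tensor\<close>)+
  finally show ?thesis using assms by (simp add: wh_rep cl_comp)
qed

lemma wh_idt [simp]:
  assumes "ob X" "ob L" "ob Z" shows "wh L (idt X) Z = idt (L @ X @ Z)"
proof -
  have "wh L (idt X) Z = cl (Ident L \<otimes>\<^sub>e Ident X \<otimes>\<^sub>e Ident Z)"
    using wh_cl[OF mor_id] assms by (simp add: idt_def)
  also have "\<dots> = cl (Ident (L @ X) \<otimes>\<^sub>e Ident Z)"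
    by (rule cl_tensor_cong[OF eqv.tensor_id eqv.refl[OF mor_id]]) (fact assms)+
  also have "\<dots> = idt (L @ X @ Z)"
    using cl_eqI[OF eqv.tensor_id, of "L @ X" Z] assms by (simp add: idt_def)
  finally show ?thesis .
qed

lemma wh_Nil [simp]:
  assumes "arr A" shows "wh [] A [] = A"
proof -
  have m: "mor P {} (rep A) (dom A) (cod A)" using assms by simp
  have "wh [] A [] = cl (Ident [] \<otimes>\<^sub>e rep A)"
    using rw_Nil[OF arr_cl[OF mor_tensor[OF mor_id m, of "[]"]]] assms
    by (simp add: wh_rep cl_rw)
  also have "\<dots> = cl (rep A)" by (rule cl_eqI[OF eqv.tensor_unit_left[OF m]])
  finally show ?thesis using assms by simp
qed

lemma wh_wh [simp]:
  assumes "arr A" "ob L" "ob Z" "ob L'" "ob Z'"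
  shows "wh L' (wh L A Z) Z' = wh (L' @ L) A (Z @ Z')"
proof -
  have m: "mor P {} (rep A) (dom A) (cod A)"
    "mor P {} (Ident L) L L" "mor P {} (Ident Z) Z Z"
    "mor P {} (Ident L') L' L'" "mor P {} (Ident Z') Z' Z'"
    using assms by (simp_all add: mor_id)
  have mLL: "mor P {} (Ident (L' @ L) \<otimes>\<^sub>e rep A) ((L' @ L) @ dom A) ((L' @ L) @ cod A)"
    using mor_tensor[OF mor_id[of "L' @ L"] m(1)] assms by (simp del: append_assoc)
  have "wh L' (wh L A Z) Z' = cl (Ident L' \<otimes>\<^sub>e (Ident L \<otimes>\<^sub>e rep A \<otimes>\<^sub>e Ident Z) \<otimes>\<^sub>e Ident Z')"
    using wh_cl[OF mor_tensor[OF mor_tensor[OF m(2,1)] m(3)] assms(4,5)] assms by (simp add: wh_rep)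
  also have "\<dots> = cl (Ident L' \<otimes>\<^sub>e (Ident L \<otimes>\<^sub>e rep A) \<otimes>\<^sub>e Ident Z \<otimes>\<^sub>e Ident Z')"
    by (rule cl_tensor_cong[OF eqv.sym[OF eqv.tensor_assoc] eqv.refl])
      (use m in \<open>blast intro: mor_tensor\<close>)+
  also have "\<dots> = cl (Ident L' \<otimes>\<^sub>e Ident L \<otimes>\<^sub>e rep A \<otimes>\<^sub>e Ident Z \<otimes>\<^sub>e Ident Z')"
    by (rule cl_tensor_cong[OF eqv.tensor[OF eqv.sym[OF eqv.tensor_assoc] eqv.refl] eqv.refl])
      (use m in \<open>blast intro: mor_tensor\<close>)+
  also have "\<dots> = cl (Ident (L' @ L) \<otimes>\<^sub>e rep A \<otimes>\<^sub>e Ident Z \<otimes>\<^sub>e Ident Z')"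
    by (rule cl_tensor_cong[OF eqv.tensor[OF eqv.tensor[OF eqv.tensor_id eqv.refl] eqv.refl] eqv.refl])
      (use m assms in \<open>blast intro: mor_tensor\<close>)+
  also have "\<dots> = cl (Ident (L' @ L) \<otimes>\<^sub>e rep A \<otimes>\<^sub>e (Ident Z \<otimes>\<^sub>e Ident Z'))"
    by (rule cl_eqI[OF eqv.tensor_assoc[OF mLL m(3,5)]])
  also have "\<dots> = cl (Ident (L' @ L) \<otimes>\<^sub>e rep A \<otimes>\<^sub>e Ident (Z @ Z'))"
    by (rule cl_tensor_cong[OF eqv.refl[OF mLL] eqv.tensor_id]) (fact assms)+
  finally show ?thesis using assms by (simp add: wh_rep)
qed

lemma wh_pls:
  assumes "arr A" "arr B" "dom B = dom A" "cod B = cod A" "ob L" "ob Z"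
  shows "wh L (A \<boxplus> B) Z = wh L A Z \<boxplus> wh L B Z"
proof -
  have m: "mor P {} (rep A) (dom A) (cod A)" "mor P {} (rep B) (dom A) (cod A)"
    "mor P {} (Ident L) L L" "mor P {} (Ident Z) Z Z"
    using assms by (simp_all add: mor_id)
  have "wh L (A \<boxplus> B) Z = cl (Ident L \<otimes>\<^sub>e Add (rep A) (rep B) \<otimes>\<^sub>e Ident Z)"
    using wh_cl[OF mor_add[OF m(1,2)] assms(5,6)] assms by (simp add: cl_add)
  also have "\<dots> = cl (Add (Ident L \<otimes>\<^sub>e rep A) (Ident L \<otimes>\<^sub>e rep B) \<otimes>\<^sub>e Ident Z)"
    by (rule cl_tensor_cong[OF eqv.tensor_add_right eqv.refl]) (fact m)+
  also have "\<dots> = cl (Add (Ident L \<otimes>\<^sub>e rep A \<otimes>\<^sub>e Ident Z) (Ident L \<otimes>\<^sub>e rep B \<otimes>\<^sub>e Ident Z))"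
    by (rule cl_eqI[OF eqv.tensor_add_left]) (use m in \<open>blast intro: mor_tensor\<close>)+
  finally show ?thesis using assms by (simp add: wh_rep cl_add)
qed

lemma wh_scl:
  assumes "arr A" "ob L" "ob Z"
  shows "wh L (scl c A) Z = scl c (wh L A Z)"
proof -
  have m: "mor P {} (rep A) (dom A) (cod A)" "mor P {} (Ident L) L L" "mor P {} (Ident Z) Z Z"
    using assms by (simp_all add: mor_id)
  have "wh L (scl c A) Z = cl (Ident L \<otimes>\<^sub>e Scale c (rep A) \<otimes>\<^sub>e Ident Z)"
    using wh_cl[OF mor_scale[OF m(1)] assms(2,3)] assms by (simp add: cl_scale)
  also have "\<dots> = cl (Scale c (Ident L \<otimes>\<^sub>e rep A) \<otimes>\<^sub>e Ident Z)"
    by (rule cl_tensor_cong[OF eqv.tensor_scale_right eqv.refl]) (fact m)+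
  also have "\<dots> = cl (Scale c (Ident L \<otimes>\<^sub>e rep A \<otimes>\<^sub>e Ident Z))"
    by (rule cl_eqI[OF eqv.tensor_scale_left]) (use m in \<open>blast intro: mor_tensor\<close>)+
  finally show ?thesis using assms by (simp add: wh_rep cl_scale)
qed

lemma wh_zer [simp]:
  assumes "ob X" "ob Y" "ob L" "ob Z"
  shows "wh L (zer X Y) Z = zer (L @ X @ Z) (L @ Y @ Z)"
  using assms wh_scl[of "zer X Y" L Z 0] by simp

lemma rw_wh: "\<lbrakk>arr A; ob Z\<rbrakk> \<Longrightarrow> rw A Z = wh [] A Z"
  by (metis append_Nil arr_wh(1) cl_rep cl_rw eqv.tensor eqv.tensor_unit_left cl_eqI eqv.refl mor_id
      mor_rep wh_rep ob_dom lists.Nil)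

text \<open>Composing one factor with the identity of its target and the other with the identity of
  its source, or conversely, and applying the interchange law gives the two orders in which the
  factors can act.\<close>

lemma tensor_interchange:
  assumes e: "mor P {} e X Y" and f: "mor P {} f Z W"
  shows "cl (e \<otimes>\<^sub>e f) = wh Y (cl f) [] \<cdot> wh [] (cl e) Z"
    and "cl (e \<otimes>\<^sub>e f) = wh [] (cl e) W \<cdot> wh X (cl f) []"
proof -
  have ob: "ob X" "ob Y" "ob Z" "ob W" using mor_lists[OF e] mor_lists[OF f] by auto
  have m: "mor P {} (Ident X) X X" "mor P {} (Ident Y) Y Y" "mor P {} (Ident Z) Z Z"
    "mor P {} (Ident W) W W" "mor P {} (Ident []) [] []"
    using ob by (simp_all add: mor_id)
  have lw: "wh V (cl f) [] = cl (Ident V \<otimes>\<^sub>e f)" if "ob V" for V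
    using wh_cl[OF f that, of "[]"] cl_eqI[OF eqv.tensor_unit_right[OF mor_tensor[OF mor_id[OF that] f]]]
    by simp
  have rw: "wh [] (cl e) V = cl (e \<otimes>\<^sub>e Ident V)" if "ob V" for V
    using wh_cl[OF e _ that, of "[]"]
      cl_tensor_cong[OF eqv.tensor_unit_left[OF e] eqv.refl[OF mor_id[OF that]]]
    by simp
  have "cl (e \<otimes>\<^sub>e f) = cl ((Ident Y \<circ>\<^sub>e e) \<otimes>\<^sub>e (f \<circ>\<^sub>e Ident Z))"
    by (rule cl_tensor_cong)
      (use e f in \<open>blast intro: eqv.sym[OF eqv.comp_id_right] eqv.sym[OF eqv.comp_id_left]\<close>)+
  also have "\<dots> = cl (Ident Y \<otimes>\<^sub>e f \<circ>\<^sub>e e \<otimes>\<^sub>e Ident Z)"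
    by (rule cl_eqI[OF eqv.interchange]) (fact e f m)+
  finally show "cl (e \<otimes>\<^sub>e f) = wh Y (cl f) [] \<cdot> wh [] (cl e) Z"
    using ob by (simp add: lw rw cl_comp)
  have "cl (e \<otimes>\<^sub>e f) = cl ((e \<circ>\<^sub>e Ident X) \<otimes>\<^sub>e (Ident W \<circ>\<^sub>e f))"
    by (rule cl_tensor_cong)
      (use e f in \<open>blast intro: eqv.sym[OF eqv.comp_id_right] eqv.sym[OF eqv.comp_id_left]\<close>)+
  also have "\<dots> = cl (e \<otimes>\<^sub>e Ident W \<circ>\<^sub>e Ident X \<otimes>\<^sub>e f)"
    by (rule cl_eqI[OF eqv.interchange]) (fact e f m)+
  finally show "cl (e \<otimes>\<^sub>e f) = wh [] (cl e) W \<cdot> wh X (cl f) []"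
    using ob by (simp add: lw rw cl_comp)
qed

text \<open>Far commutativity: the two factorisations of one tensor product are compared, with the
  strands \<open>M\<close> in between, and then whiskered by \<open>L\<close> and
  \<open>Z\<close>.\<close>

lemma wh_interchange:
  assumes "arr A" "arr B" "ob L" "ob M" "ob Z"
  shows "wh (L @ cod A @ M) B Z \<cdot> wh L A (M @ dom B @ Z) =
    wh L A (M @ cod B @ Z) \<cdot> wh (L @ dom A @ M) B Z"
proof -
  have ob: "ob (dom A)" "ob (cod A)" "ob (dom B)" "ob (cod B)"
    using assms by simp_all
  have "mor P {} (rep A) (dom A) (cod A)"
    "mor P {} (Ident M \<otimes>\<^sub>e rep B) (M @ dom B) (M @ cod B)"
    using assms by (simp_all add: mor_tensor mor_id)
  from tensor_interchange[OF this]
  have "wh (cod A) (cl (Ident M \<otimes>\<^sub>e rep B)) [] \<cdot> wh [] A (M @ dom B) =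
    wh [] A (M @ cod B) \<cdot> wh (dom A) (cl (Ident M \<otimes>\<^sub>e rep B)) []"
    using assms by simp
  moreover have "cl (Ident M \<otimes>\<^sub>e rep B) = wh M B []"
    using tensor_interchange(1)[of "Ident M" M M "rep B" "dom B" "cod B"] assms ob mor_id[of M P "{}"]
    by (simp add: idt_def[symmetric])
  ultimately have "wh (cod A) (wh M B []) [] \<cdot> wh [] A (M @ dom B) =
    wh [] A (M @ cod B) \<cdot> wh (dom A) (wh M B []) []" by simp
  from arg_cong[OF this, of "\<lambda>x. wh L x Z"] show ?thesis
    using assms ob by (simp add: wh_cmp)
qed

end

section \<open>Functors induced by enlarging a presentation\<close>

locale inclusion = A: presented P1 H1 R1 + B: presented P2 H2 R2
  for P1 P2 :: "('x, 'g, 'k::field) presentation" and H1 H2 R1 R2 +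
  assumes incl_eqv: "eqv P1 H1 R1 X Y e f \<Longrightarrow> eqv P2 H2 R2 X Y e f"
    and incl_ob: "gen_obj P1 \<subseteq> gen_obj P2"
begin

text \<open>A class over the smaller presentation is contained in a single class over the larger
  one, because the larger congruence contains the smaller. Injectivity is not claimed.\<close>

definition J where "J A = (\<Union>a\<in>A. B.cl a)"

lemma incl_mor: "mor P1 H1 e X Y \<Longrightarrow> mor P2 H2 e X Y"
  using eqv_mor[OF incl_eqv[OF eqv.refl]] by blast

lemma ob_incl [simp]: "A.ob X \<Longrightarrow> B.ob X"
  using incl_ob lists_mono by blast

lemma J_cl: "mor P1 H1 e X Y \<Longrightarrow> J (A.cl e) = B.cl e"
  unfolding J_def by (rule A.UN_cl) (use A.cl_eqI B.cl_eqI in_cls_imp_mor incl_eqv in \<open>metis+\<close>)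

lemma J_rep: "A.arr A \<Longrightarrow> J A = B.cl (A.rep A)"
  using J_cl[OF A.mor_rep[OF _ HOL.refl HOL.refl]] by simp

lemma arr_J [simp]:
  assumes "A.arr A"
  shows "B.arr (J A)" "B.dom (J A) = A.dom A" "B.cod (J A) = A.cod A"
proof -
  have "mor P2 H2 (A.rep A) (A.dom A) (A.cod A)" using incl_mor assms by simp
  then show "B.arr (J A)" "B.dom (J A) = A.dom A" "B.cod (J A) = A.cod A"
    using assms by (simp_all add: J_rep B.arr_cl B.dom_cl B.cod_cl)
qed

lemma J_cmp:
  assumes "A.arr A" "A.arr B" "A.dom B = A.cod A"
  shows "J (A.cmp B A) = B.cmp (J B) (J A)"
  using J_cl[OF mor_comp, of "A.rep A" "A.dom A" "A.cod A" "A.rep B" "A.cod B"] assms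
  by (simp add: A.cl_comp B.cl_comp J_rep)

lemma J_pls:
  assumes "A.arr A" "A.arr B" "A.dom B = A.dom A" "A.cod B = A.cod A"
  shows "J (A.pls A B) = B.pls (J A) (J B)"
  using J_cl[OF mor_add, of "A.rep A" "A.dom A" "A.cod A" "A.rep B"] assms
  by (simp add: A.cl_add B.cl_add J_rep)

lemma J_scl:
  assumes "A.arr A"
  shows "J (A.scl c A) = B.scl c (J A)"
  using J_cl[OF mor_scale, of "A.rep A" "A.dom A" "A.cod A"] assms
  by (simp add: A.cl_scale B.cl_scale J_rep)

lemma J_rw:
  assumes "A.arr A" "A.ob Z"
  shows "J (A.rw A Z) = B.rw (J A) Z"
  using J_cl[OF mor_tensor, of "A.rep A" "A.dom A" "A.cod A" "Ident Z" Z Z] assms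
  by (simp add: A.cl_rw B.cl_rw J_rep mor_id)

lemma J_idt [simp]: "A.ob X \<Longrightarrow> J (A.idt X) = B.idt X"
  using J_cl[OF mor_id] by (simp add: A.idt_def B.idt_def)

lemma J_zer [simp]: "A.ob X \<Longrightarrow> A.ob Y \<Longrightarrow> J (A.zer X Y) = B.zer X Y"
  using J_cl[OF mor_zero] by (simp add: A.zer_def B.zer_def)

end

section \<open>Unfolding of diagrams\<close>

fun is_black :: "'v letter \<Rightarrow> bool" where
  "is_black (Black i) = True"
| "is_black (Red \<theta>) = False"

primrec gsrc :: "'v generator \<Rightarrow> 'v letter list" where
  "gsrc (Dot i) = [Black i]"
| "gsrc (Cross a b) = [a, b]"
| "gsrc (Rho i) = [Black i]"

lemma KLRW_simps [simp]:
  "gens (KLRW Q) = KLRW_gens Q" "rels (KLRW Q) = KLRW_rels Q"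
  by (simp_all add: KLRW_def)

lemma KLRW_letters [simp]:
  "Black i \<in> gen_obj (KLRW Q) \<longleftrightarrow> i \<in> pverts Q"
  "Red \<theta> \<in> gen_obj (KLRW Q) \<longleftrightarrow> \<theta> \<in> dominant_weights Q"
  by (auto simp: KLRW_def letters_def)

type_synonym ('v, 'k) pres = "('v letter, 'v generator, 'k) presentation"

text \<open>The argument \<open>field_type\<close> fixes the base field inside the locale.\<close>

locale diagonal =
  fixes Q Qp :: "'v pair_pre_digraph" and \<tau> :: "'v \<Rightarrow> 'v" and field_type :: "'k::field itself"
  assumes diagonal: "diagonal_type Q \<tau> Qp"
begin

section \<open>Vertices and arrows of the doubled quiver\<close>

lemma tau_tau [simp]: "i \<in> pverts Q \<Longrightarrow> \<tau> (\<tau> i) = i"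
  using diagonal by (auto simp: diagonal_type_def)

lemma plus_in_Q [simp, intro]: "i \<in> pverts Qp \<Longrightarrow> i \<in> pverts Q"
  and tau_plus_in_Q [simp, intro]: "i \<in> pverts Qp \<Longrightarrow> \<tau> i \<in> pverts Q"
  and tau_plus_notin [simp]: "i \<in> pverts Qp \<Longrightarrow> \<tau> i \<notin> pverts Qp"
  using diagonal by (auto simp: diagonal_type_def)

lemma tau_minus_plus: "\<lbrakk>i \<in> pverts Q; i \<notin> pverts Qp\<rbrakk> \<Longrightarrow> \<tau> i \<in> pverts Qp"
  using diagonal by (auto simp: diagonal_type_def)

lemma tau_in_Q [simp]: "i \<in> pverts Q \<Longrightarrow> \<tau> i \<in> pverts Q"
  using tau_minus_plus by (cases "i \<in> pverts Qp") auto

lemma tau_plus_iff [simp]: "i \<in> pverts Q \<Longrightarrow> \<tau> i \<in> pverts Qp \<longleftrightarrow> i \<notin> pverts Qp"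
  using tau_minus_plus by (cases "i \<in> pverts Qp") auto

lemma tau_eq_iff: "\<lbrakk>i \<in> pverts Q; j \<in> pverts Q\<rbrakk> \<Longrightarrow> \<tau> i = \<tau> j \<longleftrightarrow> i = j"
  by (metis tau_tau)

text \<open>The halves have disjoint vertex sets, and arrows of \<open>Qp\<close> join vertices of
  \<open>Qp\<close>. Hence every arrow of \<open>Q\<close> stays within one half and comes from
  exactly one of the two sets in its definition.\<close>

lemma arcs_plus: "\<lbrakk>i \<in> pverts Qp; j \<in> pverts Qp\<rbrakk> \<Longrightarrow> (i, j) \<in> parcs Q \<longleftrightarrow> (i, j) \<in> parcs Qp"
  and arcs_minus: "\<lbrakk>i \<in> pverts Qp; j \<in> pverts Qp\<rbrakk> \<Longrightarrow> (\<tau> i, \<tau> j) \<in> parcs Q \<longleftrightarrow> (j, i) \<in> parcs Qp"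
  and arcs_mixed: "\<lbrakk>i \<in> pverts Qp; j \<in> pverts Qp\<rbrakk> \<Longrightarrow> (\<tau> i, j) \<notin> parcs Q \<and> (i, \<tau> j) \<notin> parcs Q"
proof -
  have arcs: "parcs Q = parcs Qp \<union> {(\<tau> j, \<tau> i) | i j. (i, j) \<in> parcs Qp}"
    and "pair_loopfree_digraph Qp"
    using diagonal by (auto simp: diagonal_type_def quiver_def)
  interpret pair_loopfree_digraph Qp by fact
  have wf: "i \<in> pverts Qp" "j \<in> pverts Qp" if "(i, j) \<in> parcs Qp" for i j
    using in_arcsD1[OF that] in_arcsD2[OF that] by auto
  show "(i, j) \<in> parcs Q \<longleftrightarrow> (i, j) \<in> parcs Qp" if "i \<in> pverts Qp" "j \<in> pverts Qp"
    unfolding arcs using that wf tau_plus_notin by auto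
  show "(\<tau> i, \<tau> j) \<in> parcs Q \<longleftrightarrow> (j, i) \<in> parcs Qp" if "i \<in> pverts Qp" "j \<in> pverts Qp"
  proof -
    have "l = i" "k = j" if "(k, l) \<in> parcs Qp" "\<tau> i = \<tau> l" "\<tau> j = \<tau> k" for k l
      using wf[OF that(1)] that(2,3) \<open>i \<in> pverts Qp\<close> \<open>j \<in> pverts Qp\<close> tau_eq_iff plus_in_Q by blast+
    moreover have "(\<tau> i, \<tau> j) \<notin> parcs Qp" using wf tau_plus_notin that by blast
    ultimately show ?thesis unfolding arcs by blast
  qed
  show "(\<tau> i, j) \<notin> parcs Q \<and> (i, \<tau> j) \<notin> parcs Q" if "i \<in> pverts Qp" "j \<in> pverts Qp"
  proof -
    have "(\<tau> i, j) \<notin> parcs Qp" "(i, \<tau> j) \<notin> parcs Qp" using that wf tau_plus_notin by blast+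
    then show ?thesis unfolding arcs using that wf tau_plus_notin by auto
  qed
qed

primrec gtgt :: "'v generator \<Rightarrow> 'v letter list" where
  "gtgt (Dot i) = [Black i]"
| "gtgt (Cross a b) = [b, a]"
| "gtgt (Rho i) = [Black (\<tau> i)]"

text \<open>\<open>mor\<close> is a relation, whereas the recursive definition of
  \<open>alpha\<close> has to compute the end words of subexpressions. On ill-typed expressions the
  values are meaningless.\<close>

primrec src :: "('v, 'k) diagram \<Rightarrow> 'v letter list" where
  "src (Gen g) = gsrc g"
| "src (Ident X) = X"
| "src (Zero X Y) = X"
| "src (Add e f) = src e"
| "src (Scale c e) = src e"
| "src (Comp g f) = src f"
| "src (Tensor e f) = src e @ src f"

primrec tgt :: "('v, 'k) diagram \<Rightarrow> 'v letter list" where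
  "tgt (Gen g) = gtgt g"
| "tgt (Ident X) = X"
| "tgt (Zero X Y) = Y"
| "tgt (Add e f) = tgt e"
| "tgt (Scale c e) = tgt e"
| "tgt (Comp g f) = tgt g"
| "tgt (Tensor e f) = tgt e @ tgt f"

text \<open>Since end words can be computed from the expression, they are unique. This supplies the
  instances of \<open>presented\<close> for the KLRW categories of both quivers and for the oKLRW
  category.\<close>

lemma mor_src_tgt:
  assumes "mor P H e X Y" "gens P \<subseteq> KLRW_gens Q" "H \<subseteq> oKLRW_gens Q \<tau>"
  shows "src e = X \<and> tgt e = Y"
  using assms
proof (induction rule: mor.induct)
  case (mor_gen g X Y H)
  then show ?case by (auto simp: oKLRW_gens_def elim!: KLRW_gens.cases)
qed auto

lemma dominant_mono: "dominant_weights Qp \<subseteq> dominant_weights Q"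
  by (auto simp: dominant_weights_def)

lemma KLRW_gens_mono: "KLRW_gens Qp \<subseteq> KLRW_gens Q"
  using dominant_mono by (auto elim!: KLRW_gens.cases intro: KLRW_gens.intros)

sublocale Kp: monoidal "KLRW Qp :: ('v, 'k) pres"
proof
  fix e :: "('v, 'k) diagram" and X Y X' Y'
  assume "mor (KLRW Qp) {} e X Y" "mor (KLRW Qp) {} e X' Y'"
  then show "X = X' \<and> Y = Y'" using KLRW_gens_mono mor_src_tgt[of "KLRW Qp" "{}" e] by (metis KLRW_simps(1) empty_subsetI)
qed

sublocale K: monoidal "KLRW Q :: ('v, 'k) pres"
proof
  fix e :: "('v, 'k) diagram" and X Y X' Y'
  assume "mor (KLRW Q) {} e X Y" "mor (KLRW Q) {} e X' Y'"
  then show "X = X' \<and> Y = Y'" using mor_src_tgt[of "KLRW Q" "{}" e] by (metis KLRW_simps(1) empty_subsetI order_refl)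
qed

sublocale O: presented "KLRW Q :: ('v, 'k) pres"
  "oKLRW_gens Q \<tau>" "oKLRW_rels Q \<tau>"
proof
  fix e :: "('v, 'k) diagram" and X Y X' Y'
  assume "mor (KLRW Q) (oKLRW_gens Q \<tau>) e X Y" "mor (KLRW Q) (oKLRW_gens Q \<tau>) e X' Y'"
  then show "X = X' \<and> Y = Y'"
    using mor_src_tgt[of "KLRW Q" "oKLRW_gens Q \<tau>" e] by (metis KLRW_simps(1) order_refl)
qed

notation Kp.cmp (infixl \<open>\<cdot>\<close> 66)
notation Kp.pls (infixl \<open>\<boxplus>\<close> 65)

section \<open>Straightened words and the unfolding of diagrams\<close>

definition minus :: "'v letter \<Rightarrow> bool"
  where "minus a \<longleftrightarrow> (\<exists>i\<in>pverts Qp. a = Black (\<tau> i))"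

fun flip :: "'v letter \<Rightarrow> 'v letter" where
  "flip (Black i) = Black (\<tau> i)"
| "flip (Red \<theta>) = Red \<theta>"

lemma minus_simps [simp]:
  "\<not> minus (Red \<theta>)"
  "i \<in> pverts Q \<Longrightarrow> minus (Black i) \<longleftrightarrow> i \<notin> pverts Qp"
  by (auto simp: minus_def) (metis tau_minus_plus tau_tau)

text \<open>The negative letters of \<open>Z\<close> are moved, one after the other, across \<open>M\<close> to the far left, where
  \<open>\<rho>\<close> makes them positive; this reverses their order.\<close>

definition lft where "lft Z = rev (map flip (filter minus Z))"
definition rgt where "rgt Z = filter (\<lambda>a. \<not> minus a) Z"
definition mv where "mv M Z = lft Z @ M @ rgt Z"

lemma lft_simps [simp]:
  "lft [] = []" "lft (a # Z) = (if minus a then lft Z @ [flip a] else lft Z)" "lft (Z @ W) = lft W @ lft Z"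
  and rgt_simps [simp]:
  "rgt [] = []" "rgt (a # Z) = (if minus a then rgt Z else a # rgt Z)" "rgt (Z @ W) = rgt Z @ rgt W"
  by (auto simp: lft_def rgt_def)

text \<open>Because \<open>lft\<close> reverses the order, the negative letters of \<open>W\<close>,
  which move later, end up further to the left. Straightening can therefore be done block by block,
  as the tensor product clause of \<open>alpha\<close> requires.\<close>

lemma mv_append: "mv M (Z @ W) = mv (mv M Z) W" and mv_Nil [simp]: "mv M [] = M"
  by (auto simp: mv_def)

text \<open>A red label of \<open>Q\<close> may involve vertices of \<open>Q_-\<close>, and the
  corresponding negative strands do not simply slide through it. The words over \<open>lam\<close>
  avoid such labels, but the congruence is generated over all words of \<open>Q\<close>.\<close>

definition good_letters :: "'v letter set"
  where "good_letters = Black ` pverts Q \<union> Red ` dominant_weights Qp"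

abbreviation good where "good X \<equiv> X \<in> lists good_letters"

lemma good_Cons [simp]:
  "Black i \<in> good_letters \<longleftrightarrow> i \<in> pverts Q"
  "Red \<theta> \<in> good_letters \<longleftrightarrow> \<theta> \<in> dominant_weights Qp"
  by (auto simp: good_letters_def)

lemma letter_in_simps [simp]:
  "\<lbrakk>a \<in> good_letters; minus a\<rbrakk> \<Longrightarrow> flip a \<in> gen_obj (KLRW Qp)"
  "\<lbrakk>a \<in> good_letters; \<not> minus a\<rbrakk> \<Longrightarrow> a \<in> gen_obj (KLRW Qp)"
  by (cases a; auto)+

lemma ob_lft [simp]: "good Z \<Longrightarrow> Kp.ob (lft Z)" and ob_rgt [simp]: "good Z \<Longrightarrow> Kp.ob (rgt Z)"
  by (induction Z) auto

lemma ob_mv [simp]: "\<lbrakk>Kp.ob M; good Z\<rbrakk> \<Longrightarrow> Kp.ob (mv M Z)"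
  by (simp add: mv_def)

abbreviation dotc where "dotc i \<equiv> Kp.cl (dot i)"
abbreviation crc where "crc a b \<equiv> Kp.cl (sigma a b)"

lemma arr_dotc [simp]:
  assumes "i \<in> pverts Qp"
  shows "Kp.arr (dotc i)" "Kp.dom (dotc i) = [Black i]" "Kp.cod (dotc i) = [Black i]"
  using Kp.arr_cl[OF mor_KLRW_gens(1)] Kp.dom_cl[OF mor_KLRW_gens(1)] Kp.cod_cl[OF mor_KLRW_gens(1)] assms
  by auto

lemma mor_cross:
  assumes "a \<in> gen_obj (KLRW Q' :: ('v, 'k) pres)" "b \<in> gen_obj (KLRW Q' :: ('v, 'k) pres)"
    "is_black a \<or> is_black b"
  shows "mor (KLRW Q' :: ('v, 'k) pres) H (sigma a b) [a, b] [b, a]"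
proof (cases a)
  case (Black i)
  then show ?thesis
    using assms by (cases b) (auto intro!: mor_KLRW_gens)
next
  case (Red \<theta>)
  then obtain j where "b = Black j" using assms by (cases b) auto
  then show ?thesis
    using Red assms by (auto intro!: mor_KLRW_gens)
qed

lemma arr_crc [simp]:
  assumes "a \<in> gen_obj (KLRW Qp :: ('v, 'k) pres)" "b \<in> gen_obj (KLRW Qp :: ('v, 'k) pres)"
    "is_black a \<or> is_black b"
  shows "Kp.arr (crc a b)" "Kp.dom (crc a b) = [a, b]" "Kp.cod (crc a b) = [b, a]"
  using Kp.arr_cl[OF mor_cross[OF assms]] Kp.dom_cl[OF mor_cross[OF assms]]
    Kp.cod_cl[OF mor_cross[OF assms]] by auto

lemma is_black_minus: "minus a \<Longrightarrow> is_black a" and is_black_flip [simp]: "is_black (flip a) = is_black a"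
  by (auto simp: minus_def) (cases a; simp)+

text \<open>Images of the generators next to a straightened word \<open>M\<close>. Negative strands
  end up to the left of \<open>M\<close>, in reversed order and with negated dots, positive ones to
  the right of \<open>M\<close>. Letters of different kinds are pulled apart, so their crossing
  disappears. \<open>Rho\<close> becomes an identity because it performs or undoes a step of the
  straightening.\<close>

primrec galpha :: "'v generator \<Rightarrow> 'v letter list \<Rightarrow> ('v, 'k) diagram set" where
  "galpha (Dot i) M = (if minus (Black i) then Kp.wh [] (Kp.scl (- 1) (dotc (\<tau> i))) M
     else Kp.wh M (dotc i) [])"
| "galpha (Cross a b) M = (if minus a \<and> minus b then Kp.wh [] (crc (flip b) (flip a)) M
     else if \<not> minus a \<and> \<not> minus b then Kp.wh M (crc a b) [] else Kp.idt (mv M [a, b]))"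
| "galpha (Rho i) M = Kp.idt (mv M [Black i])"

text \<open>A morphism between a good and a bad word is zero, but composites of such zero morphisms
  through bad words are well-formed, and \<open>alpha\<close> has to send them to zero.\<close>

primrec alpha :: "('v, 'k) diagram \<Rightarrow> 'v letter list \<Rightarrow> ('v, 'k) diagram set" where
  "alpha (Gen g) = galpha g"
| "alpha (Ident X) = (\<lambda>M. Kp.idt (mv M X))"
| "alpha (Zero X Y) = (\<lambda>M. Kp.zer (mv M X) (mv M Y))"
| "alpha (Add e f) = (\<lambda>M. alpha e M \<boxplus> alpha f M)"
| "alpha (Scale c e) = (\<lambda>M. Kp.scl c (alpha e M))"
| "alpha (Comp g f) = (\<lambda>M. if good (tgt f) then alpha g M \<cdot> alpha f M
     else Kp.zer (mv M (src f)) (mv M (tgt g)))"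
| "alpha (Tensor e f) = (\<lambda>M. alpha f (mv M (tgt e)) \<cdot> Kp.wh (lft (src f)) (alpha e M) (rgt (src f)))"

text \<open>\<open>Rho\<close> acts at the far left only: for non-empty \<open>M\<close> the words
  \<open>mv M [Black i]\<close> and \<open>mv M [Black (\<tau> i)]\<close> differ in general, and
  its image would not have the right target. In the presence of generators \<open>H\<close> the base
  is therefore empty.\<close>

definition base_ok where "base_ok H M \<longleftrightarrow> Kp.ob M \<and> (H = {} \<or> M = [])"

lemma base_ok_simps [simp]: "base_ok {} M \<longleftrightarrow> Kp.ob M" and base_ok_ob: "base_ok H M \<Longrightarrow> Kp.ob M"
  by (auto simp: base_ok_def)

text \<open>Only the end words are known to be good. For a bad word in the middle of a composite,
  the clause for \<open>Comp\<close> supplies a zero arrow of the right type.\<close>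

lemma alpha_arr:
  assumes "mor P H e X Y" "P = KLRW Q" "H \<subseteq> oKLRW_gens Q \<tau>" "good X" "good Y" "base_ok H M"
  shows "Kp.arr (alpha e M) \<and> Kp.dom (alpha e M) = mv M X \<and> Kp.cod (alpha e M) = mv M Y"
  using assms
proof (induction arbitrary: M rule: mor.induct)
  case (mor_gen g X Y H)
  have "Kp.ob M" using mor_gen base_ok_ob by blast
  have "(g, X, Y) \<in> KLRW_gens Q \<or> (g, X, Y) \<in> H" using mor_gen by simp
  then consider i where "g = Dot i" "X = [Black i]" "Y = [Black i]" "i \<in> pverts Q"
    | a b where "g = Cross a b" "X = [a, b]" "Y = [b, a]" "is_black a \<or> is_black b"
    | i where "g = Rho i" "X = [Black i]" "Y = [Black (\<tau> i)]" "i \<in> pverts Q" "M = []"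
  proof
    assume gH: "(g, X, Y) \<in> H"
    then obtain i where "g = Rho i" "X = [Black i]" "Y = [Black (\<tau> i)]" "i \<in> pverts Q"
      using mor_gen by (auto simp: oKLRW_gens_def)
    moreover have "M = []" using gH mor_gen by (auto simp: base_ok_def)
    ultimately show thesis by (rule that(3))
  next
    assume "(g, X, Y) \<in> KLRW_gens Q"
    then show thesis by cases (use that(1,2) in \<open>(simp; fail)+\<close>)
  qed
  then show ?case
  proof cases
    case 1
    then show ?thesis using \<open>Kp.ob M\<close> by (auto simp: mv_def)
  next
    case 2
    then have "a \<in> good_letters" "b \<in> good_letters" using mor_gen by auto
    then show ?thesis using 2 \<open>Kp.ob M\<close> is_black_minus by (simp add: mv_def)
  next
    case 3
    then show ?thesis by (auto simp: mv_def)
  qed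
next
  case (mor_comp H f X Y g Z)
  have "src f = X" "tgt f = Y" "tgt g = Z"
    using mor_src_tgt mor_comp by auto
  moreover have "Kp.ob M" using mor_comp base_ok_ob by blast
  ultimately show ?case using mor_comp by simp
next
  case (mor_tensor H e X Y f Z W)
  have "src f = Z" "tgt e = Y"
    using mor_src_tgt mor_tensor by auto
  moreover have "Kp.ob M" using mor_tensor base_ok_ob by blast
  then have "Kp.ob (mv M Y)" "Kp.ob M" using mor_tensor by simp_all
  ultimately show ?case using mor_tensor by (auto simp: mv_def)
next
  case (mor_id X H)
  then have "Kp.ob M" using base_ok_ob by blast
  then show ?case using mor_id by simp
next
  case (mor_zero X Y H)
  then have "Kp.ob M" using base_ok_ob by blast
  then show ?case using mor_zero by simp
qed auto

text \<open>The effect on \<open>x\<close> of tensoring with \<open>Z\<close> on the right: after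
  straightening, the strands of \<open>Z\<close> surround \<open>x\<close>, the flipped negative
  ones on its left and the others on its right.\<close>

definition wz where "wz Z x = Kp.wh (lft Z) x (rgt Z)"

lemma arr_wz [simp]:
  assumes "Kp.arr x" "good Z"
  shows "Kp.arr (wz Z x)" "Kp.dom (wz Z x) = mv (Kp.dom x) Z" "Kp.cod (wz Z x) = mv (Kp.cod x) Z"
  using assms by (simp_all add: wz_def mv_def)

lemma wz_cmp: "\<lbrakk>Kp.arr x; Kp.arr y; Kp.dom y = Kp.cod x; good Z\<rbrakk> \<Longrightarrow> wz Z (y \<cdot> x) = wz Z y \<cdot> wz Z x"
  by (simp add: wz_def Kp.wh_cmp)

lemma wz_append: "\<lbrakk>Kp.arr x; good Z; good W\<rbrakk> \<Longrightarrow> wz (Z @ W) x = wz W (wz Z x)"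
  by (simp add: wz_def)

lemma wz_idt [simp]: "\<lbrakk>Kp.ob M; good Z\<rbrakk> \<Longrightarrow> wz Z (Kp.idt M) = Kp.idt (mv M Z)"
  by (simp add: wz_def mv_def)

lemma wz_zer [simp]: "\<lbrakk>Kp.ob M; Kp.ob N; good Z\<rbrakk> \<Longrightarrow> wz Z (Kp.zer M N) = Kp.zer (mv M Z) (mv N Z)"
  by (simp add: wz_def mv_def)

lemma wz_Nil [simp]: "Kp.arr x \<Longrightarrow> wz [] x = x"
  by (simp add: wz_def)

lemma wz_pls: "\<lbrakk>Kp.arr x; Kp.arr y; Kp.dom y = Kp.dom x; Kp.cod y = Kp.cod x; good Z\<rbrakk>
    \<Longrightarrow> wz Z (x \<boxplus> y) = wz Z x \<boxplus> wz Z y"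
  and wz_scl: "\<lbrakk>Kp.arr x; good Z\<rbrakk> \<Longrightarrow> wz Z (Kp.scl c x) = Kp.scl c (wz Z x)"
  by (simp_all add: wz_def Kp.wh_pls Kp.wh_scl)

lemma alpha_tensor:
  assumes "mor (KLRW Q) H e X Y" "mor (KLRW Q) {} f Z W" "H \<subseteq> oKLRW_gens Q \<tau>"
  shows "alpha (e \<otimes>\<^sub>e f) M = alpha f (mv M Y) \<cdot> wz Z (alpha e M)"
  using mor_src_tgt[OF assms(1)] mor_src_tgt[OF assms(2)] assms(3) by (simp add: wz_def)

lemma alpha_comp:
  assumes "mor (KLRW Q) H f X Y" "mor (KLRW Q) H g Y Z" "H \<subseteq> oKLRW_gens Q \<tau>"
  shows "alpha (g \<circ>\<^sub>e f) M = (if good Y then alpha g M \<cdot> alpha f M else Kp.zer (mv M X) (mv M Z))"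
  using mor_src_tgt[OF assms(1)] mor_src_tgt[OF assms(2)] assms(3) by simp

text \<open>The image of \<open>e\<close> lives on the strands around the base and is thus disjoint
  from a diagram \<open>x\<close> on the base. For generators this is \<open>wh_interchange\<close>.
  In the tensor product case the induction hypothesis for the right factor is applied to
  \<open>x\<close> surrounded by the strands of the left one.\<close>

lemma alpha_natural:
  assumes "mor P H e X Y" "P = KLRW Q" "H = {}" "good X" "good Y" "Kp.arr x"
  shows "alpha e (Kp.cod x) \<cdot> wz X x = wz Y x \<cdot> alpha e (Kp.dom x)"
  using assms
proof (induction arbitrary: x rule: mor.induct)
  case (mor_gen g X Y H)
  have "(g, X, Y) \<in> KLRW_gens Q" using mor_gen by simp
  then consider i where "g = Dot i" "X = [Black i]" "Y = [Black i]" "i \<in> pverts Q"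
    | a b where "g = Cross a b" "X = [a, b]" "Y = [b, a]" "is_black a \<or> is_black b"
    by cases (use that(1,2) in \<open>(simp; fail)+\<close>)
  then show ?case
  proof cases
    case 1
    show ?thesis
    proof (cases "i \<in> pverts Qp")
      case True
      then show ?thesis
        using 1 mor_gen Kp.wh_interchange[of x "dotc i" "[]" "[]" "[]"] by (simp add: wz_def)
    next
      case False
      then show ?thesis
        using 1 mor_gen Kp.wh_interchange[of "Kp.scl (- 1) (dotc (\<tau> i))" x "[]" "[]" "[]"]
        by (simp add: wz_def)
    qed
  next
    case 2
    then have ab: "a \<in> good_letters" "b \<in> good_letters" using mor_gen by auto
    consider "minus a \<and> minus b" | "\<not> minus a \<and> \<not> minus b" | "minus a \<noteq> minus b" by blast
    then show ?thesis
    proof cases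
      case 1
      then show ?thesis using 2 ab mor_gen is_black_minus
          Kp.wh_interchange[of "crc (flip b) (flip a)" x "[]" "[]" "[]"] by (simp add: wz_def)
    next
      case 2
      then show ?thesis using \<open>g = _\<close> \<open>X = _\<close> \<open>Y = _\<close> \<open>is_black a \<or> _\<close> ab mor_gen
          Kp.wh_interchange[of x "crc a b" "[]" "[]" "[]"] by (simp add: wz_def)
    next
      case 3
      then show ?thesis using \<open>g = _\<close> \<open>X = _\<close> \<open>Y = _\<close> ab mor_gen by (auto simp: wz_def mv_def)
    qed
  qed
next
  case (mor_comp H f X Y g Z)
  have f: "mor (KLRW Q) {} f X Y" and g: "mor (KLRW Q) {} g Y Z" using mor_comp by auto
  have x: "Kp.ob (Kp.dom x)" "Kp.ob (Kp.cod x)" using mor_comp by auto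
  show ?case
  proof (cases "good Y")
    case True
    have "alpha (g \<circ>\<^sub>e f) (Kp.cod x) \<cdot> wz X x = alpha g (Kp.cod x) \<cdot> (alpha f (Kp.cod x) \<cdot> wz X x)"
      using True by (simp add: alpha_comp[OF f g] Kp.cmp_assoc del: alpha.simps)
    also have "\<dots> = (alpha g (Kp.cod x) \<cdot> wz Y x) \<cdot> alpha f (Kp.dom x)"
      using mor_comp.IH(1)[of x] mor_comp.prems True by (simp add: Kp.cmp_assoc)
    also have "\<dots> = wz Z x \<cdot> alpha g (Kp.dom x) \<cdot> alpha f (Kp.dom x)"
      using mor_comp True by simp
    finally show ?thesis using True by (simp add: alpha_comp[OF f g] Kp.cmp_assoc del: alpha.simps)
  next
    case False
    then show ?thesis using mor_comp x by (simp add: alpha_comp[OF f g] del: alpha.simps)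
  qed
next
  case (mor_tensor H e X Y f Z W)
  have good: "good X" "good Z" "good Y" "good W" using mor_tensor by auto
  have e: "mor (KLRW Q) {} e X Y" and f: "mor (KLRW Q) {} f Z W" using mor_tensor by auto
  have x: "Kp.ob (Kp.dom x)" "Kp.ob (Kp.cod x)" using mor_tensor by auto
  note ty = alpha_arr[OF e HOL.refl _ good(1,3), simplified]
    alpha_arr[OF f HOL.refl _ good(2,4), simplified]
  have "alpha (e \<otimes>\<^sub>e f) (Kp.cod x) \<cdot> wz (X @ Z) x
    = alpha f (mv (Kp.cod x) Y) \<cdot> wz Z (alpha e (Kp.cod x) \<cdot> wz X x)"
    using mor_tensor.prems good ty x
    by (simp add: alpha_tensor[OF e f] wz_append wz_cmp Kp.cmp_assoc del: alpha.simps)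
  also have "\<dots> = alpha f (mv (Kp.cod x) Y) \<cdot> wz Z (wz Y x \<cdot> alpha e (Kp.dom x))"
    using mor_tensor good by simp
  also have "\<dots> = (alpha f (mv (Kp.cod x) Y) \<cdot> wz Z (wz Y x)) \<cdot> wz Z (alpha e (Kp.dom x))"
    using mor_tensor.prems good ty x by (simp add: wz_cmp Kp.cmp_assoc)
  also have "\<dots> = (wz W (wz Y x) \<cdot> alpha f (mv (Kp.dom x) Y)) \<cdot> wz Z (alpha e (Kp.dom x))"
    using mor_tensor(4)[of "wz Y x"] mor_tensor good by simp
  finally show ?case
    using mor_tensor.prems good
    by (simp add: alpha_tensor[OF e f] wz_append Kp.cmp_assoc del: alpha.simps)
next
  case (mor_add H e X Y f)
  have e: "mor (KLRW Q) {} e X Y" and f: "mor (KLRW Q) {} f X Y" using mor_add by auto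
  have x: "Kp.ob (Kp.dom x)" "Kp.ob (Kp.cod x)" using mor_add by auto
  note ty = alpha_arr[OF e HOL.refl _ \<open>good X\<close> \<open>good Y\<close>, simplified]
    alpha_arr[OF f HOL.refl _ \<open>good X\<close> \<open>good Y\<close>, simplified]
  show ?case using mor_add ty x by (simp add: Kp.cmp_pls_left Kp.cmp_pls_right)
next
  case (mor_scale H e X Y c)
  have e: "mor (KLRW Q) {} e X Y" using mor_scale by auto
  have x: "Kp.ob (Kp.dom x)" "Kp.ob (Kp.cod x)" using mor_scale by auto
  note ty = alpha_arr[OF e HOL.refl _ \<open>good X\<close> \<open>good Y\<close>, simplified]
  show ?case using mor_scale ty x by (simp add: Kp.cmp_scl_left Kp.cmp_scl_right)
qed simp_all

section \<open>Compatibility of unfolding with the relations\<close>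

lemma plus_simps:
  "a \<in> gen_obj (KLRW Qp) \<Longrightarrow> \<not> minus a"
  "a \<in> gen_obj (KLRW Qp) \<Longrightarrow> a \<in> good_letters"
  by (cases a; simp)+

lemma plus_word [simp]:
  assumes "Kp.ob Z" shows "lft Z = []" "rgt Z = Z" "mv M Z = M @ Z" "good Z"
proof -
  have "lft Z = [] \<and> rgt Z = Z \<and> good Z"
    using assms by (induction Z) (simp_all add: plus_simps del: letter_in_simps)
  then show "lft Z = []" "rgt Z = Z" "mv M Z = M @ Z" "good Z" by (simp_all add: mv_def)
qed

text \<open>No strand moves when all letters are positive. Consequently \<open>alpha\<close>
  respects the relations of \<open>Qp\<close> without calculation, and on the empty base it is the
  identity on diagrams over \<open>Q_+\<close>.\<close>

lemma alpha_plus: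
  assumes "mor P H e X Y" "P = KLRW Qp" "H = {}" "Kp.ob M"
  shows "alpha e M = Kp.wh M (Kp.cl e) []"
  using assms
proof (induction arbitrary: M rule: mor.induct)
  case (mor_gen g X Y H)
  then have "(g, X, Y) \<in> KLRW_gens Qp" "Kp.ob X" by auto
  then show ?case by cases (use mor_gen in \<open>simp_all\<close>)
next
  case (mor_comp H f X Y g Z)
  have "src f = X" "tgt f = Y" "tgt g = Z"
    using mor_src_tgt[OF mor_comp(1)] mor_src_tgt[OF mor_comp(2)] mor_comp KLRW_gens_mono by auto
  moreover have "Kp.ob Y" using mor_lists mor_comp by blast
  moreover have "Kp.arr (Kp.cl f)" "Kp.cod (Kp.cl f) = Y" "Kp.arr (Kp.cl g)" "Kp.dom (Kp.cl g) = Y"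
    using mor_comp Kp.arr_cl Kp.dom_cl Kp.cod_cl by metis+
  ultimately show ?case using mor_comp by (simp add: Kp.cl_comp Kp.wh_cmp)
next
  case (mor_tensor H e X Y f Z W)
  have [simp]: "src f = Z" "tgt e = Y"
    using mor_src_tgt[OF mor_tensor(1)] mor_src_tgt[OF mor_tensor(2)] mor_tensor KLRW_gens_mono by auto
  have [simp]: "Kp.ob Y" "Kp.ob Z" using mor_lists mor_tensor by blast+
  have [simp]: "Kp.arr (Kp.cl f)" "Kp.dom (Kp.cl f) = Z" "Kp.arr (Kp.cl e)" "Kp.cod (Kp.cl e) = Y"
    using mor_tensor Kp.arr_cl Kp.dom_cl Kp.cod_cl by metis+
  have "alpha (e \<otimes>\<^sub>e f) M = Kp.wh (M @ Y) (Kp.cl f) [] \<cdot> Kp.wh M (Kp.cl e) Z"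
    using mor_tensor by simp
  also have "\<dots> = Kp.wh M (Kp.cl (e \<otimes>\<^sub>e f)) []"
    using mor_tensor Kp.tensor_interchange(1)[of e X Y f Z W] by (simp add: Kp.wh_cmp)
  finally show ?case .
next
  case (mor_add H e X Y f)
  have "Kp.arr (Kp.cl f)" "Kp.dom (Kp.cl f) = X" "Kp.cod (Kp.cl f) = Y"
    "Kp.arr (Kp.cl e)" "Kp.dom (Kp.cl e) = X" "Kp.cod (Kp.cl e) = Y"
    using mor_add Kp.arr_cl Kp.dom_cl Kp.cod_cl by metis+
  then show ?case using mor_add by (simp add: Kp.cl_add Kp.wh_pls)
next
  case (mor_scale H e X Y c)
  then have "Kp.arr (Kp.cl e)" using Kp.arr_cl by blast
  then show ?case using mor_scale by (simp add: Kp.cl_scale Kp.wh_scl)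
next
  case (mor_id X H)
  then show ?case by (simp add: Kp.idt_def[symmetric])
next
  case (mor_zero X Y H)
  then show ?case by (simp add: Kp.zer_def[symmetric])
qed

text \<open>All labels of a relation occur in its source word. The polynomials depend only on the
  arrows between these labels, and between positive vertices \<open>Q\<close> has the same arrows as
  \<open>Qp\<close>.\<close>

lemma KLRW_rels_plus:
  fixes e f :: "('v, 'k) diagram"
  assumes "(e, f) \<in> KLRW_rels Q" "mor (KLRW Q) {} e X Y" "Kp.ob X"
  shows "(e, f) \<in> KLRW_rels Qp"
proof -
  have X: "Kp.ob (src e)"
    using mor_src_tgt[OF assms(2)] assms(3) by auto
  have f2: "f2 Q i j = (f2 Qp i j :: 'k poly poly)" "f3_quotient Q i j = (f3_quotient Qp i j :: 'k poly poly poly)"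
    if "i \<in> pverts Qp" "j \<in> pverts Qp" for i j
    using that by (simp_all add: f2_def f3_quotient_def f_poly_def X_poly_def arcs_plus)
  from assms(1) show ?thesis
  proof cases
    case (dot_cross_left i j a b)
    show ?thesis unfolding dot_cross_left(1,2)
      by (rule KLRW_rels.dot_cross_left) (use X dot_cross_left in \<open>simp_all add: Diff_def\<close>)
  next
    case (dot_cross_right i j a b)
    show ?thesis unfolding dot_cross_right(1,2)
      by (rule KLRW_rels.dot_cross_right) (use X dot_cross_right in \<open>simp_all add: Diff_def\<close>)
  next
    case (cross_square i a)
    show ?thesis unfolding cross_square(1,2)
      by (rule KLRW_rels.cross_square) (use X cross_square in \<open>simp_all add: Diff_def\<close>)
  next
    case (cross_cross i j a b)
    have ij: "i \<in> pverts Qp" "j \<in> pverts Qp" using X cross_cross by (simp_all add: Diff_def)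
    show ?thesis unfolding cross_cross(1,2) f2(1)[OF ij]
      by (rule KLRW_rels.cross_cross) (use X cross_cross in \<open>simp_all add: Diff_def\<close>)
  next
    case (braid i j k a b c)
    have ij: "i \<in> pverts Qp" "j \<in> pverts Qp" using X braid by (simp_all add: Diff_def)
    show ?thesis unfolding braid(1,2) f2(2)[OF ij]
      by (rule KLRW_rels.braid) (use X braid in \<open>simp_all add: Diff_def\<close>)
  next
    case (braid_red_middle i j \<theta> a b t)
    show ?thesis unfolding braid_red_middle(1,2)
      by (rule KLRW_rels.braid_red_middle) (use X braid_red_middle in \<open>simp_all add: Diff_def\<close>)
  next
    case (braid_red_right i j \<theta> a b t)
    show ?thesis unfolding braid_red_right(1,2)
      by (rule KLRW_rels.braid_red_right) (use X braid_red_right in \<open>simp_all add: Diff_def\<close>)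
  next
    case (braid_red_left i j \<theta> a b t)
    show ?thesis unfolding braid_red_left(1,2)
      by (rule KLRW_rels.braid_red_left) (use X braid_red_left in \<open>simp_all add: Diff_def\<close>)
  next
    case (dot_red_left i \<theta> a t)
    show ?thesis unfolding dot_red_left(1,2)
      by (rule KLRW_rels.dot_red_left) (use X dot_red_left in \<open>simp_all add: Diff_def\<close>)
  next
    case (dot_red_right i \<theta> a t)
    show ?thesis unfolding dot_red_right(1,2)
      by (rule KLRW_rels.dot_red_right) (use X dot_red_right in \<open>simp_all add: Diff_def\<close>)
  next
    case (red_cross_left i \<theta> a t)
    show ?thesis unfolding red_cross_left(1,2)
      by (rule KLRW_rels.red_cross_left) (use X red_cross_left in \<open>simp_all add: Diff_def\<close>)
  next
    case (red_cross_right i \<theta> a t)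
    show ?thesis unfolding red_cross_right(1,2)
      by (rule KLRW_rels.red_cross_right) (use X red_cross_right in \<open>simp_all add: Diff_def\<close>)
  qed
qed

lemma rel_Qp:
  assumes "(e, f) \<in> KLRW_rels Qp" "Kp.ob M"
  shows "alpha e M = alpha f M"
proof -
  obtain X Y where m: "mor (KLRW Qp) {} e X Y" "mor (KLRW Qp) {} f X Y"
    using KLRW_rels_typed[OF assms(1)] by blast
  have "eqv (KLRW Qp) {} {} X Y e f" by (rule eqv.rel) (use assms m in auto)
  then show ?thesis
    using alpha_plus[OF m(1)] alpha_plus[OF m(2)] assms Kp.cl_eqI by simp
qed

lemma lookup_minus [simp]: "\<lbrakk>\<theta> \<in> dominant_weights Qp; i \<notin> pverts Qp\<rbrakk> \<Longrightarrow> Poly_Mapping.lookup \<theta> i = 0"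
  by (auto simp: dominant_weights_def in_keys_iff subset_iff)

text \<open>At most one of two opposite arrows exists, so the polynomial is a difference of the two
  variables or the constant \<open>1\<close>; the nested evaluation then unfolds by
  calculation.\<close>

lemma alpha_f2:
  assumes "quiver Q'" "Kp.ob (mv M X)" "good X" "good (tgt y)" "good (tgt z)"
    "Kp.arr (alpha y M)" "Kp.dom (alpha y M) = mv M X" "Kp.cod (alpha y M) = mv M X"
    "Kp.arr (alpha z M)" "Kp.dom (alpha z M) = mv M X" "Kp.cod (alpha z M) = mv M X"
  shows "alpha (poly_subst2 X y z (f2 Q' i j)) M =
    (if (j, i) \<in> parcs Q' then alpha y M \<boxplus> Kp.scl (- 1) (alpha z M)
     else if (i, j) \<in> parcs Q' then alpha z M \<boxplus> Kp.scl (- 1) (alpha y M)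
     else Kp.idt (mv M X))"
proof -
  have "\<not> ((i, j) \<in> parcs Q' \<and> (j, i) \<in> parcs Q')"
    using assms(1) unfolding quiver_def by blast
  then show ?thesis
    using assms(2-)
    by (cases "(i, j) \<in> parcs Q'"; cases "(j, i) \<in> parcs Q'")
      (simp_all add: f2_def f_poly_def X_poly_def poly_subst2_def poly_subst_def
        Kp.cmp_pls_right Kp.cmp_pls_left Kp.cmp_scl_left Kp.cmp_scl_right Kp.pls_commute)
qed

lemma minus_one_poly: "[:- 1:] = (- 1 :: 'a::comm_ring_1 poly)"
  by (simp add: one_pCons)

text \<open>In its first variable \<open>f_poly\<close> is affine with slope \<open>1\<close>,
  \<open>-1\<close> or \<open>0\<close>, so the numerator is this slope times
  \<open>Y\<^sub>3 - Y\<^sub>1\<close>. The non-zero factor is cancelled in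
  \<open>braid_quotient\<close>.\<close>

lemma f3_quotient_eq:
  assumes "quiver Q'"
  shows "f3_quotient Q' i j = (if (j, i) \<in> parcs Q' then 1 else if (i, j) \<in> parcs Q' then - 1 else
    (0 :: 'k poly poly poly))"
proof -
  have "\<not> ((i, j) \<in> parcs Q' \<and> (j, i) \<in> parcs Q')"
    using assms(1) unfolding quiver_def by blast
  moreover have "[:0, 1:] - [:[:[:0, 1:]:]:] \<noteq> (0 :: 'k poly poly poly)" by simp
  ultimately have "f3_quotient Q' i j * ([:0, 1:] - [:[:[:0, 1:]:]:]) =
    (if (j, i) \<in> parcs Q' then 1 else if (i, j) \<in> parcs Q' then - 1 else (0 :: 'k poly poly poly)) *
      ([:0, 1:] - [:[:[:0, 1:]:]:])"
    using braid_quotient[OF assms, of i j, where 'k = 'k]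
    by (auto simp: f_poly_def X_poly_def minus_one_poly)
  then show ?thesis
    using \<open>[:0, 1:] - _ \<noteq> 0\<close> mult_right_cancel by blast
qed

lemma alpha_poly_subst_const:
  assumes "Kp.arr (alpha (h c) M)" "Kp.dom (alpha (h c) M) = mv M X" "Kp.cod (alpha (h c) M) = mv M X"
    "good X"
  shows "alpha (poly_subst X h y [:c:]) M = alpha (h c) M"
  using assms by (simp add: poly_subst_def)

lemma alpha_f3:
  assumes "quiver Q'" "Kp.ob (mv M X)" "good X"
  shows "alpha (poly_subst3 X y\<^sub>1 y\<^sub>2 y\<^sub>3 (f3_quotient Q' i j)) M =
    (if (j, i) \<in> parcs Q' then Kp.idt (mv M X)
     else if (i, j) \<in> parcs Q' then Kp.scl (- 1) (Kp.idt (mv M X))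
     else Kp.zer (mv M X) (mv M X))"
proof -
  have "alpha (poly_subst3 X y\<^sub>1 y\<^sub>2 y\<^sub>3 [:[:[:c:]:]:]) M = Kp.scl c (Kp.idt (mv M X))" for c
    using assms(2,3) by (simp add: alpha_poly_subst_const poly_subst3_def poly_subst2_def)
  from this[of 0] this[of 1] this[of "- 1"] show ?thesis
    using assms(2) by (simp add: f3_quotient_eq[OF assms(1)] minus_one_poly pCons_one)
qed

lemma Kp_neg:
  assumes "Kp.arr A" shows "A \<boxplus> Kp.scl (- 1) A = Kp.zer (Kp.dom A) (Kp.cod A)"
    "Kp.scl (- 1) A \<boxplus> A = Kp.zer (Kp.dom A) (Kp.cod A)"
  using Kp.scl_add[OF assms, of 1 "- 1"] Kp.scl_add[OF assms, of "- 1" 1] assms by simp_all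

text \<open>Under reflection the two terms that carry a dot change their sign, while the correction
  term \<open>D\<close> does not. This rearrangement gives the relation the required shape.\<close>

lemma Kp_neg_eq:
  assumes "A = B \<boxplus> D" "Kp.arr B" "Kp.arr D" "Kp.dom D = Kp.dom B" "Kp.cod D = Kp.cod B"
  shows "Kp.scl (- 1) B = Kp.scl (- 1) A \<boxplus> D"
  using assms by (simp add: Kp.scl_pls Kp.pls_assoc Kp_neg)

lemma Kp_diff_swap:
  assumes "Kp.arr A" "Kp.arr B" "Kp.dom A = Kp.dom B" "Kp.cod A = Kp.cod B"
  shows "A \<boxplus> Kp.scl (- 1) B = Kp.scl (- 1) (B \<boxplus> Kp.scl (- 1) A)"
  using assms by (simp add: Kp.scl_pls Kp.pls_commute)

lemma quiver_Q: "quiver Q" and quiver_Qp: "quiver Qp"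
  using diagonal diagonal_type_quiver[OF diagonal] by (simp_all add: diagonal_type_def)

lemma arcs_Q_mixed: "\<lbrakk>i \<in> pverts Q; j \<in> pverts Q; (i \<in> pverts Qp) \<noteq> (j \<in> pverts Qp)\<rbrakk> \<Longrightarrow> (i, j) \<notin> parcs Q"
  using arcs_mixed[of i "\<tau> j"] arcs_mixed[of "\<tau> i" j] by auto

lemma arcs_Q_minus: "\<lbrakk>i \<in> pverts Q; j \<in> pverts Q; i \<notin> pverts Qp; j \<notin> pverts Qp\<rbrakk>
    \<Longrightarrow> (\<tau> i, \<tau> j) \<in> parcs Qp \<longleftrightarrow> (j, i) \<in> parcs Q"
  using arcs_minus[of "\<tau> j" "\<tau> i"] by simp

text \<open>The straightened negative strands lie to the left of the base \<open>M\<close>.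
  Relations among them are obtained from relations over \<open>Qp\<close> on the empty base,
  whiskered by \<open>M\<close> on the right.\<close>

lemma rel_minus:
  assumes "(e, f) \<in> KLRW_rels Qp" "Kp.ob M"
  shows "Kp.wh [] (alpha e []) M = Kp.wh [] (alpha f []) M"
  using rel_Qp[OF assms(1), of "[]"] by simp

lemmas wh_simps = Kp.wh_cmp Kp.wh_pls Kp.wh_scl Kp.cmp_scl_left Kp.cmp_scl_right Kp.scl_pls

text \<open>Reflection in a vertical line exchanges the two relations between a dot and a crossing.
  For equal labels the identity term keeps its sign although the dots are negated; solving for the
  other dotted term repairs this.\<close>

lemma alpha_dot_cross_left:
  assumes "i \<in> pverts Q" "j \<in> pverts Q" "i \<notin> pverts Qp" "j \<notin> pverts Qp" "a = Black i" "b = Black j" "Kp.ob M"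
  shows "alpha (dot j \<otimes>\<^sub>e strand a \<circ>\<^sub>e sigma a b) M =
      alpha (Add (sigma a b \<circ>\<^sub>e strand a \<otimes>\<^sub>e dot j) (delta (i = j) [a, b] [b, a] (Ident [a, b]))) M"
proof -
  let ?i = "\<tau> i" and ?j = "\<tau> j"
  note R = rel_minus[OF KLRW_rels.dot_cross_right[of ?j Qp ?i "Black ?j" "Black ?i"], of M]
  let ?X = "Kp.wh [] (crc (Black ?j) (Black ?i)) M"
  note N = Kp_neg_eq[of "?X \<cdot> Kp.wh [] (dotc ?j) (Black ?i # M)"
      "Kp.wh [Black ?i] (dotc ?j) M \<cdot> ?X" "Kp.idt (Black ?i # Black ?j # M)"]
  show ?thesis
  proof (cases "i = j")
    case True
    then show ?thesis using R N assms by (simp add: delta_def mv_def wh_simps)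
  next
    case False
    then show ?thesis using R assms by (simp add: delta_def mv_def wh_simps tau_eq_iff)
  qed
qed

lemma alpha_dot_cross_right:
  assumes "i \<in> pverts Q" "j \<in> pverts Q" "i \<notin> pverts Qp" "j \<notin> pverts Qp" "a = Black i" "b = Black j" "Kp.ob M"
  shows "alpha (sigma a b \<circ>\<^sub>e dot i \<otimes>\<^sub>e strand b) M =
      alpha (Add (strand b \<otimes>\<^sub>e dot i \<circ>\<^sub>e sigma a b) (delta (i = j) [a, b] [b, a] (Ident [a, b]))) M"
proof -
  let ?i = "\<tau> i" and ?j = "\<tau> j"
  note R = rel_minus[OF KLRW_rels.dot_cross_left[of ?j Qp ?i "Black ?j" "Black ?i"], of M]
  let ?X = "Kp.wh [] (crc (Black ?j) (Black ?i)) M"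
  note N = Kp_neg_eq[of "Kp.wh [] (dotc ?i) (Black ?j # M) \<cdot> ?X"
      "?X \<cdot> Kp.wh [Black ?j] (dotc ?i) M" "Kp.idt (Black ?i # Black ?j # M)"]
  show ?thesis
  proof (cases "i = j")
    case True
    then show ?thesis using R N assms by (simp add: delta_def mv_def wh_simps)
  next
    case False
    then show ?thesis using R assms by (simp add: delta_def mv_def wh_simps tau_eq_iff)
  qed
qed

text \<open>Here the orientation of \<open>Q_-\<close> matters. Reflection replaces the labels
  \<open>i, j\<close> by \<open>\<tau> j, \<tau> i\<close> and the variables \<open>u, v\<close> by
  \<open>- v, - u\<close>. The difference \<open>u - v\<close> is unchanged, and an arrow from
  \<open>j\<close> to \<open>i\<close> corresponds to one from \<open>\<tau> i\<close> to
  \<open>\<tau> j\<close>, which is the direction that \<open>f_poly\<close> asks for.\<close>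

lemma alpha_cross_cross:
  assumes "i \<in> pverts Q" "j \<in> pverts Q" "i \<noteq> j" "i \<notin> pverts Qp" "j \<notin> pverts Qp" "a = Black i" "b = Black j" "Kp.ob M"
  shows "alpha (sigma b a \<circ>\<^sub>e sigma a b) M =
    alpha (poly_subst2 [a, b] (dot i \<otimes>\<^sub>e strand b) (strand a \<otimes>\<^sub>e dot j) (f2 Q i j)) M"
proof -
  let ?i = "\<tau> i" and ?j = "\<tau> j"
  note R = rel_minus[OF KLRW_rels.cross_cross[of ?j Qp ?i "Black ?j" "Black ?i"], of M]
  show ?thesis
    using R assms
    by (cases "(i, j) \<in> parcs Q"; cases "(j, i) \<in> parcs Q")
      (simp_all add: mv_def wh_simps tau_eq_iff alpha_f2[OF quiver_Q] alpha_f2[OF quiver_Qp]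
        arcs_Q_minus Kp.pls_commute)
qed

text \<open>Reflection exchanges the two sides of the braid relation, so their difference changes
  sign. If there is an arrow, the quotient on the right-hand side is \<open>1\<close> or
  \<open>-1\<close> according to its direction, and for the reversed arrow it changes sign
  too.\<close>

lemma alpha_braid:
  assumes "i \<in> pverts Q" "j \<in> pverts Q" "k \<in> pverts Q" "i \<notin> pverts Qp" "j \<notin> pverts Qp" "k \<notin> pverts Qp"
    "a = Black i" "b = Black j" "c = Black k" "Kp.ob M"
  shows "alpha (Diff
         (sigma b c \<otimes>\<^sub>e strand a \<circ>\<^sub>e strand b \<otimes>\<^sub>e sigma a c \<circ>\<^sub>e sigma a b \<otimes>\<^sub>e strand c)
         (strand c \<otimes>\<^sub>e sigma a b \<circ>\<^sub>e sigma a c \<otimes>\<^sub>e strand b \<circ>\<^sub>e strand a \<otimes>\<^sub>e sigma b c)) M =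
       alpha (delta (i = k \<and> k \<noteq> j) [a, b, c] [c, b, a]
         (poly_subst3 [a, b, c]
            (dot i \<otimes>\<^sub>e Ident [b, c]) (strand a \<otimes>\<^sub>e dot j \<otimes>\<^sub>e strand c) (Ident [a, b] \<otimes>\<^sub>e dot k)
            (f3_quotient Q i j))) M"
proof -
  let ?i = "\<tau> i" and ?j = "\<tau> j" and ?k = "\<tau> k"
  let ?A = "Kp.wh [Black ?i] (crc (Black ?k) (Black ?j)) M \<cdot>
    (Kp.wh [] (crc (Black ?k) (Black ?i)) (Black ?j # M) \<cdot> Kp.wh [Black ?k] (crc (Black ?j) (Black ?i)) M)"
  let ?B = "Kp.wh [] (crc (Black ?j) (Black ?i)) (Black ?k # M) \<cdot>
    (Kp.wh [Black ?j] (crc (Black ?k) (Black ?i)) M \<cdot> Kp.wh [] (crc (Black ?k) (Black ?j)) (Black ?i # M))"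
  let ?R = "alpha (delta (?k = ?i \<and> ?i \<noteq> ?j) [Black ?k, Black ?j, Black ?i] [Black ?i, Black ?j, Black ?k]
         (poly_subst3 [Black ?k, Black ?j, Black ?i]
            (dot ?k \<otimes>\<^sub>e Ident [Black ?j, Black ?i]) (strand (Black ?k) \<otimes>\<^sub>e dot ?j \<otimes>\<^sub>e strand (Black ?i))
            (Ident [Black ?k, Black ?j] \<otimes>\<^sub>e dot ?i) (f3_quotient Qp ?k ?j))) []"
  have assms': "?k \<in> pverts Qp" "?j \<in> pverts Qp" "?i \<in> pverts Qp" "Kp.ob M" using assms by simp_all
  have 1: "?B \<boxplus> Kp.scl (- 1) ?A = Kp.wh [] ?R M"
    unfolding rel_minus[OF KLRW_rels.braid[OF assms'(1,2,3) HOL.refl HOL.refl HOL.refl] assms'(4), symmetric]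
    using assms by (simp add: mv_def Kp.wh_cmp Kp.wh_pls Kp.wh_scl Diff_def Kp.cmp_assoc)
  have "?A \<boxplus> Kp.scl (- 1) ?B = Kp.scl (- 1) (?B \<boxplus> Kp.scl (- 1) ?A)"
    by (rule Kp_diff_swap) (use assms in simp_all)
  also have "\<dots> = Kp.scl (- 1) (Kp.wh [] ?R M)" unfolding 1 ..
  also have "\<dots> = alpha (delta (i = k \<and> k \<noteq> j) [a, b, c] [c, b, a]
         (poly_subst3 [a, b, c]
            (dot i \<otimes>\<^sub>e Ident [b, c]) (strand a \<otimes>\<^sub>e dot j \<otimes>\<^sub>e strand c) (Ident [a, b] \<otimes>\<^sub>e dot k)
            (f3_quotient Q i j))) M"
  proof (cases "i = k \<and> k \<noteq> j")
    case True
    then have "\<tau> k = \<tau> i \<and> \<tau> i \<noteq> \<tau> j" using assms by (simp add: tau_eq_iff)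
    moreover have "\<not> ((i, j) \<in> parcs Q \<and> (j, i) \<in> parcs Q)"
      using quiver_Q unfolding quiver_def by blast
    ultimately show ?thesis using assms True
      by (auto simp: delta_def alpha_f3[OF quiver_Q] alpha_f3[OF quiver_Qp] arcs_Q_minus mv_def Kp.wh_scl)
  next
    case False
    then have "\<not> (\<tau> k = \<tau> i \<and> \<tau> i \<noteq> \<tau> j)" using assms by (auto simp: tau_eq_iff)
    then have "?R = Kp.zer [Black ?k, Black ?j, Black ?i] [Black ?i, Black ?j, Black ?k]"
      using assms by (simp only: delta_def if_False alpha.simps) (simp add: mv_def)
    moreover have "delta (i = k \<and> k \<noteq> j) [a, b, c] [c, b, a] e = Zero [a, b, c] [c, b, a]"
      for e :: "('v, 'k) diagram" using False by (simp only: delta_def if_False)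
    ultimately show ?thesis using assms by (simp add: mv_def)
  qed
  finally show ?thesis
    using assms by (simp add: mv_def Diff_def Kp.cmp_assoc)
qed

text \<open>A relation among positive and red strands belongs to \<open>Qp\<close>, and one among
  negative strands only is a reflection of a relation of \<open>Qp\<close>. When a negative strand
  meets a positive or a red one, their crossing becomes an identity, and the corrections between
  them vanish: the labels differ, no arrow joins the halves, and weights of \<open>Q_+\<close> are
  zero on \<open>Q_-\<close>.\<close>

lemma alpha_rel:
  assumes "(e, f) \<in> KLRW_rels Q" "mor (KLRW Q) {} e X Y" "good X" "good Y" "Kp.ob M"
  shows "alpha e M = alpha f M"
proof (cases "Kp.ob X")
  case True
  then show ?thesis using rel_Qp KLRW_rels_plus assms by blast
next
  case False
  then have nX: "\<not> Kp.ob (src e)" "good (src e)" using mor_src_tgt[OF assms(2)] assms(3) by auto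
  from assms(1) show ?thesis
  proof cases
    case (dot_cross_left i j a b)
    show ?thesis
    proof (cases "i \<in> pverts Qp \<longleftrightarrow> j \<in> pverts Qp")
      case True
      then have "i \<notin> pverts Qp" "j \<notin> pverts Qp" using nX dot_cross_left by auto
      then show ?thesis unfolding dot_cross_left(1,2)
        by (intro alpha_dot_cross_left) (use dot_cross_left \<open>Kp.ob M\<close> in auto)
    next
      case False
      then have "i \<noteq> j" by blast
      then show ?thesis using False dot_cross_left \<open>Kp.ob M\<close>
        by (cases "i \<in> pverts Qp") (simp_all add: mv_def delta_def)
    qed
  next
    case (dot_cross_right i j a b)
    show ?thesis
    proof (cases "i \<in> pverts Qp \<longleftrightarrow> j \<in> pverts Qp")
      case True
      then have "i \<notin> pverts Qp" "j \<notin> pverts Qp" using nX dot_cross_right by auto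
      then show ?thesis unfolding dot_cross_right(1,2)
        by (intro alpha_dot_cross_right) (use dot_cross_right \<open>Kp.ob M\<close> in auto)
    next
      case False
      then have "i \<noteq> j" by blast
      then show ?thesis using False dot_cross_right \<open>Kp.ob M\<close>
        by (cases "i \<in> pverts Qp") (simp_all add: mv_def delta_def)
    qed
  next
    case (cross_square i a)
    then show ?thesis
      using nX \<open>Kp.ob M\<close> rel_minus[OF KLRW_rels.cross_square[of "\<tau> i" Qp "Black (\<tau> i)"], of M]
      by (simp add: mv_def wh_simps)
  next
    case (cross_cross i j a b)
    show ?thesis
    proof (cases "i \<in> pverts Qp \<longleftrightarrow> j \<in> pverts Qp")
      case True
      then have "i \<notin> pverts Qp" "j \<notin> pverts Qp" using nX cross_cross by auto
      then show ?thesis unfolding cross_cross(1,2)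
        by (intro alpha_cross_cross) (use cross_cross \<open>Kp.ob M\<close> in auto)
    next
      case False
      then have "(i, j) \<notin> parcs Q" "(j, i) \<notin> parcs Q" using cross_cross arcs_Q_mixed by blast+
      then show ?thesis using False cross_cross \<open>Kp.ob M\<close>
        by (cases "i \<in> pverts Qp") (simp_all add: mv_def alpha_f2[OF quiver_Q])
    qed
  next
    case (braid i j k a b c)
    have not_plus: "\<not> (i \<in> pverts Qp \<and> j \<in> pverts Qp \<and> k \<in> pverts Qp)"
      using nX braid by (auto simp: Diff_def)
    show ?thesis
    proof (cases "i \<notin> pverts Qp \<and> j \<notin> pverts Qp \<and> k \<notin> pverts Qp")
      case True
      then show ?thesis unfolding braid(1,2)
        by (intro alpha_braid) (use braid \<open>Kp.ob M\<close> in auto)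
    next
      case False
      have "alpha f M = Kp.zer (mv M [a, b, c]) (mv M [c, b, a])"
      proof (cases "i = k \<and> k \<noteq> j")
        case True
        \<comment> \<open>A triple with \<open>i = k\<close> that is neither entirely positive nor
          entirely negative has \<open>i\<close> and \<open>j\<close> in different halves.\<close>
        then have "(i, j) \<notin> parcs Q" "(j, i) \<notin> parcs Q"
          using braid arcs_Q_mixed not_plus False by blast+
        then show ?thesis
          using True braid \<open>Kp.ob M\<close> alpha_f3[OF quiver_Q, of M "[a, b, c]"] by (simp add: delta_def)
      next
        case False
        then show ?thesis unfolding braid(2) by (simp only: delta_def if_False alpha.simps)
      qed
      moreover have "alpha e M = Kp.zer (mv M [a, b, c]) (mv M [c, b, a])"
      proof -
        \<comment> \<open>Exactly one of the three crossings is between strands of the same half. It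
          has the same image on both sides of the braid relation.\<close>
        have *: "i \<in> pverts Qp \<or> j \<in> pverts Qp \<or> k \<in> pverts Qp" using False by blast
        show ?thesis unfolding braid(1) Diff_def
          using * not_plus braid(3-) \<open>Kp.ob M\<close>
          by (cases "i \<in> pverts Qp"; cases "j \<in> pverts Qp"; cases "k \<in> pverts Qp")
            (simp_all add: mv_def Kp_neg)
      qed
      ultimately show ?thesis by simp
    qed
  next
    case (braid_red_middle i j \<theta> a b t)
    then show ?thesis
      using nX \<open>Kp.ob M\<close>
      by (cases "i \<in> pverts Qp"; cases "j \<in> pverts Qp")
        (auto simp add: mv_def Diff_def delta_def Kp_neg)
  next
    case (braid_red_left i j \<theta> a b t)
    then show ?thesis
      using nX \<open>Kp.ob M\<close>
      by (cases "i \<in> pverts Qp"; cases "j \<in> pverts Qp") (simp_all add: mv_def)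
  next
    case (braid_red_right i j \<theta> a b t)
    then show ?thesis
      using nX \<open>Kp.ob M\<close>
      by (cases "i \<in> pverts Qp"; cases "j \<in> pverts Qp") (simp_all add: mv_def)
  next
    case (dot_red_left i \<theta> a t)
    then show ?thesis using nX \<open>Kp.ob M\<close> by (simp add: mv_def)
  next
    case (dot_red_right i \<theta> a t)
    then show ?thesis using nX \<open>Kp.ob M\<close> by (simp add: mv_def)
  next
    case (red_cross_left i \<theta> a t)
    then show ?thesis using nX \<open>Kp.ob M\<close> by (simp add: mv_def)
  next
    case (red_cross_right i \<theta> a t)
    then show ?thesis using nX \<open>Kp.ob M\<close> by (simp add: mv_def)
  qed
qed

text \<open>The sign in \<open>galpha\<close> is made for the relation with dots. In the relation
  with crossings, the images of \<open>Rho\<close> and of crossings between the halves are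
  identities; one crossing within a half remains on each side, one negative and one positive, and
  reflection identifies them.\<close>

lemma alpha_orel:
  assumes "(e, f) \<in> oKLRW_rels Q \<tau>"
  shows "alpha e [] = alpha f []"
  using assms
proof cases
  case (rho_square i)
  then show ?thesis by (simp add: mv_def)
next
  case (rho_dot i)
  then show ?thesis by (cases "i \<in> pverts Qp") (simp_all add: mv_def wh_simps)
next
  case (rho_cross i j a b a' b')
  then show ?thesis by (cases "i \<in> pverts Qp"; cases "j \<in> pverts Qp") (simp_all add: mv_def)
qed

text \<open>The relations with \<open>Rho\<close> are respected on the empty base only; the
  condition on \<open>R\<close> together with \<open>base_ok\<close> ensures \<open>M = []\<close>
  whenever they occur. Arbitrary bases with \<open>H = {}\<close> are needed for right tensor
  factors, whose base is the straightened left factor.\<close>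

lemma alpha_eqv:
  assumes "eqv P H R X Y e f" "P = KLRW Q" "H \<subseteq> oKLRW_gens Q \<tau>" "R = {} \<or> H \<noteq> {} \<and> R \<subseteq> oKLRW_rels Q \<tau>"
    "good X" "good Y" "base_ok H M"
  shows "alpha e M = alpha f M"
  using assms
proof (induction arbitrary: M rule: eqv.induct)
  case (rel e f R H X Y)
  from rel(1) show ?case
  proof
    assume "(e, f) \<in> rels P"
    then have "(e, f) \<in> KLRW_rels Q" using rel by simp
    moreover from this obtain X' Y' where "mor (KLRW Q) {} e X' Y'" using KLRW_rels_typed by blast
    moreover from this have "X' = X" "Y' = Y"
      using mor_src_tgt[of P "{}" e X' Y'] mor_src_tgt[OF rel(2)] rel by auto
    moreover have "Kp.ob M" using rel base_ok_ob by blast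
    ultimately show ?thesis using alpha_rel rel by blast
  next
    assume "(e, f) \<in> R"
    then show ?thesis using alpha_orel rel by (auto simp: base_ok_def)
  qed
next
  case (comp H R X Y f f' Z g g')
  show ?case
    using comp eqv_mor[OF comp(1)] eqv_mor[OF comp(2)]
    by (simp add: alpha_comp[where H = H and X = X and Y = Y and Z = Z] del: alpha.simps)
next
  case (tensor H R X Y e e' Z W f f')
  then have "Kp.ob M" using base_ok_ob by blast
  then show ?case
    using tensor eqv_mor[OF tensor(1)] eqv_mor[OF tensor(2)]
    by (simp add: alpha_tensor[where H = H and X = X and Y = Y and Z = Z and W = W] del: alpha.simps)
next
  case (add_assoc H e X Y f g R)
  then show ?case using alpha_arr[OF add_assoc(1)] alpha_arr[OF add_assoc(2)] alpha_arr[OF add_assoc(3)]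
    by (simp add: Kp.pls_assoc)
next
  case (add_commute H e X Y f R)
  then show ?case using alpha_arr[OF add_commute(1)] alpha_arr[OF add_commute(2)]
    by (simp add: Kp.pls_commute)
next
  case (add_zero H e X Y R)
  then show ?case using alpha_arr[OF add_zero(1)] by simp
next
  case (scale_zero H e X Y R)
  then show ?case using alpha_arr[OF scale_zero(1)] by simp
next
  case (scale_one H e X Y R)
  then show ?case using alpha_arr[OF scale_one(1)] by simp
next
  case (scale_scale H e X Y R a b)
  then show ?case using alpha_arr[OF scale_scale(1)] by simp
next
  case (scale_add_left H e X Y R a b)
  then show ?case using alpha_arr[OF scale_add_left(1)] by (simp add: Kp.scl_add)
next
  case (scale_add_right H e X Y f R a)
  then show ?case using alpha_arr[OF scale_add_right(1)] alpha_arr[OF scale_add_right(2)]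
    by (simp add: Kp.scl_pls)
next
  case (comp_id_right H e X Y R)
  then show ?case using alpha_arr[OF comp_id_right(1)] by simp
next
  case (comp_id_left H e X Y R)
  then show ?case using alpha_arr[OF comp_id_left(1)] mor_src_tgt[OF comp_id_left(1)] by simp
next
  case (comp_assoc H f W X g Y h Z R)
  then have "Kp.ob M" using base_ok_ob by blast
  then show ?case
    using comp_assoc mor_src_tgt[OF comp_assoc(1)] mor_src_tgt[OF comp_assoc(2)]
      mor_src_tgt[OF comp_assoc(3)] alpha_arr[OF comp_assoc(1)] alpha_arr[OF comp_assoc(3)]
    by (simp add: Kp.cmp_assoc)
next
  case (comp_add_right H f X Y g h Z R)
  then have "Kp.ob M" using base_ok_ob by blast
  then show ?case
    using comp_add_right mor_src_tgt[OF comp_add_right(1)] mor_src_tgt[OF comp_add_right(2)]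
      mor_src_tgt[OF comp_add_right(3)]
      alpha_arr[OF comp_add_right(1)] alpha_arr[OF comp_add_right(2)] alpha_arr[OF comp_add_right(3)]
    by (simp add: Kp.cmp_pls_right)
next
  case (comp_add_left H f X Y g Z h R)
  then have "Kp.ob M" using base_ok_ob by blast
  then show ?case
    using comp_add_left mor_src_tgt[OF comp_add_left(1)] mor_src_tgt[OF comp_add_left(2)]
      mor_src_tgt[OF comp_add_left(3)]
      alpha_arr[OF comp_add_left(1)] alpha_arr[OF comp_add_left(2)] alpha_arr[OF comp_add_left(3)]
    by (simp add: Kp.cmp_pls_left)
next
  case (comp_scale_right H f X Y g Z R c)
  then have "Kp.ob M" using base_ok_ob by blast
  then show ?case
    using comp_scale_right mor_src_tgt[OF comp_scale_right(1)] mor_src_tgt[OF comp_scale_right(2)]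
      alpha_arr[OF comp_scale_right(1)] alpha_arr[OF comp_scale_right(2)]
    by (simp add: Kp.cmp_scl_right)
next
  case (comp_scale_left H f X Y g Z R c)
  then have "Kp.ob M" using base_ok_ob by blast
  then show ?case
    using comp_scale_left mor_src_tgt[OF comp_scale_left(1)] mor_src_tgt[OF comp_scale_left(2)]
      alpha_arr[OF comp_scale_left(1)] alpha_arr[OF comp_scale_left(2)]
    by (simp add: Kp.cmp_scl_left)
next
  case (tensor_id X Y H R)
  then have "Kp.ob M" using base_ok_ob by blast
  then show ?case using tensor_id by (simp add: mv_append wz_def[symmetric])
next
  case (interchange H f X Y g Z f' X' Y' g' Z' R)
  have f: "mor (KLRW Q) H f X Y" and g: "mor (KLRW Q) H g Y Z"
    and f': "mor (KLRW Q) {} f' X' Y'" and g': "mor (KLRW Q) {} g' Y' Z'" using interchange by auto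
  have gf: "mor (KLRW Q) H (g \<circ>\<^sub>e f) X Z" "mor (KLRW Q) {} (g' \<circ>\<^sub>e f') X' Z'"
    "mor (KLRW Q) H (f \<otimes>\<^sub>e f') (X @ X') (Y @ Y')" "mor (KLRW Q) H (g \<otimes>\<^sub>e g') (Y @ Y') (Z @ Z')"
    using f g f' g' by (blast intro: mor.intros)+
  note H = \<open>H \<subseteq> oKLRW_gens Q \<tau>\<close>
  have M: "Kp.ob M" using interchange base_ok_ob by blast
  have good: "good X" "good X'" "good Z" "good Z'" using interchange by auto
  note eqs = alpha_tensor[OF gf(1,2) H] alpha_comp[OF gf(3,4) H] alpha_tensor[OF f f' H]
    alpha_tensor[OF g g' H] alpha_comp[OF f g H] alpha_comp[OF f' g' empty_subsetI]
  \<comment> \<open>If one of the middle words is bad, both sides are composites through it and are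
    sent to zero.\<close>
  consider "good Y" "good Y'" | "\<not> good Y'" | "\<not> good Y" by blast
  then show ?case
  proof cases
    case 1
    note ty = alpha_arr[OF f HOL.refl H good(1) 1(1) \<open>base_ok H M\<close>]
      alpha_arr[OF g HOL.refl H 1(1) good(3) \<open>base_ok H M\<close>]
    have "alpha ((g \<circ>\<^sub>e f) \<otimes>\<^sub>e (g' \<circ>\<^sub>e f')) M
      = alpha g' (mv M Z) \<cdot> (alpha f' (mv M Z) \<cdot> wz X' (alpha g M)) \<cdot> wz X' (alpha f M)"
      using 1 good M ty by (simp add: eqs wz_cmp Kp.cmp_assoc del: alpha.simps)
    \<comment> \<open>Naturality in the base exchanges \<open>f'\<close> with
      \<open>g\<close>.\<close>
    also have "\<dots> = alpha g' (mv M Z) \<cdot> (wz Y' (alpha g M) \<cdot> alpha f' (mv M Y)) \<cdot> wz X' (alpha f M)"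
      using alpha_natural[OF f' HOL.refl HOL.refl good(2) 1(2), of "alpha g M"] ty by simp
    finally show ?thesis using 1 good by (simp add: eqs Kp.cmp_assoc del: alpha.simps)
  next
    case 2
    show ?thesis
    proof (cases "good Y")
      case True
      then show ?thesis using 2 good M
          alpha_arr[OF gf(1) HOL.refl H good(1,3) \<open>base_ok H M\<close>]
        by (simp add: eqs(1,2) alpha_comp[OF f' g' empty_subsetI] mv_append del: alpha.simps)
    next
      case False
      then show ?thesis using 2 good M
        by (simp add: eqs mv_append del: alpha.simps)
    qed
  next
    case 3
    have "Kp.arr (alpha (g' \<circ>\<^sub>e f') (mv M Z)) \<and> Kp.dom (alpha (g' \<circ>\<^sub>e f') (mv M Z)) = mv (mv M Z) X'
        \<and> Kp.cod (alpha (g' \<circ>\<^sub>e f') (mv M Z)) = mv (mv M Z) Z'"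
      using alpha_arr[OF gf(2) HOL.refl _ good(2,4), of "mv M Z"] good M by simp
    then show ?thesis using 3 good M
      by (simp add: eqs(1,2) alpha_comp[OF f g H] mv_append del: alpha.simps)
  qed
next
  case (tensor_add_left H e X Y f g Z W R)
  have e: "mor (KLRW Q) H e X Y" and f: "mor (KLRW Q) H f X Y" and g: "mor (KLRW Q) {} g Z W"
    using tensor_add_left by auto
  note H = \<open>H \<subseteq> oKLRW_gens Q \<tau>\<close>
  have M: "Kp.ob M" using tensor_add_left base_ok_ob by blast
  have good: "good X" "good Y" "good Z" "good W" using tensor_add_left by auto
  note ty = alpha_arr[OF e HOL.refl H good(1,2) \<open>base_ok H M\<close>]
    alpha_arr[OF f HOL.refl H good(1,2) \<open>base_ok H M\<close>] alpha_arr[OF g HOL.refl _ good(3,4), of "mv M Y"]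
  show ?case using good M ty
    by (simp add: alpha_tensor[OF mor_add[OF e f] g H] alpha_tensor[OF e g H] alpha_tensor[OF f g H]
        wz_pls Kp.cmp_pls_right del: alpha.simps(7))
next
  case (tensor_add_right H e X Y f Z W g R)
  have e: "mor (KLRW Q) H e X Y" and f: "mor (KLRW Q) {} f Z W" and g: "mor (KLRW Q) {} g Z W"
    using tensor_add_right by auto
  note H = \<open>H \<subseteq> oKLRW_gens Q \<tau>\<close>
  have M: "Kp.ob M" using tensor_add_right base_ok_ob by blast
  have good: "good X" "good Y" "good Z" "good W" using tensor_add_right by auto
  note ty = alpha_arr[OF e HOL.refl H good(1,2) \<open>base_ok H M\<close>]
    alpha_arr[OF f HOL.refl _ good(3,4), of "mv M Y"] alpha_arr[OF g HOL.refl _ good(3,4), of "mv M Y"]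
  show ?case using good M ty
    by (simp add: alpha_tensor[OF e mor_add[OF f g] H] alpha_tensor[OF e g H] alpha_tensor[OF e f H]
        Kp.cmp_pls_left del: alpha.simps(7))
next
  case (tensor_scale_left H e X Y f Z W R c)
  have e: "mor (KLRW Q) H e X Y" and f: "mor (KLRW Q) {} f Z W"
    using tensor_scale_left by auto
  note H = \<open>H \<subseteq> oKLRW_gens Q \<tau>\<close>
  have M: "Kp.ob M" using tensor_scale_left base_ok_ob by blast
  have good: "good X" "good Y" "good Z" "good W" using tensor_scale_left by auto
  note ty = alpha_arr[OF e HOL.refl H good(1,2) \<open>base_ok H M\<close>]
    alpha_arr[OF f HOL.refl _ good(3,4), of "mv M Y"]
  show ?case using good M ty
    by (simp add: alpha_tensor[OF mor_scale[OF e] f H] alpha_tensor[OF e f H]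
        wz_scl Kp.cmp_scl_right del: alpha.simps(7))
next
  case (tensor_scale_right H e X Y f Z W R c)
  have e: "mor (KLRW Q) H e X Y" and f: "mor (KLRW Q) {} f Z W"
    using tensor_scale_right by auto
  note H = \<open>H \<subseteq> oKLRW_gens Q \<tau>\<close>
  have M: "Kp.ob M" using tensor_scale_right base_ok_ob by blast
  have good: "good X" "good Y" "good Z" "good W" using tensor_scale_right by auto
  note ty = alpha_arr[OF e HOL.refl H good(1,2) \<open>base_ok H M\<close>]
    alpha_arr[OF f HOL.refl _ good(3,4), of "mv M Y"]
  show ?case using good M ty
    by (simp add: alpha_tensor[OF e mor_scale[OF f] H] alpha_tensor[OF e f H]
        Kp.cmp_scl_left del: alpha.simps(7))
next
  case (tensor_assoc H e X Y f X' Y' g X'' Y'' R)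
  have e: "mor (KLRW Q) H e X Y" and f: "mor (KLRW Q) {} f X' Y'" and g: "mor (KLRW Q) {} g X'' Y''"
    using tensor_assoc by auto
  note H = \<open>H \<subseteq> oKLRW_gens Q \<tau>\<close>
  have M: "Kp.ob M" using tensor_assoc base_ok_ob by blast
  have good: "good X" "good Y" "good X'" "good Y'" "good X''" "good Y''" using tensor_assoc by auto
  note ty = alpha_arr[OF e HOL.refl H good(1,2) \<open>base_ok H M\<close>]
    alpha_arr[OF f HOL.refl _ good(3,4), of "mv M Y"]
  show ?case using good M ty
    by (simp add: alpha_tensor[OF mor_tensor[OF e f] g H] alpha_tensor[OF e f H]
        alpha_tensor[OF e mor_tensor[OF f g] H] alpha_tensor[OF f g] wz_cmp wz_append mv_append Kp.cmp_assoc
        del: alpha.simps)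
next
  case (tensor_unit_right H e X Y R)
  have "mor (KLRW Q) {} (Ident [] :: ('v, 'k) diagram) [] []" by (rule mor_id) simp
  moreover have "Kp.ob M" using tensor_unit_right base_ok_ob by blast
  ultimately show ?case
    using tensor_unit_right alpha_arr[OF tensor_unit_right(1)] alpha_tensor[of H e X Y "Ident []" "[]" "[]" M]
    by (simp del: alpha.simps(7))
next
  case (tensor_unit_left e X Y H R)
  have "mor (KLRW Q) {} (Ident [] :: ('v, 'k) diagram) [] []" by (rule mor_id) simp
  moreover have "Kp.ob M" using tensor_unit_left base_ok_ob by blast
  ultimately show ?case
    using tensor_unit_left alpha_arr[OF tensor_unit_left(1), of M] alpha_tensor[of "{}" "Ident []" "[]" "[]" e X Y M]
    by (simp del: alpha.simps(7))
qed auto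

end

section \<open>Monotonicity of presentations, invertible arrows, right module categories\<close>

lemma mor_pres_mono:
  assumes "mor P H e X Y" "gen_obj P \<subseteq> gen_obj P'" "gens P \<subseteq> gens P'" "H \<subseteq> H'"
  shows "mor P' H' e X Y"
  using assms
proof (induction arbitrary: H' rule: mor.induct)
  case (mor_gen g X Y H)
  then show ?case using lists_mono by (intro mor.mor_gen) blast+
qed (use lists_mono in \<open>blast intro: mor.intros\<close>)+

lemma eqv_pres_mono:
  assumes "eqv P H R X Y e f" "gen_obj P \<subseteq> gen_obj P'" "gens P \<subseteq> gens P'" "rels P \<subseteq> rels P'"
    "H \<subseteq> H'" "R \<subseteq> R'"
  shows "eqv P' H' R' X Y e f"
  using assms
proof (induction arbitrary: H' R' rule: eqv.induct)
  case (rel e f R H X Y)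
  then show ?case by (intro eqv.rel) (blast intro: mor_pres_mono)+
next
  case (tensor_id X Y H R)
  then show ?case using lists_mono by (intro eqv.tensor_id) blast+
next
  case (trans H R X Y e f g)
  then show ?case by (meson eqv.trans)
qed (blast intro: eqv.intros mor_pres_mono)+

context presented
begin

definition iso where "iso x \<longleftrightarrow> arr x \<and> (\<exists>y. arr y \<and> dom y = cod x \<and> cod y = dom x \<and>
  cmp y x = idt (dom x) \<and> cmp x y = idt (cod x))"

lemma isoI: "\<lbrakk>arr x; arr y; dom y = cod x; cod y = dom x; cmp y x = idt (dom x); cmp x y = idt (cod x)\<rbrakk> \<Longrightarrow> iso x"
  by (auto simp: iso_def)

lemma isoE:
  assumes "iso x"
  obtains y where "arr y" "dom y = cod x" "cod y = dom x" "cmp y x = idt (dom x)" "cmp x y = idt (cod x)"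
  using assms by (auto simp: iso_def)

lemma iso_arr [simp]: "iso x \<Longrightarrow> arr x"
  by (simp add: iso_def)

lemma iso_idt [simp]: "ob X \<Longrightarrow> iso (idt X)"
  by (rule isoI[of _ "idt X"]) simp_all

lemma iso_cmp:
  assumes "iso x" "iso y" "dom y = cod x" shows "iso (cmp y x)"
proof -
  obtain x' y' where x: "arr x'" "dom x' = cod x" "cod x' = dom x" "cmp x' x = idt (dom x)" "cmp x x' = idt (cod x)"
    and y: "arr y'" "dom y' = cod y" "cod y' = dom y" "cmp y' y = idt (dom y)" "cmp y y' = idt (cod y)"
    using assms isoE by metis
  have "cmp (cmp x' y') (cmp y x) = cmp x' (cmp (cmp y' y) x)" by (simp add: cmp_assoc)
  moreover have "cmp (cmp y x) (cmp x' y') = cmp y (cmp (cmp x x') y')" by (simp add: cmp_assoc)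
  ultimately show ?thesis
    using assms x y by (intro isoI[of _ "cmp x' y'"]) simp_all
qed

lemma iso_rw:
  assumes "iso x" "ob Z" shows "iso (rw x Z)"
proof -
  obtain y where y: "arr y" "dom y = cod x" "cod y = dom x" "cmp y x = idt (dom x)" "cmp x y = idt (cod x)"
    using assms isoE by metis
  then show ?thesis
    using assms rw_cmp[of x y Z] rw_cmp[of y x Z]
    by (intro isoI[of _ "rw y Z"]) simp_all
qed

lemma iso_cancel_left:
  assumes "iso s" "arr x" "arr y" "cod x = dom s" "cod y = dom s" "cmp s x = cmp s y"
  shows "x = y"
proof -
  obtain t where t: "arr t" "dom t = cod s" "cmp t s = idt (dom s)" using assms isoE by metis
  have "cmp (cmp t s) x = cmp (cmp t s) y" using assms(6) by (simp add: cmp_assoc)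
  then show ?thesis using assms t by simp
qed

end

context monoidal
begin

lemma cl_tensor_left: "\<lbrakk>mor P {} e X Y; ob L\<rbrakk> \<Longrightarrow> cl (Ident L \<otimes>\<^sub>e e) = wh L (cl e) []"
  using tensor_interchange(1)[OF mor_id[of L] , of e X Y] mor_lists[of P "{}" e X Y]
    arr_cl[of e X Y] dom_cl[of e X Y] by (simp add: idt_def[symmetric])

lemma cl_tensor_right: "\<lbrakk>mor P {} e X Y; ob Z\<rbrakk> \<Longrightarrow> cl (e \<otimes>\<^sub>e Ident Z) = wh [] (cl e) Z"
  using tensor_interchange(1)[of e X Y, OF _ mor_id[of Z]] mor_lists[of P "{}" e X Y]
    arr_cl[of e X Y] cod_cl[of e X Y] by (simp add: idt_def[symmetric])

lemma iso_wh:
  assumes "iso x" "ob L" "ob Z" shows "iso (wh L x Z)"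
proof -
  obtain y where y: "arr y" "dom y = cod x" "cod y = dom x" "cmp y x = idt (dom x)" "cmp x y = idt (cod x)"
    using assms isoE by metis
  then show ?thesis
    using assms wh_cmp[of x y L Z] wh_cmp[of y x L Z]
    by (intro isoI[of _ "wh L y Z"]) simp_all
qed

end

context inclusion
begin

lemma iso_J:
  assumes "A.iso x" shows "B.iso (J x)"
proof -
  obtain y where y: "A.arr y" "A.dom y = A.cod x" "A.cod y = A.dom x"
    "A.cmp y x = A.idt (A.dom x)" "A.cmp x y = A.idt (A.cod x)"
    using assms A.isoE by metis
  then show ?thesis
    using assms J_cmp[of x y] J_cmp[of y x]
    by (intro B.isoI[of _ "J y"]) simp_all
qed

end

text \<open>A right module category over the monoidal category presented by \<open>P\<close>, with the functor \<open>J\<close>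
  acting on its generating object.\<close>

locale module_cat = K: monoidal P + O: presented P H R
  for P :: "('x, 'g, 'k::field) presentation" and H R
begin

sublocale inclusion P P "{}" H "{}" R
  by unfold_locales (auto intro: eqv_pres_mono)

lemma tensor_interchange:
  assumes e: "mor P H e X Y" and f: "mor P {} f Z W"
  shows "O.cl (e \<otimes>\<^sub>e f) = O.cmp (J (K.wh Y (K.cl f) [])) (O.rw (O.cl e) Z)"
    and "O.cl (e \<otimes>\<^sub>e f) = O.cmp (O.rw (O.cl e) W) (J (K.wh X (K.cl f) []))"
proof -
  have ob: "O.ob X" "O.ob Y" "O.ob Z" "O.ob W" using mor_lists[OF e] mor_lists[OF f] by auto
  have lw: "J (K.wh V (K.cl f) []) = O.cl (Ident V \<otimes>\<^sub>e f)" if "O.ob V" for V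
    using K.cl_tensor_left[OF f that] J_cl[OF mor_tensor[OF mor_id[OF that] f]] by simp
  have m: "mor P H (Ident X) X X" "mor P H (Ident Y) Y Y" "mor P {} (Ident Z) Z Z" "mor P {} (Ident W) W W"
    using ob by (simp_all add: mor_id)
  have "O.cl (e \<otimes>\<^sub>e f) = O.cl ((Ident Y \<circ>\<^sub>e e) \<otimes>\<^sub>e (f \<circ>\<^sub>e Ident Z))"
    by (rule O.cl_eqI[OF eqv.tensor])
      (use e f in \<open>blast intro: eqv.sym[OF eqv.comp_id_right] eqv.sym[OF eqv.comp_id_left]\<close>)+
  also have "\<dots> = O.cl (Ident Y \<otimes>\<^sub>e f \<circ>\<^sub>e e \<otimes>\<^sub>e Ident Z)"
    by (rule O.cl_eqI[OF eqv.interchange]) (fact e f m)+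
  finally show "O.cl (e \<otimes>\<^sub>e f) = O.cmp (J (K.wh Y (K.cl f) [])) (O.rw (O.cl e) Z)"
    using ob by (simp add: lw O.cl_comp O.cl_rw)
  have "O.cl (e \<otimes>\<^sub>e f) = O.cl ((e \<circ>\<^sub>e Ident X) \<otimes>\<^sub>e (Ident W \<circ>\<^sub>e f))"
    by (rule O.cl_eqI[OF eqv.tensor])
      (use e f in \<open>blast intro: eqv.sym[OF eqv.comp_id_right] eqv.sym[OF eqv.comp_id_left]\<close>)+
  also have "\<dots> = O.cl (e \<otimes>\<^sub>e Ident W \<circ>\<^sub>e Ident X \<otimes>\<^sub>e f)"
    by (rule O.cl_eqI[OF eqv.interchange]) (fact e f m)+
  finally show "O.cl (e \<otimes>\<^sub>e f) = O.cmp (O.rw (O.cl e) W) (J (K.wh X (K.cl f) []))"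
    using ob by (simp add: lw O.cl_comp O.cl_rw)
qed

text \<open>An arrow that involves the additional generators may act before or after a diagram
  \<open>x\<close> on its right: both composites are the same tensor product.\<close>

lemma rw_commute:
  assumes "O.arr u" "K.arr x"
  shows "O.cmp (O.rw u (K.cod x)) (J (K.wh (O.dom u) x [])) = O.cmp (J (K.wh (O.cod u) x [])) (O.rw u (K.dom x))"
  using tensor_interchange[of "O.rep u" "O.dom u" "O.cod u" "K.rep x" "K.dom x" "K.cod x"] assms by simp

end

locale monoidal_inclusion = A: monoidal P1 + B: monoidal P2
  for P1 P2 :: "('x, 'g, 'k::field) presentation" +
  assumes pres_mono: "gen_obj P1 \<subseteq> gen_obj P2" "gens P1 \<subseteq> gens P2" "rels P1 \<subseteq> rels P2"
begin

sublocale inclusion P1 P2 "{}" "{}" "{}" "{}"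
  by unfold_locales (use pres_mono in \<open>auto intro: eqv_pres_mono\<close>)

lemma J_wh:
  assumes "A.arr x" "A.ob L" "A.ob Z"
  shows "J (A.wh L x Z) = B.wh L (J x) Z"
proof -
  have m: "mor P1 {} (A.rep x) (A.dom x) (A.cod x)" using assms by simp
  have "J (A.wh L x Z) = B.cl (Ident L \<otimes>\<^sub>e A.rep x \<otimes>\<^sub>e Ident Z)"
    using A.wh_rep[OF assms] J_cl[OF mor_tensor[OF mor_tensor[OF mor_id m] mor_id]] assms by simp
  also have "\<dots> = B.wh L (B.cl (A.rep x)) Z"
    using B.wh_cl[OF incl_mor[OF m]] assms by simp
  finally show ?thesis using assms by (simp add: J_rep)
qed

end

section \<open>Carrying a negative strand across a positive word\<close>

context diagonal
begin

sublocale JO: module_cat "KLRW Q :: ('v, 'k) pres" "oKLRW_gens Q \<tau>" "oKLRW_rels Q \<tau>"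
  by unfold_locales

lemma KLRW_rels_mono: "(KLRW_rels Qp :: (('v, 'k) diagram \<times> ('v, 'k) diagram) set) \<subseteq> KLRW_rels Q"
proof (rule subrelI)
  have f2: "f2 Q i j = (f2 Qp i j :: 'k poly poly)" "f3_quotient Q i j = (f3_quotient Qp i j :: 'k poly poly poly)"
    if "i \<in> pverts Qp" "j \<in> pverts Qp" for i j
    using that by (simp_all add: f2_def f3_quotient_def f_poly_def X_poly_def arcs_plus)
  note dominant = subsetD[OF dominant_mono]
  fix e f :: "('v, 'k) diagram"
  assume "(e, f) \<in> KLRW_rels Qp"
  then show "(e, f) \<in> KLRW_rels Q"
  proof cases
    case (cross_cross i j a b)
    show ?thesis unfolding cross_cross(1,2) f2(1)[OF cross_cross(3,4), symmetric]
      by (rule KLRW_rels.cross_cross) (use cross_cross in auto)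
  next
    case (braid i j k a b c)
    show ?thesis unfolding braid(1,2) f2(2)[OF braid(3,4), symmetric]
      by (rule KLRW_rels.braid) (use braid in auto)
  qed (hypsubst, intro KLRW_rels.intros; (simp add: dominant; fail))+
qed

sublocale JK: monoidal_inclusion "KLRW Qp :: ('v, 'k) pres"
  "KLRW Q :: ('v, 'k) pres"
  using KLRW_gens_mono KLRW_rels_mono dominant_mono
  by unfold_locales (auto simp: KLRW_def letters_def)

notation K.cmp (infixl \<open>\<bullet>\<close> 66)
notation O.cmp (infixl \<open>\<star>\<close> 66)

abbreviation jo where "jo \<equiv> JO.J"
abbreviation jk where "jk \<equiv> JK.J"

lemma plus_letter_in_Q [simp]: "a \<in> gen_obj (KLRW Qp :: ('v, 'k) pres) \<Longrightarrow> a \<in> gen_obj (KLRW Q :: ('v, 'k) pres)"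
  using dominant_mono by (cases a) auto

lemma good_in_Q: "a \<in> good_letters \<Longrightarrow> a \<in> gen_obj (KLRW Q :: ('v, 'k) pres)"
  using dominant_mono by (cases a) auto

lemma good_ob_K [simp]: "good X \<Longrightarrow> K.ob X"
  using good_in_Q by blast

abbreviation kd where "kd i \<equiv> K.cl (dot i)"
abbreviation kc where "kc a b \<equiv> K.cl (sigma a b)"

lemma arr_kd [simp]:
  assumes "i \<in> pverts Q"
  shows "K.arr (kd i)" "K.dom (kd i) = [Black i]" "K.cod (kd i) = [Black i]"
  using K.arr_cl[OF mor_KLRW_gens(1)] K.dom_cl[OF mor_KLRW_gens(1)] K.cod_cl[OF mor_KLRW_gens(1)] assms
  by auto

lemma arr_kc [simp]:
  assumes "a \<in> gen_obj (KLRW Q :: ('v, 'k) pres)" "b \<in> gen_obj (KLRW Q :: ('v, 'k) pres)" "is_black a \<or> is_black b"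
  shows "K.arr (kc a b)" "K.dom (kc a b) = [a, b]" "K.cod (kc a b) = [b, a]"
  using K.arr_cl[OF mor_cross[OF assms]] K.dom_cl[OF mor_cross[OF assms]]
    K.cod_cl[OF mor_cross[OF assms]] by auto

lemma jk_gens [simp]:
  "i \<in> pverts Qp \<Longrightarrow> jk (dotc i) = kd i"
  "\<lbrakk>a \<in> gen_obj (KLRW Qp :: ('v, 'k) pres); b \<in> gen_obj (KLRW Qp :: ('v, 'k) pres); is_black a \<or> is_black b\<rbrakk> \<Longrightarrow> jk (crc a b) = kc a b"
  by (simp_all add: JK.J_cl[OF mor_KLRW_gens(1)] JK.J_cl[OF mor_cross])

lemma K_rel:
  assumes "(e, f) \<in> KLRW_rels Q" shows "K.cl e = K.cl f"
proof -
  obtain X Y where m: "mor (KLRW Q) {} e X Y" "mor (KLRW Q) {} f X Y"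
    using KLRW_rels_typed[OF assms(1)] by blast
  then show ?thesis using assms by (intro K.cl_eqI[of X Y] eqv.rel) auto
qed

lemma kc_tensor [simp]:
  assumes "a \<in> gen_obj (KLRW Q :: ('v, 'k) pres)" "b \<in> gen_obj (KLRW Q :: ('v, 'k) pres)" "is_black a \<or> is_black b" "K.ob Z"
  shows "K.cl (sigma a b \<otimes>\<^sub>e Ident Z) = K.wh [] (kc a b) Z" "K.cl (Ident Z \<otimes>\<^sub>e sigma a b) = K.wh Z (kc a b) []"
  by (rule K.cl_tensor_right[OF mor_cross[OF assms(1-3)] assms(4)],
      rule K.cl_tensor_left[OF mor_cross[OF assms(1-3)] assms(4)])

lemma kd_tensor [simp]:
  assumes "i \<in> pverts Q" "K.ob Z"
  shows "K.cl (dot i \<otimes>\<^sub>e Ident Z) = K.wh [] (kd i) Z" "K.cl (Ident Z \<otimes>\<^sub>e dot i) = K.wh Z (kd i) []"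
  using K.cl_tensor_left[OF mor_KLRW_gens(1)] K.cl_tensor_right[OF mor_KLRW_gens(1)] assms by auto

text \<open>The braid relations are stated as differences; where the correction is zero, this turns
  them into equations between the two sides.\<close>

lemma K_diff_eq:
  assumes "K.cl (Diff e f) = K.cl (Zero X Y)" "mor (KLRW Q) {} e X Y" "mor (KLRW Q) {} f X Y"
  shows "K.cl e = K.cl f"
proof -
  note [simp] = K.arr_cl[OF assms(2)] K.arr_cl[OF assms(3)] K.dom_cl[OF assms(2)] K.dom_cl[OF assms(3)]
    K.cod_cl[OF assms(2)] K.cod_cl[OF assms(3)]
  have "K.ob X" "K.ob Y" using mor_lists[OF assms(2)] by auto
  have "K.pls (K.scl (- 1) (K.cl f)) (K.cl f) = K.zer X Y"
    using K.scl_add[of "K.cl f" "- 1" 1] by simp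
  then have "K.cl e = K.pls (K.cl e) (K.pls (K.scl (- 1) (K.cl f)) (K.cl f))"
    by simp
  also have "\<dots> = K.pls (K.cl (Diff e f)) (K.cl f)"
    by (simp add: Diff_def K.cl_add K.cl_scale K.pls_assoc)
  also have "\<dots> = K.cl f"
    unfolding assms(1) using \<open>K.ob X\<close> \<open>K.ob Y\<close> by (simp add: K.zer_def[symmetric])
  finally show ?thesis .
qed

text \<open>Every correction term of a braid relation carries a Kronecker delta of the two outer
  strands, and \<open>a \<noteq> c\<close> removes it. The conditions on colours mean that at most
  one of the letters is red, so one of the four braid relations applies.\<close>

lemma kc_braid:
  assumes "a \<in> gen_obj (KLRW Q :: ('v, 'k) pres)" "b \<in> gen_obj (KLRW Q :: ('v, 'k) pres)" "c \<in> gen_obj (KLRW Q :: ('v, 'k) pres)" "a \<noteq> c"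
    "is_black a \<or> is_black b" "is_black b \<or> is_black c" "is_black a \<or> is_black c"
  shows "K.wh [] (kc b c) [a] \<bullet> K.wh [b] (kc a c) [] \<bullet> K.wh [] (kc a b) [c] =
    K.wh [c] (kc a b) [] \<bullet> K.wh [] (kc a c) [b] \<bullet> K.wh [a] (kc b c) []" (is "?l = ?r")
proof -
  let ?e = "sigma b c \<otimes>\<^sub>e strand a \<circ>\<^sub>e strand b \<otimes>\<^sub>e sigma a c \<circ>\<^sub>e sigma a b \<otimes>\<^sub>e strand c :: ('v, 'k) diagram"
  let ?f = "strand c \<otimes>\<^sub>e sigma a b \<circ>\<^sub>e sigma a c \<otimes>\<^sub>e strand b \<circ>\<^sub>e strand a \<otimes>\<^sub>e sigma b c :: ('v, 'k) diagram"
  have e: "mor (KLRW Q) {} ?e [a, b, c] [c, b, a]" and f: "mor (KLRW Q) {} ?f [a, b, c] [c, b, a]"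
    by (rule mor_comp mor_tensor_eq mor_cross mor_id | simp add: assms)+
  have "K.cl ?e = ?l" "K.cl ?f = ?r" using assms by (simp_all add: K.cl_comp)
  moreover have "K.cl ?e = K.cl ?f"
  proof -
    consider i j k where "a = Black i" "b = Black j" "c = Black k"
      | \<theta> j k where "a = Red \<theta>" "b = Black j" "c = Black k"
      | i \<theta> k where "a = Black i" "b = Red \<theta>" "c = Black k"
      | i j \<theta> where "a = Black i" "b = Black j" "c = Red \<theta>"
      using assms(5-7) by (metis is_black.simps(2) letter.exhaust)
    then show ?thesis
    proof cases
      case 1
      then show ?thesis
        using K_rel[OF KLRW_rels.braid[of i Q j k a b c]] assms e f
        by (intro K_diff_eq[OF _ e f]) (simp add: delta_def)
    next
      case 2
      then show ?thesis using K_rel[OF KLRW_rels.braid_red_left[of k Q j \<theta> c b a]] assms by simp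
    next
      case 3
      then show ?thesis
        using K_rel[OF KLRW_rels.braid_red_middle[of i Q k \<theta> a c b]] assms e f
        by (intro K_diff_eq[OF _ e f]) (simp add: delta_def)
    next
      case 4
      then show ?thesis using K_rel[OF KLRW_rels.braid_red_right[of i Q j \<theta> a b c]] assms by simp
    qed
  qed
  ultimately show ?thesis by simp
qed

text \<open>The part of a straightening step that needs no \<open>\<rho>\<close>: a strand from the
  right end crosses the letters of the word from the last one to the first.\<close>

primrec pass :: "'v letter \<Rightarrow> 'v letter list \<Rightarrow> ('v, 'k) diagram set" where
  "pass a [] = K.idt [a]"
| "pass a (m # M) = K.wh [] (kc m a) M \<bullet> K.wh [m] (pass a M) []"

abbreviation neg where "neg a \<equiv> minus a \<and> a \<in> good_letters"

lemma neg_in_Q [simp]: "\<lbrakk>minus a; a \<in> good_letters\<rbrakk> \<Longrightarrow> a \<in> gen_obj (KLRW Q :: ('v, 'k) pres)"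
  by (simp add: good_in_Q)

lemma arr_pass [simp]:
  assumes "neg a" "Kp.ob M"
  shows "K.arr (pass a M)" "K.dom (pass a M) = M @ [a]" "K.cod (pass a M) = a # M"
proof -
  have "K.arr (pass a M) \<and> K.dom (pass a M) = M @ [a] \<and> K.cod (pass a M) = a # M"
    using assms(2)
  proof (induction M)
    case Nil
    then show ?case using assms(1) by simp
  next
    case (Cons m M)
    then have "K.ob M" "m \<in> gen_obj (KLRW Q :: ('v, 'k) pres)" by auto
    then show ?case using Cons assms(1) is_black_minus[of a] by simp
  qed
  then show "K.arr (pass a M)" "K.dom (pass a M) = M @ [a]" "K.cod (pass a M) = a # M" by auto
qed

lemma pass_append:
  assumes "neg a" "Kp.ob M" "Kp.ob N"
  shows "pass a (M @ N) = K.wh [] (pass a M) N \<bullet> K.wh M (pass a N) []"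
  using assms(2)
proof (induction M)
  case Nil
  then show ?case using assms by simp
next
  case (Cons m M)
  then have "K.ob M" "m \<in> gen_obj (KLRW Q :: ('v, 'k) pres)" "Kp.ob M" by auto
  then show ?case using Cons assms is_black_minus[of a] by (simp add: K.wh_cmp K.cmp_assoc)
qed

text \<open>For black \<open>m\<close> no arrow joins the two halves, so the polynomial of the
  double crossing is \<open>1\<close>. For red \<open>m\<close> the exponent of the dot is the
  coefficient of a weight of \<open>Q_+\<close> at a vertex of \<open>Q_-\<close>, hence
  \<open>0\<close>.\<close>

lemma kc_kc_mixed:
  assumes "neg a" "m \<in> gen_obj (KLRW Qp :: ('v, 'k) pres)"
  shows "kc m a \<bullet> kc a m = K.idt [a, m]" "kc a m \<bullet> kc m a = K.idt [m, a]"
proof -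
  obtain i where i: "a = Black i" "i \<in> pverts Q" "i \<notin> pverts Qp"
    using assms by (auto simp: minus_def)
  have "kc m a \<bullet> kc a m = K.idt [a, m] \<and> kc a m \<bullet> kc m a = K.idt [m, a]"
  proof (cases m)
    case (Black j)
    then have j: "j \<in> pverts Qp" using assms by simp
    have [simp]: "f2 Q i j = (1 :: 'k poly poly)" "f2 Q j i = (1 :: 'k poly poly)"
      using i j arcs_Q_mixed[of i j] arcs_Q_mixed[of j i] by (auto simp: f2_def f_poly_def X_poly_def)
    have ji: "i \<noteq> j" "j \<noteq> i" using i j by auto
    have "K.cl (poly_subst2 X y z 1) = K.idt X" if "K.ob X" for X and y z :: "('v, 'k) diagram"
      using that by (simp add: poly_subst2_def poly_subst_def K.cl_ops)
    then show ?thesis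
      using K_rel[OF KLRW_rels.cross_cross[OF _ _ ji(1), of Q a m]]
        K_rel[OF KLRW_rels.cross_cross[OF _ _ ji(2), of Q m a]] Black i j
      by (simp add: K.cl_comp)
  next
    case (Red \<theta>)
    then have "\<theta> \<in> dominant_weights Qp" "\<theta> \<in> dominant_weights Q" using assms dominant_mono by auto
    then show ?thesis
      using K_rel[OF KLRW_rels.red_cross_left[of i Q \<theta> a m]]
        K_rel[OF KLRW_rels.red_cross_right[of i Q \<theta> a m]] Red i K.wh_idt[of "[a]" "[m]" "[]"]
        K.wh_idt[of "[a]" "[]" "[m]"] K.cl_tensor_left[OF mor_id, of "[a]" "[m]"]
        K.cl_tensor_right[OF mor_id, of "[a]" "[m]"]
      by (simp add: K.cl_comp K.idt_def)
  qed
  then show "kc m a \<bullet> kc a m = K.idt [a, m]" "kc a m \<bullet> kc m a = K.idt [m, a]" by auto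
qed

lemma iso_pass:
  assumes "neg a" "Kp.ob M" shows "K.iso (pass a M)"
  using assms(2)
proof (induction M)
  case Nil
  then show ?case using assms(1) by simp
next
  case (Cons m M)
  then have m: "K.ob M" "m \<in> gen_obj (KLRW Q :: ('v, 'k) pres)" "m \<in> gen_obj (KLRW Qp :: ('v, 'k) pres)" "Kp.ob M" by auto
  then have "K.iso (kc m a)"
    using kc_kc_mixed[OF assms(1) m(3)] assms(1) is_black_minus[of a]
    by (intro K.isoI[of _ "kc a m"]) simp_all
  then have "K.iso (K.wh [] (kc m a) M)" "K.iso (K.wh [m] (pass a M) [])"
    using Cons m by (simp_all add: K.iso_wh)
  then show ?case using assms(1) m is_black_minus[of a]
    by (simp add: K.iso_cmp)
qed

text \<open>The letters of \<open>M\<close> are positive or red and differ from the negative strand,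
  so the dot slides through each crossing without a correction term.\<close>

lemma pass_dot:
  assumes "i \<in> pverts Q" "i \<notin> pverts Qp" "Kp.ob M"
  shows "pass (Black i) M \<bullet> K.wh M (kd i) [] = K.wh [] (kd i) M \<bullet> pass (Black i) M"
  using assms(3)
proof (induction M)
  case Nil
  then show ?case using assms(1,2) by simp
next
  case (Cons m M)
  let ?a = "Black i"
  have m: "K.ob M" "m \<in> gen_obj (KLRW Q :: ('v, 'k) pres)" "m \<in> gen_obj (KLRW Qp :: ('v, 'k) pres)" "Kp.ob M" using Cons by auto
  have rel: "K.wh [] (kd i) [m] \<bullet> kc m ?a = kc m ?a \<bullet> K.wh [m] (kd i) []"
  proof (cases m)
    case (Black j)
    then show ?thesis using K_rel[OF KLRW_rels.dot_cross_left[of j Q i m ?a]] assms m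
      by (auto simp: K.cl_comp K.cl_add delta_def K.zer_def[symmetric])
  next
    case (Red \<theta>)
    then show ?thesis using K_rel[OF KLRW_rels.dot_red_left[of i Q \<theta> ?a m]] assms m
      by (simp add: K.cl_comp)
  qed
  from arg_cong[OF this, of "\<lambda>x. K.wh [] x M"]
  have rel': "K.wh [] (kd i) (m # M) \<bullet> K.wh [] (kc m ?a) M = K.wh [] (kc m ?a) M \<bullet> K.wh [m] (kd i) M"
    using assms m by (simp add: K.wh_cmp)
  have "pass ?a (m # M) \<bullet> K.wh (m # M) (kd i) [] = K.wh [] (kc m ?a) M \<bullet> K.wh [m] (pass ?a M \<bullet> K.wh M (kd i) []) []"
    using assms m by (simp add: K.cmp_assoc K.wh_cmp)
  also have "\<dots> = K.wh [] (kc m ?a) M \<bullet> K.wh [m] (kd i) M \<bullet> K.wh [m] (pass ?a M) []"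
    unfolding Cons.IH using assms m by (simp add: K.cmp_assoc K.wh_cmp)
  also have "\<dots> = K.wh [] (kd i) (m # M) \<bullet> pass ?a (m # M)"
    unfolding rel'[symmetric] by (simp add: K.cmp_assoc)
  finally show ?case .
qed

text \<open>The crossing of two negative strands is moved through one letter \<open>m\<close> of the
  word at a time by the braid relation. The outer strands are \<open>m\<close> and \<open>b\<close>,
  so there is no correction, even for \<open>a = b\<close>. Far commutativity (\<open>I1\<close>,
  \<open>I2\<close>) brings the crossings with \<open>m\<close> next to each other.\<close>

lemma pass_cross:
  assumes "neg a" "neg b" "Kp.ob M"
  shows "K.wh [] (kc a b) M \<bullet> (K.wh [a] (pass b M) [] \<bullet> K.wh [] (pass a M) [b]) =
    K.wh [b] (pass a M) [] \<bullet> (K.wh [] (pass b M) [a] \<bullet> K.wh M (kc a b) [])"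
  using assms(3)
proof (induction M)
  case Nil
  then show ?case using assms(1,2) is_black_minus[of a] by simp
next
  case (Cons m M)
  have m: "K.ob M" "m \<in> gen_obj (KLRW Q :: ('v, 'k) pres)" "m \<in> gen_obj (KLRW Qp :: ('v, 'k) pres)" "Kp.ob M" using Cons by auto
  have ab: "is_black a" "is_black b" "m \<noteq> b" "a \<in> gen_obj (KLRW Q :: ('v, 'k) pres)" "b \<in> gen_obj (KLRW Q :: ('v, 'k) pres)"
    using assms m(3) is_black_minus plus_simps(1) by auto
  have I1: "K.wh [a, m] (pass b M) [] \<bullet> K.wh [] (kc m a) (M @ [b]) = K.wh [] (kc m a) (b # M) \<bullet> K.wh [m, a] (pass b M) []"
    using K.wh_interchange[of "kc m a" "pass b M" "[]" "[]" "[]"] assms m ab by simp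
  have I2: "K.wh [b, m] (pass a M) [] \<bullet> K.wh [] (kc m b) (M @ [a]) = K.wh [] (kc m b) (a # M) \<bullet> K.wh [m, b] (pass a M) []"
    using K.wh_interchange[of "kc m b" "pass a M" "[]" "[]" "[]"] assms m ab by simp
  from arg_cong[OF kc_braid[of m a b], of "\<lambda>x. K.wh [] x M"]
  have B: "K.wh [] (kc a b) (m # M) \<bullet> (K.wh [a] (kc m b) M \<bullet> K.wh [] (kc m a) (b # M)) =
      K.wh [b] (kc m a) M \<bullet> (K.wh [] (kc m b) (a # M) \<bullet> K.wh [m] (kc a b) M)"
    using assms m ab by (simp add: K.wh_cmp K.cmp_assoc)
  have IH: "K.wh [m] (kc a b) M \<bullet> (K.wh [m, a] (pass b M) [] \<bullet> K.wh [m] (pass a M) [b]) =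
      K.wh [m, b] (pass a M) [] \<bullet> (K.wh [m] (pass b M) [a] \<bullet> K.wh (m # M) (kc a b) [])"
    using arg_cong[OF Cons.IH, of "\<lambda>x. K.wh [m] x []"] assms m ab by (simp add: K.wh_cmp)
  have "K.wh [] (kc a b) (m # M) \<bullet> (K.wh [a] (pass b (m # M)) [] \<bullet> K.wh [] (pass a (m # M)) [b]) =
    K.wh [] (kc a b) (m # M) \<bullet> (K.wh [a] (kc m b) M \<bullet> ((K.wh [a, m] (pass b M) [] \<bullet> K.wh [] (kc m a) (M @ [b])) \<bullet>
      K.wh [m] (pass a M) [b]))"
    using assms m ab by (simp add: K.wh_cmp K.cmp_assoc)
  also have "\<dots> = (K.wh [] (kc a b) (m # M) \<bullet> (K.wh [a] (kc m b) M \<bullet> K.wh [] (kc m a) (b # M))) \<bullet>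
      (K.wh [m, a] (pass b M) [] \<bullet> K.wh [m] (pass a M) [b])"
    unfolding I1 by (simp add: K.cmp_assoc)
  also have "\<dots> = K.wh [b] (kc m a) M \<bullet> (K.wh [] (kc m b) (a # M) \<bullet>
      (K.wh [m] (kc a b) M \<bullet> (K.wh [m, a] (pass b M) [] \<bullet> K.wh [m] (pass a M) [b])))"
    unfolding B by (simp add: K.cmp_assoc)
  also have "\<dots> = K.wh [b] (kc m a) M \<bullet> ((K.wh [] (kc m b) (a # M) \<bullet> K.wh [m, b] (pass a M) []) \<bullet>
      (K.wh [m] (pass b M) [a] \<bullet> K.wh (m # M) (kc a b) []))"
    unfolding IH by (simp add: K.cmp_assoc)
  also have "\<dots> = K.wh [b] (pass a (m # M)) [] \<bullet> (K.wh [] (pass b (m # M)) [a] \<bullet> K.wh (m # M) (kc a b) [])"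
    unfolding I2[symmetric] using assms m ab by (simp add: K.wh_cmp K.cmp_assoc)
  finally show ?case .
qed

text \<open>Dots slide through the strand \<open>a\<close>, and so do crossings by the braid
  relation, whose outer strands \<open>b\<close> and \<open>a\<close> are different. For a tensor
  product the strand passes one factor after the other.\<close>

lemma pass_natural:
  assumes "mor P H e M N" "P = KLRW Qp" "H = {}" "neg a"
  shows "pass a N \<bullet> K.wh [] (K.cl e) [a] = K.wh [a] (K.cl e) [] \<bullet> pass a M"
  using assms
proof (induction rule: mor.induct)
  case (mor_gen g M N H)
  have ab: "is_black a" "a \<in> gen_obj (KLRW Q :: ('v, 'k) pres)"
    using mor_gen is_black_minus by auto
  have ob: "K.ob M" "K.ob N" using mor_gen by auto
  have "(g, M, N) \<in> KLRW_gens Qp" using mor_gen by simp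
  then consider i where "g = Dot i" "M = [Black i]" "N = [Black i]" "i \<in> pverts Qp"
    | b c where "g = Cross b c" "M = [b, c]" "N = [c, b]" "is_black b \<or> is_black c"
    by cases (use that in \<open>(simp; fail)+\<close>)
  then show ?case
  proof cases
    case 1
    obtain j where "a = Black j" "j \<in> pverts Q" "j \<notin> pverts Qp" using mor_gen by (auto simp: minus_def)
    then show ?thesis using 1 K_rel[OF KLRW_rels.dot_cross_right[of i Q j "Black i" a]]
      by (auto simp: K.cl_comp K.cl_add delta_def K.zer_def[symmetric])
  next
    case 2
    then have "b \<in> gen_obj (KLRW Qp :: ('v, 'k) pres)" "c \<in> gen_obj (KLRW Qp :: ('v, 'k) pres)" using mor_gen by auto
    moreover from this have "b \<noteq> a" using mor_gen plus_simps(1) by auto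
    ultimately show ?thesis using 2 ab mor_gen kc_braid[of b c a] by (simp add: K.cmp_assoc)
  qed
next
  case (mor_id X H)
  then have "K.ob X" by auto
  then show ?case using mor_id by (simp add: K.idt_def[symmetric])
next
  case (mor_zero X Y H)
  then have "K.ob X" "K.ob Y" by auto
  then show ?case using mor_zero by (simp add: K.zer_def[symmetric])
next
  case (mor_add H e X Y f)
  have m: "mor (KLRW Q) {} e X Y" "mor (KLRW Q) {} f X Y" using mor_add JK.incl_mor by auto
  have "Kp.ob X" "Kp.ob Y" using mor_lists mor_add by blast+
  moreover note [simp] = K.arr_cl[OF m(1)] K.arr_cl[OF m(2)] K.dom_cl[OF m(1)] K.dom_cl[OF m(2)]
    K.cod_cl[OF m(1)] K.cod_cl[OF m(2)]
  ultimately show ?case using mor_add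
    by (simp add: K.cl_add K.wh_pls K.cmp_pls_left K.cmp_pls_right)
next
  case (mor_scale H e X Y c)
  have m: "mor (KLRW Q) {} e X Y" using mor_scale JK.incl_mor by auto
  have "Kp.ob X" "Kp.ob Y" using mor_lists mor_scale by blast+
  moreover note [simp] = K.arr_cl[OF m(1)] K.dom_cl[OF m(1)] K.cod_cl[OF m(1)]
  ultimately show ?case using mor_scale
    by (simp add: K.cl_scale K.wh_scl K.cmp_scl_left K.cmp_scl_right)
next
  case (mor_comp H f X Y g Z)
  have m: "mor (KLRW Q) {} f X Y" "mor (KLRW Q) {} g Y Z" using mor_comp JK.incl_mor by auto
  have ob: "Kp.ob X" "Kp.ob Y" "Kp.ob Z" using mor_lists mor_comp by blast+
  note [simp] = K.arr_cl[OF m(1)] K.arr_cl[OF m(2)] K.dom_cl[OF m(1)] K.dom_cl[OF m(2)]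
    K.cod_cl[OF m(1)] K.cod_cl[OF m(2)]
  have "pass a Z \<bullet> K.wh [] (K.cl (g \<circ>\<^sub>e f)) [a] = (pass a Z \<bullet> K.wh [] (K.cl g) [a]) \<bullet> K.wh [] (K.cl f) [a]"
    using mor_comp.prems by (simp add: K.cl_comp K.wh_cmp K.cmp_assoc)
  also have "\<dots> = K.wh [a] (K.cl g) [] \<bullet> (pass a Y \<bullet> K.wh [] (K.cl f) [a])"
    using mor_comp by (simp add: K.cmp_assoc)
  also have "\<dots> = K.wh [a] (K.cl (g \<circ>\<^sub>e f)) [] \<bullet> pass a X"
    using mor_comp.prems mor_comp.IH(1) by (simp add: K.cl_comp K.wh_cmp K.cmp_assoc)
  finally show ?case .
next
  case (mor_tensor H e X Y f Z W)
  have m: "mor (KLRW Q) {} e X Y" "mor (KLRW Q) {} f Z W" using mor_tensor JK.incl_mor by auto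
  have ob: "Kp.ob X" "Kp.ob Y" "Kp.ob Z" "Kp.ob W" using mor_lists mor_tensor by blast+
  then have obK: "K.ob X" "K.ob Y" "K.ob Z" "K.ob W" by auto
  note a = mor_tensor.prems(3)
  note [simp] = K.arr_cl[OF m(1)] K.arr_cl[OF m(2)] K.dom_cl[OF m(1)] K.dom_cl[OF m(2)]
    K.cod_cl[OF m(1)] K.cod_cl[OF m(2)]
  have IH1: "K.wh [] (pass a Y) Z \<bullet> K.wh [] (K.cl e) (a # Z) = K.wh [a] (K.cl e) Z \<bullet> K.wh [] (pass a X) Z"
    using arg_cong[OF mor_tensor.IH(1), of "\<lambda>x. K.wh [] x Z"] mor_tensor.prems ob obK by (simp add: K.wh_cmp)
  have IH2: "K.wh Y (pass a W) [] \<bullet> K.wh Y (K.cl f) [a] = K.wh (Y @ [a]) (K.cl f) [] \<bullet> K.wh Y (pass a Z) []"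
    using arg_cong[OF mor_tensor.IH(2), of "\<lambda>x. K.wh Y x []"] mor_tensor.prems ob obK by (simp add: K.wh_cmp)
  have J1: "K.wh (a # Y) (K.cl f) [] \<bullet> K.wh [] (pass a Y) Z = K.wh [] (pass a Y) W \<bullet> K.wh (Y @ [a]) (K.cl f) []"
    using K.wh_interchange[of "pass a Y" "K.cl f" "[]" "[]" "[]"] a ob by simp
  have J2: "K.wh Y (pass a Z) [] \<bullet> K.wh [] (K.cl e) (Z @ [a]) = K.wh [] (K.cl e) (a # Z) \<bullet> K.wh X (pass a Z) []"
    using K.wh_interchange[of "K.cl e" "pass a Z" "[]" "[]" "[]"] a ob by simp
  have "pass a (Y @ W) \<bullet> K.wh [] (K.cl (e \<otimes>\<^sub>e f)) [a] =
    K.wh [] (pass a Y) W \<bullet> ((K.wh Y (pass a W) [] \<bullet> K.wh Y (K.cl f) [a]) \<bullet> K.wh [] (K.cl e) (Z @ [a]))"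
    using a ob obK by (simp add: pass_append K.tensor_interchange(1)[OF m] K.wh_cmp K.cmp_assoc)
  also have "\<dots> = (K.wh [] (pass a Y) W \<bullet> K.wh (Y @ [a]) (K.cl f) []) \<bullet> (K.wh Y (pass a Z) [] \<bullet> K.wh [] (K.cl e) (Z @ [a]))"
    unfolding IH2 by (simp add: K.cmp_assoc)
  also have "\<dots> = K.wh (a # Y) (K.cl f) [] \<bullet> ((K.wh [] (pass a Y) Z \<bullet> K.wh [] (K.cl e) (a # Z)) \<bullet> K.wh X (pass a Z) [])"
    unfolding J1[symmetric] J2 by (simp add: K.cmp_assoc)
  also have "\<dots> = K.wh [a] (K.cl (e \<otimes>\<^sub>e f)) [] \<bullet> pass a (X @ Z)"
    unfolding IH1 using a ob obK by (simp add: pass_append K.tensor_interchange(1)[OF m] K.wh_cmp K.cmp_assoc)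
  finally show ?case .
qed

section \<open>The straightening isomorphisms\<close>

definition rho where "rho i Z = O.rw (O.cl (Gen (Rho i))) Z"

lemma arr_Rho [simp]:
  assumes "i \<in> pverts Q"
  shows "O.arr (O.cl (Gen (Rho i)))" "O.dom (O.cl (Gen (Rho i))) = [Black i]"
    "O.cod (O.cl (Gen (Rho i))) = [Black (\<tau> i)]"
  using O.arr_cl[OF mor_Rho] O.dom_cl[OF mor_Rho] O.cod_cl[OF mor_Rho] assms by auto

lemma arr_rho [simp]:
  assumes "i \<in> pverts Q" "O.ob Z"
  shows "O.arr (rho i Z)" "O.dom (rho i Z) = Black i # Z" "O.cod (rho i Z) = Black (\<tau> i) # Z"
  using assms by (simp_all add: rho_def)

lemma rw_rho [simp]: "\<lbrakk>i \<in> pverts Q; O.ob Z; O.ob W\<rbrakk> \<Longrightarrow> O.rw (rho i Z) W = rho i (Z @ W)"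
  by (simp add: rho_def)

lemma rho_commute:
  assumes "i \<in> pverts Q" "K.arr x"
  shows "rho i (K.cod x) \<star> jo (K.wh [Black i] x []) = jo (K.wh [Black (\<tau> i)] x []) \<star> rho i (K.dom x)"
  using JO.rw_commute[of "O.cl (Gen (Rho i))" x] assms by (simp add: rho_def)

lemma O_rel:
  assumes "(e, f) \<in> oKLRW_rels Q \<tau>" shows "O.cl e = O.cl f"
proof -
  obtain X Y where m: "mor (KLRW Q) (oKLRW_gens Q \<tau>) e X Y" "mor (KLRW Q) (oKLRW_gens Q \<tau>) f X Y"
    using oKLRW_rels_typed[OF assms(1)] by auto
  then show ?thesis using assms by (intro O.cl_eqI[of X Y] eqv.rel) auto
qed

lemma O_gens [simp]:
  "i \<in> pverts Q \<Longrightarrow> O.cl (dot i) = jo (kd i)"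
  "\<lbrakk>a \<in> gen_obj (KLRW Q :: ('v, 'k) pres); b \<in> gen_obj (KLRW Q :: ('v, 'k) pres); is_black a \<or> is_black b\<rbrakk>
    \<Longrightarrow> O.cl (sigma a b) = jo (kc a b)"
  by (simp_all add: JO.J_cl[OF mor_KLRW_gens(1)] JO.J_cl[OF mor_cross])

lemma rw_jo [simp]: "\<lbrakk>K.arr x; O.ob Z\<rbrakk> \<Longrightarrow> O.rw (jo x) Z = jo (K.wh [] x Z)"
  by (simp add: JO.J_rw[symmetric] K.rw_wh)

lemma rho_rho:
  assumes "i \<in> pverts Q" "O.ob Z"
  shows "rho (\<tau> i) Z \<star> rho i Z = O.idt (Black i # Z)"
  using arg_cong[OF O_rel[OF oKLRW_rels.rho_square[of i Q \<tau>]], of "\<lambda>x. O.rw x Z"] assms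
  by (simp add: O.cl_ops O.rw_cmp rho_def)

lemma rho_dot:
  assumes "i \<in> pverts Q" "O.ob Z"
  shows "rho i Z \<star> jo (K.wh [] (kd i) Z) = O.scl (- 1) (jo (K.wh [] (kd (\<tau> i)) Z) \<star> rho i Z)"
  using arg_cong[OF O_rel[OF oKLRW_rels.rho_dot[of i Q \<tau>]], of "\<lambda>x. O.rw x Z"] assms
  by (simp add: O.cl_comp O.cl_scale O.rw_cmp O.rw_scl rho_def)

lemma rho_cross:
  assumes "i \<in> pverts Q" "j \<in> pverts Q" "O.ob Z"
  defines "a \<equiv> Black i" and "b \<equiv> Black j" and "a' \<equiv> Black (\<tau> i)" and "b' \<equiv> Black (\<tau> j)"
  shows "jo (K.wh [] (kc b' a') Z) \<star> (rho j (a' # Z) \<star> (jo (K.wh [] (kc a' b) Z) \<star> rho i (b # Z))) =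
    rho i (b' # Z) \<star> (jo (K.wh [] (kc b' a) Z) \<star> (rho j (a # Z) \<star> jo (K.wh [] (kc a b) Z)))"
  using arg_cong[OF O_rel[OF oKLRW_rels.rho_cross[of i Q j a b a' \<tau> b']], of "\<lambda>x. O.rw x Z"] assms
  by (simp add: O.cl_comp O.cl_rw O.rw_cmp rho_def O.cmp_assoc)

text \<open>One step of straightening: the strand is carried to the far left, the only place where
  \<open>\<rho>\<close> acts.\<close>

definition turn where "turn i M = rho i M \<star> jo (pass (Black i) M)"

abbreviation neg_vert where "neg_vert i \<equiv> i \<in> pverts Q \<and> i \<notin> pverts Qp"

lemma arr_turn [simp]:
  assumes "neg_vert i" "Kp.ob M"
  shows "O.arr (turn i M)" "O.dom (turn i M) = M @ [Black i]" "O.cod (turn i M) = Black (\<tau> i) # M"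
  using assms by (simp_all add: turn_def)

lemma iso_turn:
  assumes "neg_vert i" "Kp.ob M" shows "O.iso (turn i M)"
proof -
  have "rho i M \<star> rho (\<tau> i) M = O.idt (Black (\<tau> i) # M)"
    using rho_rho[of "\<tau> i" M] assms by simp
  then have "O.iso (rho i M)"
    using assms rho_rho[of i M] by (intro O.isoI[of _ "rho (\<tau> i) M"]) simp_all
  then show ?thesis
    using assms iso_pass[of "Black i" M] by (simp add: turn_def O.iso_cmp JO.iso_J)
qed

text \<open>\<open>pass_natural\<close> moves \<open>x\<close> to the right of the strand. There it
  is disjoint from the strand at the far left and commutes with \<open>\<rho>\<close>.\<close>

lemma turn_natural:
  assumes "neg_vert i" "Kp.arr x"
  shows "turn i (Kp.cod x) \<star> jo (K.wh [] (jk x) [Black i]) =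
    jo (K.wh [Black (\<tau> i)] (jk x) []) \<star> turn i (Kp.dom x)"
proof -
  let ?a = "Black i" and ?M = "Kp.dom x" and ?N = "Kp.cod x"
  have ob: "Kp.ob ?M" "Kp.ob ?N" "K.ob ?M" "K.ob ?N" using assms by auto
  have "pass ?a ?N \<bullet> K.wh [] (jk x) [?a] = K.wh [?a] (jk x) [] \<bullet> pass ?a ?M"
    using pass_natural[of "KLRW Qp" "{}" "Kp.rep x" ?M ?N ?a] assms by (simp add: JK.J_rep)
  from arg_cong[OF this, of jo] ob
  have "jo (pass ?a ?N) \<star> jo (K.wh [] (jk x) [?a]) = jo (K.wh [?a] (jk x) []) \<star> jo (pass ?a ?M)"
    using assms by (simp add: JO.J_cmp)
  then have "turn i ?N \<star> jo (K.wh [] (jk x) [?a]) = (rho i ?N \<star> jo (K.wh [?a] (jk x) [])) \<star> jo (pass ?a ?M)"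
    by (simp add: turn_def O.cmp_assoc)
  also have "\<dots> = jo (K.wh [Black (\<tau> i)] (jk x) []) \<star> turn i ?M"
    using rho_commute[of i "jk x"] assms by (simp add: turn_def O.cmp_assoc)
  finally show ?thesis .
qed

text \<open>\<open>M\<close> is the prefix that is already straightened. A positive or red letter
  just joins it; a negative one is turned to its front while the remaining word waits on the
  right.\<close>

primrec straighten :: "'v letter list \<Rightarrow> 'v letter list \<Rightarrow> ('v, 'k) diagram set" where
  "straighten [] M = O.idt M"
| "straighten (a # Z) M = (case a of
     Black i \<Rightarrow> if i \<in> pverts Qp then straighten Z (M @ [a])
       else straighten Z (Black (\<tau> i) # M) \<star> O.rw (turn i M) Z
   | Red \<theta> \<Rightarrow> straighten Z (M @ [a]))"

lemma straighten_plus: "a \<in> gen_obj (KLRW Qp :: ('v, 'k) pres) \<Longrightarrow> straighten (a # Z) M = straighten Z (M @ [a])"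
  by (cases a) auto

lemma good_letter_cases:
  assumes "a \<in> good_letters"
  obtains (neg) i where "a = Black i" "neg_vert i" "minus a"
    | (pos) "a \<in> gen_obj (KLRW Qp :: ('v, 'k) pres)" "\<not> minus a"
  using assms by (cases a) auto

lemma arr_straighten [simp]:
  assumes "good Z" "Kp.ob M"
  shows "O.arr (straighten Z M)" "O.dom (straighten Z M) = M @ Z" "O.cod (straighten Z M) = mv M Z"
proof -
  have "O.arr (straighten Z M) \<and> O.dom (straighten Z M) = M @ Z \<and> O.cod (straighten Z M) = mv M Z"
    using assms
  proof (induction Z arbitrary: M)
    case Nil
    then show ?case by simp
  next
    case (Cons a Z)
    then have a: "a \<in> good_letters" and Z: "good Z" "K.ob Z" by auto
    from a show ?case
    proof (cases rule: good_letter_cases)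
      case (neg i)
      then show ?thesis using Cons Z by (simp add: mv_def)
    next
      case pos
      then show ?thesis using Cons Z by (simp add: straighten_plus mv_def del: straighten.simps)
    qed
  qed
  then show "O.arr (straighten Z M)" "O.dom (straighten Z M) = M @ Z" "O.cod (straighten Z M) = mv M Z"
    by auto
qed

lemma iso_straighten:
  assumes "good Z" "Kp.ob M" shows "O.iso (straighten Z M)"
  using assms
proof (induction Z arbitrary: M)
  case Nil
  then show ?case by simp
next
  case (Cons a Z)
  then have a: "a \<in> good_letters" and Z: "good Z" "K.ob Z" by auto
  from a show ?case
  proof (cases rule: good_letter_cases)
    case (neg i)
    then show ?thesis using Cons Z by (simp add: O.iso_cmp O.iso_rw iso_turn)
  next
    case pos
    then show ?thesis using Cons Z by (simp add: straighten_plus del: straighten.simps)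
  qed
qed

lemma straighten_append:
  assumes "good Z" "good W" "Kp.ob M"
  shows "straighten (Z @ W) M = straighten W (mv M Z) \<star> O.rw (straighten Z M) W"
  using assms(1,3)
proof (induction Z arbitrary: M)
  case Nil
  then show ?case using assms by simp
next
  case (Cons a Z)
  then have a: "a \<in> good_letters" and Z: "good Z" "K.ob Z" by auto
  have W: "K.ob W" using assms by simp
  from a show ?case
  proof (cases rule: good_letter_cases)
    case (neg i)
    then show ?thesis using Cons Z W by (simp add: O.rw_cmp mv_def O.cmp_assoc)
  next
    case pos
    then show ?thesis using Cons Z by (simp add: straighten_plus mv_def del: straighten.simps)
  qed
qed

text \<open>The induction is over all \<open>x\<close>, since each letter enlarges it: a positive or
  red letter is added to the right of \<open>x\<close>, and a negative one, by
  \<open>turn_natural\<close>, to its left. At the end \<open>x\<close> is surrounded exactly as in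
  \<open>wz\<close>.\<close>

lemma straighten_natural:
  assumes "good Z" "Kp.arr x"
  shows "straighten Z (Kp.cod x) \<star> jo (K.wh [] (jk x) Z) = jo (jk (wz Z x)) \<star> straighten Z (Kp.dom x)"
  using assms
proof (induction Z arbitrary: x)
  case Nil
  then show ?case by simp
next
  case (Cons a Z)
  then have a: "a \<in> good_letters" and "good Z" "K.ob Z" by auto
  moreover from calculation have "K.ob (a # Z)" by (intro good_ob_K) simp
  ultimately have Z: "good Z" "K.ob Z" "K.ob (a # Z)" by auto
  have ob: "Kp.ob (Kp.dom x)" "Kp.ob (Kp.cod x)" "K.ob (Kp.dom x)" "K.ob (Kp.cod x)" using Cons by auto
  from a show ?case
  proof (cases rule: good_letter_cases)
    case (neg i)
    let ?x = "Kp.wh [Black (\<tau> i)] x []"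
    have "straighten (a # Z) (Kp.cod x) \<star> jo (K.wh [] (jk x) (a # Z)) =
      straighten Z (Kp.cod ?x) \<star> O.rw (turn i (Kp.cod x) \<star> jo (K.wh [] (jk x) [Black i])) Z"
      using neg Cons.prems Z ob by (simp add: O.rw_cmp O.cmp_assoc)
    also have "\<dots> = (straighten Z (Kp.cod ?x) \<star> jo (K.wh [] (jk ?x) Z)) \<star> O.rw (turn i (Kp.dom x)) Z"
      using neg Cons.prems Z ob
      by (simp add: turn_natural O.rw_cmp O.cmp_assoc JK.J_wh)
    also have "\<dots> = jo (jk (wz Z ?x)) \<star> straighten (a # Z) (Kp.dom x)"
      using Cons.IH[of ?x] neg Cons.prems Z ob by (simp add: O.cmp_assoc)
    also have "wz Z ?x = wz (a # Z) x" using neg Z ob Cons.prems by (simp add: wz_def)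
    finally show ?thesis .
  next
    case pos
    let ?x = "Kp.wh [] x [a]"
    have "straighten Z (Kp.cod ?x) \<star> jo (K.wh [] (jk ?x) Z) = jo (jk (wz Z ?x)) \<star> straighten Z (Kp.dom ?x)"
      by (rule Cons.IH) (use pos Cons.prems Z ob in simp_all)
    moreover have "wz Z ?x = wz (a # Z) x" using pos Z ob Cons.prems by (simp add: wz_def)
    ultimately show ?thesis
      using pos Cons.prems Z ob by (simp add: straighten_plus JK.J_wh del: straighten.simps)
  qed
qed

text \<open>Dots and crossings only permute the letters of a word, so no generator connects a good
  word with a bad one. A composite or tensor product with mismatched ends has a mismatched factor
  and vanishes with it.\<close>

lemma cl_mismatch_K:
  assumes "mor P H e X Y" "P = KLRW Q" "H = {}" "good X \<noteq> good Y"
  shows "K.cl e = K.zer X Y"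
  using assms
proof (induction rule: mor.induct)
  case (mor_gen g X Y H)
  then have "(g, X, Y) \<in> KLRW_gens Q" by simp
  then have "good X = good Y" by cases auto
  then show ?case using mor_gen by simp
next
  case (mor_zero X Y H)
  then show ?case by (simp add: K.zer_def)
next
  case (mor_add H e X Y f)
  then have "K.ob X" "K.ob Y" using mor_lists by blast+
  then show ?case using mor_add by (simp add: K.cl_add)
next
  case (mor_scale H e X Y c)
  then have "K.ob X" "K.ob Y" using mor_lists by blast+
  then show ?case using mor_scale by (simp add: K.cl_scale)
next
  case (mor_comp H f X Y g Z)
  then have m: "mor (KLRW Q) {} f X Y" "mor (KLRW Q) {} g Y Z" by auto
  have ob: "K.ob X" "K.ob Y" "K.ob Z" using mor_lists m by blast+
  note [simp] = K.arr_cl[OF m(1)] K.arr_cl[OF m(2)] K.dom_cl[OF m(1)] K.dom_cl[OF m(2)]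
    K.cod_cl[OF m(1)] K.cod_cl[OF m(2)]
  show ?case using mor_comp ob by (cases "good X = good Y") (simp_all add: K.cl_comp)
next
  case (mor_tensor H e X Y f Z W)
  then have m: "mor (KLRW Q) {} e X Y" "mor (KLRW Q) {} f Z W" by auto
  have ob: "K.ob X" "K.ob Y" "K.ob Z" "K.ob W" using mor_lists m by blast+
  note [simp] = K.arr_cl[OF m(1)] K.arr_cl[OF m(2)] K.dom_cl[OF m(1)] K.dom_cl[OF m(2)]
    K.cod_cl[OF m(1)] K.cod_cl[OF m(2)]
  show ?case
  proof (cases "good X = good Y")
    case True
    then have "K.cl f = K.zer Z W" using mor_tensor by auto
    then show ?thesis using ob by (simp add: K.tensor_interchange(1)[OF m])
  next
    case False
    then show ?thesis using mor_tensor ob by (simp add: K.tensor_interchange(1)[OF m])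
  qed
qed simp

text \<open>\<open>Rho\<close> changes black letters only, and these are all good, so the argument
  for the KLRW category extends.\<close>

lemma cl_mismatch:
  assumes "mor P H e X Y" "P = KLRW Q" "H = oKLRW_gens Q \<tau>" "good X \<noteq> good Y"
  shows "O.cl e = O.zer X Y"
  using assms
proof (induction rule: mor.induct)
  case (mor_gen g X Y H)
  then consider "(g, X, Y) \<in> KLRW_gens Q" | "(g, X, Y) \<in> oKLRW_gens Q \<tau>" by auto
  then have "good X = good Y"
    by cases (auto elim!: KLRW_gens.cases simp: oKLRW_gens_def)
  then show ?case using mor_gen by simp
next
  case (mor_zero X Y H)
  then show ?case by (simp add: O.zer_def)
next
  case (mor_add H e X Y f)
  then have "O.ob X" "O.ob Y" using mor_lists by blast+
  then show ?case using mor_add by (simp add: O.cl_add)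
next
  case (mor_scale H e X Y c)
  then have "O.ob X" "O.ob Y" using mor_lists by blast+
  then show ?case using mor_scale by (simp add: O.cl_scale)
next
  case (mor_comp H f X Y g Z)
  then have m: "mor (KLRW Q) (oKLRW_gens Q \<tau>) f X Y" "mor (KLRW Q) (oKLRW_gens Q \<tau>) g Y Z" by auto
  have ob: "O.ob X" "O.ob Y" "O.ob Z" using mor_lists m by blast+
  note [simp] = O.arr_cl[OF m(1)] O.arr_cl[OF m(2)] O.dom_cl[OF m(1)] O.dom_cl[OF m(2)]
    O.cod_cl[OF m(1)] O.cod_cl[OF m(2)]
  show ?case using mor_comp ob by (cases "good X = good Y") (simp_all add: O.cl_comp)
next
  case (mor_tensor H e X Y f Z W)
  then have e: "mor (KLRW Q) (oKLRW_gens Q \<tau>) e X Y" and f: "mor (KLRW Q) {} f Z W" by auto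
  have ob: "O.ob X" "O.ob Y" "O.ob Z" "O.ob W" using mor_lists e f by blast+
  note [simp] = O.arr_cl[OF e] K.arr_cl[OF f] O.dom_cl[OF e] K.dom_cl[OF f] O.cod_cl[OF e] K.cod_cl[OF f]
  show ?case
  proof (cases "good X = good Y")
    case True
    then have "K.cl f = K.zer Z W" using mor_tensor by (intro cl_mismatch_K[OF f]) auto
    then show ?thesis using ob by (simp add: JO.tensor_interchange(1)[OF e f])
  next
    case False
    then show ?thesis using mor_tensor ob by (simp add: JO.tensor_interchange(1)[OF e f])
  qed
qed simp

section \<open>Diagrams correspond to their unfoldings under straightening\<close>

abbreviation jj where "jj x \<equiv> jo (jk x)"

lemma alpha_ty:
  assumes "mor (KLRW Q) {} e X Y" "good X" "good Y" "Kp.ob M"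
  shows "Kp.arr (alpha e M)" "Kp.dom (alpha e M) = mv M X" "Kp.cod (alpha e M) = mv M Y"
  using alpha_arr[OF assms(1) HOL.refl _ assms(2,3), of M] assms(4) by auto

text \<open>On a negative strand the dot slides to the far left and changes its sign when it meets
  \<open>\<rho>\<close>; this is the origin of the sign in \<open>galpha\<close>.\<close>

lemma straighten_dot:
  assumes "i \<in> pverts Q" "Kp.ob M"
  shows "straighten [Black i] M \<star> jo (K.wh M (kd i) []) = jj (alpha (dot i) M) \<star> straighten [Black i] M"
proof (cases "i \<in> pverts Qp")
  case True
  then show ?thesis using assms by (simp add: JK.J_wh)
next
  case False
  let ?a = "Black i"
  have "jo (pass ?a M \<bullet> K.wh M (kd i) []) = jo (K.wh [] (kd i) M \<bullet> pass ?a M)"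
    using pass_dot[of i M] assms False by simp
  then have P: "jo (pass ?a M) \<star> jo (K.wh M (kd i) []) = jo (K.wh [] (kd i) M) \<star> jo (pass ?a M)"
    using assms False by (simp add: JO.J_cmp)
  have "straighten [?a] M \<star> jo (K.wh M (kd i) []) = (rho i M \<star> jo (K.wh [] (kd i) M)) \<star> jo (pass ?a M)"
    using assms False P by (simp add: turn_def O.cmp_assoc)
  also have "\<dots> = jj (alpha (dot i) M) \<star> straighten [?a] M"
    using assms False
    by (simp add: rho_dot turn_def O.cmp_assoc O.cmp_scl_left JK.J_wh JK.J_scl JO.J_scl K.wh_scl)
  finally show ?thesis .
qed

text \<open>The crossing is carried to the left of \<open>M\<close> by \<open>pass_cross\<close>.
  There the relation between \<open>\<rho>\<close> and crossings moves it through the two turns,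
  from which it emerges reflected.\<close>

lemma straighten_cross_neg:
  assumes "neg_vert i" "neg_vert j" "Kp.ob M"
  shows "straighten [Black j, Black i] M \<star> jo (K.wh M (kc (Black i) (Black j)) []) =
    jo (K.wh [] (kc (Black (\<tau> j)) (Black (\<tau> i))) M) \<star> straighten [Black i, Black j] M"
proof -
  let ?a = "Black i" and ?b = "Black j" and ?a' = "Black (\<tau> i)" and ?b' = "Black (\<tau> j)"
  \<comment> \<open>Normal form of two successive turns: the passage of the second strand through
    \<open>M\<close> commutes with the first \<open>\<rho>\<close> and can be done before
    it.\<close>
  have st: "straighten [Black k, Black l] M =
    rho l (Black (\<tau> k) # M) \<star> (jo (K.wh [] (kc (Black (\<tau> k)) (Black l)) M) \<star>
      (rho k (Black l # M) \<star> (jo (K.wh [Black k] (pass (Black l) M) []) \<star> jo (K.wh [] (pass (Black k) M) [Black l]))))"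
    if "neg_vert k" "neg_vert l" for k l
    using that assms rho_commute[of k "pass (Black l) M"]
    by (simp add: turn_def O.rw_cmp JO.J_cmp O.cmp_assoc) (simp add: O.cmp_assoc[symmetric])
  have ab: "minus ?a" "minus ?b" "?a \<in> good_letters" "?b \<in> good_letters" using assms by auto
  have "jo (K.wh [] (kc ?a ?b) M \<bullet> (K.wh [?a] (pass ?b M) [] \<bullet> K.wh [] (pass ?a M) [?b])) =
    jo (K.wh [?b] (pass ?a M) [] \<bullet> (K.wh [] (pass ?b M) [?a] \<bullet> K.wh M (kc ?a ?b) []))"
    using pass_cross[of ?a ?b M] assms ab by simp
  then have P: "jo (K.wh [] (kc ?a ?b) M) \<star> (jo (K.wh [?a] (pass ?b M) []) \<star> jo (K.wh [] (pass ?a M) [?b])) =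
    jo (K.wh [?b] (pass ?a M) []) \<star> (jo (K.wh [] (pass ?b M) [?a]) \<star> jo (K.wh M (kc ?a ?b) []))"
    using assms ab by (simp add: JO.J_cmp)
  have "straighten [?b, ?a] M \<star> jo (K.wh M (kc ?a ?b) []) =
    rho i (?b' # M) \<star> (jo (K.wh [] (kc ?b' ?a) M) \<star> (rho j (?a # M) \<star> (jo (K.wh [] (kc ?a ?b) M) \<star>
      (jo (K.wh [?a] (pass ?b M) []) \<star> jo (K.wh [] (pass ?a M) [?b])))))"
    unfolding st[OF assms(2,1)] P by (simp add: O.cmp_assoc)
  also have "\<dots> = (rho i (?b' # M) \<star> (jo (K.wh [] (kc ?b' ?a) M) \<star> (rho j (?a # M) \<star> jo (K.wh [] (kc ?a ?b) M)))) \<star>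
      (jo (K.wh [?a] (pass ?b M) []) \<star> jo (K.wh [] (pass ?a M) [?b]))"
    by (simp add: O.cmp_assoc)
  also have "\<dots> = (jo (K.wh [] (kc ?b' ?a') M) \<star> (rho j (?a' # M) \<star> (jo (K.wh [] (kc ?a' ?b) M) \<star> rho i (?b # M)))) \<star>
      (jo (K.wh [?a] (pass ?b M) []) \<star> jo (K.wh [] (pass ?a M) [?b]))"
    using rho_cross[of i j M] assms by simp
  also have "\<dots> = jo (K.wh [] (kc ?b' ?a') M) \<star> straighten [?a, ?b] M"
    unfolding st[OF assms(1,2)] by (simp add: O.cmp_assoc)
  finally show ?thesis .
qed

text \<open>If just one letter is negative, one of the two straightenings contains a crossing of the
  two letters. It is inverse to the given crossing when \<open>a\<close> is negative, and equal to
  it when \<open>b\<close> is; in both cases what remains is the identity prescribed by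
  \<open>galpha\<close>.\<close>

lemma straighten_cross:
  assumes "a \<in> good_letters" "b \<in> good_letters" "is_black a \<or> is_black b" "Kp.ob M"
  shows "straighten [b, a] M \<star> jo (K.wh M (kc a b) []) = jj (alpha (sigma a b) M) \<star> straighten [a, b] M"
  using assms(1)
proof (cases rule: good_letter_cases)
  case (neg i)
  note a = neg
  from assms(2) show ?thesis
  proof (cases rule: good_letter_cases)
    case (neg j)
    then show ?thesis
      using straighten_cross_neg[of i j M] a assms by (simp add: JK.J_wh del: straighten.simps)
  next
    case pos
    have "K.wh M (kc b a) [] \<bullet> K.wh M (kc a b) [] = K.idt (M @ [a, b])"
      using kc_kc_mixed(1)[of a b] a pos assms is_black_minus[of a] by (simp add: K.wh_cmp[symmetric])
    then have "jo (K.wh M (kc b a) []) \<star> jo (K.wh M (kc a b) []) = O.idt (M @ [a, b])"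
      using a pos assms is_black_minus[of a] by (simp add: JO.J_cmp[symmetric])
    moreover have "straighten [b, a] M = rho i (M @ [b]) \<star> (jo (K.wh [] (pass a M) [b]) \<star> jo (K.wh M (kc b a) []))"
      using a pos assms by (simp add: straighten_plus turn_def pass_append JO.J_cmp del: straighten.simps(2))
        (simp add: turn_def pass_append JO.J_cmp)
    moreover have "straighten [a, b] M = rho i (M @ [b]) \<star> jo (K.wh [] (pass a M) [b])"
      using a pos assms plus_letter_in_Q[OF pos(1)] by (cases b) (simp_all add: turn_def O.rw_cmp)
    moreover have "alpha (sigma a b) M = Kp.idt (mv M [a, b])"
      using a pos by simp
    ultimately show ?thesis
      using a pos assms by (simp add: O.cmp_assoc mv_def del: straighten.simps alpha.simps)
  qed
next
  case pos
  note a = pos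
  from assms(2) show ?thesis
  proof (cases rule: good_letter_cases)
    case (neg j)
    have "straighten [a, b] M = rho j (M @ [a]) \<star> (jo (K.wh [] (pass b M) [a]) \<star> jo (K.wh M (kc a b) []))"
      using a neg assms by (simp add: straighten_plus turn_def pass_append JO.J_cmp del: straighten.simps(2))
        (simp add: turn_def pass_append JO.J_cmp)
    moreover have "straighten [b, a] M = rho j (M @ [a]) \<star> jo (K.wh [] (pass b M) [a])"
      using a neg assms plus_letter_in_Q[OF a(1)] by (cases a) (simp_all add: turn_def O.rw_cmp)
    moreover have "alpha (sigma a b) M = Kp.idt (mv M [a, b])"
      using a neg by simp
    ultimately show ?thesis
      using a neg assms by (simp add: O.cmp_assoc mv_def del: straighten.simps alpha.simps)
  next
    case pos
    then have "straighten [a, b] M = O.idt (M @ [a, b])" "straighten [b, a] M = O.idt (M @ [b, a])"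
      using a by (simp_all add: straighten_plus del: straighten.simps(2))
    then show ?thesis using a pos assms by (simp add: JK.J_wh del: straighten.simps)
  qed
qed

text \<open>The diagram stands to the right of an arbitrary straightened word, because it may be the
  right factor of a tensor product. A composite through a bad word is zero on both sides by
  \<open>cl_mismatch_K\<close>.\<close>

lemma straighten_alpha_K:
  assumes "mor P H f X Y" "P = KLRW Q" "H = {}" "good X" "good Y" "Kp.ob M"
  shows "straighten Y M \<star> jo (K.wh M (K.cl f) []) = jj (alpha f M) \<star> straighten X M"
  using assms
proof (induction arbitrary: M rule: mor.induct)
  case (mor_gen g X Y H)
  then have "(g, X, Y) \<in> KLRW_gens Q" by simp
  then consider i where "g = Dot i" "X = [Black i]" "Y = [Black i]" "i \<in> pverts Q"
    | a b where "g = Cross a b" "X = [a, b]" "Y = [b, a]" "is_black a \<or> is_black b"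
    by cases (use that in \<open>(simp; fail)+\<close>)
  then show ?case
  proof cases
    case 1
    then show ?thesis using straighten_dot[of i M] mor_gen by simp
  next
    case 2
    then have "a \<in> good_letters" "b \<in> good_letters" using mor_gen by auto
    then show ?thesis using straighten_cross[of a b M] 2 mor_gen by simp
  qed
next
  case (mor_id X H)
  then have "K.ob X" by auto
  then show ?case using mor_id by (simp add: K.idt_def[symmetric])
next
  case (mor_zero X Y H)
  then have "K.ob X" "K.ob Y" by auto
  then show ?case using mor_zero by (simp add: K.zer_def[symmetric])
next
  case (mor_add H e X Y f)
  then have m: "mor (KLRW Q) {} e X Y" "mor (KLRW Q) {} f X Y" by auto
  note [simp] = K.arr_cl[OF m(1)] K.arr_cl[OF m(2)] K.dom_cl[OF m(1)] K.dom_cl[OF m(2)]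
    K.cod_cl[OF m(1)] K.cod_cl[OF m(2)] alpha_ty[OF m(1)] alpha_ty[OF m(2)]
  show ?case using mor_add
    by (simp add: K.cl_add K.wh_pls JO.J_pls JK.J_pls O.cmp_pls_left O.cmp_pls_right)
next
  case (mor_scale H e X Y c)
  then have m: "mor (KLRW Q) {} e X Y" by auto
  note [simp] = K.arr_cl[OF m(1)] K.dom_cl[OF m(1)] K.cod_cl[OF m(1)] alpha_ty[OF m(1)]
  show ?case using mor_scale
    by (simp add: K.cl_scale K.wh_scl JO.J_scl JK.J_scl O.cmp_scl_left O.cmp_scl_right)
next
  case (mor_comp H f X Y g Z)
  then have m: "mor (KLRW Q) {} f X Y" "mor (KLRW Q) {} g Y Z" by auto
  note [simp] = K.arr_cl[OF m(1)] K.arr_cl[OF m(2)] K.dom_cl[OF m(1)] K.dom_cl[OF m(2)]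
    K.cod_cl[OF m(1)] K.cod_cl[OF m(2)]
  have ob: "K.ob X" "K.ob Y" "K.ob Z" "K.ob M"
    using mor_lists[OF m(1)] mor_lists[OF m(2)] mor_comp.prems by simp_all
  show ?case
  proof (cases "good Y")
    case False
    then have "K.cl f = K.zer X Y" using cl_mismatch_K[OF m(1)] mor_comp by blast
    then show ?thesis using False ob mor_comp by (simp add: alpha_comp[OF m] K.cl_comp del: alpha.simps)
  next
    case True
    note [simp] = alpha_ty[OF m(1) _ True] alpha_ty[OF m(2) True]
    have "straighten Z M \<star> jo (K.wh M (K.cl (g \<circ>\<^sub>e f)) []) =
      (straighten Z M \<star> jo (K.wh M (K.cl g) [])) \<star> jo (K.wh M (K.cl f) [])"
      using ob by (simp add: K.cl_comp K.wh_cmp JO.J_cmp O.cmp_assoc)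
    also have "\<dots> = jj (alpha g M) \<star> (straighten Y M \<star> jo (K.wh M (K.cl f) []))"
      using mor_comp True by (simp add: O.cmp_assoc)
    also have "\<dots> = jj (alpha g M) \<star> (jj (alpha f M) \<star> straighten X M)"
      using mor_comp True by simp
    also have "\<dots> = jj (alpha (g \<circ>\<^sub>e f) M) \<star> straighten X M"
      using True mor_comp.prems
      by (simp add: alpha_comp[OF m] JK.J_cmp JO.J_cmp O.cmp_assoc del: alpha.simps)
    finally show ?thesis .
  qed
next
  case (mor_tensor H e X Y f Z W)
  then have m: "mor (KLRW Q) {} e X Y" "mor (KLRW Q) {} f Z W" by auto
  have good: "good X" "good Y" "good Z" "good W" using mor_tensor by auto
  then have ob: "K.ob X" "K.ob Y" "K.ob Z" "K.ob W" "K.ob M" "Kp.ob (mv M Y)" "K.ob (mv M Y)" "Kp.ob (mv M X)"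
    using mor_tensor by simp_all
  note [simp] = K.arr_cl[OF m(1)] K.arr_cl[OF m(2)] K.dom_cl[OF m(1)] K.dom_cl[OF m(2)]
    K.cod_cl[OF m(1)] K.cod_cl[OF m(2)] alpha_ty[OF m(1) good(1,2)] alpha_ty[OF m(2) good(3,4)]
  \<comment> \<open>The straightening of the left factor does not touch the strands of
    \<open>f\<close>.\<close>
  have C: "O.rw (straighten Y M) W \<star> jo (K.wh (M @ Y) (K.cl f) []) =
    jo (K.wh (mv M Y) (K.cl f) []) \<star> O.rw (straighten Y M) Z"
    using JO.rw_commute[of "straighten Y M" "K.cl f"] good mor_tensor.prems by simp
  have "straighten (Y @ W) M \<star> jo (K.wh M (K.cl (e \<otimes>\<^sub>e f)) []) =
    straighten W (mv M Y) \<star> ((O.rw (straighten Y M) W \<star> jo (K.wh (M @ Y) (K.cl f) [])) \<star> jo (K.wh M (K.cl e) Z))"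
    using good ob mor_tensor.prems
    by (simp add: straighten_append K.tensor_interchange(1)[OF m] K.wh_cmp JO.J_cmp O.cmp_assoc)
  also have "\<dots> = (straighten W (mv M Y) \<star> jo (K.wh (mv M Y) (K.cl f) [])) \<star>
      O.rw (straighten Y M \<star> jo (K.wh M (K.cl e) [])) Z"
    unfolding C using good ob mor_tensor.prems by (simp add: O.rw_cmp O.cmp_assoc)
  also have "\<dots> = jj (alpha f (mv M Y)) \<star> ((straighten Z (mv M Y) \<star> jo (K.wh [] (jk (alpha e M)) Z)) \<star> O.rw (straighten X M) Z)"
    using mor_tensor good ob by (simp add: O.rw_cmp O.cmp_assoc)
  \<comment> \<open>The strands of \<open>Z\<close> are straightened around the image of
    \<open>e\<close>.\<close>
  also have "\<dots> = jj (alpha f (mv M Y)) \<star> ((jj (wz Z (alpha e M)) \<star> straighten Z (mv M X)) \<star> O.rw (straighten X M) Z)"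
    using straighten_natural[of Z "alpha e M"] good ob mor_tensor.prems by simp
  also have "\<dots> = jj (alpha (e \<otimes>\<^sub>e f) M) \<star> straighten (X @ Z) M"
    using good ob mor_tensor.prems
    by (simp add: straighten_append alpha_tensor[OF m] JK.J_cmp JO.J_cmp O.cmp_assoc del: alpha.simps)
  finally show ?case .
qed

lemma alpha_ty_O:
  assumes "mor (KLRW Q) (oKLRW_gens Q \<tau>) e X Y" "good X" "good Y"
  shows "Kp.arr (alpha e [])" "Kp.dom (alpha e []) = mv [] X" "Kp.cod (alpha e []) = mv [] Y"
  using alpha_arr[OF assms(1) HOL.refl _ assms(2,3), of "[]"] by (auto simp: base_ok_def)

text \<open>With \<open>\<rho>\<close> present only the empty base makes sense. Right tensor factors
  are free of \<open>\<rho>\<close> and are covered by \<open>straighten_alpha_K\<close> on the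
  straightened left factor.\<close>

lemma straighten_alpha:
  assumes "mor P H f X Y" "P = KLRW Q" "H = oKLRW_gens Q \<tau>" "good X" "good Y"
  shows "straighten Y [] \<star> O.cl f = jj (alpha f []) \<star> straighten X []"
  using assms
proof (induction rule: mor.induct)
  case (mor_gen g X Y H)
  then consider "(g, X, Y) \<in> KLRW_gens Q" | i where "g = Rho i" "X = [Black i]" "Y = [Black (\<tau> i)]" "i \<in> pverts Q"
    by (auto simp: oKLRW_gens_def)
  then show ?case
  proof cases
    case 1
    then have m: "mor (KLRW Q) {} (Gen g :: ('v, 'k) diagram) X Y"
      by (intro mor.mor_gen) (use mor_gen in auto)
    then show ?thesis
      using straighten_alpha_K[OF m, of "[]"] mor_gen K.arr_cl[OF m] JO.J_cl[OF m] by simp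
  next
    case 2
    \<comment> \<open>\<open>Rho i\<close> is the straightening of its source if \<open>i\<close> is
      negative, and the inverse of the straightening of its target if \<open>i\<close> is
      positive.\<close>
    then show ?thesis
      using rho_rho[of i "[]"] rho_rho[of "\<tau> i" "[]"]
      by (cases "i \<in> pverts Qp") (simp_all add: turn_def mv_def, simp_all add: rho_def)
  qed
next
  case (mor_id X H)
  then show ?case by (simp add: O.idt_def[symmetric])
next
  case (mor_zero X Y H)
  then show ?case by (simp add: O.zer_def[symmetric])
next
  case (mor_add H e X Y f)
  then have m: "mor (KLRW Q) (oKLRW_gens Q \<tau>) e X Y" "mor (KLRW Q) (oKLRW_gens Q \<tau>) f X Y" by auto
  note [simp] = O.arr_cl[OF m(1)] O.arr_cl[OF m(2)] O.dom_cl[OF m(1)] O.dom_cl[OF m(2)]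
    O.cod_cl[OF m(1)] O.cod_cl[OF m(2)] alpha_ty_O[OF m(1)] alpha_ty_O[OF m(2)]
  show ?case using mor_add
    by (simp add: O.cl_add JO.J_pls JK.J_pls O.cmp_pls_left O.cmp_pls_right)
next
  case (mor_scale H e X Y c)
  then have m: "mor (KLRW Q) (oKLRW_gens Q \<tau>) e X Y" by auto
  note [simp] = O.arr_cl[OF m(1)] O.dom_cl[OF m(1)] O.cod_cl[OF m(1)] alpha_ty_O[OF m(1)]
  show ?case using mor_scale
    by (simp add: O.cl_scale JO.J_scl JK.J_scl O.cmp_scl_left O.cmp_scl_right)
next
  case (mor_comp H f X Y g Z)
  then have m: "mor (KLRW Q) (oKLRW_gens Q \<tau>) f X Y" "mor (KLRW Q) (oKLRW_gens Q \<tau>) g Y Z" by auto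
  note [simp] = O.arr_cl[OF m(1)] O.arr_cl[OF m(2)] O.dom_cl[OF m(1)] O.dom_cl[OF m(2)]
    O.cod_cl[OF m(1)] O.cod_cl[OF m(2)]
  have ob: "O.ob X" "O.ob Y" "O.ob Z"
    using mor_lists[OF m(1)] mor_lists[OF m(2)] by simp_all
  show ?case
  proof (cases "good Y")
    case False
    then have "O.cl f = O.zer X Y" using cl_mismatch[OF m(1)] mor_comp by blast
    then show ?thesis using False ob mor_comp by (simp add: alpha_comp[OF m order_refl] O.cl_comp del: alpha.simps)
  next
    case True
    note [simp] = alpha_ty_O[OF m(1) _ True] alpha_ty_O[OF m(2) True]
    have "straighten Z [] \<star> O.cl (g \<circ>\<^sub>e f) = (straighten Z [] \<star> O.cl g) \<star> O.cl f"
      by (simp add: O.cl_comp O.cmp_assoc)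
    also have "\<dots> = jj (alpha g []) \<star> (straighten Y [] \<star> O.cl f)"
      using mor_comp True by (simp add: O.cmp_assoc)
    also have "\<dots> = jj (alpha g []) \<star> (jj (alpha f []) \<star> straighten X [])"
      using mor_comp True by simp
    also have "\<dots> = jj (alpha (g \<circ>\<^sub>e f) []) \<star> straighten X []"
      using True mor_comp.prems
      by (simp add: alpha_comp[OF m order_refl] JK.J_cmp JO.J_cmp O.cmp_assoc del: alpha.simps)
    finally show ?thesis .
  qed
next
  case (mor_tensor H e X Y f Z W)
  then have e: "mor (KLRW Q) (oKLRW_gens Q \<tau>) e X Y" and f: "mor (KLRW Q) {} f Z W" by auto
  have good: "good X" "good Y" "good Z" "good W" using mor_tensor by auto
  then have ob: "K.ob X" "K.ob Y" "K.ob Z" "K.ob W" "Kp.ob (mv [] Y)" "K.ob (mv [] Y)" "Kp.ob (mv [] X)"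
    by simp_all
  note [simp] = O.arr_cl[OF e] K.arr_cl[OF f] O.dom_cl[OF e] K.dom_cl[OF f]
    O.cod_cl[OF e] K.cod_cl[OF f] alpha_ty_O[OF e good(1,2)] alpha_ty[OF f good(3,4)]
  have C: "O.rw (straighten Y []) W \<star> jo (K.wh Y (K.cl f) []) =
    jo (K.wh (mv [] Y) (K.cl f) []) \<star> O.rw (straighten Y []) Z"
    using JO.rw_commute[of "straighten Y []" "K.cl f"] good by simp
  have "straighten (Y @ W) [] \<star> O.cl (e \<otimes>\<^sub>e f) =
    straighten W (mv [] Y) \<star> ((O.rw (straighten Y []) W \<star> jo (K.wh Y (K.cl f) [])) \<star> O.rw (O.cl e) Z)"
    using good ob by (simp add: straighten_append JO.tensor_interchange(1)[OF e f] O.cmp_assoc)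
  also have "\<dots> = (straighten W (mv [] Y) \<star> jo (K.wh (mv [] Y) (K.cl f) [])) \<star>
      O.rw (straighten Y [] \<star> O.cl e) Z"
    unfolding C using good ob by (simp add: O.rw_cmp O.cmp_assoc)
  also have "\<dots> = jj (alpha f (mv [] Y)) \<star> ((straighten Z (mv [] Y) \<star> jo (K.wh [] (jk (alpha e [])) Z)) \<star> O.rw (straighten X []) Z)"
    using mor_tensor.IH(1) mor_tensor.prems straighten_alpha_K[OF f HOL.refl HOL.refl good(3,4), of "mv [] Y"] good ob
    by (simp add: O.rw_cmp O.cmp_assoc)
  also have "\<dots> = jj (alpha f (mv [] Y)) \<star> ((jj (wz Z (alpha e [])) \<star> straighten Z (mv [] X)) \<star> O.rw (straighten X []) Z)"
    using straighten_natural[of Z "alpha e []"] good ob by simp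
  also have "\<dots> = jj (alpha (e \<otimes>\<^sub>e f) []) \<star> straighten (X @ Z) []"
    using good ob
    by (simp add: straighten_append alpha_tensor[OF e f order_refl] JK.J_cmp JO.J_cmp O.cmp_assoc del: alpha.simps)
  finally show ?case .
qed

end

section \<open>Equivalences from fully faithful, essentially surjective functors\<close>

text \<open>Conjugation with chosen isomorphisms \<open>\<epsilon>\<close> turns a morphism of
  \<open>D\<close> into one between objects in the image of \<open>F\<^sub>0\<close>, which lifts
  uniquely through \<open>F\<^sub>1\<close>. Uniqueness of the lift yields functoriality and
  linearity of the inverse.\<close>

lemma equivalent_categoriesI:
  fixes C :: "('o, 'a, 'k::field) lincat" and D :: "('p, 'b, 'k) lincat"
  assumes C: "linear_category C" and D: "linear_category D" and F: "linear_functor C D F\<^sub>0 F\<^sub>1"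
    and ff: "\<And>X Y. \<lbrakk>X \<in> obj C; Y \<in> obj C\<rbrakk>
      \<Longrightarrow> bij_betw (F\<^sub>1 X Y) (carrier (Hom C X Y)) (carrier (Hom D (F\<^sub>0 X) (F\<^sub>0 Y)))"
    and es: "\<And>Y. Y \<in> obj D \<Longrightarrow> \<exists>X\<in>obj C. \<exists>f. isomorphism D (F\<^sub>0 X) Y f"
  shows "equivalent_categories C D"
proof -
  interpret C: linear_category C by fact
  interpret D: linear_category D by fact
  have F0: "F\<^sub>0 X \<in> obj D" if "X \<in> obj C" for X
    using F that by (simp add: linear_functor_def)
  have F1: "F\<^sub>1 X Y f \<in> carrier (Hom D (F\<^sub>0 X) (F\<^sub>0 Y))"
    and F_add: "g \<in> carrier (Hom C X Y) \<Longrightarrow>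
      F\<^sub>1 X Y (f \<oplus>\<^bsub>Hom C X Y\<^esub> g) = F\<^sub>1 X Y f \<oplus>\<^bsub>Hom D (F\<^sub>0 X) (F\<^sub>0 Y)\<^esub> F\<^sub>1 X Y g"
    and F_smult: "F\<^sub>1 X Y (c \<odot>\<^bsub>Hom C X Y\<^esub> f) = c \<odot>\<^bsub>Hom D (F\<^sub>0 X) (F\<^sub>0 Y)\<^esub> F\<^sub>1 X Y f"
    if "X \<in> obj C" "Y \<in> obj C" "f \<in> carrier (Hom C X Y)" for X Y f g c
    using F that by (simp_all add: linear_functor_def)
  have F_id: "F\<^sub>1 X X (ident C X) = ident D (F\<^sub>0 X)" if "X \<in> obj C" for X
    using F that by (simp add: linear_functor_def)
  have F_comp: "F\<^sub>1 X Z (comp C X Y Z g f) = comp D (F\<^sub>0 X) (F\<^sub>0 Y) (F\<^sub>0 Z) (F\<^sub>1 Y Z g) (F\<^sub>1 X Y f)"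
    if "X \<in> obj C" "Y \<in> obj C" "Z \<in> obj C" "f \<in> carrier (Hom C X Y)" "g \<in> carrier (Hom C Y Z)" for X Y Z f g
    using F that by (simp add: linear_functor_def)
  obtain G\<^sub>0 \<epsilon> where G0: "\<And>Y. Y \<in> obj D \<Longrightarrow> G\<^sub>0 Y \<in> obj C"
    and iso: "\<And>Y. Y \<in> obj D \<Longrightarrow> isomorphism D (F\<^sub>0 (G\<^sub>0 Y)) Y (\<epsilon> Y)"
    using es by metis
  obtain \<delta> where eps: "\<And>Y. Y \<in> obj D \<Longrightarrow> \<epsilon> Y \<in> carrier (Hom D (F\<^sub>0 (G\<^sub>0 Y)) Y)"
    and del: "\<And>Y. Y \<in> obj D \<Longrightarrow> \<delta> Y \<in> carrier (Hom D Y (F\<^sub>0 (G\<^sub>0 Y)))"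
    and del_eps: "\<And>Y. Y \<in> obj D \<Longrightarrow> comp D (F\<^sub>0 (G\<^sub>0 Y)) Y (F\<^sub>0 (G\<^sub>0 Y)) (\<delta> Y) (\<epsilon> Y) = ident D (F\<^sub>0 (G\<^sub>0 Y))"
    and eps_del: "\<And>Y. Y \<in> obj D \<Longrightarrow> comp D Y (F\<^sub>0 (G\<^sub>0 Y)) Y (\<epsilon> Y) (\<delta> Y) = ident D Y"
    using iso unfolding isomorphism_def by metis
  define Fi where "Fi X Y = inv_into (carrier (Hom C X Y)) (F\<^sub>1 X Y)" for X Y
  have Fi: "Fi X Y g \<in> carrier (Hom C X Y)" "F\<^sub>1 X Y (Fi X Y g) = g"
    if "X \<in> obj C" "Y \<in> obj C" "g \<in> carrier (Hom D (F\<^sub>0 X) (F\<^sub>0 Y))" for X Y g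
    using ff[OF that(1,2)] that(3) unfolding Fi_def
    by (auto simp: bij_betw_def inv_into_into f_inv_into_f)
  have Fi_eq: "Fi X Y g = f" if "X \<in> obj C" "Y \<in> obj C" "f \<in> carrier (Hom C X Y)" "F\<^sub>1 X Y f = g" for X Y f g
    using ff[OF that(1,2)] that(3,4) unfolding Fi_def by (auto simp: bij_betw_def)
  define conj where "conj X Y g =
    comp D (F\<^sub>0 (G\<^sub>0 X)) Y (F\<^sub>0 (G\<^sub>0 Y)) (\<delta> Y) (comp D (F\<^sub>0 (G\<^sub>0 X)) X Y g (\<epsilon> X))" for X Y g
  define G\<^sub>1 where "G\<^sub>1 X Y g = Fi (G\<^sub>0 X) (G\<^sub>0 Y) (conj X Y g)" for X Y g
  note ob = F0 G0
  have conj: "conj X Y g \<in> carrier (Hom D (F\<^sub>0 (G\<^sub>0 X)) (F\<^sub>0 (G\<^sub>0 Y)))"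
    if "X \<in> obj D" "Y \<in> obj D" "g \<in> carrier (Hom D X Y)" for X Y g
    unfolding conj_def using that by (intro D.comp_closed ob eps del)
  have G1: "G\<^sub>1 X Y g \<in> carrier (Hom C (G\<^sub>0 X) (G\<^sub>0 Y))" "F\<^sub>1 (G\<^sub>0 X) (G\<^sub>0 Y) (G\<^sub>1 X Y g) = conj X Y g"
    if "X \<in> obj D" "Y \<in> obj D" "g \<in> carrier (Hom D X Y)" for X Y g
    unfolding G\<^sub>1_def using Fi[OF G0 G0 conj] that by auto
  have eps_conj: "comp D (F\<^sub>0 (G\<^sub>0 X)) (F\<^sub>0 (G\<^sub>0 Y)) Y (\<epsilon> Y) (conj X Y g) = comp D (F\<^sub>0 (G\<^sub>0 X)) X Y g (\<epsilon> X)"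
    if "X \<in> obj D" "Y \<in> obj D" "g \<in> carrier (Hom D X Y)" for X Y g
  proof -
    have "comp D (F\<^sub>0 (G\<^sub>0 X)) X Y g (\<epsilon> X) \<in> carrier (Hom D (F\<^sub>0 (G\<^sub>0 X)) Y)"
      using that by (intro D.comp_closed ob eps)
    then show ?thesis
      unfolding conj_def using that
      by (subst D.comp_assoc) (simp_all add: ob eps del eps_del D.comp_ident_left)
  qed
  \<comment> \<open>Since \<open>\<epsilon> Y\<close> is invertible, the conjugate of
    \<open>g\<close> is characterised by its composite with \<open>\<epsilon> Y\<close>.\<close>
  have conj_eq: "conj X Y g = h"
    if "X \<in> obj D" "Y \<in> obj D" "g \<in> carrier (Hom D X Y)" "h \<in> carrier (Hom D (F\<^sub>0 (G\<^sub>0 X)) (F\<^sub>0 (G\<^sub>0 Y)))"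
      "comp D (F\<^sub>0 (G\<^sub>0 X)) (F\<^sub>0 (G\<^sub>0 Y)) Y (\<epsilon> Y) h = comp D (F\<^sub>0 (G\<^sub>0 X)) X Y g (\<epsilon> X)" for X Y g h
    unfolding conj_def that(5)[symmetric] using that(1-4)
    by (subst D.comp_assoc) (simp_all add: ob eps del del_eps D.comp_ident_left)
  note Dmod = D.Hom_module[THEN module.axioms(2)] and Cmod = C.Hom_module[THEN module.axioms(2)]
  have G: "linear_functor D C G\<^sub>0 G\<^sub>1"
    unfolding linear_functor_def
  proof (intro conjI ballI allI)
    fix X Y assume XY: "X \<in> obj D" "Y \<in> obj D"
    fix f assume f: "f \<in> carrier (Hom D X Y)"
    show "G\<^sub>1 X Y f \<in> carrier (Hom C (G\<^sub>0 X) (G\<^sub>0 Y))" using G1 XY f by blast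
    {
      fix g assume g: "g \<in> carrier (Hom D X Y)"
      have fg: "f \<oplus>\<^bsub>Hom D X Y\<^esub> g \<in> carrier (Hom D X Y)"
        using D.Hom_module[OF XY] f g by (simp add: abelian_monoid.a_closed abelian_group_def module_def)
      have "conj X Y (f \<oplus>\<^bsub>Hom D X Y\<^esub> g) = conj X Y f \<oplus>\<^bsub>Hom D (F\<^sub>0 (G\<^sub>0 X)) (F\<^sub>0 (G\<^sub>0 Y))\<^esub> conj X Y g"
        unfolding conj_def using XY f g fg
        by (simp add: D.comp_add_left D.comp_add_right ob eps del D.comp_closed)
      then show "G\<^sub>1 X Y (f \<oplus>\<^bsub>Hom D X Y\<^esub> g) = G\<^sub>1 X Y f \<oplus>\<^bsub>Hom C (G\<^sub>0 X) (G\<^sub>0 Y)\<^esub> G\<^sub>1 X Y g"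
        using XY f g G1 C.Hom_module[OF G0 G0, OF XY] unfolding G\<^sub>1_def[of X Y "f \<oplus>\<^bsub>Hom D X Y\<^esub> g"]
        by (intro Fi_eq) (simp_all add: ob F_add abelian_monoid.a_closed abelian_group_def module_def)
    }
    fix c
    have "conj X Y (c \<odot>\<^bsub>Hom D X Y\<^esub> f) = c \<odot>\<^bsub>Hom D (F\<^sub>0 (G\<^sub>0 X)) (F\<^sub>0 (G\<^sub>0 Y))\<^esub> conj X Y f"
      unfolding conj_def using XY f
      by (simp add: D.comp_smult_left D.comp_smult_right ob eps del D.comp_closed)
    then show "G\<^sub>1 X Y (c \<odot>\<^bsub>Hom D X Y\<^esub> f) = c \<odot>\<^bsub>Hom C (G\<^sub>0 X) (G\<^sub>0 Y)\<^esub> G\<^sub>1 X Y f"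
      using XY f G1 C.Hom_module[OF G0 G0, OF XY] unfolding G\<^sub>1_def[of X Y "c \<odot>\<^bsub>Hom D X Y\<^esub> f"]
      by (intro Fi_eq) (simp_all add: ob F_smult module.smult_closed scalars_def)
  next
    fix X assume X: "X \<in> obj D"
    show "G\<^sub>1 X X (ident D X) = ident C (G\<^sub>0 X)"
      unfolding G\<^sub>1_def using X
      by (intro Fi_eq conj_eq[symmetric])
        (simp_all add: ob F_id C.ident_closed D.ident_closed D.comp_ident_left D.comp_ident_right eps)
  next
    fix X Y Z assume XYZ: "X \<in> obj D" "Y \<in> obj D" "Z \<in> obj D"
    fix f g assume fg: "f \<in> carrier (Hom D X Y)" "g \<in> carrier (Hom D Y Z)"
    have "conj X Z (comp D X Y Z g f) = comp D (F\<^sub>0 (G\<^sub>0 X)) (F\<^sub>0 (G\<^sub>0 Y)) (F\<^sub>0 (G\<^sub>0 Z)) (conj Y Z g) (conj X Y f)"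
    proof (rule conj_eq)
      have "comp D (F\<^sub>0 (G\<^sub>0 X)) (F\<^sub>0 (G\<^sub>0 Z)) Z (\<epsilon> Z)
          (comp D (F\<^sub>0 (G\<^sub>0 X)) (F\<^sub>0 (G\<^sub>0 Y)) (F\<^sub>0 (G\<^sub>0 Z)) (conj Y Z g) (conj X Y f)) =
        comp D (F\<^sub>0 (G\<^sub>0 X)) (F\<^sub>0 (G\<^sub>0 Y)) Z (comp D (F\<^sub>0 (G\<^sub>0 Y)) Y Z g (\<epsilon> Y)) (conj X Y f)"
        using XYZ fg by (subst D.comp_assoc) (simp_all add: ob eps conj eps_conj)
      also have "\<dots> = comp D (F\<^sub>0 (G\<^sub>0 X)) Y Z g (comp D (F\<^sub>0 (G\<^sub>0 X)) (F\<^sub>0 (G\<^sub>0 Y)) Y (\<epsilon> Y) (conj X Y f))"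
        using XYZ fg by (subst D.comp_assoc) (simp_all add: ob eps conj)
      also have "\<dots> = comp D (F\<^sub>0 (G\<^sub>0 X)) X Z (comp D X Y Z g f) (\<epsilon> X)"
        using XYZ fg by (simp add: eps_conj) (subst D.comp_assoc, simp_all add: ob eps)
      finally show "comp D (F\<^sub>0 (G\<^sub>0 X)) (F\<^sub>0 (G\<^sub>0 Z)) Z (\<epsilon> Z)
          (comp D (F\<^sub>0 (G\<^sub>0 X)) (F\<^sub>0 (G\<^sub>0 Y)) (F\<^sub>0 (G\<^sub>0 Z)) (conj Y Z g) (conj X Y f)) =
        comp D (F\<^sub>0 (G\<^sub>0 X)) X Z (comp D X Y Z g f) (\<epsilon> X)" .
    qed (use XYZ fg in \<open>simp_all add: ob conj D.comp_closed\<close>)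
    then show "G\<^sub>1 X Z (comp D X Y Z g f) = comp C (G\<^sub>0 X) (G\<^sub>0 Y) (G\<^sub>0 Z) (G\<^sub>1 Y Z g) (G\<^sub>1 X Y f)"
      unfolding G\<^sub>1_def[of X Z] using XYZ fg
      by (intro Fi_eq) (simp_all add: ob G1 C.comp_closed F_comp)
  qed (rule G0)
  have nat_eps: "natural_isomorphism D D (\<lambda>X. F\<^sub>0 (G\<^sub>0 X)) (\<lambda>X Y f. F\<^sub>1 (G\<^sub>0 X) (G\<^sub>0 Y) (G\<^sub>1 X Y f))
         (\<lambda>X. X) (\<lambda>X Y f. f) \<epsilon>"
    unfolding natural_isomorphism_def using iso by (simp add: G1 eps_conj)
  \<comment> \<open>The unit is the lift of the inverse of the counit at \<open>F\<^sub>0 X\<close>,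
    as the triangle identity dictates.\<close>
  define \<eta> where "\<eta> X = Fi X (G\<^sub>0 (F\<^sub>0 X)) (\<delta> (F\<^sub>0 X))" for X
  have eta: "\<eta> X \<in> carrier (Hom C X (G\<^sub>0 (F\<^sub>0 X)))" "F\<^sub>1 X (G\<^sub>0 (F\<^sub>0 X)) (\<eta> X) = \<delta> (F\<^sub>0 X)" if "X \<in> obj C" for X
    unfolding \<eta>_def using Fi[OF that G0[OF F0[OF that]] del[OF F0[OF that]]] by auto
  have F_inj: "f = g" if "F\<^sub>1 X Y f = F\<^sub>1 X Y g" "X \<in> obj C" "Y \<in> obj C" "f \<in> carrier (Hom C X Y)" "g \<in> carrier (Hom C X Y)"
    for X Y f g using Fi_eq that by metis
  have "isomorphism C X (G\<^sub>0 (F\<^sub>0 X)) (\<eta> X)" if X: "X \<in> obj C" for X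
  proof -
    let ?Y = "G\<^sub>0 (F\<^sub>0 X)"
    let ?z = "Fi ?Y X (\<epsilon> (F\<^sub>0 X))"
    have z: "?z \<in> carrier (Hom C ?Y X)" "F\<^sub>1 ?Y X ?z = \<epsilon> (F\<^sub>0 X)"
      using Fi[OF G0[OF F0[OF X]] X eps[OF F0[OF X]]] by auto
    have "comp C X ?Y X ?z (\<eta> X) = ident C X"
      by (rule F_inj[where X = X and Y = X])
        (use X in \<open>simp_all add: ob z eta F_comp C.comp_closed C.ident_closed F_id eps_del\<close>)
    moreover have "comp C ?Y X ?Y (\<eta> X) ?z = ident C ?Y"
      by (rule F_inj[where X = ?Y and Y = ?Y])
        (use X in \<open>simp_all add: ob z eta F_comp C.comp_closed C.ident_closed F_id del_eps\<close>)
    ultimately show ?thesis unfolding isomorphism_def using z eta X by blast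
  qed
  moreover have "comp C X Y (G\<^sub>0 (F\<^sub>0 Y)) (\<eta> Y) f =
      comp C X (G\<^sub>0 (F\<^sub>0 X)) (G\<^sub>0 (F\<^sub>0 Y)) (G\<^sub>1 (F\<^sub>0 X) (F\<^sub>0 Y) (F\<^sub>1 X Y f)) (\<eta> X)"
    if XY: "X \<in> obj C" "Y \<in> obj C" and f: "f \<in> carrier (Hom C X Y)" for X Y f
  proof (rule F_inj[where X = X and Y = "G\<^sub>0 (F\<^sub>0 Y)"])
    let ?X = "F\<^sub>0 X" and ?Y = "F\<^sub>0 Y" and ?f = "F\<^sub>1 X Y f"
    have f': "?f \<in> carrier (Hom D ?X ?Y)" using F1 XY f by blast
    have "comp D ?X (F\<^sub>0 (G\<^sub>0 ?X)) (F\<^sub>0 (G\<^sub>0 ?Y)) (conj ?X ?Y ?f) (\<delta> ?X) =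
      comp D ?X ?Y (F\<^sub>0 (G\<^sub>0 ?Y)) (\<delta> ?Y) (comp D ?X (F\<^sub>0 (G\<^sub>0 ?X)) ?Y (comp D (F\<^sub>0 (G\<^sub>0 ?X)) ?X ?Y ?f (\<epsilon> ?X)) (\<delta> ?X))"
      unfolding conj_def using XY f' by (subst D.comp_assoc) (simp_all add: ob del eps D.comp_closed)
    also have "comp D ?X (F\<^sub>0 (G\<^sub>0 ?X)) ?Y (comp D (F\<^sub>0 (G\<^sub>0 ?X)) ?X ?Y ?f (\<epsilon> ?X)) (\<delta> ?X) = ?f"
      using XY f' by (subst D.comp_assoc[symmetric]) (simp_all add: ob del eps eps_del D.comp_ident_right)
    finally show "F\<^sub>1 X (G\<^sub>0 ?Y) (comp C X Y (G\<^sub>0 ?Y) (\<eta> Y) f) =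
      F\<^sub>1 X (G\<^sub>0 ?Y) (comp C X (G\<^sub>0 ?X) (G\<^sub>0 ?Y) (G\<^sub>1 ?X ?Y ?f) (\<eta> X))"
      using XY f f' by (simp add: ob F_comp eta G1)
  qed (use XY f in \<open>simp_all add: ob eta G1 F1 C.comp_closed\<close>)
  ultimately have "natural_isomorphism C C (\<lambda>X. X) (\<lambda>X Y f. f)
      (\<lambda>X. G\<^sub>0 (F\<^sub>0 X)) (\<lambda>X Y f. G\<^sub>1 (F\<^sub>0 X) (F\<^sub>0 Y) (F\<^sub>1 X Y f)) \<eta>"
    unfolding natural_isomorphism_def by blast
  then show ?thesis unfolding equivalent_categories_def using F G nat_eps by blast
qed

section \<open>The category of modules\<close>

lemma lu_module_module: "lu_module_over A M \<Longrightarrow> Module.module scalars M"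
  by (simp add: lu_module_over_def)

lemma lu_module_homsI:
  assumes "f \<in> carrier M \<rightarrow>\<^sub>E carrier N"
    "\<And>x y. \<lbrakk>x \<in> carrier M; y \<in> carrier M\<rbrakk> \<Longrightarrow> f (x \<oplus>\<^bsub>M\<^esub> y) = f x \<oplus>\<^bsub>N\<^esub> f y"
    "\<And>c x. x \<in> carrier M \<Longrightarrow> f (c \<odot>\<^bsub>M\<^esub> x) = c \<odot>\<^bsub>N\<^esub> f x"
    "\<And>a x. \<lbrakk>a \<in> carrier A; x \<in> carrier M\<rbrakk> \<Longrightarrow> f (act M a x) = act N a (f x)"
  shows "f \<in> lu_module_homs A M N"
  using assms by (simp add: lu_module_homs_def)

lemma lu_module_homsD:
  assumes "f \<in> lu_module_homs A M N"
  shows "x \<in> carrier M \<Longrightarrow> f x \<in> carrier N"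
    "f \<in> extensional (carrier M)"
    "\<lbrakk>x \<in> carrier M; y \<in> carrier M\<rbrakk> \<Longrightarrow> f (x \<oplus>\<^bsub>M\<^esub> y) = f x \<oplus>\<^bsub>N\<^esub> f y"
    "x \<in> carrier M \<Longrightarrow> f (c \<odot>\<^bsub>M\<^esub> x) = c \<odot>\<^bsub>N\<^esub> f x"
    "\<lbrakk>a \<in> carrier A; x \<in> carrier M\<rbrakk> \<Longrightarrow> f (act M a x) = act N a (f x)"
  using assms by (auto simp: lu_module_homs_def PiE_def)

text \<open>Additive inverses are multiples by \<open>- 1\<close>, which leaves conditions that can
  be checked by simplification.\<close>

lemma scalar_moduleI:
  fixes M :: "('k::field, 'm, 'z) module_scheme"
  assumes "\<And>x y. \<lbrakk>x \<in> carrier M; y \<in> carrier M\<rbrakk> \<Longrightarrow> x \<oplus>\<^bsub>M\<^esub> y \<in> carrier M"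
    "\<zero>\<^bsub>M\<^esub> \<in> carrier M"
    "\<And>x y z. \<lbrakk>x \<in> carrier M; y \<in> carrier M; z \<in> carrier M\<rbrakk> \<Longrightarrow> x \<oplus>\<^bsub>M\<^esub> y \<oplus>\<^bsub>M\<^esub> z = x \<oplus>\<^bsub>M\<^esub> (y \<oplus>\<^bsub>M\<^esub> z)"
    "\<And>x y. \<lbrakk>x \<in> carrier M; y \<in> carrier M\<rbrakk> \<Longrightarrow> x \<oplus>\<^bsub>M\<^esub> y = y \<oplus>\<^bsub>M\<^esub> x"
    "\<And>x. x \<in> carrier M \<Longrightarrow> \<zero>\<^bsub>M\<^esub> \<oplus>\<^bsub>M\<^esub> x = x"
    "\<And>c x. x \<in> carrier M \<Longrightarrow> c \<odot>\<^bsub>M\<^esub> x \<in> carrier M"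
    "\<And>x. x \<in> carrier M \<Longrightarrow> 0 \<odot>\<^bsub>M\<^esub> x = \<zero>\<^bsub>M\<^esub>"
    "\<And>x. x \<in> carrier M \<Longrightarrow> 1 \<odot>\<^bsub>M\<^esub> x = x"
    "\<And>c d x. x \<in> carrier M \<Longrightarrow> (c + d) \<odot>\<^bsub>M\<^esub> x = c \<odot>\<^bsub>M\<^esub> x \<oplus>\<^bsub>M\<^esub> d \<odot>\<^bsub>M\<^esub> x"
    "\<And>c d x. x \<in> carrier M \<Longrightarrow> (c * d) \<odot>\<^bsub>M\<^esub> x = c \<odot>\<^bsub>M\<^esub> (d \<odot>\<^bsub>M\<^esub> x)"
    "\<And>c x y. \<lbrakk>x \<in> carrier M; y \<in> carrier M\<rbrakk> \<Longrightarrow> c \<odot>\<^bsub>M\<^esub> (x \<oplus>\<^bsub>M\<^esub> y) = c \<odot>\<^bsub>M\<^esub> x \<oplus>\<^bsub>M\<^esub> c \<odot>\<^bsub>M\<^esub> y"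
  shows "Module.module scalars M"
proof (rule Module.moduleI[OF cring_scalars])
  show "abelian_group M"
  proof (rule abelian_groupI)
    fix x assume x: "x \<in> carrier M"
    have "(- 1) \<odot>\<^bsub>M\<^esub> x \<oplus>\<^bsub>M\<^esub> x = (- 1) \<odot>\<^bsub>M\<^esub> x \<oplus>\<^bsub>M\<^esub> 1 \<odot>\<^bsub>M\<^esub> x" using x assms(8) by simp
    also have "\<dots> = (- 1 + 1) \<odot>\<^bsub>M\<^esub> x" by (rule assms(9)[OF x, symmetric])
    also have "\<dots> = \<zero>\<^bsub>M\<^esub>" using assms(7)[OF x] by simp
    finally show "\<exists>y\<in>carrier M. y \<oplus>\<^bsub>M\<^esub> x = \<zero>\<^bsub>M\<^esub>" using x assms(6) by blast
  qed (use assms in auto)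
qed (use assms in \<open>simp_all add: scalars_def\<close>)

locale scalar_module =
  fixes M :: "('k::field, 'm, 'z) module_scheme" (structure)
  assumes scalar_module: "Module.module scalars M"
begin

sublocale Module.module "scalars :: 'k ring" M
  by (rule scalar_module)

lemma smult_simps [simp]:
  "x \<in> carrier M \<Longrightarrow> c \<odot> x \<in> carrier M"
  "x \<in> carrier M \<Longrightarrow> 0 \<odot> x = \<zero>"
  "x \<in> carrier M \<Longrightarrow> 1 \<odot> x = x"
  "c \<odot> \<zero> = \<zero>"
  using smult_closed[of c x] smult_l_null[of x] smult_one[of x] smult_r_null[of c]
  by (simp_all add: scalars_def)

lemma smult_distrib:
  "x \<in> carrier M \<Longrightarrow> (c + d) \<odot> x = c \<odot> x \<oplus> d \<odot> x"
  "\<lbrakk>x \<in> carrier M; y \<in> carrier M\<rbrakk> \<Longrightarrow> c \<odot> (x \<oplus> y) = c \<odot> x \<oplus> c \<odot> y"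
  "x \<in> carrier M \<Longrightarrow> (c * d) \<odot> x = c \<odot> (d \<odot> x)"
  using smult_l_distr[of c d x] smult_r_distr[of c x y] smult_assoc1[of c d x]
  by (simp_all add: scalars_def)

text \<open>Serves to see that additive maps preserve zero.\<close>

lemma add_self_zero: "x \<in> carrier M \<Longrightarrow> x \<oplus> x = x \<Longrightarrow> x = \<zero>"
  using M.add.r_cancel_one[of x x] by simp

end

locale lu_module =
  fixes A :: "('k::field, 'a, 'i) lu_algebra" and M :: "('k, 'a, 'm) lu_module"
  assumes lu_module: "lu_module_over A M"
begin

sublocale scalar_module M
  using lu_module_module[OF lu_module] by (simp add: scalar_module_def)

lemma act_closed [simp]: "\<lbrakk>a \<in> carrier A; x \<in> carrier M\<rbrakk> \<Longrightarrow> act M a x \<in> carrier M"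
  and act_add_left: "\<lbrakk>a \<in> carrier A; b \<in> carrier A; x \<in> carrier M\<rbrakk>
    \<Longrightarrow> act M (a \<oplus>\<^bsub>A\<^esub> b) x = act M a x \<oplus>\<^bsub>M\<^esub> act M b x"
  and act_add_right: "\<lbrakk>a \<in> carrier A; x \<in> carrier M; y \<in> carrier M\<rbrakk>
    \<Longrightarrow> act M a (x \<oplus>\<^bsub>M\<^esub> y) = act M a x \<oplus>\<^bsub>M\<^esub> act M a y"
  and act_smult_left: "\<lbrakk>a \<in> carrier A; x \<in> carrier M\<rbrakk> \<Longrightarrow> act M (c \<odot>\<^bsub>A\<^esub> a) x = c \<odot>\<^bsub>M\<^esub> act M a x"
  and act_smult_right: "\<lbrakk>a \<in> carrier A; x \<in> carrier M\<rbrakk> \<Longrightarrow> act M a (c \<odot>\<^bsub>M\<^esub> x) = c \<odot>\<^bsub>M\<^esub> act M a x"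
  and act_mult: "\<lbrakk>a \<in> carrier A; b \<in> carrier A; x \<in> carrier M\<rbrakk>
    \<Longrightarrow> act M (a \<otimes>\<^bsub>A\<^esub> b) x = act M a (act M b x)"
  using lu_module by (simp_all add: lu_module_over_def)

lemma act_zero_right [simp]: "a \<in> carrier A \<Longrightarrow> act M a \<zero>\<^bsub>M\<^esub> = \<zero>\<^bsub>M\<^esub>"
  using act_add_right[of a "\<zero>\<^bsub>M\<^esub>" "\<zero>\<^bsub>M\<^esub>"] by (intro add_self_zero) simp_all

end

lemma module_category_simps [simp]:
  "obj (module_category A) = {M. lu_module_over A M}"
  "carrier (Hom (module_category A) M N) = lu_module_homs A M N"
  "\<zero>\<^bsub>Hom (module_category A) M N\<^esub> = (\<lambda>x\<in>carrier M. \<zero>\<^bsub>N\<^esub>)"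
  "f \<oplus>\<^bsub>Hom (module_category A) M N\<^esub> g = (\<lambda>x\<in>carrier M. f x \<oplus>\<^bsub>N\<^esub> g x)"
  "c \<odot>\<^bsub>Hom (module_category A) M N\<^esub> f = (\<lambda>x\<in>carrier M. c \<odot>\<^bsub>N\<^esub> f x)"
  "ident (module_category A) M = (\<lambda>x\<in>carrier M. x)"
  "comp (module_category A) L M N g f = compose (carrier L) g f"
  by (simp_all add: module_category_def)

lemma lu_module_homs_module:
  fixes L M :: "('k::field, 'a, 'm) lu_module"
  assumes L: "lu_module_over A L" and M: "lu_module_over A M"
  shows "Module.module scalars (Hom (module_category A) L M)"
proof -
  interpret L: lu_module A L using L by (simp add: lu_module_def)
  interpret M: lu_module A M using M by (simp add: lu_module_def)
  note H = lu_module_homsD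
  have ext: "f = g" if "f \<in> lu_module_homs A L M" "g \<in> extensional (carrier L)" "\<And>x. x \<in> carrier L \<Longrightarrow> f x = g x" for f g
    using that H(2)[of f] by (intro extensionalityI) auto
  show ?thesis
  proof (rule scalar_moduleI)
    fix f g assume "f \<in> carrier (Hom (module_category A) L M)" "g \<in> carrier (Hom (module_category A) L M)"
    then have f: "f \<in> lu_module_homs A L M" and g: "g \<in> lu_module_homs A L M" by simp_all
    note [simp] = H(1)[OF f] H(1)[OF g]
    show "f \<oplus>\<^bsub>Hom (module_category A) L M\<^esub> g \<in> carrier (Hom (module_category A) L M)"
      unfolding module_category_simps
      by (rule lu_module_homsI)
        (simp_all add: H[OF f] H[OF g] M.M.a_ac M.act_add_right M.smult_distrib)
    show "f \<oplus>\<^bsub>Hom (module_category A) L M\<^esub> g = g \<oplus>\<^bsub>Hom (module_category A) L M\<^esub> f"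
      by (auto simp: M.M.a_comm)
    show "c \<odot>\<^bsub>Hom (module_category A) L M\<^esub> (f \<oplus>\<^bsub>Hom (module_category A) L M\<^esub> g) =
      c \<odot>\<^bsub>Hom (module_category A) L M\<^esub> f \<oplus>\<^bsub>Hom (module_category A) L M\<^esub> c \<odot>\<^bsub>Hom (module_category A) L M\<^esub> g" for c
      by (auto simp: M.smult_distrib)
    fix h assume "h \<in> carrier (Hom (module_category A) L M)"
    then have h: "h \<in> lu_module_homs A L M" by simp
    show "f \<oplus>\<^bsub>Hom (module_category A) L M\<^esub> g \<oplus>\<^bsub>Hom (module_category A) L M\<^esub> h =
      f \<oplus>\<^bsub>Hom (module_category A) L M\<^esub> (g \<oplus>\<^bsub>Hom (module_category A) L M\<^esub> h)"
      by (auto simp: M.M.a_assoc H(1)[OF h])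
  next
    show "\<zero>\<^bsub>Hom (module_category A) L M\<^esub> \<in> carrier (Hom (module_category A) L M)"
      unfolding module_category_simps by (rule lu_module_homsI) simp_all
  next
    fix f c assume "f \<in> carrier (Hom (module_category A) L M)"
    then have f: "f \<in> lu_module_homs A L M" by simp
    note [simp] = H(1)[OF f]
    show "\<zero>\<^bsub>Hom (module_category A) L M\<^esub> \<oplus>\<^bsub>Hom (module_category A) L M\<^esub> f = f"
      by (rule ext[OF f, symmetric]) simp_all
    show "1 \<odot>\<^bsub>Hom (module_category A) L M\<^esub> f = f"
      by (rule ext[OF f, symmetric]) simp_all
    show "0 \<odot>\<^bsub>Hom (module_category A) L M\<^esub> f = \<zero>\<^bsub>Hom (module_category A) L M\<^esub>"
      by auto
    show "c \<odot>\<^bsub>Hom (module_category A) L M\<^esub> f \<in> carrier (Hom (module_category A) L M)"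
      unfolding module_category_simps
      by (rule lu_module_homsI)
        (simp_all add: H[OF f] M.act_smult_right M.smult_distrib mult.commute flip: M.smult_distrib(3))
    fix d
    show "(c + d) \<odot>\<^bsub>Hom (module_category A) L M\<^esub> f =
      c \<odot>\<^bsub>Hom (module_category A) L M\<^esub> f \<oplus>\<^bsub>Hom (module_category A) L M\<^esub> d \<odot>\<^bsub>Hom (module_category A) L M\<^esub> f"
      "(c * d) \<odot>\<^bsub>Hom (module_category A) L M\<^esub> f =
      c \<odot>\<^bsub>Hom (module_category A) L M\<^esub> (d \<odot>\<^bsub>Hom (module_category A) L M\<^esub> f)"
      by (auto simp: M.smult_distrib)
  qed
qed

lemma linear_category_module_category:
  "linear_category (module_category A :: (('k::field, 'a, 'm) lu_module, 'm \<Rightarrow> 'm, 'k) lincat)"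
proof (rule linear_category.intro)
  note H = lu_module_homsD
  fix L M :: "('k, 'a, 'm) lu_module"
  assume "L \<in> obj (module_category A)" "M \<in> obj (module_category A)"
  then have L: "lu_module_over A L" and M: "lu_module_over A M" by simp_all
  interpret L: lu_module A L using L by (simp add: lu_module_def)
  interpret M: lu_module A M using M by (simp add: lu_module_def)
  show "Module.module scalars (Hom (module_category A) L M)"
    by (rule lu_module_homs_module[OF L M])
  show "ident (module_category A) L \<in> carrier (Hom (module_category A) L L)"
    unfolding module_category_simps by (rule lu_module_homsI) simp_all
  fix f assume "f \<in> carrier (Hom (module_category A) L M)"
  then have f: "f \<in> lu_module_homs A L M" by simp
  note [simp] = H(1)[OF f]
  show "comp (module_category A) L L M f (ident (module_category A) L) = f"
    "comp (module_category A) L M M (ident (module_category A) M) f = f"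
    using H(2)[OF f] by (auto simp: compose_def fun_eq_iff extensional_def)
  fix N :: "('k, 'a, 'm) lu_module"
  assume N: "N \<in> obj (module_category A)"
  interpret N: lu_module A N using N by (simp add: lu_module_def)
  fix g assume "g \<in> carrier (Hom (module_category A) M N)"
  then have g: "g \<in> lu_module_homs A M N" by simp
  note [simp] = H(1)[OF g]
  show "comp (module_category A) L M N g f \<in> carrier (Hom (module_category A) L N)"
    unfolding module_category_simps compose_def
    by (rule lu_module_homsI) (simp_all add: H[OF f] H[OF g])
  show "comp (module_category A) L M N (c \<odot>\<^bsub>Hom (module_category A) M N\<^esub> g) f =
      c \<odot>\<^bsub>Hom (module_category A) L N\<^esub> comp (module_category A) L M N g f"
    "comp (module_category A) L M N g (c \<odot>\<^bsub>Hom (module_category A) L M\<^esub> f) =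
      c \<odot>\<^bsub>Hom (module_category A) L N\<^esub> comp (module_category A) L M N g f" for c
    by (auto simp: compose_def H(4)[OF g])
  show "comp (module_category A) L M N (g \<oplus>\<^bsub>Hom (module_category A) M N\<^esub> g') f =
      comp (module_category A) L M N g f \<oplus>\<^bsub>Hom (module_category A) L N\<^esub> comp (module_category A) L M N g' f" for g'
    by (auto simp: compose_def)
  show "comp (module_category A) L M N g (f \<oplus>\<^bsub>Hom (module_category A) L M\<^esub> f') =
      comp (module_category A) L M N g f \<oplus>\<^bsub>Hom (module_category A) L N\<^esub> comp (module_category A) L M N g f'"
    if "f' \<in> carrier (Hom (module_category A) L M)" for f'
    using that lu_module_homsD(1)[of f' A L M] by (auto simp: compose_def H(3)[OF g])
  show "comp (module_category A) L N K h (comp (module_category A) L M N g f) =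
    comp (module_category A) L M K (comp (module_category A) M N K h g) f" for K h
    by (auto simp: compose_def)
qed

section \<open>The algebra of a linear category and its modules\<close>

lemma additive_finsum:
  assumes G: "abelian_group G" and K: "abelian_group K"
    and h: "\<And>x. x \<in> carrier G \<Longrightarrow> h x \<in> carrier K"
      "\<And>x y. \<lbrakk>x \<in> carrier G; y \<in> carrier G\<rbrakk> \<Longrightarrow> h (x \<oplus>\<^bsub>G\<^esub> y) = h x \<oplus>\<^bsub>K\<^esub> h y"
    and J: "finite J" "\<And>j. j \<in> J \<Longrightarrow> f j \<in> carrier G"
  shows "h (finsum G f J) = finsum K (\<lambda>j. h (f j)) J"
proof -
  interpret G: abelian_group G by fact
  interpret K: abelian_group K by fact
  have "h \<zero>\<^bsub>G\<^esub> \<oplus>\<^bsub>K\<^esub> h \<zero>\<^bsub>G\<^esub> = h \<zero>\<^bsub>G\<^esub>" using h(2)[of "\<zero>\<^bsub>G\<^esub>" "\<zero>\<^bsub>G\<^esub>"] by simp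
  then have zero: "h \<zero>\<^bsub>G\<^esub> = \<zero>\<^bsub>K\<^esub>" using K.add.r_cancel_one[of "h \<zero>\<^bsub>G\<^esub>" "h \<zero>\<^bsub>G\<^esub>"] h(1)[of "\<zero>\<^bsub>G\<^esub>"] by simp
  show ?thesis using J
  proof (induction J rule: finite_induct)
    case (insert j J)
    then show ?case
      using h by (simp add: G.finsum_insert K.finsum_insert Pi_def)
  qed (simp add: zero)
qed

lemma (in abelian_group) finsum_superset:
  assumes "finite J" "I \<subseteq> J" "\<And>j. j \<in> J - I \<Longrightarrow> f j = \<zero>" "\<And>j. j \<in> J \<Longrightarrow> f j \<in> carrier G"
  shows "finsum G f I = finsum G f J"
  using assms by (intro add.finprod_mono_neutral_cong_left) auto

lemma (in abelian_group) finsum_single: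
  assumes "finite J" "i \<in> J" "\<And>j. j \<in> J \<Longrightarrow> j \<noteq> i \<Longrightarrow> f j = \<zero>" "f i \<in> carrier G"
  shows "finsum G f J = f i"
proof -
  have "finsum G f {i} = finsum G f J"
    by (rule finsum_superset) (use assms in \<open>auto, metis zero_closed\<close>)
  then show ?thesis using assms by simp
qed

locale hom_alg = linear_category C for C :: "('o, 'a, 'k::field) lincat" +
  fixes S :: "'o set"
  assumes S_obj: "S \<subseteq> obj C"
begin

abbreviation A where "A \<equiv> hom_algebra C S"
abbreviation hom where "hom X Y \<equiv> carrier (Hom C X Y)"
abbreviation zero_hom ("\<zero>\<^sub>h") where "\<zero>\<^sub>h X Y \<equiv> \<zero>\<^bsub>Hom C X Y\<^esub>"

text \<open>A matrix unit with entry \<open>f\<close>, when the algebra is regarded as finitely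
  supported matrices over the Hom spaces.\<close>

definition elem where "elem X Y f = (\<lambda>(X', Y')\<in>S \<times> S. if X' = X \<and> Y' = Y then f else \<zero>\<^sub>h X' Y')"

lemma obj [simp]: "X \<in> S \<Longrightarrow> X \<in> obj C"
  using S_obj by blast

lemma scalar_hom: "\<lbrakk>X \<in> S; Y \<in> S\<rbrakk> \<Longrightarrow> scalar_module (Hom C X Y)"
  by (simp add: scalar_module_def Hom_module)

lemma ab_hom: "\<lbrakk>X \<in> S; Y \<in> S\<rbrakk> \<Longrightarrow> abelian_group (Hom C X Y)"
  using Hom_module[of X Y] by (simp add: module_def)

lemma hom_simps [simp]:
  assumes "X \<in> S" "Y \<in> S"
  shows "\<zero>\<^sub>h X Y \<in> hom X Y"
    "\<lbrakk>f \<in> hom X Y; g \<in> hom X Y\<rbrakk> \<Longrightarrow> f \<oplus>\<^bsub>Hom C X Y\<^esub> g \<in> hom X Y"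
    "f \<in> hom X Y \<Longrightarrow> \<zero>\<^sub>h X Y \<oplus>\<^bsub>Hom C X Y\<^esub> f = f"
    "f \<in> hom X Y \<Longrightarrow> f \<oplus>\<^bsub>Hom C X Y\<^esub> \<zero>\<^sub>h X Y = f"
    "f \<in> hom X Y \<Longrightarrow> c \<odot>\<^bsub>Hom C X Y\<^esub> f \<in> hom X Y"
    "c \<odot>\<^bsub>Hom C X Y\<^esub> \<zero>\<^sub>h X Y = \<zero>\<^sub>h X Y"
proof -
  interpret scalar_module "Hom C X Y" by (rule scalar_hom[OF assms])
  show "\<zero>\<^sub>h X Y \<in> hom X Y"
    "\<lbrakk>f \<in> hom X Y; g \<in> hom X Y\<rbrakk> \<Longrightarrow> f \<oplus>\<^bsub>Hom C X Y\<^esub> g \<in> hom X Y"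
    "f \<in> hom X Y \<Longrightarrow> \<zero>\<^sub>h X Y \<oplus>\<^bsub>Hom C X Y\<^esub> f = f"
    "f \<in> hom X Y \<Longrightarrow> f \<oplus>\<^bsub>Hom C X Y\<^esub> \<zero>\<^sub>h X Y = f"
    "f \<in> hom X Y \<Longrightarrow> c \<odot>\<^bsub>Hom C X Y\<^esub> f \<in> hom X Y"
    "c \<odot>\<^bsub>Hom C X Y\<^esub> \<zero>\<^sub>h X Y = \<zero>\<^sub>h X Y"
    by simp_all
qed

lemma comp_hom [simp]: "\<lbrakk>X \<in> S; Y \<in> S; Z \<in> S; f \<in> hom X Y; g \<in> hom Y Z\<rbrakk> \<Longrightarrow> comp C X Y Z g f \<in> hom X Z"
  by (simp add: comp_closed)

lemma ident_hom [simp]: "X \<in> S \<Longrightarrow> ident C X \<in> hom X X"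
  by (simp add: ident_closed)

lemma comp_zero [simp]:
  assumes "X \<in> S" "Y \<in> S" "Z \<in> S"
  shows "g \<in> hom Y Z \<Longrightarrow> comp C X Y Z g (\<zero>\<^sub>h X Y) = \<zero>\<^sub>h X Z"
    "f \<in> hom X Y \<Longrightarrow> comp C X Y Z (\<zero>\<^sub>h Y Z) f = \<zero>\<^sub>h X Z"
proof -
  interpret scalar_module "Hom C X Z" using assms by (simp add: scalar_hom)
  show "g \<in> hom Y Z \<Longrightarrow> comp C X Y Z g (\<zero>\<^sub>h X Y) = \<zero>\<^sub>h X Z"
    using comp_add_right[of X Y Z "\<zero>\<^sub>h X Y" "\<zero>\<^sub>h X Y" g] assms by (intro add_self_zero) simp_all
  show "f \<in> hom X Y \<Longrightarrow> comp C X Y Z (\<zero>\<^sub>h Y Z) f = \<zero>\<^sub>h X Z"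
    using comp_add_left[of X Y Z f "\<zero>\<^sub>h Y Z" "\<zero>\<^sub>h Y Z"] assms by (intro add_self_zero) simp_all
qed

definition supp where "supp a = {(X, Y) \<in> S \<times> S. a (X, Y) \<noteq> \<zero>\<^sub>h X Y}"

lemma carrier_iff: "a \<in> carrier A \<longleftrightarrow>
  a \<in> extensional (S \<times> S) \<and> (\<forall>X\<in>S. \<forall>Y\<in>S. a (X, Y) \<in> hom X Y) \<and> finite (supp a)"
  by (auto simp: hom_algebra_def supp_def PiE_def Pi_def)

lemma carrierD [simp]: "\<lbrakk>a \<in> carrier A; X \<in> S; Y \<in> S\<rbrakk> \<Longrightarrow> a (X, Y) \<in> hom X Y"
  by (simp add: carrier_iff)

lemma finite_column: "\<lbrakk>a \<in> carrier A; X \<in> S\<rbrakk> \<Longrightarrow> finite {Y \<in> S. a (X, Y) \<noteq> \<zero>\<^sub>h X Y}"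
  by (rule finite_subset[of _ "snd ` supp a"]) (force simp: carrier_iff supp_def)+

lemma ops [simp]:
  assumes "X \<in> S" "Y \<in> S"
  shows "(a \<oplus>\<^bsub>A\<^esub> b) (X, Y) = a (X, Y) \<oplus>\<^bsub>Hom C X Y\<^esub> b (X, Y)"
    "\<zero>\<^bsub>A\<^esub> (X, Y) = \<zero>\<^sub>h X Y" "(c \<odot>\<^bsub>A\<^esub> a) (X, Y) = c \<odot>\<^bsub>Hom C X Y\<^esub> a (X, Y)"
    "elem X' Y' f (X, Y) = (if X = X' \<and> Y = Y' then f else \<zero>\<^sub>h X Y)"
  using assms by (simp_all add: hom_algebra_def elem_def)

lemma mult_apply:
  assumes "X \<in> S" "Z \<in> S"
  shows "(a \<otimes>\<^bsub>A\<^esub> b) (X, Z) =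
    (\<Oplus>\<^bsub>Hom C X Z\<^esub>Y\<in>{Y \<in> S. b (X, Y) \<noteq> \<zero>\<^sub>h X Y}. comp C X Y Z (a (Y, Z)) (b (X, Y)))"
  using assms by (simp add: hom_algebra_def)

lemma ext_ops [simp]: "a \<oplus>\<^bsub>A\<^esub> b \<in> extensional (S \<times> S)" "\<zero>\<^bsub>A\<^esub> \<in> extensional (S \<times> S)"
  "c \<odot>\<^bsub>A\<^esub> a \<in> extensional (S \<times> S)" "elem X Y f \<in> extensional (S \<times> S)" "a \<otimes>\<^bsub>A\<^esub> b \<in> extensional (S \<times> S)"
  by (simp_all add: hom_algebra_def elem_def)

lemma idem_elem: "idem A X = elem X X (ident C X)"
  by (simp add: hom_algebra_def elem_def)

lemma index_A [simp]: "index A = S"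
  by (simp add: hom_algebra_def)

lemma extI:
  assumes "a \<in> extensional (S \<times> S)" "b \<in> extensional (S \<times> S)"
    "\<And>X Y. \<lbrakk>X \<in> S; Y \<in> S\<rbrakk> \<Longrightarrow> a (X, Y) = b (X, Y)"
  shows "a = b"
  using assms by (intro extensionalityI[of a "S \<times> S"]) auto

lemma closed [simp]:
  "\<lbrakk>a \<in> carrier A; b \<in> carrier A\<rbrakk> \<Longrightarrow> a \<oplus>\<^bsub>A\<^esub> b \<in> carrier A"
  "\<zero>\<^bsub>A\<^esub> \<in> carrier A"
  "a \<in> carrier A \<Longrightarrow> c \<odot>\<^bsub>A\<^esub> a \<in> carrier A"
  "\<lbrakk>X \<in> S; Y \<in> S; f \<in> hom X Y\<rbrakk> \<Longrightarrow> elem X Y f \<in> carrier A"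
proof -
  {
    have "supp (a \<oplus>\<^bsub>A\<^esub> b) \<subseteq> supp a \<union> supp b" by (auto simp: supp_def)
    moreover assume "a \<in> carrier A" "b \<in> carrier A"
    ultimately show "a \<oplus>\<^bsub>A\<^esub> b \<in> carrier A"
      unfolding carrier_iff by (simp add: finite_subset)
  }
  have "supp \<zero>\<^bsub>A\<^esub> = {}" by (auto simp: supp_def)
  then show "\<zero>\<^bsub>A\<^esub> \<in> carrier A" by (simp add: carrier_iff)
  show "c \<odot>\<^bsub>A\<^esub> a \<in> carrier A" if "a \<in> carrier A"
  proof -
    have "supp (c \<odot>\<^bsub>A\<^esub> a) \<subseteq> supp a" by (auto simp: supp_def)
    then show ?thesis using that unfolding carrier_iff by (simp add: finite_subset)
  qed
  show "elem X Y f \<in> carrier A" if "X \<in> S" "Y \<in> S" "f \<in> hom X Y"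
  proof -
    have "supp (elem X Y f) \<subseteq> {(X, Y)}" by (auto simp: supp_def split: if_splits)
    then have "finite (supp (elem X Y f))" by (rule finite_subset) simp
    then show ?thesis using that unfolding carrier_iff by auto
  qed
qed

lemma add_zero_left [simp]: "a \<in> carrier A \<Longrightarrow> \<zero>\<^bsub>A\<^esub> \<oplus>\<^bsub>A\<^esub> a = a"
  by (rule extI) (auto simp: carrier_iff)

lemma elem_add: "\<lbrakk>X \<in> S; Y \<in> S; f \<in> hom X Y; g \<in> hom X Y\<rbrakk>
    \<Longrightarrow> elem X Y (f \<oplus>\<^bsub>Hom C X Y\<^esub> g) = elem X Y f \<oplus>\<^bsub>A\<^esub> elem X Y g"
  by (rule extI) auto

lemma elem_smult: "\<lbrakk>X \<in> S; Y \<in> S; f \<in> hom X Y\<rbrakk>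
    \<Longrightarrow> elem X Y (c \<odot>\<^bsub>Hom C X Y\<^esub> f) = c \<odot>\<^bsub>A\<^esub> elem X Y f"
  by (rule extI) auto

lemma elem_zero: "\<lbrakk>X \<in> S; Y \<in> S\<rbrakk> \<Longrightarrow> elem X Y (\<zero>\<^sub>h X Y) = \<zero>\<^bsub>A\<^esub>"
  by (rule extI) auto

text \<open>Splitting off one entry shrinks the support. Additive statements are reduced in this way
  to matrix units, whose products are compositions in \<open>C\<close>.\<close>

lemma algebra_induct [consumes 1, case_names zero elem add]:
  assumes "a \<in> carrier A" and "P \<zero>\<^bsub>A\<^esub>"
    and "\<And>X Y f. \<lbrakk>X \<in> S; Y \<in> S; f \<in> hom X Y\<rbrakk> \<Longrightarrow> P (elem X Y f)"
    and "\<And>a b. \<lbrakk>a \<in> carrier A; b \<in> carrier A; P a; P b\<rbrakk> \<Longrightarrow> P (a \<oplus>\<^bsub>A\<^esub> b)"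
  shows "P a"
  using assms(1)
proof (induction "card (supp a)" arbitrary: a)
  case 0
  then have "supp a = {}" by (simp add: carrier_iff)
  then have "a = \<zero>\<^bsub>A\<^esub>" using 0 by (intro extI) (auto simp: carrier_iff supp_def)
  then show ?case using assms(2) by simp
next
  case (Suc n)
  then obtain X Y where XY: "(X, Y) \<in> supp a" by (metis card.empty nat.distinct(1) equals0I surj_pair)
  then have S: "X \<in> S" "Y \<in> S" by (auto simp: supp_def)
  define b where "b = (\<lambda>(X', Y')\<in>S \<times> S. if X' = X \<and> Y' = Y then \<zero>\<^sub>h X' Y' else a (X', Y'))"
  have supp_b: "supp b = supp a - {(X, Y)}" by (auto simp: supp_def b_def)
  have b: "b \<in> carrier A"
  proof -
    have "b (X', Y') \<in> hom X' Y'" if "X' \<in> S" "Y' \<in> S" for X' Y'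
      using that Suc.prems S by (auto simp: b_def)
    moreover have "b \<in> extensional (S \<times> S)" by (simp add: b_def)
    ultimately show ?thesis using Suc.prems supp_b by (simp add: carrier_iff)
  qed
  have "card (supp b) = n" using supp_b XY Suc.hyps(2) by simp
  then have "P b" using Suc.hyps(1) b by simp
  moreover have "a = elem X Y (a (X, Y)) \<oplus>\<^bsub>A\<^esub> b"
    by (rule extI) (use Suc.prems S in \<open>auto simp: carrier_iff b_def\<close>)
  ultimately show ?case
    using assms(3,4) S Suc.prems b by (metis carrierD closed(4))
qed

text \<open>The index set of the sum in a product depends on the second factor. Enlarging it to a
  common finite set makes products with different second factors comparable.\<close>

lemma mult_apply_superset:
  assumes "a \<in> carrier A" "b \<in> carrier A" "X \<in> S" "Z \<in> S" "finite J" "J \<subseteq> S"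
    "{Y \<in> S. b (X, Y) \<noteq> \<zero>\<^sub>h X Y} \<subseteq> J"
  shows "(a \<otimes>\<^bsub>A\<^esub> b) (X, Z) = (\<Oplus>\<^bsub>Hom C X Z\<^esub>Y\<in>J. comp C X Y Z (a (Y, Z)) (b (X, Y)))"
  unfolding mult_apply[OF assms(3,4)]
  by (rule abelian_group.finsum_superset[OF ab_hom]) (use assms in auto)

lemma mult_add_left:
  assumes "a \<in> carrier A" "a' \<in> carrier A" "b \<in> carrier A"
  shows "(a \<oplus>\<^bsub>A\<^esub> a') \<otimes>\<^bsub>A\<^esub> b = a \<otimes>\<^bsub>A\<^esub> b \<oplus>\<^bsub>A\<^esub> a' \<otimes>\<^bsub>A\<^esub> b"
proof (rule extI)
  fix X Z assume XZ: "X \<in> S" "Z \<in> S"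
  interpret H: abelian_group "Hom C X Z" by (rule ab_hom[OF XZ])
  let ?J = "{Y \<in> S. b (X, Y) \<noteq> \<zero>\<^sub>h X Y}"
  have "((a \<oplus>\<^bsub>A\<^esub> a') \<otimes>\<^bsub>A\<^esub> b) (X, Z) =
    (\<Oplus>\<^bsub>Hom C X Z\<^esub>Y\<in>?J. comp C X Y Z (a (Y, Z)) (b (X, Y)) \<oplus>\<^bsub>Hom C X Z\<^esub> comp C X Y Z (a' (Y, Z)) (b (X, Y)))"
    unfolding mult_apply[OF XZ]
    by (rule H.finsum_cong') (use assms XZ in \<open>auto simp: comp_add_left\<close>)
  also have "\<dots> = (a \<otimes>\<^bsub>A\<^esub> b) (X, Z) \<oplus>\<^bsub>Hom C X Z\<^esub> (a' \<otimes>\<^bsub>A\<^esub> b) (X, Z)"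
    unfolding mult_apply[OF XZ] by (rule H.finsum_addf) (use assms XZ in auto)
  finally show "((a \<oplus>\<^bsub>A\<^esub> a') \<otimes>\<^bsub>A\<^esub> b) (X, Z) = (a \<otimes>\<^bsub>A\<^esub> b \<oplus>\<^bsub>A\<^esub> a' \<otimes>\<^bsub>A\<^esub> b) (X, Z)"
    using XZ by simp
qed simp_all

lemma mult_add_right:
  assumes "a \<in> carrier A" "b' \<in> carrier A" "b \<in> carrier A"
  shows "a \<otimes>\<^bsub>A\<^esub> (b \<oplus>\<^bsub>A\<^esub> b') = a \<otimes>\<^bsub>A\<^esub> b \<oplus>\<^bsub>A\<^esub> a \<otimes>\<^bsub>A\<^esub> b'"
proof (rule extI)
  fix X Z assume XZ: "X \<in> S" "Z \<in> S"
  interpret H: abelian_group "Hom C X Z" by (rule ab_hom[OF XZ])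
  let ?J = "{Y \<in> S. b (X, Y) \<noteq> \<zero>\<^sub>h X Y} \<union> {Y \<in> S. b' (X, Y) \<noteq> \<zero>\<^sub>h X Y}"
  have J: "finite ?J" "?J \<subseteq> S" using finite_column assms XZ by auto
  have sub: "{Y \<in> S. (b \<oplus>\<^bsub>A\<^esub> b') (X, Y) \<noteq> \<zero>\<^sub>h X Y} \<subseteq> ?J" using XZ by auto
  have "(a \<otimes>\<^bsub>A\<^esub> (b \<oplus>\<^bsub>A\<^esub> b')) (X, Z) = (\<Oplus>\<^bsub>Hom C X Z\<^esub>Y\<in>?J. comp C X Y Z (a (Y, Z)) ((b \<oplus>\<^bsub>A\<^esub> b') (X, Y)))"
    by (rule mult_apply_superset) (use assms XZ J sub in auto)
  also have "\<dots> = (\<Oplus>\<^bsub>Hom C X Z\<^esub>Y\<in>?J. comp C X Y Z (a (Y, Z)) (b (X, Y)) \<oplus>\<^bsub>Hom C X Z\<^esub> comp C X Y Z (a (Y, Z)) (b' (X, Y)))"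
    by (rule H.finsum_cong') (use assms XZ in \<open>auto simp: comp_add_right\<close>)
  also have "\<dots> = (a \<otimes>\<^bsub>A\<^esub> b) (X, Z) \<oplus>\<^bsub>Hom C X Z\<^esub> (a \<otimes>\<^bsub>A\<^esub> b') (X, Z)"
    unfolding mult_apply_superset[OF assms(1,3) XZ J Un_upper1] mult_apply_superset[OF assms(1,2) XZ J Un_upper2]
    by (rule H.finsum_addf) (use assms XZ in auto)
  finally show "(a \<otimes>\<^bsub>A\<^esub> (b \<oplus>\<^bsub>A\<^esub> b')) (X, Z) = (a \<otimes>\<^bsub>A\<^esub> b \<oplus>\<^bsub>A\<^esub> a \<otimes>\<^bsub>A\<^esub> b') (X, Z)"
    using XZ by simp
qed simp_all

lemma mult_elem:
  assumes "X \<in> S" "Y \<in> S" "Y' \<in> S" "Z \<in> S" "f \<in> hom X Y" "g \<in> hom Y' Z"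
  shows "elem Y' Z g \<otimes>\<^bsub>A\<^esub> elem X Y f = (if Y = Y' then elem X Z (comp C X Y Z g f) else \<zero>\<^bsub>A\<^esub>)"
proof (rule extI)
  fix X' Z' assume XZ: "X' \<in> S" "Z' \<in> S"
  interpret H: abelian_group "Hom C X' Z'" by (rule ab_hom[OF XZ])
  have "(elem Y' Z g \<otimes>\<^bsub>A\<^esub> elem X Y f) (X', Z') =
    (\<Oplus>\<^bsub>Hom C X' Z'\<^esub>V\<in>{Y}. comp C X' V Z' (elem Y' Z g (V, Z')) (elem X Y f (X', V)))"
    by (rule mult_apply_superset) (use assms XZ in \<open>auto split: if_splits\<close>)
  also have "\<dots> = (if Y = Y' then elem X Z (comp C X Y Z g f) else \<zero>\<^bsub>A\<^esub>) (X', Z')"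
    using assms XZ by auto
  finally show "(elem Y' Z g \<otimes>\<^bsub>A\<^esub> elem X Y f) (X', Z') =
    (if Y = Y' then elem X Z (comp C X Y Z g f) else \<zero>\<^bsub>A\<^esub>) (X', Z')" .
qed (simp_all split: if_split)

lemma mult_zero [simp]: "b \<in> carrier A \<Longrightarrow> \<zero>\<^bsub>A\<^esub> \<otimes>\<^bsub>A\<^esub> b = \<zero>\<^bsub>A\<^esub>" "a \<in> carrier A \<Longrightarrow> a \<otimes>\<^bsub>A\<^esub> \<zero>\<^bsub>A\<^esub> = \<zero>\<^bsub>A\<^esub>"
proof -
  show "\<zero>\<^bsub>A\<^esub> \<otimes>\<^bsub>A\<^esub> b = \<zero>\<^bsub>A\<^esub>" if "b \<in> carrier A"
  proof (rule extI)
    fix X Z assume XZ: "X \<in> S" "Z \<in> S"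
    interpret H: abelian_group "Hom C X Z" by (rule ab_hom[OF XZ])
    show "(\<zero>\<^bsub>A\<^esub> \<otimes>\<^bsub>A\<^esub> b) (X, Z) = \<zero>\<^bsub>A\<^esub> (X, Z)"
      using that XZ by (simp add: mult_apply) (rule H.add.finprod_one_eqI, simp)
  qed simp_all
  show "a \<otimes>\<^bsub>A\<^esub> \<zero>\<^bsub>A\<^esub> = \<zero>\<^bsub>A\<^esub>" if "a \<in> carrier A"
  proof (rule extI)
    fix X Z assume XZ: "X \<in> S" "Z \<in> S"
    interpret H: abelian_group "Hom C X Z" by (rule ab_hom[OF XZ])
    have "{Y \<in> S. \<zero>\<^bsub>A\<^esub> (X, Y) \<noteq> \<zero>\<^sub>h X Y} = {}" using XZ by auto
    then show "(a \<otimes>\<^bsub>A\<^esub> \<zero>\<^bsub>A\<^esub>) (X, Z) = \<zero>\<^bsub>A\<^esub> (X, Z)"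
      unfolding mult_apply[OF XZ] using XZ by (simp only: H.finsum_empty ops)
  qed simp_all
qed

lemma mult_closed [simp]:
  assumes "a \<in> carrier A" "b \<in> carrier A" shows "a \<otimes>\<^bsub>A\<^esub> b \<in> carrier A"
  using assms
proof (induction a rule: algebra_induct)
  case (elem Y' Z g)
  from elem(4) show ?case
    by (induction b rule: algebra_induct) (use elem in \<open>auto simp: mult_elem mult_add_right\<close>)
qed (simp_all add: mult_add_left)

text \<open>Multiplicativity extends from matrix units by additivity. For the decomposition it
  suffices that \<open>x\<close> is a finite sum of its own components: by orthogonality of the
  idempotents, every decomposition consists of these components.\<close>

lemma lu_moduleI:
  fixes M :: "('k, 'o \<times> 'o \<Rightarrow> 'a, 'm) lu_module"
  assumes M: "Module.module scalars M"
    and closed: "\<And>a x. \<lbrakk>a \<in> carrier A; x \<in> carrier M\<rbrakk> \<Longrightarrow> act M a x \<in> carrier M"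
    and add_left: "\<And>a b x. \<lbrakk>a \<in> carrier A; b \<in> carrier A; x \<in> carrier M\<rbrakk> \<Longrightarrow> act M (a \<oplus>\<^bsub>A\<^esub> b) x = act M a x \<oplus>\<^bsub>M\<^esub> act M b x"
    and add_right: "\<And>a x y. \<lbrakk>a \<in> carrier A; x \<in> carrier M; y \<in> carrier M\<rbrakk> \<Longrightarrow> act M a (x \<oplus>\<^bsub>M\<^esub> y) = act M a x \<oplus>\<^bsub>M\<^esub> act M a y"
    and smult: "\<And>c a x. \<lbrakk>a \<in> carrier A; x \<in> carrier M\<rbrakk> \<Longrightarrow> act M (c \<odot>\<^bsub>A\<^esub> a) x = c \<odot>\<^bsub>M\<^esub> act M a x"
      "\<And>c a x. \<lbrakk>a \<in> carrier A; x \<in> carrier M\<rbrakk> \<Longrightarrow> act M a (c \<odot>\<^bsub>M\<^esub> x) = c \<odot>\<^bsub>M\<^esub> act M a x"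
    and elem: "\<And>X Y Y' Z f g x. \<lbrakk>X \<in> S; Y \<in> S; Y' \<in> S; Z \<in> S; f \<in> hom X Y; g \<in> hom Y' Z; x \<in> carrier M\<rbrakk> \<Longrightarrow>
      act M (elem Y' Z g) (act M (elem X Y f) x) = (if Y = Y' then act M (elem X Z (comp C X Y Z g f)) x else \<zero>\<^bsub>M\<^esub>)"
    and span: "\<And>x. x \<in> carrier M \<Longrightarrow> \<exists>J. finite J \<and> J \<subseteq> S \<and> x = finsum M (\<lambda>X. act M (idem A X) x) J"
  shows "lu_module_over A M"
proof -
  interpret scalar_module M using M by (simp add: scalar_module_def)
  let ?pr = "\<lambda>X. act M (idem A X)"
  have idem: "idem A X \<in> carrier A" if "X \<in> S" for X using that by (simp add: idem_elem)
  have pr: "?pr X x \<in> carrier M" if "X \<in> S" "x \<in> carrier M" for X x using that closed idem by simp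
  have pr_pr: "?pr X (?pr Y x) = (if X = Y then ?pr X x else \<zero>\<^bsub>M\<^esub>)"
    if "X \<in> S" "Y \<in> S" "x \<in> carrier M" for X Y x
    using that elem[of Y Y X X "ident C Y" "ident C X" x] by (auto simp: idem_elem comp_ident_left)
  have zero_right: "act M a \<zero>\<^bsub>M\<^esub> = \<zero>\<^bsub>M\<^esub>" if "a \<in> carrier A" for a
    using add_right[of a "\<zero>\<^bsub>M\<^esub>" "\<zero>\<^bsub>M\<^esub>"] closed[of a "\<zero>\<^bsub>M\<^esub>"] that by (intro add_self_zero) simp_all
  have zero_left: "act M \<zero>\<^bsub>A\<^esub> x = \<zero>\<^bsub>M\<^esub>" if "x \<in> carrier M" for x
    using add_left[of "\<zero>\<^bsub>A\<^esub>" "\<zero>\<^bsub>A\<^esub>" x] closed[of "\<zero>\<^bsub>A\<^esub>" x] that by (intro add_self_zero) simp_all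
  \<comment> \<open>By orthogonality the idempotent at \<open>X\<close> extracts the summand with
    index \<open>X\<close>.\<close>
  have pr_sum: "?pr X (finsum M u J) = (if X \<in> J then u X else \<zero>\<^bsub>M\<^esub>)"
    if X: "X \<in> S" and J: "finite J" "J \<subseteq> S" and u: "\<And>j. j \<in> J \<Longrightarrow> u j \<in> ?pr j ` carrier M" for X J u
  proof -
    have u': "u j \<in> carrier M" "?pr j (u j) = u j" if "j \<in> J" for j
      using u[OF that] pr pr_pr J(2) that by auto
    have ne: "?pr X (u j) = \<zero>\<^bsub>M\<^esub>" if "j \<in> J" "j \<noteq> X" for j
      using pr_pr[OF X, of j "u j"] u'[OF that(1)] that J zero_right by auto
    have "?pr X (finsum M u J) = finsum M (\<lambda>j. ?pr X (u j)) J"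
      by (rule additive_finsum[OF abelian_group_axioms abelian_group_axioms])
        (use pr X u' J add_right idem in auto)
    also have "\<dots> = (if X \<in> J then u X else \<zero>\<^bsub>M\<^esub>)"
    proof (cases "X \<in> J")
      case True
      then have "finsum M (\<lambda>j. ?pr X (u j)) J = ?pr X (u X)"
        using J ne pr u' X by (intro finsum_single) auto
      then show ?thesis using True u' by simp
    next
      case False
      then show ?thesis using ne by (auto intro: M.add.finprod_one_eqI)
    qed
    finally show ?thesis .
  qed
  have unique: "\<exists>!u. u \<in> (\<Pi>\<^sub>E i\<in>index A. ?pr i ` carrier M) \<and> finite {i \<in> index A. u i \<noteq> \<zero>\<^bsub>M\<^esub>} \<and>
       x = (\<Oplus>\<^bsub>M\<^esub>i\<in>{i \<in> index A. u i \<noteq> \<zero>\<^bsub>M\<^esub>}. u i)" if x: "x \<in> carrier M" for x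
  proof (rule ex1I[of _ "\<lambda>X\<in>S. ?pr X x"])
    obtain J where J: "finite J" "J \<subseteq> S" "x = finsum M (\<lambda>X. ?pr X x) J" using span[OF x] by blast
    have out: "?pr X x = \<zero>\<^bsub>M\<^esub>" if "X \<in> S" "X \<notin> J" for X
    proof -
      have "?pr X x = ?pr X (finsum M (\<lambda>X. ?pr X x) J)" using J(3) by simp
      also have "\<dots> = \<zero>\<^bsub>M\<^esub>" using that J x by (subst pr_sum) auto
      finally show ?thesis .
    qed
    have sub: "{i \<in> S. (\<lambda>X\<in>S. ?pr X x) i \<noteq> \<zero>\<^bsub>M\<^esub>} \<subseteq> J" using out by auto
    have "finsum M (\<lambda>X\<in>S. ?pr X x) J = finsum M (\<lambda>X. ?pr X x) J"
      by (rule M.finsum_cong') (use J x pr in auto)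
    then have "x = finsum M (\<lambda>X\<in>S. ?pr X x) J" using J(3) by simp
    also have "\<dots> = finsum M (\<lambda>X\<in>S. ?pr X x) {i \<in> S. (\<lambda>X\<in>S. ?pr X x) i \<noteq> \<zero>\<^bsub>M\<^esub>}"
      using J sub x pr by (intro finsum_superset[symmetric]) auto
    finally have eq: "x = finsum M (\<lambda>X\<in>S. ?pr X x) {i \<in> S. (\<lambda>X\<in>S. ?pr X x) i \<noteq> \<zero>\<^bsub>M\<^esub>}" .
    show "(\<lambda>X\<in>S. ?pr X x) \<in> (\<Pi>\<^sub>E i\<in>index A. ?pr i ` carrier M) \<and>
        finite {i \<in> index A. (\<lambda>X\<in>S. ?pr X x) i \<noteq> \<zero>\<^bsub>M\<^esub>} \<and>
        x = (\<Oplus>\<^bsub>M\<^esub>i\<in>{i \<in> index A. (\<lambda>X\<in>S. ?pr X x) i \<noteq> \<zero>\<^bsub>M\<^esub>}. (\<lambda>X\<in>S. ?pr X x) i)"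
      unfolding index_A
    proof (intro conjI)
      show "x = (\<Oplus>\<^bsub>M\<^esub>i\<in>{i \<in> S. (\<lambda>X\<in>S. ?pr X x) i \<noteq> \<zero>\<^bsub>M\<^esub>}. (\<lambda>X\<in>S. ?pr X x) i)" by (rule eq)
    qed (use x finite_subset[OF sub J(1)] in auto)
  next
    fix u
    assume u: "u \<in> (\<Pi>\<^sub>E i\<in>index A. ?pr i ` carrier M) \<and> finite {i \<in> index A. u i \<noteq> \<zero>\<^bsub>M\<^esub>} \<and>
       x = (\<Oplus>\<^bsub>M\<^esub>i\<in>{i \<in> index A. u i \<noteq> \<zero>\<^bsub>M\<^esub>}. u i)"
    have "?pr X x = u X" if X: "X \<in> S" for X
    proof -
      have "?pr X x = ?pr X (\<Oplus>\<^bsub>M\<^esub>i\<in>{i \<in> S. u i \<noteq> \<zero>\<^bsub>M\<^esub>}. u i)" using u by simp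
      also have "\<dots> = u X" using X u by (subst pr_sum) auto
      finally show ?thesis .
    qed
    then show "u = (\<lambda>X\<in>S. ?pr X x)"
      using u by (intro extensionalityI[of _ S]) (auto simp: PiE_def)
  qed
  have mult: "act M (a \<otimes>\<^bsub>A\<^esub> b) x = act M a (act M b x)"
    if "a \<in> carrier A" "b \<in> carrier A" "x \<in> carrier M" for a b x
    using that(1)
  proof (induction a rule: algebra_induct)
    case zero
    then show ?case using that zero_left closed by simp
  next
    case (add a a')
    then show ?case using that closed add_left by (simp add: mult_add_left)
  next
    case e: (elem Y' Z g)
    from that(2) show ?case
    proof (induction b rule: algebra_induct)
      case zero
      then show ?case using that zero_left zero_right e by simp
    next
      case (add b b')
      then show ?case using that closed add_left add_right e by (simp add: mult_add_right)
    next
      case (elem X Y f)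
      then show ?case using that e zero_left assms(7)[of X Y Y' Z f g x] by (simp add: mult_elem)
    qed
  qed
  show ?thesis
    unfolding lu_module_over_def
    using M closed add_left add_right smult mult unique by (intro conjI ballI allI) simp_all
qed

end

section \<open>Components of a module with respect to the orthogonal idempotents\<close>

locale hom_module = hom_alg C S + lu_module "hom_algebra C S" M
  for C :: "('o, 'a, 'k::field) lincat" and S and M :: "('k, 'o \<times> 'o \<Rightarrow> 'a, 'm) lu_module"
begin

abbreviation pr where "pr X x \<equiv> act M (idem A X) x"
abbreviation el where "el X Y f x \<equiv> act M (elem X Y f) x"

lemma idem_closed [simp]: "X \<in> S \<Longrightarrow> idem A X \<in> carrier A"
  by (simp add: idem_elem)

lemma act_zero_left [simp]: "x \<in> carrier M \<Longrightarrow> act M \<zero>\<^bsub>A\<^esub> x = \<zero>\<^bsub>M\<^esub>"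
  using act_add_left[of "\<zero>\<^bsub>A\<^esub>" "\<zero>\<^bsub>A\<^esub>" x] by (intro add_self_zero) simp_all

lemma el_el:
  assumes "X \<in> S" "Y \<in> S" "Y' \<in> S" "Z \<in> S" "f \<in> hom X Y" "g \<in> hom Y' Z" "x \<in> carrier M"
  shows "el Y' Z g (el X Y f x) = (if Y = Y' then el X Z (comp C X Y Z g f) x else \<zero>\<^bsub>M\<^esub>)"
  using assms act_mult[of "elem Y' Z g" "elem X Y f" x] by (auto simp: mult_elem)

lemma pr_el:
  assumes "X \<in> S" "Y \<in> S" "Z \<in> S" "f \<in> hom X Y" "x \<in> carrier M"
  shows "pr Z (el X Y f x) = (if Z = Y then el X Y f x else \<zero>\<^bsub>M\<^esub>)"
    "el X Y f (pr Z x) = (if Z = X then el X Y f x else \<zero>\<^bsub>M\<^esub>)"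
  using assms by (auto simp: idem_elem el_el comp_ident_left comp_ident_right)

lemma pr_pr: "\<lbrakk>X \<in> S; Y \<in> S; x \<in> carrier M\<rbrakk> \<Longrightarrow> pr X (pr Y x) = (if X = Y then pr X x else \<zero>\<^bsub>M\<^esub>)"
  using pr_el(1)[of Y Y X "ident C Y" x] by (simp add: idem_elem)

text \<open>Applying the idempotents to the decomposition that the definition of a module provides
  identifies its members as the components \<open>pr X x\<close>.\<close>

lemma decompose:
  assumes x: "x \<in> carrier M"
  shows "finite {X \<in> S. pr X x \<noteq> \<zero>\<^bsub>M\<^esub>}" "x = finsum M (\<lambda>X. pr X x) {X \<in> S. pr X x \<noteq> \<zero>\<^bsub>M\<^esub>}"
proof -
  obtain u where u: "u \<in> (\<Pi>\<^sub>E i\<in>S. pr i ` carrier M)" "finite {i \<in> S. u i \<noteq> \<zero>\<^bsub>M\<^esub>}"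
      "x = finsum M u {i \<in> S. u i \<noteq> \<zero>\<^bsub>M\<^esub>}"
  proof -
    have "\<exists>!u. u \<in> (\<Pi>\<^sub>E i\<in>index A. pr i ` carrier M) \<and> finite {i \<in> index A. u i \<noteq> \<zero>\<^bsub>M\<^esub>} \<and>
       x = (\<Oplus>\<^bsub>M\<^esub>i\<in>{i \<in> index A. u i \<noteq> \<zero>\<^bsub>M\<^esub>}. u i)"
      using lu_module x unfolding lu_module_over_def by blast
    then show thesis using that unfolding index_A by blast
  qed
  have uM: "u j \<in> carrier M" "pr j (u j) = u j" if "j \<in> S" for j
    using u(1) that pr_pr by (auto simp: PiE_def Pi_def)
  have pr_u: "pr X (u j) = (if X = j then u j else \<zero>\<^bsub>M\<^esub>)" if "X \<in> S" "j \<in> S" for X j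
    using pr_pr[of X j "u j"] uM[OF that(2)] that by auto
  have "pr X x = u X" if X: "X \<in> S" for X
  proof -
    have "pr X x = finsum M (\<lambda>j. pr X (u j)) {i \<in> S. u i \<noteq> \<zero>\<^bsub>M\<^esub>}"
      unfolding u(3)
      by (rule additive_finsum[OF abelian_group_axioms abelian_group_axioms])
        (use X uM u(2) act_add_right in auto)
    also have "\<dots> = u X"
    proof (cases "u X = \<zero>\<^bsub>M\<^esub>")
      case True
      then show ?thesis using X pr_u by (auto intro: M.add.finprod_one_eqI)
    next
      case False
      then show ?thesis using X u(2) uM pr_u by (subst finsum_single[of _ X]) auto
    qed
    finally show ?thesis .
  qed
  then have "{X \<in> S. pr X x \<noteq> \<zero>\<^bsub>M\<^esub>} = {i \<in> S. u i \<noteq> \<zero>\<^bsub>M\<^esub>}" and eq: "\<And>X. X \<in> S \<Longrightarrow> pr X x = u X" by auto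
  then show "finite {X \<in> S. pr X x \<noteq> \<zero>\<^bsub>M\<^esub>}" using u(2) by simp
  have "finsum M (\<lambda>X. pr X x) {X \<in> S. pr X x \<noteq> \<zero>\<^bsub>M\<^esub>} = finsum M u {i \<in> S. u i \<noteq> \<zero>\<^bsub>M\<^esub>}"
    by (rule M.finsum_cong') (use eq uM in auto)
  then show "x = finsum M (\<lambda>X. pr X x) {X \<in> S. pr X x \<noteq> \<zero>\<^bsub>M\<^esub>}" using u(3) by simp
qed

lemma module_induct [consumes 1, case_names zero pr add]:
  assumes "x \<in> carrier M" and "P \<zero>\<^bsub>M\<^esub>"
    and "\<And>X y. \<lbrakk>X \<in> S; y \<in> carrier M; pr X y = y\<rbrakk> \<Longrightarrow> P y"
    and "\<And>y z. \<lbrakk>y \<in> carrier M; z \<in> carrier M; P y; P z\<rbrakk> \<Longrightarrow> P (y \<oplus>\<^bsub>M\<^esub> z)"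
  shows "P x"
proof -
  have "P (finsum M (\<lambda>X. pr X x) J)" if "finite J" "J \<subseteq> S" for J
    using that
  proof (induction J)
    case (insert X J)
    have "P (pr X x)" using assms(1) insert by (intro assms(3)[of X]) (auto simp: pr_pr)
    then show ?case using insert assms(1)
      by (subst M.finsum_insert) (auto intro!: assms(4) M.finsum_closed)
  qed (simp add: assms(2))
  then show ?thesis using decompose[OF assms(1)] by (metis (no_types, lifting) mem_Collect_eq subsetI)
qed

lemma eq_by_pr:
  assumes "x \<in> carrier M" "y \<in> carrier M" "\<And>X. X \<in> S \<Longrightarrow> pr X x = pr X y"
  shows "x = y"
proof -
  have "{X \<in> S. pr X x \<noteq> \<zero>\<^bsub>M\<^esub>} = {X \<in> S. pr X y \<noteq> \<zero>\<^bsub>M\<^esub>}" using assms(3) by auto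
  moreover have "finsum M (\<lambda>X. pr X x) {X \<in> S. pr X y \<noteq> \<zero>\<^bsub>M\<^esub>} = finsum M (\<lambda>X. pr X y) {X \<in> S. pr X y \<noteq> \<zero>\<^bsub>M\<^esub>}"
    by (rule M.finsum_cong') (use assms in auto)
  ultimately show ?thesis
    using decompose(2)[OF assms(1)] decompose(2)[OF assms(2)] by simp
qed

end

section \<open>Morita equivalence along a fully faithful, surjective functor\<close>

lemma lu_module_homs_zero:
  assumes "lu_module_over A M" "lu_module_over A N" "f \<in> lu_module_homs A M N"
  shows "f \<zero>\<^bsub>M\<^esub> = \<zero>\<^bsub>N\<^esub>"
proof -
  interpret M: lu_module A M using assms by (simp add: lu_module_def)
  interpret N: lu_module A N using assms by (simp add: lu_module_def)
  show ?thesis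
    using lu_module_homsD(3)[OF assms(3), of "\<zero>\<^bsub>M\<^esub>" "\<zero>\<^bsub>M\<^esub>"] lu_module_homsD(1)[OF assms(3), of "\<zero>\<^bsub>M\<^esub>"]
    by (intro N.add_self_zero) simp_all
qed

lemma lu_module_homs_isomorphism:
  assumes M: "lu_module_over A M" and N: "lu_module_over A N" and f: "f \<in> lu_module_homs A M N"
    and bij: "bij_betw f (carrier M) (carrier N)"
  shows "\<exists>g. isomorphism (module_category A) N M g"
proof -
  interpret M: lu_module A M using M by (simp add: lu_module_def)
  interpret N: lu_module A N using N by (simp add: lu_module_def)
  let ?g = "\<lambda>y\<in>carrier N. inv_into (carrier M) f y"
  have g: "?g y \<in> carrier M" "f (?g y) = y" if "y \<in> carrier N" for y
    using bij that by (auto simp: bij_betw_def inv_into_into f_inv_into_f)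
  have gf: "?g (f x) = x" if "x \<in> carrier M" for x
    using bij that lu_module_homsD(1)[OF f that] by (simp add: bij_betw_def)
  have eq: "?g y = x" if "x \<in> carrier M" "f x = y" for x y using gf that by blast
  note H = lu_module_homsD[OF f]
  have "?g \<in> lu_module_homs A N M"
  proof (rule lu_module_homsI)
    show "?g \<in> carrier N \<rightarrow>\<^sub>E carrier M" using g by auto
    show "?g (x \<oplus>\<^bsub>N\<^esub> y) = ?g x \<oplus>\<^bsub>M\<^esub> ?g y" if "x \<in> carrier N" "y \<in> carrier N" for x y
      by (rule eq) (use g that H in simp_all)
    show "?g (c \<odot>\<^bsub>N\<^esub> x) = c \<odot>\<^bsub>M\<^esub> ?g x" if "x \<in> carrier N" for c x
      by (rule eq) (use g that H in simp_all)
    show "?g (act N a x) = act M a (?g x)" if "a \<in> carrier A" "x \<in> carrier N" for a x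
      by (rule eq) (use g that H in simp_all)
  qed
  moreover have "compose (carrier N) f ?g = (\<lambda>x\<in>carrier N. x)" "compose (carrier M) ?g f = (\<lambda>x\<in>carrier M. x)"
    using g gf H(1) by (auto simp: compose_def)
  ultimately show ?thesis
    using f by (intro exI[of _ ?g]) (auto simp: isomorphism_def)
qed

lemma scalar_module_transport:
  fixes P :: "('k::field, 'n, 'y) module_scheme" and M :: "('k, 'm, 'z) module_scheme"
  assumes P: "Module.module scalars P" and bij: "bij_betw h (carrier P) (carrier M)"
    and add: "\<And>x y. \<lbrakk>x \<in> carrier P; y \<in> carrier P\<rbrakk> \<Longrightarrow> h (x \<oplus>\<^bsub>P\<^esub> y) = h x \<oplus>\<^bsub>M\<^esub> h y"
    and zero: "h \<zero>\<^bsub>P\<^esub> = \<zero>\<^bsub>M\<^esub>"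
    and smult: "\<And>c x. x \<in> carrier P \<Longrightarrow> h (c \<odot>\<^bsub>P\<^esub> x) = c \<odot>\<^bsub>M\<^esub> h x"
  shows "Module.module scalars M"
proof -
  interpret P: scalar_module P using P by (simp add: scalar_module_def)
  have elim: thesis if "y \<in> carrier M" "\<And>x. x \<in> carrier P \<Longrightarrow> y = h x \<Longrightarrow> thesis" for y thesis
    using bij that by (auto simp: bij_betw_def)
  have intro: "h x \<in> carrier M" if "x \<in> carrier P" for x
    using bij that by (auto simp: bij_betw_def)
  show ?thesis
  proof (rule scalar_moduleI)
    show "\<zero>\<^bsub>M\<^esub> \<in> carrier M" using intro[of "\<zero>\<^bsub>P\<^esub>"] zero by simp
  qed (erule elim | simp add: add[symmetric] smult[symmetric] zero[symmetric] intro P.M.a_ac P.smult_distrib)+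
qed

context hom_alg
begin

text \<open>Transport of structure along a bijection. It serves to realise a module of families
  inside a prescribed type of elements.\<close>

lemma lu_module_transport:
  fixes P :: "('k, 'o \<times> 'o \<Rightarrow> 'a, 'n) lu_module" and M :: "('k, 'o \<times> 'o \<Rightarrow> 'a, 'm) lu_module"
  assumes P: "lu_module_over A P" and bij: "bij_betw h (carrier P) (carrier M)"
    and add: "\<And>x y. \<lbrakk>x \<in> carrier P; y \<in> carrier P\<rbrakk> \<Longrightarrow> h (x \<oplus>\<^bsub>P\<^esub> y) = h x \<oplus>\<^bsub>M\<^esub> h y"
    and zero: "h \<zero>\<^bsub>P\<^esub> = \<zero>\<^bsub>M\<^esub>"
    and smult: "\<And>c x. x \<in> carrier P \<Longrightarrow> h (c \<odot>\<^bsub>P\<^esub> x) = c \<odot>\<^bsub>M\<^esub> h x"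
    and act: "\<And>a x. \<lbrakk>a \<in> carrier A; x \<in> carrier P\<rbrakk> \<Longrightarrow> h (act P a x) = act M a (h x)"
  shows "lu_module_over A M"
proof -
  interpret P: hom_module C S P using P by unfold_locales
  have M: "Module.module scalars M"
    by (rule scalar_module_transport[OF lu_module_module[OF P] bij add zero smult])
  interpret M: scalar_module M using M by (simp add: scalar_module_def)
  have elim: thesis if "y \<in> carrier M" "\<And>x. x \<in> carrier P \<Longrightarrow> y = h x \<Longrightarrow> thesis" for y thesis
    using bij that by (auto simp: bij_betw_def)
  have intro: "h x \<in> carrier M" if "x \<in> carrier P" for x
    using bij that by (auto simp: bij_betw_def)
  show ?thesis
  proof (rule lu_moduleI[OF M])
    fix X Y Y' Z f g y
    assume *: "X \<in> S" "Y \<in> S" "Y' \<in> S" "Z \<in> S" "f \<in> hom X Y" "g \<in> hom Y' Z" and "y \<in> carrier M"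
    then obtain x where x: "x \<in> carrier P" "y = h x" by (rule_tac elim)
    show "act M (elem Y' Z g) (act M (elem X Y f) y) =
      (if Y = Y' then act M (elem X Z (comp C X Y Z g f)) y else \<zero>\<^bsub>M\<^esub>)"
      using * x P.el_el[OF *(1-6) x(1)] by (auto simp: act[symmetric] zero)
  next
    fix y assume "y \<in> carrier M"
    then obtain x where x: "x \<in> carrier P" "y = h x" by (rule elim)
    let ?J = "{X \<in> S. P.pr X x \<noteq> \<zero>\<^bsub>P\<^esub>}"
    have "y = h (finsum P (\<lambda>X. P.pr X x) ?J)" using P.decompose(2)[OF x(1)] x by simp
    also have "\<dots> = finsum M (\<lambda>X. h (P.pr X x)) ?J"
      by (rule additive_finsum[OF P.abelian_group_axioms M.abelian_group_axioms])
        (use x intro add P.decompose(1) in auto)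
    also have "\<dots> = finsum M (\<lambda>X. act M (idem A X) y) ?J"
      by (rule M.M.finsum_cong') (use x intro in \<open>auto simp: act[symmetric]\<close>)
    finally show "\<exists>J. finite J \<and> J \<subseteq> S \<and> y = finsum M (\<lambda>X. act M (idem A X) y) J"
      using P.decompose(1)[OF x(1)] by (intro exI[of _ ?J]) auto
  qed ((erule elim)+, simp add: add[symmetric] smult[symmetric] act[symmetric] intro
      P.act_add_left P.act_add_right P.act_smult_left P.act_smult_right; fail)+
qed

end

text \<open>The object map is a retraction of \<open>S\<close> onto \<open>T\<close>. Its fibres are finite, which together with
  the infinite base field bounds the cardinality of the pullback of a module.\<close>

locale covering = C: hom_alg C S + D: hom_alg D T
  for C :: "('o, 'a, 'k::field) lincat" and S and D :: "('o, 'b, 'k) lincat" and T +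
  fixes P0 :: "'o \<Rightarrow> 'o" and P1 :: "'o \<Rightarrow> 'o \<Rightarrow> 'a \<Rightarrow> 'b"
  assumes T_sub: "T \<subseteq> S"
    and P0 [simp]: "X \<in> S \<Longrightarrow> P0 X \<in> T" and P0_T [simp]: "Y \<in> T \<Longrightarrow> P0 Y = Y"
    and P1_bij: "\<lbrakk>X \<in> S; Y \<in> S\<rbrakk> \<Longrightarrow> bij_betw (P1 X Y) (C.hom X Y) (D.hom (P0 X) (P0 Y))"
    and P1_add: "\<lbrakk>X \<in> S; Y \<in> S; f \<in> C.hom X Y; g \<in> C.hom X Y\<rbrakk>
      \<Longrightarrow> P1 X Y (f \<oplus>\<^bsub>Hom C X Y\<^esub> g) = P1 X Y f \<oplus>\<^bsub>Hom D (P0 X) (P0 Y)\<^esub> P1 X Y g"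
    and P1_smult: "\<lbrakk>X \<in> S; Y \<in> S; f \<in> C.hom X Y\<rbrakk>
      \<Longrightarrow> P1 X Y (c \<odot>\<^bsub>Hom C X Y\<^esub> f) = c \<odot>\<^bsub>Hom D (P0 X) (P0 Y)\<^esub> P1 X Y f"
    and P1_ident: "X \<in> S \<Longrightarrow> P1 X X (ident C X) = ident D (P0 X)"
    and P1_comp: "\<lbrakk>X \<in> S; Y \<in> S; Z \<in> S; f \<in> C.hom X Y; g \<in> C.hom Y Z\<rbrakk>
      \<Longrightarrow> P1 X Z (comp C X Y Z g f) = comp D (P0 X) (P0 Y) (P0 Z) (P1 Y Z g) (P1 X Y f)"
    and fibre: "Y \<in> T \<Longrightarrow> finite {X \<in> S. P0 X = Y}"
    and infinite_field: "infinite (UNIV :: 'k set)"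
begin

lemma T_S [simp]: "Y \<in> T \<Longrightarrow> Y \<in> S"
  using T_sub by blast

lemma P1 [simp]: "\<lbrakk>X \<in> S; Y \<in> S; f \<in> C.hom X Y\<rbrakk> \<Longrightarrow> P1 X Y f \<in> D.hom (P0 X) (P0 Y)"
  using P1_bij by (auto simp: bij_betw_def)

lemma P1_zero [simp]: "\<lbrakk>X \<in> S; Y \<in> S\<rbrakk> \<Longrightarrow> P1 X Y (\<zero>\<^bsub>Hom C X Y\<^esub>) = \<zero>\<^bsub>Hom D (P0 X) (P0 Y)\<^esub>"
  using P1_add[of X Y "\<zero>\<^bsub>Hom C X Y\<^esub>" "\<zero>\<^bsub>Hom C X Y\<^esub>"] D.scalar_hom[of "P0 X" "P0 Y"]
  by (intro scalar_module.add_self_zero) simp_all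

section \<open>The corner functor and its full faithfulness\<close>

definition Q1 where "Q1 X Y = inv_into (C.hom X Y) (P1 X Y)"

lemma Q1 [simp]:
  assumes "X \<in> S" "Y \<in> S" "g \<in> D.hom (P0 X) (P0 Y)"
  shows "Q1 X Y g \<in> C.hom X Y" "P1 X Y (Q1 X Y g) = g"
  using P1_bij[OF assms(1,2)] assms(3) unfolding Q1_def
  by (auto simp: bij_betw_def inv_into_into f_inv_into_f)

lemma Q1_eq: "\<lbrakk>X \<in> S; Y \<in> S; f \<in> C.hom X Y; P1 X Y f = g\<rbrakk> \<Longrightarrow> Q1 X Y g = f"
  using P1_bij unfolding Q1_def by (auto simp: bij_betw_def)

lemma Q1_add: "\<lbrakk>X \<in> S; Y \<in> S; f \<in> D.hom (P0 X) (P0 Y); g \<in> D.hom (P0 X) (P0 Y)\<rbrakk>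
      \<Longrightarrow> Q1 X Y (f \<oplus>\<^bsub>Hom D (P0 X) (P0 Y)\<^esub> g) = Q1 X Y f \<oplus>\<^bsub>Hom C X Y\<^esub> Q1 X Y g"
  and Q1_smult: "\<lbrakk>X \<in> S; Y \<in> S; f \<in> D.hom (P0 X) (P0 Y)\<rbrakk>
      \<Longrightarrow> Q1 X Y (c \<odot>\<^bsub>Hom D (P0 X) (P0 Y)\<^esub> f) = c \<odot>\<^bsub>Hom C X Y\<^esub> Q1 X Y f"
  and Q1_comp: "\<lbrakk>X \<in> S; Y \<in> S; Z \<in> S; f \<in> D.hom (P0 X) (P0 Y); g \<in> D.hom (P0 Y) (P0 Z)\<rbrakk>
      \<Longrightarrow> Q1 X Z (comp D (P0 X) (P0 Y) (P0 Z) g f) = comp C X Y Z (Q1 Y Z g) (Q1 X Y f)"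
  and Q1_ident: "X \<in> S \<Longrightarrow> Q1 X X (ident D (P0 X)) = ident C X"
  and Q1_zero [simp]: "\<lbrakk>X \<in> S; Y \<in> S\<rbrakk> \<Longrightarrow> Q1 X Y (\<zero>\<^bsub>Hom D (P0 X) (P0 Y)\<^esub>) = \<zero>\<^bsub>Hom C X Y\<^esub>"
  by (rule Q1_eq; simp add: P1_add P1_smult P1_comp P1_ident)+

text \<open>On \<open>T\<close> the object map is the identity, so \<open>Q1\<close> identifies Hom
  spaces of \<open>D\<close> with Hom spaces of \<open>C\<close> between the same objects. The
  algebra of \<open>D\<close> thus becomes the corner of the algebra of \<open>C\<close> that
  belongs to \<open>T\<close>.\<close>

definition psi where "psi b = (\<lambda>(X, Y)\<in>S \<times> S. if X \<in> T \<and> Y \<in> T then Q1 X Y (b (X, Y)) else \<zero>\<^bsub>Hom C X Y\<^esub>)"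

lemma psi_apply [simp]: "\<lbrakk>X \<in> S; Y \<in> S\<rbrakk> \<Longrightarrow>
    psi b (X, Y) = (if X \<in> T \<and> Y \<in> T then Q1 X Y (b (X, Y)) else \<zero>\<^bsub>Hom C X Y\<^esub>)"
  by (simp add: psi_def)

lemma psi_ext [simp]: "psi b \<in> extensional (S \<times> S)"
  by (simp add: psi_def)

text \<open>For objects of \<open>T\<close> simplification removes \<open>P0\<close>, after which
  the general rules for \<open>Q1\<close> no longer match; these are their simplified forms.\<close>

lemma Q1_T_ops:
  assumes "X \<in> T" "Y \<in> T"
  shows "\<lbrakk>f \<in> D.hom X Y; g \<in> D.hom X Y\<rbrakk> \<Longrightarrow> Q1 X Y (f \<oplus>\<^bsub>Hom D X Y\<^esub> g) = Q1 X Y f \<oplus>\<^bsub>Hom C X Y\<^esub> Q1 X Y g"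
    "f \<in> D.hom X Y \<Longrightarrow> Q1 X Y (c \<odot>\<^bsub>Hom D X Y\<^esub> f) = c \<odot>\<^bsub>Hom C X Y\<^esub> Q1 X Y f"
    "Q1 X Y (\<zero>\<^bsub>Hom D X Y\<^esub>) = \<zero>\<^bsub>Hom C X Y\<^esub>"
  using Q1_add[of X Y f g] Q1_smult[of X Y f c] Q1_zero[of X Y] assms by simp_all

lemma psi_closed [simp]:
  assumes b: "b \<in> carrier D.A" shows "psi b \<in> carrier C.A"
proof -
  have "C.supp (psi b) \<subseteq> D.supp b"
    by (auto simp: C.supp_def D.supp_def Q1_T_ops split: if_splits)
  then have "finite (C.supp (psi b))"
    by (rule finite_subset) (use b D.carrier_iff in blast)
  moreover have "psi b (X, Y) \<in> C.hom X Y" if "X \<in> S" "Y \<in> S" for X Y using that b by simp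
  ultimately show ?thesis by (simp only: C.carrier_iff psi_ext) simp
qed

lemma psi_add: "\<lbrakk>a \<in> carrier D.A; b \<in> carrier D.A\<rbrakk> \<Longrightarrow> psi (a \<oplus>\<^bsub>D.A\<^esub> b) = psi a \<oplus>\<^bsub>C.A\<^esub> psi b"
  by (intro C.extI) (simp_all add: Q1_T_ops)

lemma psi_smult: "a \<in> carrier D.A \<Longrightarrow> psi (c \<odot>\<^bsub>D.A\<^esub> a) = c \<odot>\<^bsub>C.A\<^esub> psi a"
  by (intro C.extI) (simp_all add: Q1_T_ops)

lemma psi_elem: "\<lbrakk>X \<in> T; Y \<in> T; f \<in> D.hom X Y\<rbrakk> \<Longrightarrow> psi (D.elem X Y f) = C.elem X Y (Q1 X Y f)"
  by (intro C.extI) (auto simp: Q1_T_ops)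

lemma psi_idem: "X \<in> T \<Longrightarrow> psi (idem D.A X) = idem C.A X"
  using Q1_ident[of X] by (simp add: D.idem_elem C.idem_elem psi_elem)

lemma psi_zero: "psi \<zero>\<^bsub>D.A\<^esub> = \<zero>\<^bsub>C.A\<^esub>"
  by (intro C.extI) (simp_all add: Q1_T_ops)

text \<open>The sum of the components at objects of \<open>T\<close>. As \<open>T\<close> may be
  infinite, the sum of its idempotents need not exist in the algebra, and the subspace is described
  by the vanishing of all other components.\<close>

definition corner :: "('k, 'o \<times> 'o \<Rightarrow> 'a, 'm) lu_module \<Rightarrow> ('k, 'o \<times> 'o \<Rightarrow> 'b, 'm) lu_module"
  where "corner M =
    \<lparr>carrier = {x \<in> carrier M. \<forall>X\<in>S - T. act M (idem C.A X) x = \<zero>\<^bsub>M\<^esub>}, mult = undefined, one = undefined,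
     ring.zero = \<zero>\<^bsub>M\<^esub>, add = add M, smult = smult M, act = (\<lambda>b. act M (psi b))\<rparr>"

lemma corner_simps [simp]:
  "carrier (corner M) = {x \<in> carrier M. \<forall>X\<in>S - T. act M (idem C.A X) x = \<zero>\<^bsub>M\<^esub>}"
  "\<zero>\<^bsub>corner M\<^esub> = \<zero>\<^bsub>M\<^esub>" "x \<oplus>\<^bsub>corner M\<^esub> y = x \<oplus>\<^bsub>M\<^esub> y" "c \<odot>\<^bsub>corner M\<^esub> x = c \<odot>\<^bsub>M\<^esub> x"
  "act (corner M) b x = act M (psi b) x"
  by (simp_all add: corner_def)

lemma corner_lu_module:
  assumes "lu_module_over C.A M"
  shows "lu_module_over D.A (corner M)"
proof -
  interpret M: hom_module C S M using assms by unfold_locales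
  have mod: "Module.module scalars (corner M)"
    by (rule scalar_moduleI) (auto simp: M.M.a_ac M.act_add_right M.act_smult_right M.smult_distrib)
  interpret FM: scalar_module "corner M" using mod by (simp add: scalar_module_def)
  show ?thesis
  proof (rule D.lu_moduleI[OF mod])
    fix a x assume a: "a \<in> carrier D.A" and x: "x \<in> carrier (corner M)"
    have "\<forall>X\<in>S - T. M.pr X (act M (psi a) x) = \<zero>\<^bsub>M\<^esub>"
      using a
    proof (induction a rule: D.algebra_induct)
      case (elem X Y f)
      then show ?case using x by (auto simp: psi_elem M.pr_el)
    qed (use x in \<open>auto simp: psi_zero psi_add M.act_add_left M.act_add_right\<close>)
    then show "act (corner M) a x \<in> carrier (corner M)" using a x by simp
  next
    fix X Y Y' Z f g x
    assume *: "X \<in> T" "Y \<in> T" "Y' \<in> T" "Z \<in> T" "f \<in> D.hom X Y" "g \<in> D.hom Y' Z" "x \<in> carrier (corner M)"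
    then show "act (corner M) (D.elem Y' Z g) (act (corner M) (D.elem X Y f) x) =
      (if Y = Y' then act (corner M) (D.elem X Z (comp D X Y Z g f)) x else \<zero>\<^bsub>corner M\<^esub>)"
      using Q1_comp[of X Y Z f g] by (auto simp: psi_elem M.el_el)
  next
    fix x assume x: "x \<in> carrier (corner M)"
    let ?J = "{X \<in> S. M.pr X x \<noteq> \<zero>\<^bsub>M\<^esub>}"
    have J: "?J \<subseteq> T" "finite ?J" using x M.decompose(1)[of x] by auto
    have pr: "M.pr X x \<in> carrier (corner M)" if "X \<in> T" for X
      using x that by (auto simp: M.pr_pr)
    have "x = finsum M (\<lambda>X. M.pr X x) ?J" using x M.decompose(2)[of x] by simp
    also have "\<dots> = finsum (corner M) (\<lambda>X. M.pr X x) ?J"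
      by (rule additive_finsum[where h = "\<lambda>x. x", OF FM.abelian_group_axioms M.abelian_group_axioms, symmetric])
        (use J pr in auto)
    also have "\<dots> = finsum (corner M) (\<lambda>X. act (corner M) (idem D.A X) x) ?J"
      by (rule FM.M.finsum_cong') (use J pr in \<open>auto simp: psi_idem subset_iff\<close>)
    finally show "\<exists>J. finite J \<and> J \<subseteq> T \<and> x = finsum (corner M) (\<lambda>X. act (corner M) (idem D.A X) x) J"
      using J by blast
  qed (auto simp: psi_add psi_smult M.act_add_left M.act_add_right M.act_smult_left M.act_smult_right)
qed

lemma hom_corner:
  assumes M: "lu_module_over C.A M" and N: "lu_module_over C.A N" and f: "f \<in> lu_module_homs C.A M N"
    and x: "x \<in> carrier (corner M)"
  shows "f x \<in> carrier (corner N)"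
proof -
  interpret M: hom_module C S M using M by unfold_locales
  interpret N: hom_module C S N using N by unfold_locales
  have "N.pr X (f x) = \<zero>\<^bsub>N\<^esub>" if "X \<in> S - T" for X
    using lu_module_homsD(5)[OF f, of "idem C.A X" x] lu_module_homs_zero[OF M N f] that x by simp
  then show ?thesis using x lu_module_homsD(1)[OF f] by simp
qed

lemma corner_functor:
  "linear_functor (module_category C.A) (module_category D.A) corner (\<lambda>M N f. restrict f (carrier (corner M)))"
  unfolding linear_functor_def
proof (intro conjI ballI allI)
  fix M :: "('k, 'o \<times> 'o \<Rightarrow> 'a, 'm) lu_module"
  assume "M \<in> obj (module_category C.A)"
  then have M: "lu_module_over C.A M" by simp
  interpret M: hom_module C S M using M by unfold_locales
  show "corner M \<in> obj (module_category D.A)" using corner_lu_module[OF M] by simp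
  show "restrict (ident (module_category C.A) M) (carrier (corner M)) = ident (module_category D.A) (corner M)"
    by auto
  fix N :: "('k, 'o \<times> 'o \<Rightarrow> 'a, 'm) lu_module"
  assume "N \<in> obj (module_category C.A)"
  then have N: "lu_module_over C.A N" by simp
  interpret N: hom_module C S N using N by unfold_locales
  fix f assume "f \<in> carrier (Hom (module_category C.A) M N)"
  then have f: "f \<in> lu_module_homs C.A M N" by simp
  have fx: "f x \<in> carrier (corner N)" if "x \<in> carrier (corner M)" for x
    by (rule hom_corner[OF M N f that])
  have op: "x \<oplus>\<^bsub>M\<^esub> y \<in> carrier (corner M)" "c \<odot>\<^bsub>M\<^esub> x \<in> carrier (corner M)" "b \<in> carrier D.A \<Longrightarrow> act M (psi b) x \<in> carrier (corner M)"
    if "x \<in> carrier (corner M)" "y \<in> carrier (corner M)" for x y c b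
    using that lu_module.act_closed[of D.A "corner M" b x] corner_lu_module[OF M]
    by (auto simp: M.act_add_right M.act_smult_right lu_module_def)
  show "restrict f (carrier (corner M)) \<in> carrier (Hom (module_category D.A) (corner M) (corner N))"
    unfolding module_category_simps
  proof (rule lu_module_homsI)
    show "restrict f (carrier (corner M)) \<in> carrier (corner M) \<rightarrow>\<^sub>E carrier (corner N)"
      using fx by (intro restrict_PiE_iff[THEN iffD2]) blast
  qed (use op lu_module_homsD[OF f] in auto)
  show "restrict (f \<oplus>\<^bsub>Hom (module_category C.A) M N\<^esub> g) (carrier (corner M)) =
    restrict f (carrier (corner M)) \<oplus>\<^bsub>Hom (module_category D.A) (corner M) (corner N)\<^esub> restrict g (carrier (corner M))" for g
    by (auto simp: fun_eq_iff)
  show "restrict (c \<odot>\<^bsub>Hom (module_category C.A) M N\<^esub> f) (carrier (corner M)) =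
    c \<odot>\<^bsub>Hom (module_category D.A) (corner M) (corner N)\<^esub> restrict f (carrier (corner M))" for c
    by (auto simp: fun_eq_iff)
  fix L g
  show "restrict (comp (module_category C.A) M N L g f) (carrier (corner M)) =
    comp (module_category D.A) (corner M) (corner N) (corner L) (restrict g (carrier (corner N))) (restrict f (carrier (corner M)))"
    using fx by (auto simp: fun_eq_iff compose_def)
qed

text \<open>Since \<open>P0 (P0 X) = P0 X\<close>, the identity of \<open>P0 X\<close> in
  \<open>D\<close> lifts to mutually inverse arrows between \<open>X\<close> and \<open>P0 X\<close>
  in \<open>C\<close>. Acting with them transports components of a module from \<open>X\<close> to
  \<open>T\<close> and back.\<close>

definition to_T where "to_T X = C.elem X (P0 X) (Q1 X (P0 X) (ident D (P0 X)))"
definition from_T where "from_T X = C.elem (P0 X) X (Q1 (P0 X) X (ident D (P0 X)))"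

lemma to_T_parts:
  assumes "X \<in> S"
  shows "Q1 X (P0 X) (ident D (P0 X)) \<in> C.hom X (P0 X)" "Q1 (P0 X) X (ident D (P0 X)) \<in> C.hom (P0 X) X"
    "comp C X (P0 X) X (Q1 (P0 X) X (ident D (P0 X))) (Q1 X (P0 X) (ident D (P0 X))) = ident C X"
    "comp C (P0 X) X (P0 X) (Q1 X (P0 X) (ident D (P0 X))) (Q1 (P0 X) X (ident D (P0 X))) = ident C (P0 X)"
proof -
  show 1: "Q1 X (P0 X) (ident D (P0 X)) \<in> C.hom X (P0 X)" "Q1 (P0 X) X (ident D (P0 X)) \<in> C.hom (P0 X) X"
    using assms by simp_all
  show "comp C X (P0 X) X (Q1 (P0 X) X (ident D (P0 X))) (Q1 X (P0 X) (ident D (P0 X))) = ident C X"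
    using Q1_comp[of X "P0 X" X "ident D (P0 X)" "ident D (P0 X)"] assms
    by (simp add: D.comp_ident_left Q1_ident)
  show "comp C (P0 X) X (P0 X) (Q1 X (P0 X) (ident D (P0 X))) (Q1 (P0 X) X (ident D (P0 X))) = ident C (P0 X)"
    using Q1_comp[of "P0 X" X "P0 X" "ident D (P0 X)" "ident D (P0 X)"] Q1_ident[of "P0 X"] assms
    by (simp add: D.comp_ident_left)
qed

lemma to_T_closed [simp]: "X \<in> S \<Longrightarrow> to_T X \<in> carrier C.A" "X \<in> S \<Longrightarrow> from_T X \<in> carrier C.A"
  using to_T_parts by (simp_all add: to_T_def from_T_def)

lemma to_T_act:
  assumes M: "lu_module_over C.A M" and X: "X \<in> S" and x: "x \<in> carrier M"
  shows "act M (to_T X) x \<in> carrier (corner M)"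
    "act M (from_T X) (act M (to_T X) x) = act M (idem C.A X) x"
    "\<lbrakk>Y \<in> S\<rbrakk> \<Longrightarrow> act M (to_T X) (act M (idem C.A Y) x) = (if Y = X then act M (to_T X) x else \<zero>\<^bsub>M\<^esub>)"
    "\<lbrakk>Y \<in> S\<rbrakk> \<Longrightarrow> act M (to_T Y) (act M (from_T X) x) = (if Y = X then act M (idem C.A (P0 X)) x else \<zero>\<^bsub>M\<^esub>)"
proof -
  interpret M: hom_module C S M using M by unfold_locales
  note parts = to_T_parts[OF X]
  show "act M (to_T X) x \<in> carrier (corner M)"
    using X x parts P0[OF X] by (auto simp: to_T_def M.pr_el)
  show "act M (from_T X) (act M (to_T X) x) = act M (idem C.A X) x"
    using X x parts by (simp add: to_T_def from_T_def M.el_el C.idem_elem)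
  show "\<lbrakk>Y \<in> S\<rbrakk> \<Longrightarrow> act M (to_T X) (act M (idem C.A Y) x) = (if Y = X then act M (to_T X) x else \<zero>\<^bsub>M\<^esub>)"
    using X x parts by (simp add: to_T_def M.pr_el)
  show "\<lbrakk>Y \<in> S\<rbrakk> \<Longrightarrow> act M (to_T Y) (act M (from_T X) x) = (if Y = X then act M (idem C.A (P0 X)) x else \<zero>\<^bsub>M\<^esub>)"
    using X x parts to_T_parts[of Y] by (auto simp: to_T_def from_T_def M.el_el C.idem_elem)
qed

text \<open>Acting with \<open>from_T X\<close> recovers the component at \<open>X\<close>, so all
  components agree.\<close>

lemma eq_by_to_T:
  assumes "lu_module_over C.A M" "x \<in> carrier M" "y \<in> carrier M"
    "\<And>X. X \<in> S \<Longrightarrow> act M (to_T X) x = act M (to_T X) y"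
  shows "x = y"
proof -
  interpret M: hom_module C S M using assms(1) by unfold_locales
  show ?thesis
    by (rule M.eq_by_pr) (use assms to_T_act(2)[OF assms(1)] in metis)+
qed

text \<open>An extension of \<open>h\<close> is forced on every component: transport it to
  \<open>T\<close>, apply \<open>h\<close>, and transport the result back.\<close>

lemma corner_full:
  assumes M: "lu_module_over C.A M" and N: "lu_module_over C.A N"
    and h: "h \<in> lu_module_homs D.A (corner M) (corner N)"
  shows "\<exists>f\<in>lu_module_homs C.A M N. restrict f (carrier (corner M)) = h"
proof -
  interpret M: hom_module C S M using M by unfold_locales
  interpret N: hom_module C S N using N by unfold_locales
  note H = lu_module_homsD[OF h]
  have hN: "h x \<in> carrier N" if "x \<in> carrier (corner M)" for x using H(1)[OF that] by simp
  note toM = to_T_act[OF M] and toN = to_T_act[OF N]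
  have h_zero: "h \<zero>\<^bsub>M\<^esub> = \<zero>\<^bsub>N\<^esub>"
    using lu_module_homs_zero[OF corner_lu_module[OF M] corner_lu_module[OF N] h] by simp
  \<comment> \<open>The graph of the extension: the components of \<open>y\<close>, transported to
    \<open>T\<close>, are those that \<open>h\<close> prescribes. Described in this way, additivity
    and uniqueness need no decomposition of \<open>x\<close>.\<close>
  define R where "R x y \<longleftrightarrow> y \<in> carrier N \<and> (\<forall>X\<in>S. act N (to_T X) y = h (act M (to_T X) x))" for x y
  have h_add: "h (x \<oplus>\<^bsub>M\<^esub> y) = h x \<oplus>\<^bsub>N\<^esub> h y" if "x \<in> carrier (corner M)" "y \<in> carrier (corner M)" for x y
    using H(3)[OF that] by simp
  have h_smult: "h (c \<odot>\<^bsub>M\<^esub> x) = c \<odot>\<^bsub>N\<^esub> h x" if "x \<in> carrier (corner M)" for c x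
    using H(4)[OF that] by simp
  have h_el: "h (M.el X Y (Q1 X Y g) x) = N.el X Y (Q1 X Y g) (h x)"
    if "X \<in> T" "Y \<in> T" "g \<in> D.hom X Y" "x \<in> carrier (corner M)" for X Y g x
    using H(5)[of "D.elem X Y g" x] that by (simp add: psi_elem)
  have h_idem: "N.pr X (h x) = h (M.pr X x)" if "X \<in> T" "x \<in> carrier (corner M)" for X x
  proof -
    have "idem D.A X \<in> carrier D.A" using that by (simp add: D.idem_elem)
    from H(5)[OF this that(2)] show ?thesis using that by (simp add: psi_idem)
  qed
  have h_pr: "N.pr X (h x) = h x" if "X \<in> T" "M.pr X x = x" "x \<in> carrier (corner M)" for X x
    using h_idem that by simp
  have R_add: "R (x \<oplus>\<^bsub>M\<^esub> x') (y \<oplus>\<^bsub>N\<^esub> y')" if "R x y" "R x' y'" "x \<in> carrier M" "x' \<in> carrier M" for x y x' y'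
    using that toM(1) by (simp add: R_def M.act_add_right N.act_add_right h_add del: corner_simps(1))
  have R_smult: "R (c \<odot>\<^bsub>M\<^esub> x) (c \<odot>\<^bsub>N\<^esub> y)" if "R x y" "x \<in> carrier M" for c x y
    using that toM(1) by (simp add: R_def M.act_smult_right N.act_smult_right h_smult del: corner_simps(1))
  have R_zero: "R \<zero>\<^bsub>M\<^esub> \<zero>\<^bsub>N\<^esub>" by (simp add: R_def h_zero)
  have R_unique: "y = y'" if "R x y" "R x y'" for x y y'
  proof (rule eq_by_to_T[OF N])
    show "act N (to_T X) y = act N (to_T X) y'" if "X \<in> S" for X
      using \<open>R x y\<close> \<open>R x y'\<close> that unfolding R_def by metis
  qed (use that in \<open>simp_all add: R_def\<close>)
  have R_ex: "\<exists>y. R x y" if "x \<in> carrier M" for x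
    using that
  proof (induction x rule: M.module_induct)
    case zero
    then show ?case using R_zero by blast
  next
    case (add x y)
    then show ?case using R_add by blast
  next
    \<comment> \<open>An element concentrated at \<open>X\<close> is transported to
      \<open>P0 X\<close>, mapped by \<open>h\<close> and transported back.\<close>
    case (pr X x)
    let ?z = "h (act M (to_T X) x)"
    have z: "?z \<in> carrier N" using hN toM(1) pr by blast
    have "M.pr (P0 X) (act M (to_T X) x) = act M (to_T X) x"
      using pr to_T_parts[of X] by (simp add: to_T_def M.pr_el)
    then have "N.pr (P0 X) ?z = ?z"
      using pr toM(1) by (intro h_pr) auto
    moreover have "act M (to_T Y) x = \<zero>\<^bsub>M\<^esub>" if "Y \<in> S" "Y \<noteq> X" for Y
      using toM(3)[of Y x X] that pr by simp
    ultimately have "R x (act N (from_T X) ?z)"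
      using pr z toN(4)[of X ?z] h_zero by (auto simp: R_def)
    then show ?case by blast
  qed
  define f where "f = (\<lambda>x\<in>carrier M. THE y. R x y)"
  have Rf: "R x (f x)" if "x \<in> carrier M" for x
    using R_ex[OF that] R_unique that unfolding f_def by (metis restrict_apply' theI)
  have f_eq: "f x = y" if "R x y" "x \<in> carrier M" for x y
    using R_unique Rf that by blast
  have "f \<in> lu_module_homs C.A M N"
  proof (rule lu_module_homsI)
    show "f \<in> carrier M \<rightarrow>\<^sub>E carrier N"
      using Rf by (auto simp: R_def f_def)
    show "f (x \<oplus>\<^bsub>M\<^esub> y) = f x \<oplus>\<^bsub>N\<^esub> f y" if "x \<in> carrier M" "y \<in> carrier M" for x y
      using that Rf by (intro f_eq R_add) simp_all
    show "f (c \<odot>\<^bsub>M\<^esub> x) = c \<odot>\<^bsub>N\<^esub> f x" if "x \<in> carrier M" for c x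
      using that Rf by (intro f_eq R_smult) simp_all
    fix a x assume "a \<in> carrier C.A" and x: "x \<in> carrier M"
    then have "R (act M a x) (act N a (f x))"
    proof (induction a rule: C.algebra_induct)
      case zero
      then show ?case using R_zero Rf[OF x] by (simp add: R_def)
    next
      case (add a b)
      then show ?case using R_add Rf[OF x] x by (simp add: R_def M.act_add_left N.act_add_left)
    next
      case (elem X Y g)
      let ?g = "P1 X Y g"
      have g: "?g \<in> D.hom (P0 X) (P0 Y)" "?g \<in> D.hom (P0 (P0 X)) (P0 (P0 Y))" using elem by simp_all
      have fx: "f x \<in> carrier N" using Rf[OF x] by (simp add: R_def)
      \<comment> \<open>Transport to \<open>T\<close> is natural: both composites are the lift of
        \<open>P1 X Y g\<close> to a morphism from \<open>X\<close> to \<open>P0 Y\<close>.\<close>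
      have eq: "comp C X Y (P0 Y) (Q1 Y (P0 Y) (ident D (P0 Y))) g =
        comp C X (P0 X) (P0 Y) (Q1 (P0 X) (P0 Y) ?g) (Q1 X (P0 X) (ident D (P0 X)))"
      proof -
        have "comp C X Y (P0 Y) (Q1 Y (P0 Y) (ident D (P0 Y))) g = Q1 X (P0 Y) ?g"
          by (rule Q1_eq[symmetric]) (use elem g in \<open>simp_all add: P1_comp D.comp_ident_left\<close>)
        moreover have "comp C X (P0 X) (P0 Y) (Q1 (P0 X) (P0 Y) ?g) (Q1 X (P0 X) (ident D (P0 X))) = Q1 X (P0 Y) ?g"
          by (rule Q1_eq[symmetric]) (use elem g in \<open>simp_all add: P1_comp D.comp_ident_right\<close>)
        ultimately show ?thesis by simp
      qed
      have key: "act L (to_T Y) (act L (C.elem X Y g) z) = act L (C.elem (P0 X) (P0 Y) (Q1 (P0 X) (P0 Y) ?g)) (act L (to_T X) z)"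
        if L: "lu_module_over C.A L" "z \<in> carrier L" for L :: "('k, 'o \<times> 'o \<Rightarrow> 'a, 'm) lu_module" and z
      proof -
        interpret L: hom_module C S L using L by unfold_locales
        show ?thesis using elem g that to_T_parts[of X] to_T_parts[of Y]
          by (simp add: to_T_def L.el_el eq)
      qed
      have other: "act L (to_T Z) (act L (C.elem X Y g) z) = \<zero>\<^bsub>L\<^esub>"
        if L: "lu_module_over C.A L" "z \<in> carrier L" "Z \<in> S" "Z \<noteq> Y" for L :: "('k, 'o \<times> 'o \<Rightarrow> 'a, 'm) lu_module" and z Z
      proof -
        interpret L: hom_module C S L using L by unfold_locales
        show ?thesis using elem that to_T_parts[of Z] by (simp add: to_T_def L.el_el)
      qed
      have "act N (to_T Z) (N.el X Y g (f x)) = h (act M (to_T Z) (M.el X Y g x))" if Z: "Z \<in> S" for Z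
      proof (cases "Z = Y")
        case True
        have "act N (to_T X) (f x) = h (act M (to_T X) x)" using Rf[OF x] elem by (simp add: R_def)
        then show ?thesis
          using True key[OF N fx] key[OF M x] h_el[of "P0 X" "P0 Y" ?g "act M (to_T X) x"] g elem toM(1)[of X x] x
          by (simp del: corner_simps(1))
      next
        case False
        then show ?thesis using other[OF N fx Z] other[OF M x Z] h_zero by simp
      qed
      then show ?case using elem fx by (simp add: R_def)
    qed
    then show "f (act M a x) = act N a (f x)" using \<open>a \<in> carrier C.A\<close> x by (intro f_eq) simp_all
  qed
  moreover have "restrict f (carrier (corner M)) = h"
  proof (rule extensionalityI[of _ "carrier (corner M)"])
    show "h \<in> extensional (carrier (corner M))" by (rule H(2))
    fix x assume x: "x \<in> carrier (corner M)"
    \<comment> \<open>For \<open>X\<close> in \<open>T\<close> the transport is the idempotent at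
      \<open>X\<close>; outside \<open>T\<close> the corner elements \<open>x\<close> and
      \<open>h x\<close> have no component.\<close>
    have "act N (to_T X) (h x) = h (act M (to_T X) x)" if X: "X \<in> S" for X
    proof (cases "X \<in> T")
      case True
      have "to_T X = idem C.A X" using True Q1_ident[of X] by (simp add: to_T_def C.idem_elem)
      then show ?thesis using h_idem[OF True x] by simp
    next
      case False
      have "act M (to_T X) x = act M (to_T X) (M.pr X x)" "act N (to_T X) (h x) = act N (to_T X) (N.pr X (h x))"
        using toM(3)[of X x X] toN(3)[of X "h x" X] x X hN[OF x] by simp_all
      then show ?thesis using False X x H(1)[OF x] h_zero by simp
    qed
    then have "R x (h x)" using hN[OF x] by (simp add: R_def)
    then show "restrict f (carrier (corner M)) x = h x" using x by (simp add: f_eq)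
  qed simp
  ultimately show ?thesis by blast
qed

text \<open>Both maps commute with the action of \<open>to_T X\<close>, whose values lie in the
  corner, where the maps agree.\<close>

lemma corner_faithful:
  assumes M: "lu_module_over C.A M" and N: "lu_module_over C.A N"
    and f: "f \<in> lu_module_homs C.A M N" and g: "g \<in> lu_module_homs C.A M N"
    and eq: "restrict f (carrier (corner M)) = restrict g (carrier (corner M))"
  shows "f = g"
proof (rule extensionalityI[of _ "carrier M"])
  fix x assume x: "x \<in> carrier M"
  show "f x = g x"
  proof (rule eq_by_to_T[OF N])
    fix X assume X: "X \<in> S"
    have "act N (to_T X) (f x) = f (act M (to_T X) x)" "act N (to_T X) (g x) = g (act M (to_T X) x)"
      using lu_module_homsD(5)[OF f, of "to_T X" x] lu_module_homsD(5)[OF g, of "to_T X" x] x X by simp_all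
    then show "act N (to_T X) (f x) = act N (to_T X) (g x)"
      using to_T_act(1)[OF M X x] eq by (metis restrict_apply')
  qed (use lu_module_homsD(1)[OF f x] lu_module_homsD(1)[OF g x] in auto)
qed (use lu_module_homsD(2)[OF f] lu_module_homsD(2)[OF g] in auto)

end

section \<open>The pullback of a module, its cardinality and its corner\<close>

locale covering_module = covering C S D T P0 P1 + N: hom_module D T N
  for C :: "('o, 'a, 'k::field) lincat" and S and D :: "('o, 'b, 'k) lincat" and T and P0 P1
    and N :: "('k, 'o \<times> 'o \<Rightarrow> 'b, 'm) lu_module"
begin

definition act_at where "act_at a X Y x = N.el (P0 X) (P0 Y) (P1 X Y (a (X, Y))) x"

text \<open>Its component at \<open>X\<close> is a copy of the component of \<open>N\<close> at
  \<open>P0 X\<close>. The elements are finitely supported families, so the underlying type is a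
  function type and not yet \<open>'m\<close>.\<close>

definition pullback :: "('k, 'o \<times> 'o \<Rightarrow> 'a, 'o \<Rightarrow> 'm) lu_module"
  where "pullback =
    \<lparr>carrier = {u \<in> extensional S. (\<forall>X\<in>S. u X \<in> carrier N \<and> N.pr (P0 X) (u X) = u X) \<and>
        finite {X \<in> S. u X \<noteq> \<zero>\<^bsub>N\<^esub>}}, mult = undefined, one = undefined,
     ring.zero = (\<lambda>X\<in>S. \<zero>\<^bsub>N\<^esub>), add = (\<lambda>u v. \<lambda>X\<in>S. u X \<oplus>\<^bsub>N\<^esub> v X), smult = (\<lambda>c u. \<lambda>X\<in>S. c \<odot>\<^bsub>N\<^esub> u X),
     act = (\<lambda>a u. \<lambda>Y\<in>S. finsum N (\<lambda>X. act_at a X Y (u X)) {X \<in> S. u X \<noteq> \<zero>\<^bsub>N\<^esub>})\<rparr>"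

lemma pullback_simps:
  "\<zero>\<^bsub>pullback\<^esub> = (\<lambda>X\<in>S. \<zero>\<^bsub>N\<^esub>)" "u \<oplus>\<^bsub>pullback\<^esub> v = (\<lambda>X\<in>S. u X \<oplus>\<^bsub>N\<^esub> v X)" "c \<odot>\<^bsub>pullback\<^esub> u = (\<lambda>X\<in>S. c \<odot>\<^bsub>N\<^esub> u X)"
  by (simp_all add: pullback_def)

lemma act_pullback_def: "act pullback a u = (\<lambda>Y\<in>S. finsum N (\<lambda>X. act_at a X Y (u X)) {X \<in> S. u X \<noteq> \<zero>\<^bsub>N\<^esub>})"
  by (simp add: pullback_def)

lemma pullbackI:
  assumes "u \<in> extensional S" "\<And>X. X \<in> S \<Longrightarrow> u X \<in> carrier N" "\<And>X. X \<in> S \<Longrightarrow> N.pr (P0 X) (u X) = u X"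
    "finite {X \<in> S. u X \<noteq> \<zero>\<^bsub>N\<^esub>}"
  shows "u \<in> carrier pullback"
  using assms by (simp add: pullback_def)

lemma pullbackD [simp]:
  assumes "u \<in> carrier pullback"
  shows "X \<in> S \<Longrightarrow> u X \<in> carrier N" "X \<in> S \<Longrightarrow> N.pr (P0 X) (u X) = u X" "finite {X \<in> S. u X \<noteq> \<zero>\<^bsub>N\<^esub>}"
    "u \<in> extensional S"
  using assms by (simp_all add: pullback_def)

lemma pullback_eqI:
  assumes "u \<in> carrier pullback" "v \<in> extensional S" "\<And>X. X \<in> S \<Longrightarrow> u X = v X"
  shows "u = v"
  by (rule extensionalityI[OF pullbackD(4)[OF assms(1)] assms(2,3)])

lemma pullback_closed:
  "\<zero>\<^bsub>pullback\<^esub> \<in> carrier pullback"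
  "\<lbrakk>u \<in> carrier pullback; v \<in> carrier pullback\<rbrakk> \<Longrightarrow> u \<oplus>\<^bsub>pullback\<^esub> v \<in> carrier pullback"
  "u \<in> carrier pullback \<Longrightarrow> c \<odot>\<^bsub>pullback\<^esub> u \<in> carrier pullback"
proof -
  show "\<zero>\<^bsub>pullback\<^esub> \<in> carrier pullback" by (rule pullbackI) (auto simp: pullback_simps)
  show "u \<oplus>\<^bsub>pullback\<^esub> v \<in> carrier pullback" if u: "u \<in> carrier pullback" and v: "v \<in> carrier pullback"
  proof -
    have "{X \<in> S. (u \<oplus>\<^bsub>pullback\<^esub> v) X \<noteq> \<zero>\<^bsub>N\<^esub>} \<subseteq> {X \<in> S. u X \<noteq> \<zero>\<^bsub>N\<^esub>} \<union> {X \<in> S. v X \<noteq> \<zero>\<^bsub>N\<^esub>}"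
      by (auto simp: pullback_simps)
    then have "finite {X \<in> S. (u \<oplus>\<^bsub>pullback\<^esub> v) X \<noteq> \<zero>\<^bsub>N\<^esub>}"
      by (rule finite_subset) (use u v in simp)
    then show ?thesis by (intro pullbackI) (use u v in \<open>simp_all add: pullback_simps N.act_add_right\<close>)
  qed
  show "c \<odot>\<^bsub>pullback\<^esub> u \<in> carrier pullback" if u: "u \<in> carrier pullback"
  proof -
    have "{X \<in> S. (c \<odot>\<^bsub>pullback\<^esub> u) X \<noteq> \<zero>\<^bsub>N\<^esub>} \<subseteq> {X \<in> S. u X \<noteq> \<zero>\<^bsub>N\<^esub>}"
      by (auto simp: pullback_simps)
    then have "finite {X \<in> S. (c \<odot>\<^bsub>pullback\<^esub> u) X \<noteq> \<zero>\<^bsub>N\<^esub>}"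
      by (rule finite_subset) (use u in simp)
    then show ?thesis by (intro pullbackI) (use u in \<open>simp_all add: pullback_simps N.act_smult_right\<close>)
  qed
qed

lemma pullback_module: "Module.module scalars pullback"
proof (rule scalar_moduleI)
  show "\<zero>\<^bsub>pullback\<^esub> \<oplus>\<^bsub>pullback\<^esub> u = u" "1 \<odot>\<^bsub>pullback\<^esub> u = u" if "u \<in> carrier pullback" for u
    using that by (auto intro!: pullback_eqI[OF that, symmetric] simp: pullback_simps)
qed (simp_all add: pullback_closed, auto simp: pullback_simps N.M.a_ac N.smult_distrib intro!: restrict_ext)

sublocale P: scalar_module pullback
  using pullback_module by (simp add: scalar_module_def)

lemma act_at_closed [simp]:
  "\<lbrakk>a \<in> carrier C.A; X \<in> S; Y \<in> S; x \<in> carrier N\<rbrakk> \<Longrightarrow> act_at a X Y x \<in> carrier N"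
  by (simp add: act_at_def)

lemma act_at_simps:
  assumes "a \<in> carrier C.A" "X \<in> S" "Y \<in> S" "x \<in> carrier N"
  shows "y \<in> carrier N \<Longrightarrow> act_at a X Y (x \<oplus>\<^bsub>N\<^esub> y) = act_at a X Y x \<oplus>\<^bsub>N\<^esub> act_at a X Y y"
    "act_at a X Y (c \<odot>\<^bsub>N\<^esub> x) = c \<odot>\<^bsub>N\<^esub> act_at a X Y x"
    "b \<in> carrier C.A \<Longrightarrow> act_at (a \<oplus>\<^bsub>C.A\<^esub> b) X Y x = act_at a X Y x \<oplus>\<^bsub>N\<^esub> act_at b X Y x"
    "act_at (c \<odot>\<^bsub>C.A\<^esub> a) X Y x = c \<odot>\<^bsub>N\<^esub> act_at a X Y x"
    "N.pr (P0 Y) (act_at a X Y x) = act_at a X Y x"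
  using assms
  by (simp_all add: act_at_def N.act_add_right N.act_smult_right P1_add P1_smult D.elem_add D.elem_smult
      N.act_add_left N.act_smult_left N.pr_el)

lemma act_pullback:
  assumes "a \<in> carrier C.A" "u \<in> carrier pullback" "finite J" "J \<subseteq> S" "{X \<in> S. u X \<noteq> \<zero>\<^bsub>N\<^esub>} \<subseteq> J" "Y \<in> S"
  shows "act pullback a u Y = finsum N (\<lambda>X. act_at a X Y (u X)) J"
proof -
  have "act pullback a u Y = finsum N (\<lambda>X. act_at a X Y (u X)) {X \<in> S. u X \<noteq> \<zero>\<^bsub>N\<^esub>}"
    using assms by (simp add: act_pullback_def)
  also have "\<dots> = finsum N (\<lambda>X. act_at a X Y (u X)) J"
  proof (rule N.finsum_superset)
    show "act_at a X Y (u X) = \<zero>\<^bsub>N\<^esub>" if "X \<in> J - {X \<in> S. u X \<noteq> \<zero>\<^bsub>N\<^esub>}" for X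
    proof -
      have "X \<in> S" "u X = \<zero>\<^bsub>N\<^esub>" using that assms(4) by auto
      then show ?thesis using assms(1,6) by (simp add: act_at_def)
    qed
    show "act_at a X Y (u X) \<in> carrier N" if "X \<in> J" for X
      using that assms by (intro act_at_closed pullbackD(1)) blast+
  qed (use assms in simp_all)
  finally show ?thesis .
qed

lemma act_pullback_closed:
  assumes a: "a \<in> carrier C.A" and u: "u \<in> carrier pullback"
  shows "act pullback a u \<in> carrier pullback"
proof (rule pullbackI)
  let ?J = "{X \<in> S. u X \<noteq> \<zero>\<^bsub>N\<^esub>}"
  show "act pullback a u \<in> extensional S" by (simp add: act_pullback_def)
  have eq: "act pullback a u Y = finsum N (\<lambda>X. act_at a X Y (u X)) ?J" if "Y \<in> S" for Y
    by (rule act_pullback) (use a u that in auto)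
  show "act pullback a u Y \<in> carrier N" if "Y \<in> S" for Y
    unfolding eq[OF that] by (rule N.M.finsum_closed) (use a u that in auto)
  show "N.pr (P0 Y) (act pullback a u Y) = act pullback a u Y" if Y: "Y \<in> S" for Y
  proof -
    have "N.pr (P0 Y) (finsum N (\<lambda>X. act_at a X Y (u X)) ?J) = finsum N (\<lambda>X. N.pr (P0 Y) (act_at a X Y (u X))) ?J"
      by (rule additive_finsum[OF N.abelian_group_axioms N.abelian_group_axioms])
        (use Y a u N.act_add_right in auto)
    also have "\<dots> = finsum N (\<lambda>X. act_at a X Y (u X)) ?J"
      by (rule N.M.finsum_cong') (use Y a u in \<open>auto simp: act_at_simps\<close>)
    finally show ?thesis by (simp add: eq Y)
  qed
  \<comment> \<open>A non-zero value at \<open>Y\<close> requires a non-zero entry of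
    \<open>a\<close> with target \<open>Y\<close>, and there are finitely many of these.\<close>
  have "{Y \<in> S. act pullback a u Y \<noteq> \<zero>\<^bsub>N\<^esub>} \<subseteq> snd ` C.supp a"
  proof
    fix Y assume Y: "Y \<in> {Y \<in> S. act pullback a u Y \<noteq> \<zero>\<^bsub>N\<^esub>}"
    then obtain X where "X \<in> S" "act_at a X Y (u X) \<noteq> \<zero>\<^bsub>N\<^esub>"
      using eq[of Y] N.M.add.finprod_one_eqI[of ?J "\<lambda>X. act_at a X Y (u X)"] by auto
    then have "(X, Y) \<in> C.supp a"
      using Y u by (auto simp: C.supp_def act_at_def D.elem_zero)
    then show "Y \<in> snd ` C.supp a" by force
  qed
  then show "finite {Y \<in> S. act pullback a u Y \<noteq> \<zero>\<^bsub>N\<^esub>}"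
    by (rule finite_subset) (use a C.carrier_iff in blast)
qed

lemma act_pullback_elem:
  assumes "X \<in> S" "Y \<in> S" "f \<in> C.hom X Y" and u: "u \<in> carrier pullback"
  shows "act pullback (C.elem X Y f) u =
    (\<lambda>Y'\<in>S. if Y' = Y then N.el (P0 X) (P0 Y) (P1 X Y f) (u X) else \<zero>\<^bsub>N\<^esub>)"
proof (rule pullback_eqI)
  have e: "C.elem X Y f \<in> carrier C.A" using assms by simp
  show "act pullback (C.elem X Y f) u \<in> carrier pullback" by (rule act_pullback_closed[OF e u])
  fix Y' assume Y': "Y' \<in> S"
  let ?J = "insert X {X \<in> S. u X \<noteq> \<zero>\<^bsub>N\<^esub>}"
  have at: "act_at (C.elem X Y f) X' Y' (u X') =
      (if X' = X \<and> Y' = Y then N.el (P0 X) (P0 Y) (P1 X Y f) (u X) else \<zero>\<^bsub>N\<^esub>)" if "X' \<in> S" for X'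
    using that Y' assms by (auto simp: act_at_def D.elem_zero)
  have "act pullback (C.elem X Y f) u Y' = finsum N (\<lambda>X'. act_at (C.elem X Y f) X' Y' (u X')) ?J"
    by (rule act_pullback[OF e u]) (use assms Y' in auto)
  also have "\<dots> = act_at (C.elem X Y f) X Y' (u X)"
    by (rule N.finsum_single) (use assms Y' at e in auto)
  finally show "act pullback (C.elem X Y f) u Y' =
      (\<lambda>Y'\<in>S. if Y' = Y then N.el (P0 X) (P0 Y) (P1 X Y f) (u X) else \<zero>\<^bsub>N\<^esub>) Y'"
    using at[of X] assms Y' by simp
qed simp

lemma act_pullback_idem:
  "\<lbrakk>X \<in> S; u \<in> carrier pullback\<rbrakk> \<Longrightarrow> act pullback (idem C.A X) u = (\<lambda>Y\<in>S. if Y = X then u X else \<zero>\<^bsub>N\<^esub>)"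
  using act_pullback_elem[of X X "ident C X" u]
  by (auto simp: C.idem_elem P1_ident D.idem_elem[symmetric])

lemma pullback_lu_module: "lu_module_over C.A pullback"
proof (rule C.lu_moduleI[OF pullback_module act_pullback_closed])
  fix a b u assume *: "a \<in> carrier C.A" "b \<in> carrier C.A" "u \<in> carrier pullback"
  let ?J = "{X \<in> S. u X \<noteq> \<zero>\<^bsub>N\<^esub>}"
  show "act pullback (a \<oplus>\<^bsub>C.A\<^esub> b) u = act pullback a u \<oplus>\<^bsub>pullback\<^esub> act pullback b u"
  proof (rule pullback_eqI)
    fix Y assume Y: "Y \<in> S"
    have "act pullback (a \<oplus>\<^bsub>C.A\<^esub> b) u Y = finsum N (\<lambda>X. act_at (a \<oplus>\<^bsub>C.A\<^esub> b) X Y (u X)) ?J"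
      by (rule act_pullback) (use * Y in auto)
    also have "\<dots> = finsum N (\<lambda>X. act_at a X Y (u X) \<oplus>\<^bsub>N\<^esub> act_at b X Y (u X)) ?J"
      by (rule N.M.finsum_cong') (use * Y in \<open>auto simp: act_at_simps\<close>)
    also have "\<dots> = finsum N (\<lambda>X. act_at a X Y (u X)) ?J \<oplus>\<^bsub>N\<^esub> finsum N (\<lambda>X. act_at b X Y (u X)) ?J"
      by (rule N.M.finsum_addf) (use * Y in auto)
    finally show "act pullback (a \<oplus>\<^bsub>C.A\<^esub> b) u Y = (act pullback a u \<oplus>\<^bsub>pullback\<^esub> act pullback b u) Y"
      using * Y by (simp add: pullback_simps act_pullback[of _ _ ?J])
  qed (use * in \<open>simp_all add: act_pullback_closed pullback_simps\<close>)
next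
  fix a u v assume *: "a \<in> carrier C.A" "u \<in> carrier pullback" "v \<in> carrier pullback"
  let ?J = "{X \<in> S. u X \<noteq> \<zero>\<^bsub>N\<^esub>} \<union> {X \<in> S. v X \<noteq> \<zero>\<^bsub>N\<^esub>}"
  show "act pullback a (u \<oplus>\<^bsub>pullback\<^esub> v) = act pullback a u \<oplus>\<^bsub>pullback\<^esub> act pullback a v"
  proof (rule pullback_eqI)
    fix Y assume Y: "Y \<in> S"
    have "act pullback a (u \<oplus>\<^bsub>pullback\<^esub> v) Y = finsum N (\<lambda>X. act_at a X Y ((u \<oplus>\<^bsub>pullback\<^esub> v) X)) ?J"
      by (rule act_pullback) (use * Y in \<open>auto simp: pullback_closed\<close>, auto simp: pullback_simps)
    also have "\<dots> = finsum N (\<lambda>X. act_at a X Y (u X) \<oplus>\<^bsub>N\<^esub> act_at a X Y (v X)) ?J"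
      by (rule N.M.finsum_cong') (use * Y in \<open>auto simp: pullback_simps act_at_simps\<close>)
    also have "\<dots> = finsum N (\<lambda>X. act_at a X Y (u X)) ?J \<oplus>\<^bsub>N\<^esub> finsum N (\<lambda>X. act_at a X Y (v X)) ?J"
      by (rule N.M.finsum_addf) (use * Y in auto)
    also have "\<dots> = act pullback a u Y \<oplus>\<^bsub>N\<^esub> act pullback a v Y"
      using * Y by (subst (1 2) act_pullback[of _ _ ?J]) auto
    finally show "act pullback a (u \<oplus>\<^bsub>pullback\<^esub> v) Y = (act pullback a u \<oplus>\<^bsub>pullback\<^esub> act pullback a v) Y"
      using Y by (simp add: pullback_simps)
  qed (use * in \<open>simp_all add: act_pullback_closed pullback_closed\<close>)
next
  fix a u c assume *: "a \<in> carrier C.A" "u \<in> carrier pullback"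
  let ?J = "{X \<in> S. u X \<noteq> \<zero>\<^bsub>N\<^esub>}"
  have smult: "finsum N (\<lambda>X. c \<odot>\<^bsub>N\<^esub> act_at a X Y (u X)) ?J = c \<odot>\<^bsub>N\<^esub> act pullback a u Y" if "Y \<in> S" for Y
    using * that
    by (subst act_pullback[of _ _ ?J])
      (auto intro!: additive_finsum[OF N.abelian_group_axioms N.abelian_group_axioms, symmetric] simp: N.smult_distrib)
  show "act pullback (c \<odot>\<^bsub>C.A\<^esub> a) u = c \<odot>\<^bsub>pullback\<^esub> act pullback a u"
  proof (rule pullback_eqI)
    fix Y assume Y: "Y \<in> S"
    have "act pullback (c \<odot>\<^bsub>C.A\<^esub> a) u Y = finsum N (\<lambda>X. act_at (c \<odot>\<^bsub>C.A\<^esub> a) X Y (u X)) ?J"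
      by (rule act_pullback) (use * Y in auto)
    also have "\<dots> = finsum N (\<lambda>X. c \<odot>\<^bsub>N\<^esub> act_at a X Y (u X)) ?J"
      by (rule N.M.finsum_cong') (use * Y in \<open>auto simp: act_at_simps\<close>)
    finally show "act pullback (c \<odot>\<^bsub>C.A\<^esub> a) u Y = (c \<odot>\<^bsub>pullback\<^esub> act pullback a u) Y"
      using Y smult[OF Y] by (simp add: pullback_simps)
  qed (use * in \<open>simp_all add: act_pullback_closed\<close>)
  show "act pullback a (c \<odot>\<^bsub>pullback\<^esub> u) = c \<odot>\<^bsub>pullback\<^esub> act pullback a u"
  proof (rule pullback_eqI)
    fix Y assume Y: "Y \<in> S"
    have "act pullback a (c \<odot>\<^bsub>pullback\<^esub> u) Y = finsum N (\<lambda>X. act_at a X Y ((c \<odot>\<^bsub>pullback\<^esub> u) X)) ?J"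
      by (rule act_pullback) (use * Y in \<open>auto simp: pullback_closed\<close>, auto simp: pullback_simps)
    also have "\<dots> = finsum N (\<lambda>X. c \<odot>\<^bsub>N\<^esub> act_at a X Y (u X)) ?J"
      by (rule N.M.finsum_cong') (use * Y in \<open>auto simp: pullback_simps act_at_simps\<close>)
    finally show "act pullback a (c \<odot>\<^bsub>pullback\<^esub> u) Y = (c \<odot>\<^bsub>pullback\<^esub> act pullback a u) Y"
      using Y smult[OF Y] by (simp add: pullback_simps)
  qed (use * in \<open>simp_all add: act_pullback_closed pullback_closed\<close>)
next
  fix X Y Y' Z f g u
  assume *: "X \<in> S" "Y \<in> S" "Y' \<in> S" "Z \<in> S" "f \<in> C.hom X Y" "g \<in> C.hom Y' Z" "u \<in> carrier pullback"
  have "act pullback (C.elem X Y f) u \<in> carrier pullback" using * by (simp add: act_pullback_closed)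
  then have "act pullback (C.elem Y' Z g) (act pullback (C.elem X Y f) u) = (\<lambda>Y''\<in>S. if Y'' = Z
      then N.el (P0 Y') (P0 Z) (P1 Y' Z g) (if Y' = Y then N.el (P0 X) (P0 Y) (P1 X Y f) (u X) else \<zero>\<^bsub>N\<^esub>) else \<zero>\<^bsub>N\<^esub>)"
    using * by (subst act_pullback_elem) (auto simp: act_pullback_elem)
  also have "\<dots> = (if Y = Y' then act pullback (C.elem X Z (comp C X Y Z g f)) u else \<zero>\<^bsub>pullback\<^esub>)"
    using * by (auto simp: act_pullback_elem N.el_el P1_comp pullback_simps intro!: restrict_ext)
  finally show "act pullback (C.elem Y' Z g) (act pullback (C.elem X Y f) u) =
    (if Y = Y' then act pullback (C.elem X Z (comp C X Y Z g f)) u else \<zero>\<^bsub>pullback\<^esub>)" .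
next
  fix u assume u: "u \<in> carrier pullback"
  let ?J = "{X \<in> S. u X \<noteq> \<zero>\<^bsub>N\<^esub>}"
  have closed: "act pullback (idem C.A X) u \<in> carrier pullback" if "X \<in> S" for X
    using that u by (simp add: C.idem_elem act_pullback_closed)
  have "u = finsum pullback (\<lambda>X. act pullback (idem C.A X) u) ?J"
  proof (rule pullback_eqI[OF u])
    have sum: "finsum pullback (\<lambda>X. act pullback (idem C.A X) u) ?J \<in> carrier pullback"
      by (rule P.M.finsum_closed) (use closed in auto)
    then show "finsum pullback (\<lambda>X. act pullback (idem C.A X) u) ?J \<in> extensional S"
      by simp
    fix Y assume Y: "Y \<in> S"
    have "finsum pullback (\<lambda>X. act pullback (idem C.A X) u) ?J Y = finsum N (\<lambda>X. act pullback (idem C.A X) u Y) ?J"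
      by (rule additive_finsum[where h = "\<lambda>u. u Y", OF P.abelian_group_axioms N.abelian_group_axioms])
        (use Y u closed in \<open>auto simp: pullback_simps\<close>)
    also have "\<dots> = u Y"
    proof (cases "u Y = \<zero>\<^bsub>N\<^esub>")
      case True
      then show ?thesis using u Y by (auto simp: act_pullback_idem intro!: N.M.add.finprod_one_eqI)
    next
      case False
      then show ?thesis using u Y by (subst N.finsum_single[of _ Y]) (auto simp: act_pullback_idem)
    qed
    finally show "u Y = finsum pullback (\<lambda>X. act pullback (idem C.A X) u) ?J Y" by simp
  qed
  then show "\<exists>J. finite J \<and> J \<subseteq> S \<and> u = finsum pullback (\<lambda>X. act pullback (idem C.A X) u) J"
    using u by (intro exI[of _ ?J]) auto
qed

text \<open>The multiples of a non-zero element by different scalars are different.\<close>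

lemma infinite_module:
  assumes "n \<in> carrier N" "n \<noteq> \<zero>\<^bsub>N\<^esub>"
  shows "infinite (carrier N)"
proof
  assume "finite (carrier N)"
  moreover have "inj (\<lambda>c. c \<odot>\<^bsub>N\<^esub> n)"
  proof (rule injI, rule ccontr)
    fix c d assume eq: "c \<odot>\<^bsub>N\<^esub> n = d \<odot>\<^bsub>N\<^esub> n" and "c \<noteq> d"
    have "(c - d) \<odot>\<^bsub>N\<^esub> n \<oplus>\<^bsub>N\<^esub> d \<odot>\<^bsub>N\<^esub> n = d \<odot>\<^bsub>N\<^esub> n"
      using assms eq by (simp flip: N.smult_distrib(1))
    then have "(c - d) \<odot>\<^bsub>N\<^esub> n = \<zero>\<^bsub>N\<^esub>" using assms by (simp add: N.M.add.l_cancel_one)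
    then have "inverse (c - d) \<odot>\<^bsub>N\<^esub> ((c - d) \<odot>\<^bsub>N\<^esub> n) = \<zero>\<^bsub>N\<^esub>" by simp
    then show False using assms \<open>c \<noteq> d\<close> by (simp flip: N.smult_distrib(3))
  qed
  moreover have "range (\<lambda>c. c \<odot>\<^bsub>N\<^esub> n) \<subseteq> carrier N" using assms by auto
  ultimately have "finite (UNIV :: 'k set)" by (metis finite_imageD finite_subset)
  then show False using infinite_field by simp
qed

text \<open>The equivalence is stated for a fixed type of elements, so the pullback has to fit into
  the size of \<open>N\<close>. Unless \<open>N\<close> is zero, its carrier is infinite and absorbs
  finite powers, products with itself and finite subsets; it remains to bound the number of
  indices.\<close>

lemma pullback_lepoll: "carrier pullback \<lesssim> carrier N"
proof (cases "carrier N = {\<zero>\<^bsub>N\<^esub>}")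
  case True
  then have "u = (\<lambda>X\<in>S. \<zero>\<^bsub>N\<^esub>)" if "u \<in> carrier pullback" for u
    by (intro pullback_eqI[OF that]) (use pullbackD(1)[OF that] in auto)
  then have "inj_on (\<lambda>u. \<zero>\<^bsub>N\<^esub>) (carrier pullback)" by (metis inj_onI)
  then show ?thesis unfolding lepoll_def by (intro exI[of _ "\<lambda>u. \<zero>\<^bsub>N\<^esub>"]) auto
next
  case False
  then obtain n where "n \<in> carrier N" "n \<noteq> \<zero>\<^bsub>N\<^esub>" using N.M.zero_closed by blast
  then have inf: "infinite (carrier N)" by (rule infinite_module)
  have sq: "carrier N \<times> carrier N \<lesssim> carrier N"
    using card_of_Times_same_infinite[OF inf] by (simp add: eqpoll_iff_card_of_ordIso[symmetric] eqpoll_imp_lepoll)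
  \<comment> \<open>A family vanishes at indices where the component of \<open>N\<close> is zero, so
    only the others are counted.\<close>
  let ?S = "{X \<in> S. \<exists>n\<in>carrier N. N.pr (P0 X) n = n \<and> n \<noteq> \<zero>\<^bsub>N\<^esub>}"
  have "\<forall>Y. \<exists>n. (\<exists>n\<in>carrier N. N.pr Y n = n \<and> n \<noteq> \<zero>\<^bsub>N\<^esub>) \<longrightarrow> n \<in> carrier N \<and> N.pr Y n = n \<and> n \<noteq> \<zero>\<^bsub>N\<^esub>" by blast
  \<comment> \<open>\<open>w Y\<close> is a non-zero element of the component at \<open>Y\<close>,
    provided that there is one. It determines \<open>Y\<close>, because different components meet
    only in zero.\<close>
  from choice[OF this] obtain w where w: "\<And>Y. (\<exists>n\<in>carrier N. N.pr Y n = n \<and> n \<noteq> \<zero>\<^bsub>N\<^esub>) \<Longrightarrow> w Y \<in> carrier N \<and> N.pr Y (w Y) = w Y \<and> w Y \<noteq> \<zero>\<^bsub>N\<^esub>"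
    by blast
  \<comment> \<open>Indices with the same image under \<open>P0\<close> are told apart by a number,
    the fibres being finite.\<close>
  define idx where "idx X = to_nat_on {X' \<in> S. P0 X' = P0 X} X" for X
  have "inj_on (\<lambda>X. (w (P0 X), idx X)) ?S"
  proof (rule inj_onI)
    fix X X' assume X: "X \<in> ?S" "X' \<in> ?S" and eq: "(w (P0 X), idx X) = (w (P0 X'), idx X')"
    have P0_eq: "P0 X = P0 X'"
    proof (rule ccontr)
      assume "P0 X \<noteq> P0 X'"
      then have "N.pr (P0 X) (N.pr (P0 X') (w (P0 X'))) = \<zero>\<^bsub>N\<^esub>"
        using X w[of "P0 X'"] by (subst N.pr_pr) auto
      moreover have "N.pr (P0 X') (w (P0 X')) = w (P0 X')" "N.pr (P0 X) (w (P0 X)) = w (P0 X)" "w (P0 X) \<noteq> \<zero>\<^bsub>N\<^esub>"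
        using X w by blast+
      ultimately show False using eq by simp
    qed
    have "inj_on (to_nat_on {X'' \<in> S. P0 X'' = P0 X}) {X'' \<in> S. P0 X'' = P0 X}"
      using X fibre[of "P0 X"] by (intro inj_on_to_nat_on countable_finite) simp
    then show "X = X'"
      by (rule inj_onD) (use eq X in \<open>simp_all add: idx_def P0_eq\<close>)
  qed
  then have "?S \<lesssim> carrier N \<times> (UNIV :: nat set)"
    unfolding lepoll_def using w by (intro exI[of _ "\<lambda>X. (w (P0 X), idx X)"]) auto
  also have "\<dots> \<lesssim> carrier N \<times> carrier N"
    using inf by (intro times_lepoll_mono) (simp_all add: infinite_le_lepoll)
  finally have "?S \<lesssim> carrier N" using sq lepoll_trans by blast
  then have "?S \<times> carrier N \<lesssim> carrier N"
    using times_lepoll_mono[of ?S "carrier N" "carrier N" "carrier N"] sq lepoll_trans by blast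
  then obtain j where j: "inj_on j (?S \<times> carrier N)" "j ` (?S \<times> carrier N) \<subseteq> carrier N"
    by (auto simp: lepoll_def)
  \<comment> \<open>A family is recovered from the graph of its restriction to the support, a finite
    set of pairs.\<close>
  let ?graph = "\<lambda>u. (\<lambda>X. (X, u X)) ` {X \<in> S. u X \<noteq> \<zero>\<^bsub>N\<^esub>}"
  have graph: "?graph u \<in> Fpow (?S \<times> carrier N)" if "u \<in> carrier pullback" for u
  proof -
    have "?graph u \<subseteq> ?S \<times> carrier N" using pullbackD(1,2)[OF that] by blast
    then show ?thesis unfolding Fpow_def using that by simp
  qed
  have "inj_on ?graph (carrier pullback)"
  proof (rule inj_onI)
    fix u v assume u: "u \<in> carrier pullback" and v: "v \<in> carrier pullback" and eq: "?graph u = ?graph v"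
    show "u = v"
    proof (rule pullback_eqI[OF u])
      fix X assume "X \<in> S"
      then have "y = u X \<and> y \<noteq> \<zero>\<^bsub>N\<^esub> \<longleftrightarrow> y = v X \<and> y \<noteq> \<zero>\<^bsub>N\<^esub>" for y
        using eq[unfolded set_eq_iff, rule_format, of "(X, y)"] by auto
      then show "u X = v X" by metis
    qed (use v in simp)
  qed
  then have "carrier pullback \<lesssim> Fpow (?S \<times> carrier N)"
    unfolding lepoll_def using graph by (intro exI[of _ ?graph]) blast
  also have "\<dots> \<lesssim> Fpow (carrier N)"
    unfolding lepoll_def
    using inj_on_image_Fpow[OF j(1)] image_Fpow_mono[OF j(2)] by (intro exI[of _ "image j"] conjI)
  also have "\<dots> \<lesssim> carrier N"
    using eqpoll_Fpow[OF inf] by (rule eqpoll_imp_lepoll)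
  finally show ?thesis .
qed

text \<open>Comparison of \<open>N\<close> with the corner of its pullback: over \<open>T\<close>,
  where \<open>P0\<close> is the identity, both have the same components.\<close>

definition unit_map where "unit_map n = (\<lambda>X\<in>S. if X \<in> T then N.pr X n else \<zero>\<^bsub>N\<^esub>)"

lemma unit_map_closed:
  assumes "n \<in> carrier N"
  shows "unit_map n \<in> carrier (corner pullback)"
proof -
  have "{X \<in> S. unit_map n X \<noteq> \<zero>\<^bsub>N\<^esub>} \<subseteq> {X \<in> T. N.pr X n \<noteq> \<zero>\<^bsub>N\<^esub>}"
    by (auto simp: unit_map_def)
  then have "finite {X \<in> S. unit_map n X \<noteq> \<zero>\<^bsub>N\<^esub>}"
    using N.decompose(1)[OF assms] by (rule finite_subset)
  then have "unit_map n \<in> carrier pullback"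
    using assms by (intro pullbackI) (simp_all add: unit_map_def N.pr_pr)
  moreover from this have "act pullback (idem C.A X) (unit_map n) = \<zero>\<^bsub>pullback\<^esub>" if "X \<in> S - T" for X
    using that by (auto simp: act_pullback_idem pullback_simps unit_map_def)
  ultimately show ?thesis by simp
qed

lemma unit_map_bij: "bij_betw unit_map (carrier N) (carrier (corner pullback))"
proof (intro bij_betw_imageI inj_onI subset_antisym)
  fix m n assume *: "m \<in> carrier N" "n \<in> carrier N" and eq: "unit_map m = unit_map n"
  show "m = n"
  proof (rule N.eq_by_pr[OF *])
    show "N.pr X m = N.pr X n" if "X \<in> T" for X
      using fun_cong[OF eq, of X] that by (simp add: unit_map_def)
  qed
next
  show "unit_map ` carrier N \<subseteq> carrier (corner pullback)" using unit_map_closed by blast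
next
  show "carrier (corner pullback) \<subseteq> unit_map ` carrier N"
  proof
    fix u assume u: "u \<in> carrier (corner pullback)"
    then have up: "u \<in> carrier pullback" by simp
    have out: "u X = \<zero>\<^bsub>N\<^esub>" if X: "X \<in> S - T" for X
    proof -
      have "act pullback (idem C.A X) u X = \<zero>\<^bsub>pullback\<^esub> X" using u X by simp
      then show ?thesis using X up by (simp add: act_pullback_idem pullback_simps)
    qed
    let ?J = "{X \<in> S. u X \<noteq> \<zero>\<^bsub>N\<^esub>}"
    have J: "finite ?J" "?J \<subseteq> T" using up out by auto
    \<comment> \<open>A family concentrated on \<open>T\<close> comes from the sum of its
      values.\<close>
    let ?n = "finsum N u ?J"
    have n: "?n \<in> carrier N" using up by (intro N.M.finsum_closed) auto
    have pr_u: "N.pr X (u Y) = (if X = Y then u Y else \<zero>\<^bsub>N\<^esub>)" if "X \<in> T" "Y \<in> T" for X Y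
      using N.pr_pr[of X Y "u Y"] pullbackD(1,2)[OF up, of Y] that by auto
    have "N.pr X ?n = u X" if X: "X \<in> T" for X
    proof -
      have "N.pr X ?n = finsum N (\<lambda>Y. N.pr X (u Y)) ?J"
        by (rule additive_finsum[OF N.abelian_group_axioms N.abelian_group_axioms])
          (use X up J N.act_add_right in auto)
      also have "\<dots> = u X"
      proof (cases "u X = \<zero>\<^bsub>N\<^esub>")
        case True
        have "finsum N (\<lambda>Y. N.pr X (u Y)) ?J = \<zero>\<^bsub>N\<^esub>"
          by (rule N.M.add.finprod_one_eqI) (use True X J pr_u in \<open>auto split: if_splits\<close>)
        then show ?thesis using True by simp
      next
        case False
        then show ?thesis using X J pr_u up by (subst N.finsum_single[of _ X]) auto
      qed
      finally show ?thesis .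
    qed
    then have "u = unit_map ?n"
      by (intro pullback_eqI[OF up]) (use out in \<open>auto simp: unit_map_def\<close>)
    then show "u \<in> unit_map ` carrier N" using n by blast
  qed
qed

lemma unit_map_ops:
  "\<lbrakk>m \<in> carrier N; n \<in> carrier N\<rbrakk> \<Longrightarrow> unit_map (m \<oplus>\<^bsub>N\<^esub> n) = unit_map m \<oplus>\<^bsub>pullback\<^esub> unit_map n"
  "n \<in> carrier N \<Longrightarrow> unit_map (c \<odot>\<^bsub>N\<^esub> n) = c \<odot>\<^bsub>pullback\<^esub> unit_map n"
  by (auto simp: unit_map_def pullback_simps N.act_add_right N.act_smult_right intro!: restrict_ext)

lemma unit_map_zero: "unit_map \<zero>\<^bsub>N\<^esub> = \<zero>\<^bsub>pullback\<^esub>"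
  by (auto simp: unit_map_def pullback_simps intro!: restrict_ext)

lemma unit_map_act:
  assumes "b \<in> carrier D.A" and n: "n \<in> carrier N"
  shows "unit_map (act N b n) = act pullback (psi b) (unit_map n)"
proof -
  interpret PB: hom_module C S pullback using pullback_lu_module by unfold_locales
  have u: "unit_map n \<in> carrier pullback" using unit_map_closed[OF n] by simp
  show ?thesis
    using assms(1)
  proof (induction b rule: D.algebra_induct)
    case zero
    show ?case using n u by (simp add: psi_zero unit_map_zero)
  next
    case (add a b)
    then show ?case using n u by (simp add: psi_add N.act_add_left PB.act_add_left unit_map_ops)
  next
    case (elem X Y f)
    have "act pullback (psi (D.elem X Y f)) (unit_map n) =
        (\<lambda>Y'\<in>S. if Y' = Y then N.el X Y f (unit_map n X) else \<zero>\<^bsub>N\<^esub>)"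
      using elem u Q1(2)[of X Y f] by (auto simp: psi_elem act_pullback_elem intro!: restrict_ext)
    also have "\<dots> = unit_map (N.el X Y f n)"
      using elem n by (auto simp: unit_map_def N.pr_el intro!: restrict_ext)
    finally show ?case by simp
  qed
qed

text \<open>Essential surjectivity of the corner functor. The pullback is copied into the type of
  \<open>N\<close> along an injection \<open>i\<close>, and \<open>unit_map\<close> followed by
  \<open>i\<close> identifies \<open>N\<close> with the corner of the copy.\<close>

lemma pullback_unit:
  "\<exists>M::('k, 'o \<times> 'o \<Rightarrow> 'a, 'm) lu_module. lu_module_over C.A M \<and> (\<exists>f. isomorphism (module_category D.A) (corner M) N f)"
proof -
  interpret PB: hom_module C S pullback using pullback_lu_module by unfold_locales
  obtain i :: "('o \<Rightarrow> 'm) \<Rightarrow> 'm" where i: "inj_on i (carrier pullback)"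
    using pullback_lepoll unfolding lepoll_def by blast
  define i' where "i' = inv_into (carrier pullback) i"
  have [simp]: "i' (i u) = u" if "u \<in> carrier pullback" for u
    unfolding i'_def by (rule inv_into_f_f[OF i that])
  define M :: "('k, 'o \<times> 'o \<Rightarrow> 'a, 'm) lu_module" where "M =
    \<lparr>carrier = i ` carrier pullback, mult = undefined, one = undefined, ring.zero = i \<zero>\<^bsub>pullback\<^esub>,
     add = (\<lambda>x y. i (i' x \<oplus>\<^bsub>pullback\<^esub> i' y)), smult = (\<lambda>c x. i (c \<odot>\<^bsub>pullback\<^esub> i' x)),
     act = (\<lambda>a x. i (act pullback a (i' x)))\<rparr>"
  have M_simps: "carrier M = i ` carrier pullback" "\<zero>\<^bsub>M\<^esub> = i \<zero>\<^bsub>pullback\<^esub>"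
    "x \<oplus>\<^bsub>M\<^esub> y = i (i' x \<oplus>\<^bsub>pullback\<^esub> i' y)" "c \<odot>\<^bsub>M\<^esub> x = i (c \<odot>\<^bsub>pullback\<^esub> i' x)"
    "act M a x = i (act pullback a (i' x))" for x y c a
    by (simp_all add: M_def)
  have M: "lu_module_over C.A M"
    by (rule C.lu_module_transport[OF pullback_lu_module, where h = i])
      (use i in \<open>simp_all add: M_simps bij_betw_def\<close>)
  have eq_zero: "i u = i \<zero>\<^bsub>pullback\<^esub> \<longleftrightarrow> u = \<zero>\<^bsub>pullback\<^esub>" if "u \<in> carrier pullback" for u
    using inj_on_eq_iff[OF i that, of "\<zero>\<^bsub>pullback\<^esub>"] by simp
  have corner_M: "carrier (corner M) = i ` carrier (corner pullback)"
    by (auto simp: M_simps eq_zero)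
  have um: "unit_map n \<in> carrier pullback" if "n \<in> carrier N" for n
    using unit_map_closed[OF that] by simp
  let ?k = "\<lambda>n\<in>carrier N. i (unit_map n)"
  have "?k \<in> lu_module_homs D.A N (corner M)"
  proof (rule lu_module_homsI)
    show "?k \<in> carrier N \<rightarrow>\<^sub>E carrier (corner M)"
      unfolding corner_M by (intro restrict_PiE_iff[THEN iffD2]) (use unit_map_closed in blast)
  qed (simp_all add: M_simps um unit_map_ops unit_map_act)
  moreover have "bij_betw ?k (carrier N) (carrier (corner M))"
  proof -
    have "bij_betw i (carrier (corner pullback)) (carrier (corner M))"
      unfolding corner_M using i by (intro inj_on_imp_bij_betw) (auto intro: inj_on_subset)
    from bij_betw_trans[OF unit_map_bij this] have "bij_betw (i \<circ> unit_map) (carrier N) (carrier (corner M))" .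
    then show ?thesis by (rule bij_betw_cong[THEN iffD1, rotated]) simp
  qed
  ultimately show ?thesis
    using M lu_module_homs_isomorphism[OF N.lu_module corner_lu_module[OF M]] by blast
qed

end

context covering
begin

lemma covering_morita: "morita_equivalent TYPE('m) C.A D.A"
  unfolding morita_equivalent_def
proof (rule equivalent_categoriesI[OF linear_category_module_category linear_category_module_category corner_functor])
  fix M N :: "('k, 'o \<times> 'o \<Rightarrow> 'a, 'm) lu_module"
  assume "M \<in> obj (module_category C.A)" "N \<in> obj (module_category C.A)"
  then have M: "lu_module_over C.A M" and N: "lu_module_over C.A N" by simp_all
  show "bij_betw (\<lambda>f. restrict f (carrier (corner M))) (carrier (Hom (module_category C.A) M N))
      (carrier (Hom (module_category D.A) (corner M) (corner N)))"
    unfolding module_category_simps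
  proof (intro bij_betw_imageI inj_onI subset_antisym)
    show "f = g" if "f \<in> lu_module_homs C.A M N" "g \<in> lu_module_homs C.A M N"
      "restrict f (carrier (corner M)) = restrict g (carrier (corner M))" for f g
      by (rule corner_faithful[OF M N that])
    have "restrict f (carrier (corner M)) \<in> carrier (Hom (module_category D.A) (corner M) (corner N))"
      if "f \<in> carrier (Hom (module_category C.A) M N)" for f
      using corner_functor M N that unfolding linear_functor_def by (metis mem_Collect_eq module_category_simps(1))
    then show "(\<lambda>f. restrict f (carrier (corner M))) ` lu_module_homs C.A M N \<subseteq> lu_module_homs D.A (corner M) (corner N)"
      unfolding module_category_simps by blast
    show "lu_module_homs D.A (corner M) (corner N) \<subseteq> (\<lambda>f. restrict f (carrier (corner M))) ` lu_module_homs C.A M N"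
      using corner_full[OF M N] by blast
  qed
next
  fix N :: "('k, 'o \<times> 'o \<Rightarrow> 'b, 'm) lu_module"
  assume "N \<in> obj (module_category D.A)"
  then have "lu_module_over D.A N" by simp
  then interpret covering_module C S D T P0 P1 N by unfold_locales
  show "\<exists>M\<in>obj (module_category C.A). \<exists>f. isomorphism (module_category D.A) (corner M) N f"
    using pullback_unit by simp
qed

end

section \<open>The unfolding functor\<close>

context presented
begin

abbreviation category where "category \<equiv> presented_module_category P H R"

lemma category_simps [simp]:
  "obj category = lists (gen_obj P)"
  "A \<in> carrier (Hom category X Y) \<longleftrightarrow> arr A \<and> dom A = X \<and> cod A = Y"
  "ob X \<Longrightarrow> ident category X = idt X"
proof -
  show "A \<in> carrier (Hom category X Y) \<longleftrightarrow> arr A \<and> dom A = X \<and> cod A = Y"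
  proof
    assume "A \<in> carrier (Hom category X Y)"
    then obtain e where "mor P H e X Y" "A = eqv_class P H R X Y e" by (auto simp: presented_carrier)
    then show "arr A \<and> dom A = X \<and> cod A = Y"
      using arr_cl dom_cl cod_cl cl_eqv_class by metis
  next
    assume *: "arr A \<and> dom A = X \<and> cod A = Y"
    then obtain e where "mor P H e X Y" "A = cl e" by (auto elim: arrE)
    then show "A \<in> carrier (Hom category X Y)"
      unfolding presented_carrier by (auto simp: cl_eqv_class)
  qed
qed (simp_all add: presented_module_category_def idt_def cl_eqv_class[OF mor_id])

lemma category_ops [simp]:
  assumes "arr A" "dom A = X" "cod A = Y"
  shows "\<lbrakk>arr B; dom B = X; cod B = Y\<rbrakk> \<Longrightarrow> A \<oplus>\<^bsub>Hom category X Y\<^esub> B = A \<boxplus> B"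
    "c \<odot>\<^bsub>Hom category X Y\<^esub> A = scl c A"
    "\<lbrakk>arr B; dom B = Y; cod B = Z\<rbrakk> \<Longrightarrow> comp category X Y Z B A = B \<cdot> A"
proof -
  obtain e where e: "mor P H e X Y" "A = cl e" using assms by (auto elim: arrE)
  show "c \<odot>\<^bsub>Hom category X Y\<^esub> A = scl c A"
    using presented_smult[OF e(1), where R = R]
    by (simp add: e(2) cl_scale flip: cl_eqv_class[OF mor_scale[OF e(1)]] cl_eqv_class[OF e(1)])
  show "A \<oplus>\<^bsub>Hom category X Y\<^esub> B = A \<boxplus> B" if B: "arr B" "dom B = X" "cod B = Y"
  proof -
    obtain f where f: "mor P H f X Y" "B = cl f" using arrE[OF B(1)] B(2,3) by metis
    show ?thesis
      using presented_add[OF e(1) f(1), where R = R]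
      by (simp add: e(2) f(2) cl_add flip: cl_eqv_class[OF mor_add[OF e(1) f(1)]] cl_eqv_class[OF e(1)] cl_eqv_class[OF f(1)])
  qed
  show "comp category X Y Z B A = B \<cdot> A" if B: "arr B" "dom B = Y" "cod B = Z"
  proof -
    obtain f where f: "mor P H f Y Z" "B = cl f" using arrE[OF B(1)] B(2,3) by metis
    show ?thesis
      using presented_comp[OF e(1) f(1), where R = R]
      by (simp add: e(2) f(2) cl_comp flip: cl_eqv_class[OF mor_comp[OF e(1) f(1)]] cl_eqv_class[OF e(1)] cl_eqv_class[OF f(1)])
  qed
qed

lemma hom_alg_category: "S \<subseteq> lists (gen_obj P) \<Longrightarrow> hom_alg category S"
  by (simp add: hom_alg_def hom_alg_axioms_def linear_category_presented)

end

section \<open>Full faithfulness of the unfolding functor\<close>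

context diagonal
begin

text \<open>\<open>alpha\<close> on the empty base, read on classes; for good end words the choice
  of the representative is immaterial by \<open>unfold_cl\<close>.\<close>

definition unfold where "unfold A = alpha (O.rep A) []"

text \<open>Supplies the side condition of \<open>alpha_eqv\<close>: without vertices there are
  neither generators \<open>\<rho>\<close> nor relations for them.\<close>

lemma oKLRW_rels_cases:
  "(oKLRW_rels Q \<tau> :: (('v, 'k) diagram \<times> ('v, 'k) diagram) set) = {} \<or> oKLRW_gens Q \<tau> \<noteq> {}"
proof (cases "pverts Q = {}")
  case True
  then have "(e, f) \<notin> oKLRW_rels Q \<tau>" for e f :: "('v, 'k) diagram"
    by (auto elim: oKLRW_rels.cases)
  then show ?thesis by auto
qed (auto simp: oKLRW_gens_def)

lemma unfold_cl:
  assumes m: "mor (KLRW Q) (oKLRW_gens Q \<tau>) e X Y" and good: "good X" "good Y"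
  shows "unfold (O.cl e) = alpha e []"
proof -
  have "mor (KLRW Q) (oKLRW_gens Q \<tau>) (O.rep (O.cl e)) X Y"
    using m by (simp add: O.arr_cl O.dom_cl O.cod_cl)
  moreover have "O.cl (O.rep (O.cl e)) = O.cl e" using O.arr_cl[OF m] by simp
  ultimately have "eqv (KLRW Q) (oKLRW_gens Q \<tau>) (oKLRW_rels Q \<tau>) X Y (O.rep (O.cl e)) e"
    by (intro O.cl_eqD)
  then show ?thesis
    unfolding unfold_def
    by (rule alpha_eqv) (use oKLRW_rels_cases good in \<open>auto simp: base_ok_def\<close>)
qed

definition hom_good where "hom_good X Y A \<longleftrightarrow> O.arr A \<and> O.dom A = X \<and> O.cod A = Y \<and> good X \<and> good Y"

lemma hom_goodE:
  assumes "hom_good X Y A"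
  obtains e where "mor (KLRW Q) (oKLRW_gens Q \<tau>) e X Y" "A = O.cl e" "good X" "good Y"
  using assms by (auto simp: hom_good_def elim: O.arrE)

lemma hom_goodD [simp]:
  assumes "hom_good X Y A" shows "O.arr A" "O.dom A = X" "O.cod A = Y"
  using assms by (simp_all add: hom_good_def)

lemma arr_unfold [simp]:
  assumes "hom_good X Y A"
  shows "Kp.arr (unfold A)" "Kp.dom (unfold A) = mv [] X" "Kp.cod (unfold A) = mv [] Y"
proof -
  obtain e where e: "mor (KLRW Q) (oKLRW_gens Q \<tau>) e X Y" "A = O.cl e" "good X" "good Y"
    using assms by (rule hom_goodE)
  show "Kp.arr (unfold A)" "Kp.dom (unfold A) = mv [] X" "Kp.cod (unfold A) = mv [] Y"
    using alpha_ty_O[OF e(1,3,4)] by (simp_all add: e(2) unfold_cl[OF e(1,3,4)])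
qed

lemma unfold_ops:
  assumes A: "hom_good X Y A"
  shows "hom_good X Y B \<Longrightarrow> unfold (O.pls A B) = unfold A \<boxplus> unfold B"
    "unfold (O.scl c A) = Kp.scl c (unfold A)"
    "hom_good Y Z B \<Longrightarrow> unfold (B \<star> A) = unfold B \<cdot> unfold A"
proof -
  obtain e where e: "mor (KLRW Q) (oKLRW_gens Q \<tau>) e X Y" "A = O.cl e" "good X" "good Y"
    using A by (rule hom_goodE)
  show "unfold (O.scl c A) = Kp.scl c (unfold A)"
    using e unfold_cl[OF mor_scale[OF e(1)] e(3,4)] by (simp add: unfold_cl O.cl_scale)
  show "unfold (O.pls A B) = unfold A \<boxplus> unfold B" if B: "hom_good X Y B"
  proof -
    obtain f where f: "mor (KLRW Q) (oKLRW_gens Q \<tau>) f X Y" "B = O.cl f" using B by (rule hom_goodE)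
    show ?thesis
      using e f unfold_cl[OF mor_add[OF e(1) f(1)] e(3,4)] by (simp add: unfold_cl O.cl_add)
  qed
  show "unfold (B \<star> A) = unfold B \<cdot> unfold A" if B: "hom_good Y Z B"
  proof -
    obtain f where f: "mor (KLRW Q) (oKLRW_gens Q \<tau>) f Y Z" "B = O.cl f" "good Z" using B by (rule hom_goodE)
    show ?thesis
      using e f unfold_cl[OF mor_comp[OF e(1) f(1)] e(3) f(3)]
      by (simp add: unfold_cl O.cl_comp alpha_comp[OF e(1) f(1)] del: alpha.simps)
  qed
qed

lemma unfold_idt:
  assumes X: "good X" shows "unfold (O.idt X) = Kp.idt (mv [] X)"
proof -
  have "mor (KLRW Q) (oKLRW_gens Q \<tau>) (Ident X :: ('v, 'k) diagram) X X" using good_ob_K[OF X] by (rule mor_id)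
  from unfold_cl[OF this X X] show ?thesis by (simp add: O.idt_def)
qed

lemma unfold_jj:
  assumes x: "Kp.arr x" shows "unfold (jj x) = x"
proof -
  obtain e where e: "mor (KLRW Qp) {} e (Kp.dom x) (Kp.cod x)" "x = Kp.cl e" using x by (rule Kp.arrE)
  have m: "mor (KLRW Q) {} e (Kp.dom x) (Kp.cod x)" using JK.incl_mor[OF e(1)] .
  have "jj x = O.cl e" using e by (simp add: JK.J_cl[OF e(1)] JO.J_cl[OF m])
  moreover have "mor (KLRW Q) (oKLRW_gens Q \<tau>) e (Kp.dom x) (Kp.cod x)" using JO.incl_mor[OF m] .
  moreover have "Kp.ob (Kp.dom x)" "Kp.ob (Kp.cod x)" using mor_lists[OF e(1)] by simp_all
  ultimately show ?thesis
    using alpha_plus[OF e(1), of "[]"] e x by (simp add: unfold_cl)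
qed

lemma straighten_unfold:
  assumes "hom_good X Y A"
  shows "straighten Y [] \<star> A = jj (unfold A) \<star> straighten X []"
proof -
  obtain e where e: "mor (KLRW Q) (oKLRW_gens Q \<tau>) e X Y" "A = O.cl e" "good X" "good Y"
    using assms by (rule hom_goodE)
  show ?thesis
    using straighten_alpha[OF e(1) HOL.refl HOL.refl e(3,4)] by (simp only: e(2) unfold_cl[OF e(1,3,4)])
qed

text \<open>By \<open>straighten_unfold\<close> the unfolding determines the composite of the arrow
  with the straightening of its target, and the latter is invertible.\<close>

lemma unfold_inj:
  assumes A: "hom_good X Y A" and B: "hom_good X Y B" and eq: "unfold A = unfold B"
  shows "A = B"
proof (rule O.iso_cancel_left)
  show "O.iso (straighten Y [])" by (rule iso_straighten) (use A in \<open>simp_all add: hom_good_def del: hom_goodD\<close>)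
  show "straighten Y [] \<star> A = straighten Y [] \<star> B"
    using straighten_unfold[OF A] straighten_unfold[OF B] eq by simp
qed (use A B in \<open>simp_all add: hom_good_def del: hom_goodD\<close>)

lemma unfold_straighten:
  assumes X: "good X"
  obtains t where "hom_good (mv [] X) X t" "unfold t \<cdot> unfold (straighten X []) = Kp.idt (mv [] X)"
proof -
  let ?s = "straighten X []"
  have ob: "Kp.ob (mv [] X)" using X by simp
  obtain t where t: "O.arr t" "O.dom t = O.cod ?s" "O.cod t = O.dom ?s" "t \<star> ?s = O.idt (O.dom ?s)"
    using iso_straighten[OF X, of "[]"] by (auto elim: O.isoE)
  have s: "hom_good X (mv [] X) ?s" and t': "hom_good (mv [] X) X t"
    using X t ob by (simp_all add: hom_good_def del: hom_goodD)
  have "unfold t \<cdot> unfold ?s = Kp.idt (mv [] X)"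
    using unfold_ops(3)[OF s t'] t X by (simp add: unfold_idt)
  with t' show thesis by (rule that)
qed

lemma unfold_surj:
  assumes "good X" "good Y" and g: "Kp.arr g" "Kp.dom g = mv [] X" "Kp.cod g = mv [] Y"
  obtains A where "hom_good X Y A" "unfold A = g"
proof -
  let ?s = "\<lambda>X. straighten X []"
  have ob: "Kp.ob (mv [] X)" "Kp.ob (mv [] Y)" using assms by simp_all
  obtain t where t: "hom_good (mv [] X) X t" "unfold t \<cdot> unfold (?s X) = Kp.idt (mv [] X)"
    using unfold_straighten[OF assms(1)] by metis
  obtain t' where t': "hom_good (mv [] Y) Y t'" "unfold t' \<cdot> unfold (?s Y) = Kp.idt (mv [] Y)"
    using unfold_straighten[OF assms(2)] by metis
  have s: "hom_good X (mv [] X) (?s X)" "hom_good Y (mv [] Y) (?s Y)"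
    using assms ob by (simp_all add: hom_good_def del: hom_goodD)
  \<comment> \<open>The unfolding of a straightening is never computed; only a left inverse of it is
    used. The unknown factors are built into \<open>h\<close> in such a way that they
    cancel.\<close>
  define h where "h = unfold (?s Y) \<cdot> (g \<cdot> unfold t)"
  have h: "Kp.arr h" "Kp.dom h = mv [] X" "Kp.cod h = mv [] Y"
    unfolding h_def using g t s ob by simp_all
  have j: "hom_good (mv [] X) (mv [] Y) (jj h)" using h ob by (simp add: hom_good_def del: hom_goodD)
  have jt: "hom_good X (mv [] Y) (jj h \<star> ?s X)" using j s by (simp add: hom_good_def del: hom_goodD)
  show thesis
  proof (rule that)
    show "hom_good X Y (t' \<star> (jj h \<star> ?s X))" using jt t' by (simp add: hom_good_def del: hom_goodD)
    have "unfold (t' \<star> (jj h \<star> ?s X)) = unfold t' \<cdot> (h \<cdot> unfold (?s X))"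
      using unfold_ops(3)[OF jt t'(1)] unfold_ops(3)[OF s(1) j] unfold_jj[OF h(1)] by simp
    also have "\<dots> = (unfold t' \<cdot> unfold (?s Y)) \<cdot> (g \<cdot> (unfold t \<cdot> unfold (?s X)))"
      by (simp add: h_def Kp.cmp_assoc)
    finally show "unfold (t' \<star> (jj h \<star> ?s X)) = g" using t t' g by simp
  qed
qed

text \<open>Only black letters are moved past others, and the red letters keep their order.\<close>

lemma mv_Nil_reds: "good Z \<Longrightarrow> [\<theta>. Red \<theta> \<leftarrow> mv [] Z] = [\<theta>. Red \<theta> \<leftarrow> Z]"
proof -
  have "[\<theta>. Red \<theta> \<leftarrow> lft Z] = []"  if "good Z"
    using that by (induction Z) (auto simp: minus_def)
  moreover have "[\<theta>. Red \<theta> \<leftarrow> rgt Z] = [\<theta>. Red \<theta> \<leftarrow> Z]" if "good Z"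
    using that by (induction Z) (auto simp: minus_def)
  ultimately show "good Z \<Longrightarrow> [\<theta>. Red \<theta> \<leftarrow> mv [] Z] = [\<theta>. Red \<theta> \<leftarrow> Z]"
    by (simp add: mv_def)
qed

text \<open>Straightening keeps the length, and each letter of \<open>X\<close> or its flip occurs
  in \<open>Y\<close>; only finitely many words have this property.\<close>

lemma mv_fibre: "finite {X. good X \<and> mv [] X = Y}"
proof (rule finite_subset)
  have flip: "flip (flip a) = a" if "a \<in> good_letters" for a using that by (cases a) auto
  have fold: "length (mv [] X) = length X \<and> set X \<subseteq> set (mv [] X) \<union> flip ` set (mv [] X)" if "good X" for X
  proof
    show "length (mv [] X) = length X" by (induction X) (auto simp: mv_def)
    show "set X \<subseteq> set (mv [] X) \<union> flip ` set (mv [] X)"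
    proof
      fix a assume a: "a \<in> set X"
      then have "flip (flip a) = a" using that flip by blast
      moreover have "(if minus a then flip a else a) \<in> set (mv [] X)"
        using a by (auto simp: mv_def lft_def rgt_def)
      ultimately show "a \<in> set (mv [] X) \<union> flip ` set (mv [] X)"
        by (metis UnI1 UnI2 imageI)
    qed
  qed
  show "{X. good X \<and> mv [] X = Y} \<subseteq> {X. set X \<subseteq> set Y \<union> flip ` set Y \<and> length X = length Y}"
  proof
    fix X assume "X \<in> {X. good X \<and> mv [] X = Y}"
    then have "good X" "Y = mv [] X" by simp_all
    then show "X \<in> {X. set X \<subseteq> set Y \<union> flip ` set Y \<and> length X = length Y}"
      using fold[OF \<open>good X\<close>] by (simp only: mem_Collect_eq)
  qed
qed (rule finite_lists_length_eq, simp)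

lemma covering_unfold:
  assumes lam: "set lam \<subseteq> dominant_weights Qp" and inf: "infinite (UNIV :: 'k set)"
  shows "covering (O.category) (words_over Q lam) (Kp.category) (words_over Qp lam) (mv []) (\<lambda>X Y. unfold)"
proof -
  have S: "good X" "O.ob X" "[\<theta>. Red \<theta> \<leftarrow> X] = lam" if "X \<in> words_over Q lam" for X
  proof -
    show X: "[\<theta>. Red \<theta> \<leftarrow> X] = lam" using that by (simp add: words_over_def)
    \<comment> \<open>The red letters of the word are those of \<open>lam\<close>, hence weights of
      \<open>Q_+\<close>; this excludes the bad words.\<close>
    have "a \<in> good_letters" if "a \<in> set X" for a
    proof (cases a)
      case (Black i)
      then show ?thesis using that \<open>X \<in> words_over Q lam\<close> by (auto simp: words_over_def letters_def)
    next
      case (Red \<theta>)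
      then have "\<theta> \<in> set [\<theta>. Red \<theta> \<leftarrow> X]" using that by (auto intro!: bexI[of _ a])
      then show ?thesis using Red X lam by auto
    qed
    then show "good X" by auto
    then show "O.ob X" by simp
  qed
  have T: "Kp.ob Y" "Y \<in> words_over Q lam" if "Y \<in> words_over Qp lam" for Y
  proof -
    show "Kp.ob Y" using that by (simp add: words_over_def KLRW_def)
    then have "O.ob Y" by simp
    then show "Y \<in> words_over Q lam" using that by (simp add: words_over_def KLRW_def)
  qed
  have hom: "A \<in> carrier (Hom O.category X Y) \<longleftrightarrow> hom_good X Y A" if "X \<in> words_over Q lam" "Y \<in> words_over Q lam" for A X Y
    using that S by (simp add: hom_good_def del: hom_goodD)
  show ?thesis
  proof (intro covering.intro covering_axioms.intro O.hom_alg_category Kp.hom_alg_category)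
    show "words_over Q lam \<subseteq> lists (gen_obj (KLRW Q :: ('v, 'k) pres))" using S by blast
    show "words_over Qp lam \<subseteq> lists (gen_obj (KLRW Qp :: ('v, 'k) pres))" using T by blast
    show "words_over Qp lam \<subseteq> words_over Q lam" using T by blast
    show "mv [] X \<in> words_over Qp lam" if "X \<in> words_over Q lam" for X
    proof -
      have "Kp.ob (mv [] X)" using S[OF that] by simp
      then show ?thesis using mv_Nil_reds[of X] S[OF that] by (simp add: words_over_def KLRW_def)
    qed
    show "mv [] Y = Y" if "Y \<in> words_over Qp lam" for Y
      using T[OF that] by simp
    show "finite {X \<in> words_over Q lam. mv [] X = Y}" for Y
      by (rule finite_subset[OF _ mv_fibre[of Y]]) (use S in blast)
    show "infinite (UNIV :: 'k set)" by (rule inf)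
    fix X Y assume XY: "X \<in> words_over Q lam" "Y \<in> words_over Q lam"
    note good = S(1)[OF XY(1)] S(1)[OF XY(2)]
    show "bij_betw unfold (carrier (Hom O.category X Y)) (carrier (Hom Kp.category (mv [] X) (mv [] Y)))"
    proof (rule bij_betw_imageI)
      show "inj_on unfold (carrier (Hom O.category X Y))"
        by (rule inj_onI) (use unfold_inj hom[OF XY] in blast)
      have "unfold A \<in> carrier (Hom Kp.category (mv [] X) (mv [] Y))" if "A \<in> carrier (Hom O.category X Y)" for A
      proof -
        have "hom_good X Y A" using that hom[OF XY] by blast
        then show ?thesis by simp
      qed
      moreover have "\<exists>A. hom_good X Y A \<and> unfold A = g" if "g \<in> carrier (Hom Kp.category (mv [] X) (mv [] Y))" for g
      proof -
        have "Kp.arr g" "Kp.dom g = mv [] X" "Kp.cod g = mv [] Y" using that by simp_all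
        then show ?thesis by (metis unfold_surj[OF good])
      qed
      ultimately show "unfold ` carrier (Hom O.category X Y) = carrier (Hom Kp.category (mv [] X) (mv [] Y))"
        using hom[OF XY] by blast
    qed
    fix A assume A: "A \<in> carrier (Hom O.category X Y)"
    then have A': "hom_good X Y A" using hom[OF XY] by blast
    show "unfold (c \<odot>\<^bsub>Hom O.category X Y\<^esub> A) = c \<odot>\<^bsub>Hom Kp.category (mv [] X) (mv [] Y)\<^esub> unfold A" for c
      using A' by (simp add: unfold_ops)
    show "unfold (A \<oplus>\<^bsub>Hom O.category X Y\<^esub> B) = unfold A \<oplus>\<^bsub>Hom Kp.category (mv [] X) (mv [] Y)\<^esub> unfold B"
      if "B \<in> carrier (Hom O.category X Y)" for B
    proof -
      have "hom_good X Y B" using that hom[OF XY] by blast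
      then show ?thesis using A' by (simp add: unfold_ops)
    qed
    fix Z B assume Z: "Z \<in> words_over Q lam" and B: "B \<in> carrier (Hom O.category Y Z)"
    then have "hom_good Y Z B" using hom[OF XY(2)] by blast
    then show "unfold (comp O.category X Y Z B A) =
        comp Kp.category (mv [] X) (mv [] Y) (mv [] Z) (unfold B) (unfold A)"
      using A' by (simp add: unfold_ops(3)[OF A'])
  next
    fix X assume "X \<in> words_over Q lam"
    then show "unfold (ident O.category X) = ident Kp.category (mv [] X)"
      using S by (simp add: unfold_idt)
  qed
qed

end

text \<open>Over a finite field, adding \<open>1\<close> to the product of all linear factors gives
  a non-constant polynomial without a root.\<close>

lemma infinite_alg_closed_field: "infinite (UNIV :: 'k::alg_closed_field set)"
proof
  assume fin: "finite (UNIV :: 'k set)"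
  let ?p = "\<Prod>a\<in>UNIV. [:- a, 1:] :: 'k poly"
  have "degree (\<Prod>a\<in>A. [:- a, 1:] :: 'k poly) = card A" for A :: "'k set"
    by (subst degree_prod_eq_sum_degree) auto
  then have "degree (?p + 1) > 0"
    using fin by (subst degree_add_eq_left) (auto simp: card_gt_0_iff)
  then obtain x where "poly (?p + 1) x = 0" using alg_closed_imp_poly_has_root by blast
  moreover have "poly ?p x = 0" using fin by (auto simp: poly_prod prod_zero_iff)
  ultimately show False by simp
qed

theorem theorem2p11:
  fixes Q Qp :: "'v pair_pre_digraph"
    and \<tau> :: "'v \<Rightarrow> 'v"
    and lam :: "'v weight list"
  assumes "diagonal_type Q \<tau> Qp"
    and "set lam \<subseteq> dominant_weights Qp"
  shows "morita_equivalent TYPE('m)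
    (oKLRW_algebra Q \<tau> lam ::
      ('k::alg_closed_field, 'v letter list \<times> 'v letter list \<Rightarrow> ('v, 'k) diagram set,
       'v letter list) lu_algebra)
    (KLRW_algebra Qp lam ::
      ('k, 'v letter list \<times> 'v letter list \<Rightarrow> ('v, 'k) diagram set, 'v letter list) lu_algebra)"
proof -
  interpret diagonal Q Qp \<tau> "TYPE('k)" by unfold_locales (rule assms(1))
  show ?thesis
    unfolding oKLRW_algebra_def KLRW_algebra_def oKLRW_category_def KLRW_category_def presented_monoidal_category_def
    by (rule covering.covering_morita[OF covering_unfold[OF assms(2) infinite_alg_closed_field]])
qed

end
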